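(* Let $R$ be a complete regular local ring of dimension $d\ge 0$, $\Lambda$ an $R$-order which is an isolated singularity, $m\ge d$, $T$ an $m$-cotilting $\Lambda$-module, and $\mathcal B:={}^\perp T\subseteq\operatorname{mod}\Lambda$. For a subcategory $\mathcal B'$ of $\operatorname{mod}\Lambda$ put $$o(\mathcal B'):=\sup_{\mathcal C\subseteq\mathcal B',\ \mathcal C\perp_1\mathcal C}\#\operatorname{ind}\mathcal C .$$ (1) $\operatorname{rep.dim}_1\Lambda\le 3$ implies $o(\operatorname{CM}\Lambda)<\infty$. (2) If $\mathcal B$ has a maximal $1$-orthogonal subcategory $\mathcal C$, then $o(\mathcal B)=\#\operatorname{ind}\mathcal C$. (3) If $\mathcal B$ has a subcategory $\mathcal C$ such that $\Lambda\in\mathcal C$ and $\mathcal C\text{-}\dim\mathcal B\le 1$, then $o(\mathcal B)\le\#\operatorname{ind}\mathcal C$.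
   Context: $\operatorname{mod}\Lambda$ is the category of finitely generated left $\Lambda$-modules. Subcategories are full and closed under isomorphisms, finite direct sums and direct summands; $\operatorname{ind}\mathcal C$ is the set of isomorphism classes of indecomposable objects of $\mathcal C$. For a module-finite $R$-algebra $\Lambda$: $\operatorname{CM}\Lambda$ is the category of finitely generated left $\Lambda$-modules which are projective as $R$-modules; $\Lambda$ is an $R$-order if $\Lambda\in\operatorname{CM}\Lambda$; $\Lambda$ is an isolated singularity if $\operatorname{gl.dim}(\Lambda\otimes_R R_{\mathfrak p})=\operatorname{ht}\mathfrak p$ for every non-maximal prime ideal $\mathfrak p$ of $R$. Put $D_d:=\operatorname{Hom}_R(-,R)$. Write $X\perp_l Y$ if $\operatorname{Ext}^i_\Lambda(X,Y)=0$ for $0<i\le l$, and $\perp:=\perp_\infty$; ${}^\perp T:=\{X\in\operatorname{mod}\Lambda\mid X\perp T\}$. A module $T\in\operatorname{CM}\Lambda$ is $m$-cotilting if $T\perp T$ and there are exact sequences $0\to T\to I_0\to\cdots\to I_{m-d}\to 0$ and $0\to T_{m-d}\to\cdots\to T_0\to D_d\Lambda\to 0$ with $I_i\in\operatorname{add}{}_\Lambda(D_d\Lambda)$ and $T_i\in\operatorname{add}{}_\Lambda T$. A functorially finite subcategory $\mathcal C$ of $\mathcal B$ is maximal $l$-orthogonal if $\mathcal C=\{X\in\mathcal B\mid\mathcal C\perp_l X\}=\{X\in\mathcal B\mid X\perp_l\mathcal C\}$. $\mathcal C\text{-}\dim\mathcal B\le 1$ means that for every $X\in\mathcal B$ there is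 a complex $0\to C_1\to C_0\to X$ with $C_0,C_1\in\mathcal C$ such that $0\to\operatorname{Hom}_\Lambda(C,C_1)\to\operatorname{Hom}_\Lambda(C,C_0)\to\operatorname{Hom}_\Lambda(C,X)\to 0$ is exact for every $C\in\mathcal C$. $\operatorname{rep.dim}_1\Lambda:=\inf\{\operatorname{gl.dim}\operatorname{End}_\Lambda(M)\mid M\in\operatorname{CM}\Lambda,\ \Lambda\oplus D_d\Lambda\in\operatorname{add}M\}$. *)

theory Defs
  imports "HOL-Library.Extended_Nat" "HOL-Algebra.Free_Abelian_Groups"
    "HOL-Algebra.Ring_Divisibility" "HOL-Algebra.Ideal_Product" "HOL-Algebra.Module"
begin

section \<open>Left modules over a not necessarily commutative ring\<close>

text \<open>
  The library locale \<^locale>\<open>module\<close> asks for a commutative base ring. The same record type is used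
  here; the fields \<open>mult\<close> and \<open>one\<close> of a module record carry no information and are ignored.
\<close>

locale left_module = A?: ring A + M?: abelian_group M
  for A :: "('a, 'c) ring_scheme" (structure) and M :: "('a, 'x) module" (structure) +
  assumes smult_closed:
      "\<lbrakk>a \<in> carrier A; x \<in> carrier M\<rbrakk> \<Longrightarrow> a \<odot>\<^bsub>M\<^esub> x \<in> carrier M"
    and smult_l_distr:
      "\<lbrakk>a \<in> carrier A; b \<in> carrier A; x \<in> carrier M\<rbrakk> \<Longrightarrow>
        (a \<oplus>\<^bsub>A\<^esub> b) \<odot>\<^bsub>M\<^esub> x = a \<odot>\<^bsub>M\<^esub> x \<oplus>\<^bsub>M\<^esub> b \<odot>\<^bsub>M\<^esub> x"
    and smult_r_distr:
      "\<lbrakk>a \<in> carrier A; x \<in> carrier M; y \<in> carrier M\<rbrakk> \<Longrightarrow>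
        a \<odot>\<^bsub>M\<^esub> (x \<oplus>\<^bsub>M\<^esub> y) = a \<odot>\<^bsub>M\<^esub> x \<oplus>\<^bsub>M\<^esub> a \<odot>\<^bsub>M\<^esub> y"
    and smult_assoc:
      "\<lbrakk>a \<in> carrier A; b \<in> carrier A; x \<in> carrier M\<rbrakk> \<Longrightarrow>
        (a \<otimes>\<^bsub>A\<^esub> b) \<odot>\<^bsub>M\<^esub> x = a \<odot>\<^bsub>M\<^esub> (b \<odot>\<^bsub>M\<^esub> x)"
    and smult_one: "x \<in> carrier M \<Longrightarrow> \<one>\<^bsub>A\<^esub> \<odot>\<^bsub>M\<^esub> x = x"

text \<open>Homomorphisms are extensional functions, so that equal maps are equal functions.\<close>

definition mod_hom ::
  "('a, 'c) ring_scheme \<Rightarrow> ('a, 'x) module \<Rightarrow> ('a, 'y) module \<Rightarrow> ('x \<Rightarrow> 'y) set" where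
  "mod_hom A X Y = {f \<in> carrier X \<rightarrow>\<^sub>E carrier Y.
     (\<forall>x\<in>carrier X. \<forall>y\<in>carrier X. f (x \<oplus>\<^bsub>X\<^esub> y) = f x \<oplus>\<^bsub>Y\<^esub> f y) \<and>
     (\<forall>a\<in>carrier A. \<forall>x\<in>carrier X. f (a \<odot>\<^bsub>X\<^esub> x) = a \<odot>\<^bsub>Y\<^esub> f x)}"

definition mod_iso :: "('a, 'c) ring_scheme \<Rightarrow> ('a, 'x) module \<Rightarrow> ('a, 'y) module \<Rightarrow> bool" where
  "mod_iso A X Y \<longleftrightarrow> (\<exists>f\<in>mod_hom A X Y. bij_betw f (carrier X) (carrier Y))"

definition zero_map :: "('a, 'x) module \<Rightarrow> ('a, 'y) module \<Rightarrow> 'x \<Rightarrow> 'y" where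
  "zero_map X Y = (\<lambda>x\<in>carrier X. \<zero>\<^bsub>Y\<^esub>)"

definition hom_group ::
  "('a, 'c) ring_scheme \<Rightarrow> ('a, 'x) module \<Rightarrow> ('a, 'y) module \<Rightarrow> ('x \<Rightarrow> 'y) monoid" where
  "hom_group A X Y = \<lparr>carrier = mod_hom A X Y,
     monoid.mult = (\<lambda>f g. \<lambda>x\<in>carrier X. f x \<oplus>\<^bsub>Y\<^esub> g x),
     one = zero_map X Y\<rparr>"

definition End_ring :: "('a, 'c) ring_scheme \<Rightarrow> ('a, 'x) module \<Rightarrow> ('x \<Rightarrow> 'x) ring" where
  "End_ring A X = \<lparr>carrier = mod_hom A X X,
     monoid.mult = (\<lambda>f g. compose (carrier X) f g),
     one = (\<lambda>x\<in>carrier X. x),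
     zero = zero_map X X,
     add = (\<lambda>f g. \<lambda>x\<in>carrier X. f x \<oplus>\<^bsub>X\<^esub> g x)\<rparr>"

definition is_zero_module :: "('a, 'x) module \<Rightarrow> bool" where
  "is_zero_module X \<longleftrightarrow> carrier X = {\<zero>\<^bsub>X\<^esub>}"

definition regular_module :: "('a, 'c) ring_scheme \<Rightarrow> ('a, 'a) module" where
  "regular_module A = \<lparr>carrier = carrier A, monoid.mult = monoid.mult A, one = one A,
     zero = zero A, add = add A, smult = monoid.mult A\<rparr>"

definition direct_sum :: "('a, 'x) module \<Rightarrow> ('a, 'y) module \<Rightarrow> ('a, 'x \<times> 'y) module" where
  "direct_sum X Y = \<lparr>carrier = carrier X \<times> carrier Y, monoid.mult = undefined, one = undefined,
     zero = (\<zero>\<^bsub>X\<^esub>, \<zero>\<^bsub>Y\<^esub>),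
     add = (\<lambda>(x, y) (x', y'). (x \<oplus>\<^bsub>X\<^esub> x', y \<oplus>\<^bsub>Y\<^esub> y')),
     smult = (\<lambda>a (x, y). (a \<odot>\<^bsub>X\<^esub> x, a \<odot>\<^bsub>Y\<^esub> y))\<rparr>"

text \<open>The direct sum of copies of \<open>X\<close> indexed by \<open>I\<close>.\<close>

definition copower :: "('a, 'x) module \<Rightarrow> 'i set \<Rightarrow> ('a, 'i \<Rightarrow> 'x) module" where
  "copower X I = \<lparr>
     carrier = {f \<in> I \<rightarrow>\<^sub>E carrier X. finite {i \<in> I. f i \<noteq> \<zero>\<^bsub>X\<^esub>}},
     monoid.mult = undefined, one = undefined,
     zero = (\<lambda>i\<in>I. \<zero>\<^bsub>X\<^esub>),
     add = (\<lambda>f g. \<lambda>i\<in>I. f i \<oplus>\<^bsub>X\<^esub> g i),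
     smult = (\<lambda>a f. \<lambda>i\<in>I. a \<odot>\<^bsub>X\<^esub> f i)\<rparr>"

definition fg_module :: "('a, 'c) ring_scheme \<Rightarrow> ('a, 'x) module \<Rightarrow> bool" where
  "fg_module A X \<longleftrightarrow> left_module A X \<and>
     (\<exists>S\<subseteq>carrier X. finite S \<and> (\<forall>N. submodule N A X \<and> S \<subseteq> N \<longrightarrow> N = carrier X))"

text \<open>
  Projective: a direct summand of a free module. A projective module is a direct summand of the
  free module on its own carrier, so the types of \<open>I\<close> and \<open>Q\<close> are no restriction.
\<close>

definition projective_module :: "('a, 'c) ring_scheme \<Rightarrow> ('a, 'p) module \<Rightarrow> bool" where
  "projective_module A P \<longleftrightarrow> left_module A P \<and>
     (\<exists>(I :: 'p set) (Q :: ('a, 'p \<Rightarrow> 'a) module).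
        left_module A Q \<and> mod_iso A (direct_sum P Q) (copower (regular_module A) I))"


section \<open>Resolutions, homological dimensions, Ext\<close>

text \<open>
  \<open>\<dots> \<rightarrow> P 1 \<rightarrow> P 0 \<rightarrow> X \<rightarrow> 0\<close> is exact, with \<open>d i : P (i + 1) \<rightarrow> P i\<close> and \<open>e : P 0 \<rightarrow> X\<close>;
  and dually for coresolutions. A finite exact sequence \<open>0 \<rightarrow> P n \<rightarrow> \<dots> \<rightarrow> P 0 \<rightarrow> X \<rightarrow> 0\<close> is a
  resolution with \<open>P i\<close> zero for \<open>i > n\<close>.
\<close>

definition resolution ::
  "('a, 'c) ring_scheme \<Rightarrow> (nat \<Rightarrow> ('a, 'p) module) \<Rightarrow> (nat \<Rightarrow> 'p \<Rightarrow> 'p) \<Rightarrow> ('p \<Rightarrow> 'x) \<Rightarrow>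
   ('a, 'x) module \<Rightarrow> bool" where
  "resolution A P d e X \<longleftrightarrow>
     (\<forall>i. left_module A (P i)) \<and>
     e \<in> mod_hom A (P 0) X \<and> (\<forall>i. d i \<in> mod_hom A (P (Suc i)) (P i)) \<and>
     e ` carrier (P 0) = carrier X \<and>
     d 0 ` carrier (P (Suc 0)) = a_kernel (P 0) X e \<and>
     (\<forall>i. d (Suc i) ` carrier (P (Suc (Suc i))) = a_kernel (P (Suc i)) (P i) (d i))"

definition coresolution ::
  "('a, 'c) ring_scheme \<Rightarrow> ('a, 'x) module \<Rightarrow> ('x \<Rightarrow> 'q) \<Rightarrow> (nat \<Rightarrow> ('a, 'q) module) \<Rightarrow>
   (nat \<Rightarrow> 'q \<Rightarrow> 'q) \<Rightarrow> bool" where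
  "coresolution A X e I d \<longleftrightarrow>
     (\<forall>i. left_module A (I i)) \<and>
     e \<in> mod_hom A X (I 0) \<and> (\<forall>i. d i \<in> mod_hom A (I i) (I (Suc i))) \<and>
     inj_on e (carrier X) \<and>
     e ` carrier X = a_kernel (I 0) (I (Suc 0)) (d 0) \<and>
     (\<forall>i. d i ` carrier (I i) = a_kernel (I (Suc i)) (I (Suc (Suc i))) (d (Suc i)))"

definition projective_resolution ::
  "('a, 'c) ring_scheme \<Rightarrow> (nat \<Rightarrow> ('a, 'p) module) \<Rightarrow> (nat \<Rightarrow> 'p \<Rightarrow> 'p) \<Rightarrow> ('p \<Rightarrow> 'x) \<Rightarrow>
   ('a, 'x) module \<Rightarrow> bool" where
  "projective_resolution A P d e X \<longleftrightarrow>
     resolution A P d e X \<and> (\<forall>i. projective_module A (P i))"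

text \<open>
  Universe: up to isomorphism, every finitely generated module over a ring with carrier type
  \<open>'a\<close> is a quotient of a power of the ring, hence lives on the carrier type \<open>(nat \<Rightarrow> 'a) set\<close>.
  A module on this carrier type has a free resolution on the same carrier type, and since the global
  dimension of any ring is already attained on cyclic modules (Auslander), \<open>gl_dim\<close> does not
  depend on this choice of type.
\<close>

type_synonym 'a umodule = "('a, (nat \<Rightarrow> 'a) set) module"

definition proj_dim :: "('a, 'c) ring_scheme \<Rightarrow> ('a, 'x) module \<Rightarrow> enat" where
  "proj_dim A X = Inf {enat n | n. \<exists>(P :: nat \<Rightarrow> 'a umodule) d e.
     projective_resolution A P d e X \<and> (\<forall>i>n. is_zero_module (P i))}"

definition gl_dim :: "('a, 'c) ring_scheme \<Rightarrow> enat" where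
  "gl_dim A = (SUP X\<in>{X :: 'a umodule. left_module A X}. proj_dim A X)"

text \<open>
  \<open>Ext_from A P d Y i\<close> is the \<open>i\<close>-th cohomology group of the complex \<open>Hom(P, Y)\<close>; \<open>Ext\<close> takes
  some projective resolution of \<open>X\<close>.
\<close>

definition cocycles ::
  "('a, 'c) ring_scheme \<Rightarrow> (nat \<Rightarrow> ('a, 'p) module) \<Rightarrow> (nat \<Rightarrow> 'p \<Rightarrow> 'p) \<Rightarrow> ('a, 'y) module \<Rightarrow>
   nat \<Rightarrow> ('p \<Rightarrow> 'y) set" where
  "cocycles A P d Y i = {f \<in> mod_hom A (P i) Y.
     compose (carrier (P (Suc i))) f (d i) = zero_map (P (Suc i)) Y}"

definition coboundaries ::
  "('a, 'c) ring_scheme \<Rightarrow> (nat \<Rightarrow> ('a, 'p) module) \<Rightarrow> (nat \<Rightarrow> 'p \<Rightarrow> 'p) \<Rightarrow> ('a, 'y) module \<Rightarrow>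
   nat \<Rightarrow> ('p \<Rightarrow> 'y) set" where
  "coboundaries A P d Y i = (case i of
     0 \<Rightarrow> {zero_map (P 0) Y}
   | Suc j \<Rightarrow> (\<lambda>g. compose (carrier (P (Suc j))) g (d j)) ` mod_hom A (P j) Y)"

definition Ext_from ::
  "('a, 'c) ring_scheme \<Rightarrow> (nat \<Rightarrow> ('a, 'p) module) \<Rightarrow> (nat \<Rightarrow> 'p \<Rightarrow> 'p) \<Rightarrow> ('a, 'y) module \<Rightarrow>
   nat \<Rightarrow> ('p \<Rightarrow> 'y) set monoid" where
  "Ext_from A P d Y i =
     (hom_group A (P i) Y)\<lparr>carrier := cocycles A P d Y i\<rparr> Mod coboundaries A P d Y i"

definition Ext ::
  "('a, 'c) ring_scheme \<Rightarrow> nat \<Rightarrow> ('a, 'x) module \<Rightarrow> ('a, 'y) module \<Rightarrow>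
   ((nat \<Rightarrow> 'a) set \<Rightarrow> 'y) set monoid" where
  "Ext A i X Y =
     (case (SOME (P :: nat \<Rightarrow> 'a umodule, d, e). projective_resolution A P d e X) of
       (P, d, e) \<Rightarrow> Ext_from A P d Y i)"

definition Ext_perp ::
  "('a, 'c) ring_scheme \<Rightarrow> enat \<Rightarrow> ('a, 'x) module \<Rightarrow> ('a, 'y) module \<Rightarrow> bool" where
  "Ext_perp A l X Y \<longleftrightarrow> (\<forall>i>0. enat i \<le> l \<longrightarrow> trivial_group (Ext A i X Y))"


section \<open>Commutative algebra\<close>

definition height :: "('r, 'q) ring_scheme \<Rightarrow> 'r set \<Rightarrow> enat" where
  "height R p = Sup {enat n | n. \<exists>c :: nat \<Rightarrow> 'r set.
     (\<forall>i\<le>n. primeideal (c i) R) \<and> (\<forall>i<n. c i \<subset> c (Suc i)) \<and> c n = p}"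

definition krull_dim :: "('r, 'q) ring_scheme \<Rightarrow> enat" where
  "krull_dim R = Sup {enat n | n. \<exists>c :: nat \<Rightarrow> 'r set.
     (\<forall>i\<le>n. primeideal (c i) R) \<and> (\<forall>i<n. c i \<subset> c (Suc i))}"

locale noetherian_local_ring = cring R + noetherian_ring R for R (structure) +
  assumes unique_maximalideal: "\<exists>!I. maximalideal I R"

definition max_ideal :: "('r, 'q) ring_scheme \<Rightarrow> 'r set" where
  "max_ideal R = (THE I. maximalideal I R)"

locale regular_local_ring = noetherian_local_ring R for R (structure) +
  assumes regular: "\<exists>S\<subseteq>carrier R. finite S \<and> enat (card S) = krull_dim R \<and> max_ideal R = Idl S"

text \<open>Completeness in the \<open>max_ideal\<close>-adic topology: separated, and Cauchy sequences converge.\<close>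

locale complete_regular_local_ring = regular_local_ring R for R (structure) +
  assumes separated: "(\<Inter>n::nat. max_ideal R [^]\<^bsub>ideals_set R\<^esub> n) = {\<zero>}"
    and complete: "\<And>x :: nat \<Rightarrow> _. \<lbrakk>\<And>n. x n \<in> carrier R;
        \<And>n. x (Suc n) \<ominus> x n \<in> max_ideal R [^]\<^bsub>ideals_set R\<^esub> n\<rbrakk> \<Longrightarrow>
      \<exists>y\<in>carrier R. \<forall>n. y \<ominus> x n \<in> max_ideal R [^]\<^bsub>ideals_set R\<^esub> n"

text \<open>The localization of \<open>R\<close> at a multiplicative set \<open>S\<close>, as an \<open>R\<close>-algebra.\<close>

definition frac_rel :: "('r, 'q) ring_scheme \<Rightarrow> 'r set \<Rightarrow> (('r \<times> 'r) \<times> ('r \<times> 'r)) set" where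
  "frac_rel R S = {((a, s), (b, t)). a \<in> carrier R \<and> b \<in> carrier R \<and> s \<in> S \<and> t \<in> S \<and>
     (\<exists>u\<in>S. u \<otimes>\<^bsub>R\<^esub> (t \<otimes>\<^bsub>R\<^esub> a \<ominus>\<^bsub>R\<^esub> s \<otimes>\<^bsub>R\<^esub> b) = \<zero>\<^bsub>R\<^esub>)}"

definition localization ::
  "('r, 'q) ring_scheme \<Rightarrow> 'r set \<Rightarrow> ('r, ('r \<times> 'r) set) module" where
  "localization R S = (let frac = (\<lambda>a s. frac_rel R S `` {(a, s)}) in
     \<lparr>carrier = (carrier R \<times> S) // frac_rel R S,
      monoid.mult = (\<lambda>X Y. \<Union>(a, s)\<in>X. \<Union>(b, t)\<in>Y. frac (a \<otimes>\<^bsub>R\<^esub> b) (s \<otimes>\<^bsub>R\<^esub> t)),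
      one = frac \<one>\<^bsub>R\<^esub> \<one>\<^bsub>R\<^esub>,
      zero = frac \<zero>\<^bsub>R\<^esub> \<one>\<^bsub>R\<^esub>,
      add = (\<lambda>X Y. \<Union>(a, s)\<in>X. \<Union>(b, t)\<in>Y.
        frac (t \<otimes>\<^bsub>R\<^esub> a \<oplus>\<^bsub>R\<^esub> s \<otimes>\<^bsub>R\<^esub> b) (s \<otimes>\<^bsub>R\<^esub> t)),
      smult = (\<lambda>r X. \<Union>(a, s)\<in>X. frac (r \<otimes>\<^bsub>R\<^esub> a) s)\<rparr>)"

text \<open>
  The tensor product \<open>L \<otimes>\<^sub>R N\<close> of \<open>R\<close>-algebras: the free abelian group on \<open>L \<times> N\<close>, made a ring by
  \<open>(a, b) (a', b') = (a a', b b')\<close>, modulo the bilinearity relations. Products of a relation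
  with generators are relations, so the two-sided ideal they generate is the subgroup they generate.
\<close>

definition pre_tensor ::
  "('r, 'a) module \<Rightarrow> ('r, 'b) module \<Rightarrow> ('a \<times> 'b \<Rightarrow>\<^sub>0 int) ring" where
  "pre_tensor L N = \<lparr>carrier = {c. Poly_Mapping.keys c \<subseteq> carrier L \<times> carrier N},
     monoid.mult = (\<lambda>c c'. frag_extend (\<lambda>(a, b). frag_extend (\<lambda>(a', b').
        frag_of (a \<otimes>\<^bsub>L\<^esub> a', b \<otimes>\<^bsub>N\<^esub> b')) c') c),
     one = frag_of (\<one>\<^bsub>L\<^esub>, \<one>\<^bsub>N\<^esub>),
     zero = 0,
     add = (+)\<rparr>"

definition tensor_relations ::
  "('r, 'q) ring_scheme \<Rightarrow> ('r, 'a) module \<Rightarrow> ('r, 'b) module \<Rightarrow> ('a \<times> 'b \<Rightarrow>\<^sub>0 int) set" where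
  "tensor_relations R L N =
     {frag_of (a \<oplus>\<^bsub>L\<^esub> a', b) - frag_of (a, b) - frag_of (a', b) | a a' b.
        a \<in> carrier L \<and> a' \<in> carrier L \<and> b \<in> carrier N} \<union>
     {frag_of (a, b \<oplus>\<^bsub>N\<^esub> b') - frag_of (a, b) - frag_of (a, b') | a b b'.
        a \<in> carrier L \<and> b \<in> carrier N \<and> b' \<in> carrier N} \<union>
     {frag_of (r \<odot>\<^bsub>L\<^esub> a, b) - frag_of (a, r \<odot>\<^bsub>N\<^esub> b) | r a b.
        r \<in> carrier R \<and> a \<in> carrier L \<and> b \<in> carrier N}"

definition tensor_algebra ::
  "('r, 'q) ring_scheme \<Rightarrow> ('r, 'a) module \<Rightarrow> ('r, 'b) module \<Rightarrow> ('a \<times> 'b \<Rightarrow>\<^sub>0 int) set ring" where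
  "tensor_algebra R L N =
     pre_tensor L N Quot (Idl\<^bsub>pre_tensor L N\<^esub> tensor_relations R L N)"


section \<open>Orders\<close>

text \<open>Unlike in \<^locale>\<open>algebra\<close>, \<open>L\<close> need not be commutative.\<close>

locale module_finite_algebra = R?: cring R + L?: ring L
  for R :: "('r, 'q) ring_scheme" (structure) and L :: "('r, 'l) module" (structure) +
  assumes fg_over_base: "fg_module R L"
    and smult_mult_left: "\<lbrakk>r \<in> carrier R; x \<in> carrier L; y \<in> carrier L\<rbrakk> \<Longrightarrow>
        (r \<odot>\<^bsub>L\<^esub> x) \<otimes>\<^bsub>L\<^esub> y = r \<odot>\<^bsub>L\<^esub> (x \<otimes>\<^bsub>L\<^esub> y)"
    and smult_mult_right: "\<lbrakk>r \<in> carrier R; x \<in> carrier L; y \<in> carrier L\<rbrakk> \<Longrightarrow>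
        x \<otimes>\<^bsub>L\<^esub> (r \<odot>\<^bsub>L\<^esub> y) = r \<odot>\<^bsub>L\<^esub> (x \<otimes>\<^bsub>L\<^esub> y)"

definition restrict_scalars :: "('r, 'l) module \<Rightarrow> ('l, 'x) module \<Rightarrow> ('r, 'x) module" where
  "restrict_scalars L X = \<lparr>carrier = carrier X, monoid.mult = monoid.mult X, one = one X,
     zero = zero X, add = add X, smult = (\<lambda>r x. (r \<odot>\<^bsub>L\<^esub> \<one>\<^bsub>L\<^esub>) \<odot>\<^bsub>X\<^esub> x)\<rparr>"

definition is_CM :: "('r, 'q) ring_scheme \<Rightarrow> ('r, 'l) module \<Rightarrow> ('l, 'x) module \<Rightarrow> bool" where
  "is_CM R L X \<longleftrightarrow> fg_module L X \<and> projective_module R (restrict_scalars L X)"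

locale order_algebra = module_finite_algebra R L
  for R :: "('r, 'q) ring_scheme" (structure) and L :: "('r, 'l) module" (structure) +
  assumes CM_self: "is_CM R L (regular_module L)"

definition isolated_singularity :: "('r, 'q) ring_scheme \<Rightarrow> ('r, 'l) module \<Rightarrow> bool" where
  "isolated_singularity R L \<longleftrightarrow>
     (\<forall>p. primeideal p R \<and> \<not> maximalideal p R \<longrightarrow>
        gl_dim (tensor_algebra R L (localization R (carrier R - p))) = height R p)"

text \<open>
  \<open>Hom\<^sub>R(L, R)\<close> as a left \<open>L\<close>-module, via the right action of \<open>L\<close> on itself.
\<close>

definition dual_regular :: "('r, 'q) ring_scheme \<Rightarrow> ('r, 'l) module \<Rightarrow> ('l, 'l \<Rightarrow> 'r) module" where
  "dual_regular R L = \<lparr>carrier = mod_hom R L (regular_module R),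
     monoid.mult = undefined, one = undefined,
     zero = (\<lambda>x\<in>carrier L. \<zero>\<^bsub>R\<^esub>),
     add = (\<lambda>f g. \<lambda>x\<in>carrier L. f x \<oplus>\<^bsub>R\<^esub> g x),
     smult = (\<lambda>a f. \<lambda>x\<in>carrier L. f (x \<otimes>\<^bsub>L\<^esub> a))\<rparr>"


section \<open>Subcategories of the category of finitely generated modules\<close>

text \<open>
  A full subcategory is given by its class of objects, taken in the universe \<^typ>\<open>'a umodule\<close>.
  A module on another carrier type belongs to a subcategory when it is isomorphic to a member.
\<close>

definition fg_modules :: "('a, 'c) ring_scheme \<Rightarrow> 'a umodule set" where
  "fg_modules A = {X. fg_module A X}"

definition subcategory :: "('a, 'c) ring_scheme \<Rightarrow> 'a umodule set \<Rightarrow> bool" where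
  "subcategory A C \<longleftrightarrow> C \<subseteq> fg_modules A \<and>
     (\<forall>X\<in>C. \<forall>Y\<in>fg_modules A. mod_iso A X Y \<longrightarrow> Y \<in> C) \<and>
     (\<forall>Z\<in>fg_modules A. is_zero_module Z \<longrightarrow> Z \<in> C) \<and>
     (\<forall>X\<in>fg_modules A. \<forall>Y\<in>fg_modules A. \<forall>Z\<in>fg_modules A.
        mod_iso A Z (direct_sum X Y) \<longrightarrow> (X \<in> C \<and> Y \<in> C \<longleftrightarrow> Z \<in> C))"

definition belongs_to :: "('a, 'c) ring_scheme \<Rightarrow> ('a, 'x) module \<Rightarrow> 'a umodule set \<Rightarrow> bool" where
  "belongs_to A X C \<longleftrightarrow> (\<exists>Y\<in>C. mod_iso A X Y)"

definition add_closure :: "('a, 'c) ring_scheme \<Rightarrow> ('a, 'x) module \<Rightarrow> 'a umodule set" where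
  "add_closure A M = {X \<in> fg_modules A. \<exists>Y\<in>fg_modules A. \<exists>n::nat.
     mod_iso A (direct_sum X Y) (copower M {..<n})}"

definition indecomposable :: "('a, 'c) ring_scheme \<Rightarrow> 'a umodule \<Rightarrow> bool" where
  "indecomposable A X \<longleftrightarrow> \<not> is_zero_module X \<and>
     (\<forall>Y\<in>fg_modules A. \<forall>Z\<in>fg_modules A.
        mod_iso A X (direct_sum Y Z) \<longrightarrow> is_zero_module Y \<or> is_zero_module Z)"

definition ind :: "('a, 'c) ring_scheme \<Rightarrow> 'a umodule set \<Rightarrow> 'a umodule set set" where
  "ind A C = (\<lambda>X. {Y \<in> fg_modules A. mod_iso A X Y}) ` {X \<in> C. indecomposable A X}"

definition ecard :: "'s set \<Rightarrow> enat" where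
  "ecard S = (if finite S then enat (card S) else \<infinity>)"

definition CM :: "('r, 'q) ring_scheme \<Rightarrow> ('r, 'l) module \<Rightarrow> 'l umodule set" where
  "CM R L = {X. is_CM R L X}"

definition left_perp :: "('a, 'c) ring_scheme \<Rightarrow> ('a, 't) module \<Rightarrow> 'a umodule set" where
  "left_perp A T = {X \<in> fg_modules A. Ext_perp A \<infinity> X T}"

definition cotilting ::
  "('r, 'q) ring_scheme \<Rightarrow> ('r, 'l) module \<Rightarrow> nat \<Rightarrow> nat \<Rightarrow> ('l, 't) module \<Rightarrow> bool" where
  "cotilting R L d m T \<longleftrightarrow> is_CM R L T \<and> Ext_perp L \<infinity> T T \<and>
     (\<exists>e I f. coresolution L T e I f \<and>
        (\<forall>i\<le>m - d. I i \<in> add_closure L (dual_regular R L)) \<and> (\<forall>i>m - d. is_zero_module (I i))) \<and>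
     (\<exists>U f e. resolution L U f e (dual_regular R L) \<and>
        (\<forall>i\<le>m - d. U i \<in> add_closure L T) \<and> (\<forall>i>m - d. is_zero_module (U i)))"

definition contravariantly_finite ::
  "('a, 'c) ring_scheme \<Rightarrow> 'a umodule set \<Rightarrow> 'a umodule set \<Rightarrow> bool" where
  "contravariantly_finite A B C \<longleftrightarrow> (\<forall>X\<in>B. \<exists>C0\<in>C. \<exists>f\<in>mod_hom A C0 X. \<forall>C'\<in>C.
     (\<lambda>g. compose (carrier C') f g) ` mod_hom A C' C0 = mod_hom A C' X)"

definition covariantly_finite ::
  "('a, 'c) ring_scheme \<Rightarrow> 'a umodule set \<Rightarrow> 'a umodule set \<Rightarrow> bool" where
  "covariantly_finite A B C \<longleftrightarrow> (\<forall>X\<in>B. \<exists>C0\<in>C. \<exists>f\<in>mod_hom A X C0. \<forall>C'\<in>C.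
     (\<lambda>g. compose (carrier X) g f) ` mod_hom A C0 C' = mod_hom A X C')"

definition functorially_finite ::
  "('a, 'c) ring_scheme \<Rightarrow> 'a umodule set \<Rightarrow> 'a umodule set \<Rightarrow> bool" where
  "functorially_finite A B C \<longleftrightarrow> contravariantly_finite A B C \<and> covariantly_finite A B C"

definition maximal_orthogonal ::
  "('a, 'c) ring_scheme \<Rightarrow> 'a umodule set \<Rightarrow> enat \<Rightarrow> 'a umodule set \<Rightarrow> bool" where
  "maximal_orthogonal A B l C \<longleftrightarrow> subcategory A C \<and> C \<subseteq> B \<and> functorially_finite A B C \<and>
     C = {X \<in> B. \<forall>Y\<in>C. Ext_perp A l Y X} \<and>
     C = {X \<in> B. \<forall>Y\<in>C. Ext_perp A l X Y}"

text \<open>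
  \<open>C\<close>-dim \<open>B\<close> \<open>\<le> 1\<close>. The last three conjuncts say that
  \<open>0 \<rightarrow> Hom(C', C1) \<rightarrow> Hom(C', C0) \<rightarrow> Hom(C', X) \<rightarrow> 0\<close> is exact.
\<close>

definition rel_dim_le_1 ::
  "('a, 'c) ring_scheme \<Rightarrow> 'a umodule set \<Rightarrow> 'a umodule set \<Rightarrow> bool" where
  "rel_dim_le_1 A C B \<longleftrightarrow> (\<forall>X\<in>B. \<exists>C0\<in>C. \<exists>C1\<in>C.
     \<exists>f1\<in>mod_hom A C1 C0. \<exists>f0\<in>mod_hom A C0 X.
       compose (carrier C1) f0 f1 = zero_map C1 X \<and>
       (\<forall>C'\<in>C.
          inj_on (\<lambda>g. compose (carrier C') f1 g) (mod_hom A C' C1) \<and>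
          (\<lambda>g. compose (carrier C') f1 g) ` mod_hom A C' C1 =
            {g \<in> mod_hom A C' C0. compose (carrier C') f0 g = zero_map C' X} \<and>
          (\<lambda>g. compose (carrier C') f0 g) ` mod_hom A C' C0 = mod_hom A C' X))"

text \<open>
  Endomorphism rings of \<open>M \<in> CM R L\<close> are noetherian on both sides for an \<open>R\<close>-order \<open>L\<close> over noetherian
  \<open>R\<close>, so their left and right global dimensions agree.
\<close>

definition rep_dim_1 :: "('r, 'q) ring_scheme \<Rightarrow> ('r, 'l) module \<Rightarrow> enat" where
  "rep_dim_1 R L = Inf {gl_dim (End_ring L M) | M. M \<in> CM R L \<and>
     belongs_to L (direct_sum (regular_module L) (dual_regular R L)) (add_closure L M)}"

definition orth_number :: "('a, 'c) ring_scheme \<Rightarrow> 'a umodule set \<Rightarrow> enat" where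
  "orth_number A B = (SUP C\<in>{C. subcategory A C \<and> C \<subseteq> B \<and> (\<forall>X\<in>C. \<forall>Y\<in>C. Ext_perp A 1 X Y)}.
     ecard (ind A C))"

end

theory Submission
  imports Defs "HOL-Library.Multiset"
begin

text \<open>
  The proof counts classes in the Grothendieck group of a Krull-Schmidt category. Idempotents of an
  algebra that is finite over a complete local ring lift modulo the maximal ideal, so indecomposable
  modules have local endomorphism rings (\<open>indecomposable_local\<close>), and every finitely generated module
  \<open>X\<close> has a well-defined multiset \<open>dec X\<close> of classes of indecomposable summands (\<open>krull_schmidt\<close>).

  Call a map \<open>u: P \<rightarrow> Q\<close> orthogonal to \<open>v: P' \<rightarrow> Q'\<close> if every map \<open>P \<rightarrow> Q'\<close> has the form \<open>b u + v c\<close>.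
  If \<open>u\<close> and \<open>v\<close> are relative resolutions of modules \<open>X\<close> and \<open>X'\<close>, this follows from \<open>Ext\<^sup>1(X, X') = 0\<close>. Two maps
  with the same source and the same target that are orthogonal to themselves and to each other have
  the same direct sum of kernel and cokernel up to isomorphism (\<open>kc_orth\<close>): this is the algebraic form of the
  principle that a presentation of a rigid module is generic among all presentations by the same modules, so
  that a rigid module is determined by the class \<open>[Q] - [P]\<close>. The proof avoids geometry by comparing
  block matrices.

  Now let a set of pairwise orthogonal maps \<open>u: P \<rightarrow> Q\<close> be given such that kernel and cokernel together are
  one indecomposable module, different for different maps, and all summands of all \<open>P\<close> and \<open>Q\<close> belong to a finite set \<open>S\<close>. If
  there are more maps than elements of \<open>S\<close>, the vectors \<open>dec Q - dec P\<close> satisfy a nontrivial integral relation.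
  Sorting its terms by sign yields two direct sums of the given maps and of identity maps with the
  same source and isomorphic targets. They contradict \<open>kc_orth\<close>, because their kernels and cokernels contain
  different indecomposables (\<open>card_le_of_orth\<close>). Thus a rigid class is at most as large as \<open>S\<close>.

  In part (3) the maps are the relative resolutions \<open>C\<^sub>1 \<rightarrow> C\<^sub>0\<close>; these are exact since \<open>\<Lambda>\<close> belongs to \<open>C\<close>
  (\<open>rigid_card_le\<close>). Part (2) reduces to part (3), since the kernel of a right approximation by a maximal
  orthogonal \<open>C\<close> belongs to \<open>C\<close> (\<open>maximal_orthogonal_rel_dim\<close>), while \<open>C\<close> itself is rigid.

  In part (1), let \<open>E = End M\<close> have global dimension at most three, where \<open>\<Lambda>\<close> and its dual are
  summands of powers of \<open>M\<close>. For a lattice \<open>X\<close> the \<open>E\<close>-module \<open>Hom(X, M)\<close> is a second syzygy, so a presentation of it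
  by a power of \<open>E\<close> has a projective kernel (\<open>add_resolution\<close>). This means that there is a complex
  \<open>0 \<rightarrow> X \<rightarrow> C\<^sub>0 \<rightarrow> C\<^sub>1 \<rightarrow> 0\<close> with \<open>C\<^sub>0\<close> and \<open>C\<^sub>1\<close> in \<open>add M\<close> that \<open>Hom(-, M)\<close> makes exact. As the dual of \<open>\<Lambda>\<close> is in \<open>add M\<close>,
  duality over \<open>R\<close> makes it exact, too, and hence it is exact itself (\<open>add_resolution_exact\<close>). The maps
  \<open>C\<^sub>0 \<rightarrow> C\<^sub>1\<close> then bound every rigid class of lattices by the number of indecomposable summands of \<open>M\<close>.

  Extension groups enter only through the vanishing of \<open>Ext\<^sup>1\<close> for modules and their syzygies, which says that maps on
  a syzygy extend to the projective module that contains it (\<open>Ext_trivial_iff\<close>).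
\<close>

section \<open>Modules and linear maps\<close>

abbreviation (input) add_in ("(_ +[_]/ _)" [65, 0, 66] 65) where "x +[X] y \<equiv> x \<oplus>\<^bsub>X\<^esub> y"
abbreviation (input) diff_in ("(_ -[_]/ _)" [65, 0, 66] 65) where "x -[X] y \<equiv> x \<ominus>\<^bsub>X\<^esub> y"
abbreviation (input) neg_in ("(-[_]/ _)" [0, 81] 80) where "-[X] x \<equiv> \<ominus>\<^bsub>X\<^esub> x"
abbreviation (input) mult_in ("(_ *[_]/ _)" [70, 0, 71] 70) where "x *[A] y \<equiv> x \<otimes>\<^bsub>A\<^esub> y"
abbreviation (input) smult_in ("(_ .[_]/ _)" [70, 0, 71] 70) where "a .[X] x \<equiv> a \<odot>\<^bsub>X\<^esub> x"
abbreviation (input) zero_in ("0[_]") where "0[X] \<equiv> \<zero>\<^bsub>X\<^esub>"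
abbreviation (input) one_in ("1[_]") where "1[A] \<equiv> \<one>\<^bsub>A\<^esub>"
abbreviation (input) in_carrier ("(_ \<in>[_])" [51, 0] 50) where "x \<in>[X] \<equiv> x \<in> carrier X"
abbreviation (input) "lmod \<equiv> left_module"
abbreviation (input) "fgm \<equiv> fg_module"
abbreviation (input) "dirsum \<equiv> direct_sum"
abbreviation (input) "reg_mod \<equiv> regular_module"
abbreviation (input) "rscal \<equiv> restrict_scalars"
type_synonym 'a umod = "'a umodule"


lemmas (in left_module) [simp, intro] = smult_closed
lemmas (in left_module) [simp] = smult_one

context left_module
begin

lemma smult_l_null [simp]: "x \<in>[M] ==> 0[A] .[M] x = 0[M]"
 using smult_l_distr[of "0[A]" "0[A]" x] M.add.l_cancel_one' by fastforce

lemma smult_r_null [simp]: "a \<in>[A] ==> a .[M] 0[M] = 0[M]"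
 using smult_r_distr[of a "0[M]" "0[M]"] M.add.l_cancel_one' by fastforce

lemma smult_l_minus:
 "[|a \<in>[A]; x \<in>[M]|] ==> (-[A] a) .[M] x = -[M] (a .[M] x)"
 using smult_l_distr[of "-[A] a" a x] by (intro M.minus_equality[symmetric]) (auto simp: A.l_neg)

lemma smult_r_minus:
 "[|a \<in>[A]; x \<in>[M]|] ==> a .[M] (-[M] x) = -[M] (a .[M] x)"
 using smult_r_distr[of a "-[M] x" x] by (intro M.minus_equality[symmetric]) (auto simp: M.l_neg)

lemma minus_zero_module: "-[M] 0[M] = 0[M]"
 by simp

lemmas module_simprules
 [algebra left_module "zero M" "add M" "a_inv M" "a_minus M" "smult M"] =
 M.a_closed M.zero_closed M.a_inv_closed M.minus_closed smult_closed
 M.a_assoc M.l_zero M.l_neg M.a_comm M.minus_eq M.r_zero M.r_neg M.r_neg2 M.r_neg1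
 M.minus_add M.minus_minus minus_zero_module M.a_lcomm
 smult_r_distr smult_r_null smult_l_null smult_r_minus smult_one

lemma minus_eq_zero_iff:
 "[|x \<in>[M]; y \<in>[M]|] ==> x -[M] y = 0[M] \<longleftrightarrow> x = y"
 by (metis M.a_inv_closed M.minus_equality M.minus_minus M.r_neg M.minus_eq)

lemma smult_finsum:
 assumes "finite J" "g : J \<rightarrow> carrier M" "a \<in>[A]"
 shows "a .[M] finsum M g J = finsum M (%j. a .[M] g j) J"
 using assms by (induct J) (auto simp: smult_r_distr Pi_def)

lemma finsum_smult:
 assumes "finite J" "g : J \<rightarrow> carrier A" "x \<in>[M]"
 shows "finsum A g J .[M] x = finsum M (%j. g j .[M] x) J"
 using assms by (induct J) (auto simp: smult_l_distr Pi_def)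

lemma submodule_intro:
 assumes "N <= carrier M" "0[M] : N" "!!x y. [|x : N; y : N|] ==> x +[M] y : N"
  "!!a x. [|a \<in>[A]; x : N|] ==> a .[M] x : N"
 shows "submodule N A M"
proof (intro submodule.intro subgroup.intro)
 fix x assume "x : N"
 hence "-[M] x = (-[A] 1[A]) .[M] x" using assms(1) by (auto simp: smult_l_minus)
 thus "inv\<^bsub>add_monoid M\<^esub> x : N" using assms(4)[OF _ \<open>x : N\<close>] by (simp flip: a_inv_def)
qed (use assms in "auto simp: submodule_axioms_def")

lemma subm:
 assumes "submodule N A M"
 shows "N <= carrier M" "0[M] : N" "!!x y. [|x : N; y : N|] ==> x +[M] y : N"
  "!!a x. [|a \<in>[A]; x : N|] ==> a .[M] x : N"
  "!!x. x : N ==> -[M] x : N" "!!x y. [|x : N; y : N|] ==> x -[M] y : N"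
 using submodule.axioms[OF assms]
 by (auto simp: subgroup_def submodule_axioms_def a_inv_def M.minus_eq)

end

lemma (in left_module) all_laws:
 shows "!!x y. [|x \<in>[M]; y \<in>[M]|] ==> x +[M] y \<in>[M]" "0[M] \<in>[M]"
  "!!x y z. [|x \<in>[M]; y \<in>[M]; z \<in>[M]|] ==>
    (x +[M] y) +[M] z = x +[M] (y +[M] z)"
  "!!x y. [|x \<in>[M]; y \<in>[M]|] ==> x +[M] y = y +[M] x"
  "!!x. x \<in>[M] ==> 0[M] +[M] x = x" "!!x. x \<in>[M] ==> x +[M] 0[M] = x"
  "!!a x. [|a \<in>[A]; x \<in>[M]|] ==> a .[M] x \<in>[M]"
  "!!a b x. [|a \<in>[A]; b \<in>[A]; x \<in>[M]|] ==>
    (a +[A] b) .[M] x = a .[M] x +[M] b .[M] x"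
  "!!a x y. [|a \<in>[A]; x \<in>[M]; y \<in>[M]|] ==>
    a .[M] (x +[M] y) = a .[M] x +[M] a .[M] y"
  "!!a b x. [|a \<in>[A]; b \<in>[A]; x \<in>[M]|] ==>
    (a *[A] b) .[M] x = a .[M] (b .[M] x)"
  "!!x. x \<in>[M] ==> 1[A] .[M] x = x"
  "!!x. x \<in>[M] ==> 0[A] .[M] x = 0[M]" "!!a. a \<in>[A] ==> a .[M] 0[M] = 0[M]"
  "ring A" "abelian_group M"
 by (auto simp: M.a_assoc smult_l_distr smult_r_distr smult_assoc A.ring_axioms M.abelian_group_axioms
   intro: M.a_comm)

lemmas lmodD = left_module.all_laws

lemma left_module_intro:
 assumes "ring A"
  "!!x y. [|x \<in>[M]; y \<in>[M]|] ==> x +[M] y \<in>[M]" "0[M] \<in>[M]"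
  "!!x y z. [|x \<in>[M]; y \<in>[M]; z \<in>[M]|] ==>
    (x +[M] y) +[M] z = x +[M] (y +[M] z)"
  "!!x y. [|x \<in>[M]; y \<in>[M]|] ==> x +[M] y = y +[M] x"
  "!!x. x \<in>[M] ==> 0[M] +[M] x = x"
  "!!a x. [|a \<in>[A]; x \<in>[M]|] ==> a .[M] x \<in>[M]"
  "!!a b x. [|a \<in>[A]; b \<in>[A]; x \<in>[M]|] ==>
    (a +[A] b) .[M] x = a .[M] x +[M] b .[M] x"
  "!!a x y. [|a \<in>[A]; x \<in>[M]; y \<in>[M]|] ==>
    a .[M] (x +[M] y) = a .[M] x +[M] a .[M] y"
  "!!a b x. [|a \<in>[A]; b \<in>[A]; x \<in>[M]|] ==>
    (a *[A] b) .[M] x = a .[M] (b .[M] x)"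
  "!!x. x \<in>[M] ==> 1[A] .[M] x = x"
  "!!x. x \<in>[M] ==> 0[A] .[M] x = 0[M]"
 shows "lmod A M"
proof -
 interpret A: ring A by fact
 have "\<exists>y\<in>carrier M. y +[M] x = 0[M]" if "x \<in>[M]" for x
  using assms(7)[of "-[A] 1[A]" x] assms(8)[of "-[A] 1[A]" "1[A]" x] assms(11,12)[of x] that
  by (auto simp: A.l_neg intro!: bexI[of _ "-[A] 1[A] .[M] x"])
 thus ?thesis
  by (intro left_module.intro left_module_axioms.intro abelian_groupI) (use assms in auto)
qed

text \<open>
 Linear maps are not required to be extensional, which makes them easier to compose and add than
 elements of \<^const>\<open>mod_hom\<close>; restricting to the carrier passes from the former to the latter.
\<close>

definition lin :: "('a, 'c) ring_scheme => ('a, 'x) module => ('a, 'y) module => ('x => 'y) => bool" where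
 "lin A X Y f \<longleftrightarrow> f : carrier X \<rightarrow> carrier Y &
   (\<forall>x\<in>carrier X. \<forall>y\<in>carrier X. f (x +[X] y) = f x +[Y] f y) &
   (\<forall>a\<in>carrier A. \<forall>x\<in>carrier X. f (a .[X] x) = a .[Y] f x)"

definition ker :: "('a, 'x) module => ('a, 'y) module => ('x => 'y) => 'x set" where
 "ker X Y f = {x : carrier X. f x = 0[Y]}"

abbreviation sub :: "('a, 'x) module => 'x set => ('a, 'x) module" where
 "sub X N \<equiv> X\<lparr>carrier := N\<rparr>"

lemma linI:
 assumes "!!x. x \<in>[X] ==> f x \<in>[Y]"
  "!!x y. [|x \<in>[X]; y \<in>[X]|] ==> f (x +[X] y) = f x +[Y] f y"
  "!!a x. [|a \<in>[A]; x \<in>[X]|] ==> f (a .[X] x) = a .[Y] f x"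
 shows "lin A X Y f"
 using assms by (auto simp: lin_def)

lemma lin_cl: "[|lin A X Y f; x \<in>[X]|] ==> f x \<in>[Y]"
 and lin_add: "[|lin A X Y f; x \<in>[X]; y \<in>[X]|] ==> f (x +[X] y) = f x +[Y] f y"
 and lin_smult: "[|lin A X Y f; a \<in>[A]; x \<in>[X]|] ==> f (a .[X] x) = a .[Y] f x"
 by (auto simp: lin_def)

lemma lin_cong: "[|lin A X Y f; !!x. x \<in>[X] ==> f x = g x; lmod A X|] ==> lin A X Y g"
 unfolding lin_def using left_module.smult_closed[of A X]
 by (auto simp: Pi_def abelian_monoid.a_closed abelian_group.axioms(1) left_module.axioms(2))

lemma mod_hom_lin: "f : mod_hom A X Y ==> lin A X Y f"
 by (auto simp: mod_hom_def lin_def)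

lemma mod_hom_iff_lin: "f : mod_hom A X Y \<longleftrightarrow> lin A X Y f & f : extensional (carrier X)"
 by (auto simp: mod_hom_def lin_def PiE_def)

lemma lin_mod_hom:
 assumes "lmod A X" "lin A X Y f" shows "restrict f (carrier X) : mod_hom A X Y"
 by (simp add: mod_hom_iff_lin lin_cong[OF assms(2) _ assms(1)])

lemma lin_comp: "[|lin A X Y f; lin A Y Z g|] ==> lin A X Z (%x. g (f x))"
 by (auto simp: lin_def Pi_def)

lemma lin_id: "lin A X X (%x. x)"
 by (auto simp: lin_def)

lemma lin_zero:
 assumes "lmod A X" "lmod A Y" "lin A X Y f" shows "f 0[X] = 0[Y]"
proof -
 interpret X: left_module A X by fact
 interpret Y: left_module A Y by fact
 show ?thesis using lin_smult[OF assms(3), of "0[A]" "0[X]"] lin_cl[OF assms(3)] by simp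
qed

lemma lin_minus:
 assumes "lmod A X" "lmod A Y" "lin A X Y f" "x \<in>[X]"
 shows "f (-[X] x) = -[Y] f x"
proof -
 interpret X: left_module A X by fact
 interpret Y: left_module A Y by fact
 show ?thesis using assms lin_smult[OF assms(3), of "-[A] 1[A]" x] lin_cl[OF assms(3)]
  by (simp add: X.smult_l_minus Y.smult_l_minus)
qed

lemma lin_diff:
 assumes "lmod A X" "lmod A Y" "lin A X Y f" "x \<in>[X]" "y \<in>[X]"
 shows "f (x -[X] y) = f x -[Y] f y"
proof -
 interpret X: left_module A X by fact
 interpret Y: left_module A Y by fact
 show ?thesis using assms by (simp add: X.minus_eq Y.minus_eq lin_add lin_minus[OF assms(1,2,3)])
qed

lemma lin_finsum:
 assumes "lmod A X" "lmod A Y" "lin A X Y f" "finite J" "g : J \<rightarrow> carrier X"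
 shows "f (finsum X g J) = finsum Y (%j. f (g j)) J"
proof -
 interpret X: left_module A X by fact
 interpret Y: left_module A Y by fact
 show ?thesis using assms(4,5)
  by induct (auto simp: lin_zero[OF assms(1-3)] lin_add[OF assms(3)] Pi_def lin_cl[OF assms(3)])
qed

lemma lin_plus:
 assumes "lmod A Y" "lin A X Y f" "lin A X Y g"
 shows "lin A X Y (%x. f x +[Y] g x)"
proof -
 interpret Y: left_module A Y by fact
 show ?thesis using assms(2,3)
  by (auto simp: lin_def Pi_def Y.a_ac Y.smult_r_distr)
qed

lemma lin_subtract:
 assumes "lmod A Y" "lin A X Y f" "lin A X Y g"
 shows "lin A X Y (%x. f x -[Y] g x)"
proof -
 interpret Y: left_module A Y by fact
 show ?thesis using assms(2,3)
  by (auto simp: lin_def Pi_def Y.minus_eq Y.minus_add Y.a_ac Y.smult_r_distr Y.smult_r_minus)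
qed

lemma lin_zero_map: "lmod A Y ==> lin A X Y (%x. 0[Y])"
proof -
 assume "lmod A Y" then interpret Y: left_module A Y .
 show ?thesis by (auto simp: lin_def)
qed

lemma lin_sum:
 assumes "lmod A Y" "finite J" "!!j. j : J ==> lin A X Y (f j)"
 shows "lin A X Y (%x. finsum Y (%j. f j x) J)"
proof -
 interpret Y: left_module A Y by fact
 have [simp]: "j : J ==> x \<in>[X] ==> f j x \<in>[Y]" for j x
  using lin_cl[OF assms(3)] by blast
 show ?thesis
  by (intro linI)
   (auto simp: Pi_def Y.smult_finsum assms(2) lin_add[OF assms(3)] lin_smult[OF assms(3)]
    simp flip: Y.finsum_addf intro!: Y.finsum_cong')
qed

lemma sub_lmod:
 assumes "lmod A X" "submodule N A X" shows "lmod A (sub X N)"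
proof -
 interpret X: left_module A X by fact
 note N = X.subm[OF assms(2)]
 hence [simp]: "x : N ==> x \<in>[X]" for x by auto
 show ?thesis
  by (rule left_module_intro)
   (use N X.A.ring_axioms in \<open>auto simp: X.a_ac X.smult_l_distr X.smult_r_distr X.smult_assoc\<close>)
qed

lemma lin_incl: "N <= carrier X ==> lin A (sub X N) X (%x. x)"
 by (auto simp: lin_def)

lemma lin_into_sub: "lin A X (sub Y N) f \<longleftrightarrow> lin A X Y f & f ` carrier X <= N" if "N <= carrier Y"
 using that by (auto simp: lin_def)

lemma lin_from_sub: "lin A X Y f ==> N <= carrier X ==> lin A (sub X N) Y f"
 by (auto simp: lin_def Pi_def subset_iff)

lemma ker_submodule:
 assumes "lmod A X" "lmod A Y" "lin A X Y f" shows "submodule (ker X Y f) A X"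
proof -
 interpret X: left_module A X by fact
 interpret Y: left_module A Y by fact
 show ?thesis by (rule X.submodule_intro)
  (auto simp: ker_def lin_zero[OF assms] lin_add[OF assms(3)] lin_smult[OF assms(3)])
qed

lemma image_submodule:
 assumes "lmod A X" "lmod A Y" "lin A X Y f" "submodule N A X"
 shows "submodule (f ` N) A Y"
proof -
 interpret X: left_module A X by fact
 interpret Y: left_module A Y by fact
 note N = X.subm[OF assms(4)]
 show ?thesis
 proof (rule Y.submodule_intro)
  show "f ` N <= carrier Y" using N(1) lin_cl[OF assms(3)] by auto
  show "0[Y] : f ` N" using N(2) lin_zero[OF assms(1-3)] by force
  fix x y assume "x : f ` N" "y : f ` N"
  thus "x +[Y] y : f ` N"
   using N(1,3) lin_add[OF assms(3)] by (auto simp: subset_iff image_iff) metis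
 next
  fix a x assume "a \<in>[A]" "x : f ` N"
  thus "a .[Y] x : f ` N"
   using N(1,4) lin_smult[OF assms(3)] by (auto simp: subset_iff image_iff) metis
 qed
qed

lemma vimage_submodule:
 assumes "lmod A X" "lmod A Y" "lin A X Y f" "submodule N A Y"
 shows "submodule {x : carrier X. f x : N} A X"
proof -
 interpret X: left_module A X by fact
 interpret Y: left_module A Y by fact
 note N = Y.subm[OF assms(4)]
 show ?thesis by (rule X.submodule_intro)
  (auto simp: lin_zero[OF assms(1-3)] lin_add[OF assms(3)] lin_smult[OF assms(3)] N)
qed

lemma carrier_submodule: "lmod A X ==> submodule (carrier X) A X"
proof -
 assume "lmod A X" then interpret X: left_module A X .
 show ?thesis by (rule X.submodule_intro) auto
qed

lemma inter_submodule:
 assumes "lmod A X" "submodule N A X" "submodule N' A X" shows "submodule (N \<inter> N') A X"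
proof -
 interpret X: left_module A X by fact
 show ?thesis using X.subm[OF assms(2)] X.subm[OF assms(3)]
  by (intro X.submodule_intro) auto
qed

lemma ker_iff_diff:
 assumes "lmod A X" "lmod A Y" "lin A X Y f" "x \<in>[X]" "y \<in>[X]"
 shows "f x = f y \<longleftrightarrow> x -[X] y : ker X Y f"
proof -
 interpret X: left_module A X by fact
 interpret Y: left_module A Y by fact
 show ?thesis using assms(4,5)
  by (simp add: ker_def lin_diff[OF assms] Y.minus_eq_zero_iff lin_cl[OF assms(3)])
qed

lemma inj_on_iff_ker:
 assumes "lmod A X" "lmod A Y" "lin A X Y f"
 shows "inj_on f (carrier X) \<longleftrightarrow> ker X Y f = {0[X]}"
proof -
 interpret X: left_module A X by fact
 show ?thesis
 proof
  assume i: "inj_on f (carrier X)"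
  show "ker X Y f = {0[X]}"
   using lin_zero[OF assms] inj_onD[OF i] by (fastforce simp: ker_def)
 next
  assume k: "ker X Y f = {0[X]}"
  show "inj_on f (carrier X)"
   using ker_iff_diff[OF assms] k X.minus_eq_zero_iff by (auto intro!: inj_onI)
 qed
qed

lemma factor_surj:
 assumes X: "lmod A X" and Q: "lmod A Q" and Y: "lmod A Y"
  and q: "lin A X Q q" "q ` carrier X = carrier Q"
  and g: "lin A X Y g" and k: "ker X Q q <= ker X Y g"
 obtains g' where "lin A Q Y g'" "!!x. x \<in>[X] ==> g' (q x) = g x"
proof -
 interpret X: left_module A X by fact
 interpret Q: left_module A Q by fact
 interpret Y: left_module A Y by fact
 define s where "s u = (SOME x. x \<in>[X] & q x = u)" for u
 have s: "s u \<in>[X]" "q (s u) = u" if "u \<in>[Q]" for u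
 proof -
  have "u : q ` carrier X" using q(2) that by simp
  hence "\<exists>x. x \<in>[X] & q x = u" by blast
  from someI_ex[OF this] show "s u \<in>[X]" "q (s u) = u" by (auto simp: s_def)
 qed
 have gq: "g x = g y" if "x \<in>[X]" "y \<in>[X]" "q x = q y" for x y
  using ker_iff_diff[OF X Q q(1) that(1,2)] ker_iff_diff[OF X Y g that(1,2)] k that(3) by auto
 define g' where "g' u = g (s u)" for u
 have e: "g' (q x) = g x" if "x \<in>[X]" for x
  unfolding g'_def using that by (intro gq) (auto simp: s lin_cl[OF q(1)])
 have "lin A Q Y g'"
 proof (rule linI)
  fix u assume u: "u \<in>[Q]" thus "g' u \<in>[Y]"
   by (simp add: g'_def s lin_cl[OF g])
  fix v assume v: "v \<in>[Q]"
  show "g' (u +[Q] v) = g' u +[Y] g' v"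
   using e[of "s u +[X] s v"] u v by (simp add: s lin_add[OF q(1)] lin_add[OF g]) (simp add: g'_def)
 next
  fix a u assume u: "a \<in>[A]" "u \<in>[Q]"
  thus "g' (a .[Q] u) = a .[Y] g' u"
   using e[of "a .[X] s u"] u by (simp add: s lin_smult[OF q(1)] lin_smult[OF g]) (simp add: g'_def)
 qed
 with e show ?thesis using that by blast
qed

lemma factor_inj:
 assumes K: "lmod A K" and X: "lmod A X" and Y: "lmod A Y"
  and i: "lin A K X i" "inj_on i (carrier K)"
  and g: "lin A Y X g" and im: "g ` carrier Y <= i ` carrier K"
 obtains g' where "lin A Y K g'" "!!y. y \<in>[Y] ==> i (g' y) = g y"
proof -
 interpret K: left_module A K by fact
 interpret Y: left_module A Y by fact
 define g' where "g' y = inv_into (carrier K) i (g y)" for y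
 have s: "g' y \<in>[K]" "i (g' y) = g y" if "y \<in>[Y]" for y
  using im that by (auto simp: g'_def subset_iff inv_into_into f_inv_into_f)
 have "lin A Y K g'"
  by (rule linI; intro s inj_onD[OF i(2)])
   (auto simp: s lin_add[OF i(1)] lin_add[OF g] lin_smult[OF i(1)] lin_smult[OF g])
 with s show ?thesis using that by blast
qed

definition iso :: "('a, 'c) ring_scheme => ('a, 'x) module => ('a, 'y) module => ('x => 'y) => bool" where
 "iso A X Y f \<longleftrightarrow> lin A X Y f & bij_betw f (carrier X) (carrier Y)"

lemma mod_iso_iff: "lmod A X ==> mod_iso A X Y \<longleftrightarrow> (\<exists>f. iso A X Y f)"
 unfolding mod_iso_def iso_def
 using mod_hom_lin lin_mod_hom[of A X Y] bij_betw_cong[of "carrier X" "restrict f (carrier X)" f for f]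
 by (metis (no_types, lifting) restrict_apply')

lemma iso_inverse:
 assumes "lmod A X" "lmod A Y" "iso A X Y f"
 obtains g where "iso A Y X g" "!!x. x \<in>[X] ==> g (f x) = x" "!!y. y \<in>[Y] ==> f (g y) = y"
proof -
 have f: "lin A X Y f" "inj_on f (carrier X)" "f ` carrier X = carrier Y"
  using assms(3) by (auto simp: iso_def bij_betw_def)
 obtain g where g: "lin A Y X g" "!!y. y \<in>[Y] ==> f (g y) = y"
  using factor_inj[OF assms(1,2,2) f(1,2) lin_id] f(3) by auto
 have gf: "g (f x) = x" if "x \<in>[X]" for x
  using inj_onD[OF f(2), of "g (f x)" x] that g(2) lin_cl[OF f(1) that] lin_cl[OF g(1)] by auto
 have "bij_betw g (carrier Y) (carrier X)"
  by (rule bij_betw_byWitness[of _ f]) (auto simp: g gf lin_cl[OF f(1)] lin_cl[OF g(1)])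
 thus ?thesis using that g gf by (auto simp: iso_def)
qed

lemma isoI:
 assumes "lin A X Y f" "lin A Y X g" "!!x. x \<in>[X] ==> g (f x) = x" "!!y. y \<in>[Y] ==> f (g y) = y"
 shows "iso A X Y f"
 unfolding iso_def using assms
 by (auto intro!: bij_betw_byWitness[of _ g] simp: lin_cl)

lemma isoD: "iso A X Y f ==> lin A X Y f" "iso A X Y f ==> inj_on f (carrier X)"
 "iso A X Y f ==> f ` carrier X = carrier Y"
 by (auto simp: iso_def bij_betw_def)

lemma iso_comp: "[|iso A X Y f; iso A Y Z g|] ==> iso A X Z (%x. g (f x))"
 unfolding iso_def using bij_betw_trans[of f _ _ g] by (auto simp: lin_comp comp_def)

lemma iso_id: "iso A X X (%x. x)"
 by (auto simp: iso_def lin_id bij_betw_def)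

lemma mod_isoI: "[|lmod A X; iso A X Y f|] ==> mod_iso A X Y"
 using mod_iso_iff by blast

lemma mod_isoE:
 assumes "mod_iso A X Y" "lmod A X" obtains f where "iso A X Y f"
 using assms mod_iso_iff by blast

lemma mod_iso_refl: "lmod A X ==> mod_iso A X X"
 using iso_id mod_iso_iff by blast

lemma mod_iso_sym: "[|lmod A X; lmod A Y; mod_iso A X Y|] ==> mod_iso A Y X"
 by (metis mod_iso_iff iso_inverse)

lemma mod_iso_trans: "[|lmod A X; lmod A Y; mod_iso A X Y; mod_iso A Y Z|] ==> mod_iso A X Z"
 by (metis mod_iso_iff iso_comp)

lemma surj_same_kernel_iso:
 assumes X: "lmod A X" and Q: "lmod A Q" and Q': "lmod A Q'"
  and q: "lin A X Q q" "q ` carrier X = carrier Q"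
  and q': "lin A X Q' q'" "q' ` carrier X = carrier Q'" and k: "ker X Q q = ker X Q' q'"
 shows "mod_iso A Q Q'"
proof -
 obtain f where f: "lin A Q Q' f" "!!x. x \<in>[X] ==> f (q x) = q' x"
  using factor_surj[OF X Q Q' q q'(1)] k by auto
 obtain g where g: "lin A Q' Q g" "!!x. x \<in>[X] ==> g (q' x) = q x"
  using factor_surj[OF X Q' Q q' q(1)] k by auto
 have "iso A Q Q' f"
 proof (rule isoI[OF f(1) g(1)])
  show "g (f u) = u" if "u \<in>[Q]" for u using that f(2) g(2) unfolding q(2)[symmetric] by auto
  show "f (g u) = u" if "u \<in>[Q']" for u using that f(2) g(2) unfolding q'(2)[symmetric] by auto
 qed
 thus ?thesis using mod_iso_iff[OF Q] by blast
qed

section \<open>Direct sums\<close>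

lemma direct_sum_simps [simp]:
 "carrier (dirsum X Y) = carrier X \<times> carrier Y"
 "0[dirsum X Y] = (0[X], 0[Y])"
 "p +[dirsum X Y] p' = (fst p +[X] fst p', snd p +[Y] snd p')"
 "a .[dirsum X Y] p = (a .[X] fst p, a .[Y] snd p)"
 by (auto simp: direct_sum_def split: prod.splits)

lemma dsum_lmod:
 assumes "lmod A X" "lmod A Y" shows "lmod A (dirsum X Y)"
proof -
 interpret X: left_module A X by fact
 interpret Y: left_module A Y by fact
 show ?thesis
  by (rule left_module_intro)
   (auto simp: X.A.ring_axioms X.a_ac Y.a_ac X.smult_l_distr X.smult_r_distr X.smult_assoc
    Y.smult_l_distr Y.smult_r_distr Y.smult_assoc)
qed

lemma lin_fst: "lin A (dirsum X Y) X fst" and lin_snd: "lin A (dirsum X Y) Y snd"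
 by (auto simp: lin_def)

lemma lin_pair: "[|lin A X Y f; lin A X Z g|] ==> lin A X (dirsum Y Z) (%x. (f x, g x))"
 by (auto simp: lin_def Pi_def)

lemma lin_inl: "lmod A Y ==> lin A X (dirsum X Y) (%x. (x, 0[Y]))"
 by (intro lin_pair lin_id lin_zero_map)

lemma lin_inr: "lmod A X ==> lin A Y (dirsum X Y) (%y. (0[X], y))"
 by (intro lin_pair lin_id lin_zero_map)

lemma lin_fst': "lin A X Z f ==> lin A (dirsum X Y) Z (%p. f (fst p))"
 by (rule lin_comp[OF lin_fst])

lemma lin_snd': "lin A Y Z f ==> lin A (dirsum X Y) Z (%p. f (snd p))"
 by (rule lin_comp[OF lin_snd])

lemma iso_direct_sum:
 assumes "iso A X X' f" "iso A Y Y' g"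
 shows "iso A (dirsum X Y) (dirsum X' Y') (%p. (f (fst p), g (snd p)))"
 using assms unfolding iso_def
 by (auto simp: lin_def bij_betw_def inj_on_def Pi_def) (auto simp: image_iff)

lemma mod_iso_direct_sum:
 assumes "lmod A X" "lmod A Y" "mod_iso A X X'" "mod_iso A Y Y'"
 shows "mod_iso A (dirsum X Y) (dirsum X' Y')"
proof -
 obtain f g where "iso A X X' f" "iso A Y Y' g"
  using assms mod_isoE by metis
 thus ?thesis
  by (intro mod_isoI[OF _ iso_direct_sum] dsum_lmod assms)
qed

lemma mod_iso_direct_sum_comm:
 assumes "lmod A X" "lmod A Y"
 shows "mod_iso A (dirsum X Y) (dirsum Y X)"
proof -
 have "iso A (dirsum X Y) (dirsum Y X) (%p. (snd p, fst p))"
  by (rule isoI[of _ _ _ _ "%p. (snd p, fst p)"]) (auto intro: lin_pair lin_fst lin_snd)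
 thus ?thesis using mod_iso_iff dsum_lmod[OF assms] by blast
qed

lemma mod_iso_direct_sum_assoc:
 assumes "lmod A X" "lmod A Y" "lmod A Z"
 shows "mod_iso A (dirsum (dirsum X Y) Z) (dirsum X (dirsum Y Z))"
proof -
 have "iso A (dirsum (dirsum X Y) Z) (dirsum X (dirsum Y Z))
  (%p. (fst (fst p), snd (fst p), snd p))"
  by (rule isoI[of _ _ _ _ "%p. ((fst p, fst (snd p)), snd (snd p))"];
    (intro lin_pair lin_fst lin_snd lin_comp[OF lin_fst lin_fst] lin_comp[OF lin_fst lin_snd]
     lin_comp[OF lin_snd lin_fst] lin_comp[OF lin_snd lin_snd])?) auto
 thus ?thesis by (rule mod_isoI[rotated]) (intro dsum_lmod assms)
qed

lemma split_iso:
 assumes X: "lmod A X" and Y: "lmod A Y"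
  and s: "lin A X Y s" and r: "lin A Y X r" and rs: "!!x. x \<in>[X] ==> r (s x) = x"
 shows "mod_iso A Y (dirsum X (sub Y (ker Y X r)))"
proof -
 interpret X: left_module A X by fact
 interpret Y: left_module A Y by fact
 have kY: "ker Y X r <= carrier Y" by (auto simp: ker_def)
 have l1: "lin A Y Y (%y. y -[Y] s (r y))"
  by (intro lin_subtract[OF Y] lin_id lin_comp[OF r s])
 have "lin A Y (sub Y (ker Y X r)) (%y. y -[Y] s (r y))"
  unfolding lin_into_sub[OF kY] using l1
  by (auto simp: ker_def lin_diff[OF Y X r] lin_cl[OF r] lin_cl[OF s] rs X.minus_eq_zero_iff)
 hence f: "lin A Y (dirsum X (sub Y (ker Y X r))) (%y. (r y, y -[Y] s (r y)))"
  by (intro lin_pair r)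
 have g: "lin A (dirsum X (sub Y (ker Y X r))) Y (%p. s (fst p) +[Y] snd p)"
  by (intro lin_plus[OF Y] lin_fst'[OF s] lin_snd'[OF lin_incl[OF kY]])
 have cl: "r y \<in>[X]" "s (r y) \<in>[Y]" if "y \<in>[Y]" for y
  using that r s by (auto intro: lin_cl)
 have e: "s (r y) +[Y] (y -[Y] s (r y)) = y" if "y \<in>[Y]" for y
  using cl[OF that] that by algebra
 have "iso A Y (dirsum X (sub Y (ker Y X r))) (%y. (r y, y -[Y] s (r y)))"
 proof (rule isoI[OF f g])
  fix p assume "p \<in>[dirsum X (sub Y (ker Y X r))]"
  then obtain x k where p: "p = (x, k)" "x \<in>[X]" "k \<in>[Y]" "r k = 0[X]"
   by (auto simp: ker_def)
  have "r (s x +[Y] k) = x" using p by (simp add: lin_add[OF r] lin_cl[OF s] rs)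
  moreover have "(s x +[Y] k) -[Y] s x = k" using p(3) lin_cl[OF s p(2)] by algebra
  ultimately show "(r (s (fst p) +[Y] snd p), (s (fst p) +[Y] snd p) -[Y] s (r (s (fst p) +[Y] snd p))) = p"
   by (simp add: p(1))
 qed (use e in auto)
 thus ?thesis using mod_iso_iff[OF Y] by blast
qed

definition msum :: "'i set => ('i => ('a, 'x) module) => ('a, 'i => 'x) module" where
 "msum J X = \<lparr>carrier = Pi\<^sub>E J (%j. carrier (X j)), monoid.mult = undefined, one = undefined,
   zero = (\<lambda>j\<in>J. 0[X j]), add = (%f g. \<lambda>j\<in>J. f j +[X j] g j),
   smult = (%a f. \<lambda>j\<in>J. a .[X j] f j)\<rparr>"

lemma msum_simps [simp]:
 "carrier (msum J X) = Pi\<^sub>E J (%j. carrier (X j))" "0[msum J X] = (\<lambda>j\<in>J. 0[X j])"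
 "p +[msum J X] p' = (\<lambda>j\<in>J. p j +[X j] p' j)" "a .[msum J X] p = (\<lambda>j\<in>J. a .[X j] p j)"
 by (auto simp: msum_def)

lemma copower_finite: "finite J ==> copower X J = msum J (%_. X)"
 by (auto simp: copower_def msum_def)

lemma msum_lmod:
 assumes "ring A" "!!j. j : J ==> lmod A (X j)" shows "lmod A (msum J X)"
proof -
 have [simp]: "1[A] \<in>[A]" "0[A] \<in>[A]" "!!a b. a \<in>[A] ==> b \<in>[A] ==> a +[A] b \<in>[A]"
  "!!a b. a \<in>[A] ==> b \<in>[A] ==> a *[A] b \<in>[A]"
  using ring.ring_simprules[OF assms(1)] by auto
 show ?thesis
  by (rule left_module_intro[OF assms(1)]; (rule ext)?)
   (auto simp: PiE_iff lmodD(1-3,5-13)[OF assms(2)] restrict_def extensional_def fun_eq_iff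
    intro: lmodD(4)[OF assms(2)])
qed

lemma lin_proj: "j : J ==> lin A (msum J X) (X j) (%p. p j)"
 by (auto simp: lin_def)

lemma lin_tuple:
 assumes "!!j. j : J ==> lin A Y (X j) (f j)" shows "lin A Y (msum J X) (%y. \<lambda>j\<in>J. f j y)"
 by (rule linI) (auto simp: lin_cl[OF assms] lin_add[OF assms] lin_smult[OF assms])

lemma lin_cotuple:
 assumes "lmod A Y" "finite J" "!!j. j : J ==> lin A (X j) Y (f j)"
 shows "lin A (msum J X) Y (%p. finsum Y (%j. f j (p j)) J)"
 by (intro lin_sum assms(1,2) lin_comp[of A "msum J X" "X j" "%p. p j" Y "f j" for j] lin_proj assms(3))

definition minj :: "'i set => ('i => ('a, 'x) module) => 'i => 'x => 'i => 'x" where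
 "minj J X j x = (\<lambda>i\<in>J. if i = j then x else 0[X i])"

lemma minj_apply: "i : J ==> minj J X j x i = (if i = j then x else 0[X i])"
 by (simp add: minj_def)

lemma lin_minj:
 assumes "!!j. j : J ==> lmod A (X j)" "j : J" shows "lin A (X j) (msum J X) (minj J X j)"
proof -
 have "lin A (X j) (X i) (%x. if i = j then x else 0[X i])" if "i : J" for i
  using assms that by (cases "i = j") (auto simp: lin_id lin_zero_map)
 from lin_tuple[where J=J and A=A and Y="X j" and X=X and f="%i x. if i = j then x else 0[X i]", OF this] show ?thesis
  by (simp add: minj_def[abs_def])
qed

lemma finsum_single:
 assumes "lmod A Y" "finite J" "j : J" "x \<in>[Y]" "!!i. [|i : J; i \<noteq> j|] ==> g i = 0[Y]" "g j = x"
 shows "finsum Y g J = x"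
proof -
 interpret Y: left_module A Y by fact
 have "finsum Y g J = finsum Y (%i. if j = i then x else 0[Y]) J"
  using assms by (intro Y.finsum_cong') auto
 also have "... = x" using Y.finsum_singleton[of j J "%_. x"] assms by simp
 finally show ?thesis .
qed

lemma msum_expand:
 assumes "ring A" "finite J" "!!j. j : J ==> lmod A (X j)" "p \<in>[msum J X]"
 shows "finsum (msum J X) (%j. minj J X j (p j)) J = p"
proof -
 interpret S: left_module A "msum J X" by (rule msum_lmod[OF assms(1,3)])
 have m: "j : J ==> minj J X j (p j) \<in>[msum J X]" for j
  using assms(4) by (intro lin_cl[OF lin_minj[OF assms(3)]]) (auto simp: PiE_iff)
 have "finsum (msum J X) (%j. minj J X j (p j)) J i = p i" if i: "i : J" for i
 proof -
  have "finsum (msum J X) (%j. minj J X j (p j)) J i = finsum (X i) (%j. minj J X j (p j) i) J"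
   using lin_finsum[OF S.left_module_axioms assms(3)[OF i] lin_proj[OF i] assms(2)] m by auto
  also have "... = p i"
   by (rule finsum_single[OF assms(3)[OF i] assms(2) i]) (use assms(4) i in "auto simp: minj_def")
  finally show ?thesis .
 qed
 moreover have "finsum (msum J X) (%j. minj J X j (p j)) J \<in>[msum J X]"
  by (rule S.finsum_closed) (use m in auto)
 ultimately show ?thesis
  using assms(4) PiE_ext[of "finsum (msum J X) (%j. minj J X j (p j)) J" J "%j. carrier (X j)" p] by simp
qed

lemma lin_msum_expand:
 assumes "ring A" "finite J" "!!j. j : J ==> lmod A (X j)" "lmod A Y"
  "lin A (msum J X) Y f" "p \<in>[msum J X]"
 shows "f p = finsum Y (%j. f (minj J X j (p j))) J"
proof -
 have "f p = f (finsum (msum J X) (%j. minj J X j (p j)) J)" by (simp add: msum_expand[OF assms(1-3,6)])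
 also have "... = finsum Y (%j. f (minj J X j (p j))) J"
 proof (rule lin_finsum[OF msum_lmod[OF assms(1,3)] assms(4,5,2)])
  show "(%j. minj J X j (p j)) : J \<rightarrow> carrier (msum J X)"
  proof
   fix j assume j: "j : J"
   show "minj J X j (p j) \<in>[msum J X]"
    using assms(6) j by (intro lin_cl[OF lin_minj[OF assms(3) j]]) (auto simp: PiE_iff)
  qed
 qed
 finally show ?thesis .
qed

lemma iso_msum_insert:
 assumes "j \<notin> J"
 shows "iso A (msum (insert j J) X) (dirsum (X j) (msum J X)) (%p. (p j, restrict p J))"
proof -
 have f: "lin A (msum (insert j J) X) (dirsum (X j) (msum J X)) (%p. (p j, restrict p J))"
  by (intro lin_pair lin_proj) (auto simp: lin_def fun_eq_iff)
 have g: "lin A (dirsum (X j) (msum J X)) (msum (insert j J) X) (%p. \<lambda>i\<in>insert j J. if i = j then fst p else snd p i)"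
  by (rule lin_tuple) (auto simp: lin_def)
 show ?thesis
  by (rule isoI[OF f g]) (use assms in "auto simp: fun_eq_iff PiE_iff extensional_def restrict_def")
qed

lemma regular_module_simps [simp]:
 "carrier (reg_mod A) = carrier A" "0[reg_mod A] = 0[A]"
 "x +[reg_mod A] y = x +[A] y" "a .[reg_mod A] x = a *[A] x"
 by (auto simp: regular_module_def)

lemma regular_lmod: "ring A ==> lmod A (reg_mod A)"
proof -
 assume "ring A" then interpret ring A .
 show ?thesis
  by (rule left_module_intro) (auto simp: ring_axioms a_ac l_distr r_distr m_assoc)
qed

lemma regular_minus: "ring A ==> x \<in>[A] ==> -[reg_mod A] x = -[A] x"
 by (simp add: a_inv_def m_inv_def regular_module_def)

lemma regular_finsum: "finsum (reg_mod A) f J = finsum A f J"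
 by (simp add: finsum_def finprod_def regular_module_def)

lemma lin_from_regular:
 assumes "lmod A X" "x \<in>[X]" shows "lin A (reg_mod A) X (%a. a .[X] x)"
proof -
 interpret X: left_module A X by fact
 show ?thesis by (rule linI) (auto simp: X.smult_l_distr X.smult_assoc assms(2))
qed

section \<open>Finitely generated modules\<close>

abbreviation free :: "('a, 'c) ring_scheme => 'i set => ('a, 'i => 'a) module" where
 "free A J \<equiv> msum J (%_. reg_mod A)"

definition lincomb :: "('a, 'x) module => 'i set => ('i => 'x) => ('i => 'a) => 'x" where
 "lincomb X J z c = finsum X (%j. c j .[X] z j) J"

definition gens :: "('a, 'c) ring_scheme => ('a, 'x) module => 'i set => ('i => 'x) => bool" where
 "gens A X J z \<longleftrightarrow> finite J & z : J \<rightarrow> carrier X & lincomb X J z ` carrier (free A J) = carrier X"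

lemma free_lmod: "ring A ==> lmod A (free A J)"
 by (intro msum_lmod regular_lmod)

lemma lin_lincomb:
 assumes "lmod A X" "finite J" "z : J \<rightarrow> carrier X"
 shows "lin A (free A J) X (lincomb X J z)"
 unfolding lincomb_def[abs_def]
 by (rule lin_cotuple[OF assms(1,2)], rule lin_from_regular[OF assms(1)]) (use assms(3) in auto)

lemma lincomb_closed:
 assumes "lmod A X" "z : J \<rightarrow> carrier X" "c : J \<rightarrow> carrier A"
 shows "lincomb X J z c \<in>[X]"
proof -
 interpret X: left_module A X by fact
 show ?thesis unfolding lincomb_def using assms(2,3) by (intro X.finsum_closed) (auto simp: Pi_def)
qed

lemma lincomb_restrict:
 assumes "lmod A X" "z : J \<rightarrow> carrier X" "c : J \<rightarrow> carrier A"
 shows "lincomb X J z (restrict c J) = lincomb X J z c"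
proof -
 interpret X: left_module A X by fact
 show ?thesis unfolding lincomb_def using assms(2,3)
  by (intro X.finsum_cong') (auto simp: Pi_def)
qed

lemma finsum_in_submodule:
 assumes "lmod A X" "submodule N A X" "finite J" "!!j. j : J ==> g j : N"
 shows "finsum X g J : N"
proof -
 interpret X: left_module A X by fact
 note N = X.subm[OF assms(2)]
 show ?thesis using assms(3,4)
 proof (induct J)
  case (insert j J)
  have "finsum X g (insert j J) = g j +[X] finsum X g J"
   using insert N(1) by (intro X.finsum_insert) auto
  with insert N show ?case by auto
 qed (use N in auto)
qed

lemma lincomb_in_submodule:
 assumes "lmod A X" "submodule N A X" "finite J" "z : J \<rightarrow> N" "c : J \<rightarrow> carrier A"
 shows "lincomb X J z c : N"
proof -
 interpret X: left_module A X by fact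
 show ?thesis unfolding lincomb_def using assms(4,5)
  by (intro finsum_in_submodule[OF assms(1-3)] X.subm(4)[OF assms(2)]) auto
qed

lemma lin_lincomb_image:
 assumes "lmod A X" "lmod A Y" "lin A X Y f" "finite J" "z : J \<rightarrow> carrier X" "c : J \<rightarrow> carrier A"
 shows "f (lincomb X J z c) = lincomb Y J (%j. f (z j)) c"
proof -
 interpret X: left_module A X by fact
 interpret Y: left_module A Y by fact
 have "f (lincomb X J z c) = finsum Y (%j. f (c j .[X] z j)) J"
  unfolding lincomb_def using assms(5,6) by (intro lin_finsum[OF assms(1-4)]) (auto simp: Pi_def)
 also have "... = lincomb Y J (%j. f (z j)) c"
  unfolding lincomb_def using assms(5,6) lin_cl[OF assms(3)]
  by (intro Y.finsum_cong') (auto simp: Pi_def lin_smult[OF assms(3)])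
 finally show ?thesis .
qed

lemma lincomb_delta:
 assumes "lmod A X" "finite J" "z : J \<rightarrow> carrier X" "j : J"
 shows "lincomb X J z (%i. if i = j then 1[A] else 0[A]) = z j"
proof -
 interpret X: left_module A X by fact
 show ?thesis unfolding lincomb_def using assms(3,4)
  by (intro finsum_single[OF assms(1,2,4)]) (auto simp: Pi_def)
qed

lemma gensD:
 assumes "gens A X J z"
 shows "finite J" "z : J \<rightarrow> carrier X" "!!j. j : J ==> z j \<in>[X]"
  "lincomb X J z ` carrier (free A J) = carrier X"
proof -
 show "lincomb X J z ` carrier (free A J) = carrier X" using assms unfolding gens_def by (elim conjE)
 show "finite J" using assms unfolding gens_def by (elim conjE)
 show z: "z : J \<rightarrow> carrier X" using assms unfolding gens_def by (elim conjE)
 show "j : J ==> z j \<in>[X]" for j using z by (rule funcset_mem)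
qed

lemma gens_expand:
 assumes "gens A X J z" "x \<in>[X]"
 obtains c where "c \<in>[free A J]" "x = lincomb X J z c"
 using assms unfolding gens_def by blast

lemma gens_subset:
 assumes "gens A X J z" "!!c. c \<in>[free A J] ==> lincomb X J z c : N" shows "carrier X <= N"
proof
 fix x assume "x \<in>[X]"
 from gens_expand[OF assms(1) this] assms(2) show "x : N" by metis
qed

lemma gensI:
 assumes "lmod A X" "finite J" "z : J \<rightarrow> carrier X"
  "!!x. x \<in>[X] ==> \<exists>c\<in>J \<rightarrow> carrier A. x = lincomb X J z c"
 shows "gens A X J z"
proof -
 have "x : lincomb X J z ` carrier (free A J)" if x: "x \<in>[X]" for x
 proof -
  obtain c where c: "c : J \<rightarrow> carrier A" "x = lincomb X J z c" using assms(4)[OF x] by auto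
  thus ?thesis
   using lincomb_restrict[OF assms(1,3) c(1)] by (intro image_eqI[of _ _ "restrict c J"]) auto
 qed
 thus ?thesis using lin_cl[OF lin_lincomb[OF assms(1-3)]]
  by (auto simp: gens_def assms(2,3))
qed

lemma span_submodule:
 assumes "lmod A X" "finite J" "z : J \<rightarrow> carrier X"
 shows "submodule (lincomb X J z ` carrier (free A J)) A X"
proof -
 have F: "lmod A (free A J)" by (rule free_lmod[OF left_module.axioms(1)[OF assms(1)]])
 show ?thesis by (rule image_submodule[OF F assms(1) lin_lincomb[OF assms] carrier_submodule[OF F]])
qed

lemma generator_in_span:
 assumes "lmod A X" "finite J" "z : J \<rightarrow> carrier X" "j : J"
 shows "z j : lincomb X J z ` carrier (free A J)"
proof -
 interpret X: left_module A X by fact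
 let ?d = "%k. if k = j then 1[A] else 0[A]"
 have "?d : J \<rightarrow> carrier A" by auto
 hence "lincomb X J z (restrict ?d J) = z j"
  using lincomb_restrict[OF assms(1,3)] lincomb_delta[OF assms] by simp
 moreover have "lincomb X J z (restrict ?d J) : lincomb X J z ` carrier (free A J)"
  by (rule imageI) auto
 ultimately show ?thesis by simp
qed

lemma gens_reindex:
 assumes "lmod A X" "gens A X J z" "finite I" "z ` J <= y ` I" "y : I \<rightarrow> carrier X"
 shows "gens A X I y"
proof -
 interpret X: left_module A X by fact
 note fJ = gensD(1,2)[OF assms(2)]
 have sm: "submodule (lincomb X I y ` carrier (free A I)) A X" (is "submodule ?N A X")
  by (rule span_submodule[OF assms(1,3,5)])
 have "z j : ?N" if "j : J" for j
 proof -
  have "z j : y ` I" using subsetD[OF assms(4) imageI[OF that]] .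
  then obtain i where i: "i : I" "z j = y i" by (rule imageE)
  show ?thesis unfolding i(2) by (rule generator_in_span[OF assms(1,3,5) i(1)])
 qed
 hence "lincomb X J z c : ?N" if "c \<in>[free A J]" for c
  using that by (intro lincomb_in_submodule[OF assms(1) sm fJ(1)]) auto
 hence "carrier X <= ?N" by (rule gens_subset[OF assms(2)])
 moreover have "?N <= carrier X" using X.subm(1)[OF sm] .
 ultimately show ?thesis using assms(3,5) unfolding gens_def by (intro conjI equalityI)
qed

lemma fg_module_iff_gens:
 "fgm A X \<longleftrightarrow> lmod A X & (\<exists>n z. gens A X {..<n::nat} z)"
proof
 assume fg: "fgm A X"
 hence X: "lmod A X" by (simp add: fg_module_def)
 interpret X: left_module A X by fact
 obtain S where S: "S <= carrier X" "finite S" "!!N. submodule N A X ==> S <= N ==> N = carrier X"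
  using fg by (auto simp: fg_module_def)
 obtain n and z :: "nat => _" where z: "S = z ` {..<n}"
  using finite_imp_nat_seg_image_inj_on[OF S(2)] by (auto simp: lessThan_def)
 have zc: "z : {..<n} \<rightarrow> carrier X" using S(1) z by auto
 have sm: "submodule (lincomb X {..<n} z ` carrier (free A {..<n})) A X" (is "submodule ?N A X")
  by (rule span_submodule[OF X _ zc]) simp
 have "z j : ?N" if "j < n" for j
  by (rule generator_in_span[OF X _ zc]) (use that in auto)
 hence "?N = carrier X" by (intro S(3)[OF sm]) (auto simp: z)
 hence "gens A X {..<n} z" using zc by (simp add: gens_def)
 thus "lmod A X & (\<exists>n z. gens A X {..<n::nat} z)" using X by blast
next
 assume "lmod A X & (\<exists>n z. gens A X {..<n::nat} z)"
 then obtain n z where X: "lmod A X" and z: "gens A X {..<n::nat} z" by auto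
 have "N = carrier X" if N: "submodule N A X" "z ` {..<n} <= N" for N
 proof -
  have "lincomb X {..<n} z c : N" if "c \<in>[free A {..<n}]" for c
   using that N(2) by (intro lincomb_in_submodule[OF X N(1)]) auto
  hence "carrier X <= N" by (rule gens_subset[OF z])
  thus ?thesis using left_module.subm(1)[OF X N(1)] by auto
 qed
 thus "fgm A X" using X z unfolding fg_module_def
  by (auto intro!: exI[of _ "z ` {..<n}"] simp: gens_def)
qed

lemma gens_fg:
 assumes "lmod A X" "gens A X J z" shows "fgm A X"
proof -
 note J = gensD(1,2)[OF assms(2)]
 obtain n and y :: "nat => _" where y: "z ` J = y ` {..<n}"
  using finite_imp_nat_seg_image_inj_on[of "z ` J"] J(1) by (auto simp: lessThan_def)
 have "y : {..<n} \<rightarrow> carrier X"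
 proof
  fix i assume "i : {..<n}"
  hence "y i : z ` J" unfolding y by (rule imageI)
  thus "y i \<in>[X]" using J(2) by auto
 qed
 hence "gens A X {..<n} y" using gens_reindex[OF assms, of "{..<n}" y] y by simp
 thus ?thesis unfolding fg_module_iff_gens using assms(1) by blast
qed

lemma fg_lmod: "fgm A X ==> lmod A X"
 by (simp add: fg_module_def)

lemma fg_obtain:
 assumes "fgm A X" obtains n z where "gens A X {..<n::nat} z"
 using assms unfolding fg_module_iff_gens by blast

lemma gens_surj:
 assumes "lmod A X" "lmod A Y" "lin A X Y f" "f ` carrier X = carrier Y" "gens A X J z"
 shows "gens A Y J (%j. f (z j))"
proof (rule gensI[OF assms(2)])
 note J = gensD(1,2)[OF assms(5)]
 from J show "finite J" "(%j. f (z j)) : J \<rightarrow> carrier Y" using lin_cl[OF assms(3)] by auto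
 fix y assume "y \<in>[Y]"
 then obtain x where x: "x \<in>[X]" "y = f x" using assms(4) by auto
 obtain c where c: "c \<in>[free A J]" "x = lincomb X J z c" using gens_expand[OF assms(5) x(1)] .
 have c': "c : J \<rightarrow> carrier A" using c(1) by (auto simp: PiE_iff)
 thus "\<exists>c\<in>J \<rightarrow> carrier A. y = lincomb Y J (%j. f (z j)) c"
  using lin_lincomb_image[OF assms(1-3) J c'] c(2) x(2) by auto
qed

lemma fg_surj:
 assumes "fgm A X" "lmod A Y" "lin A X Y f" "f ` carrier X = carrier Y"
 shows "fgm A Y"
proof -
 obtain n z where "gens A X {..<n::nat} z" using fg_obtain[OF assms(1)] .
 from gens_surj[OF fg_lmod[OF assms(1)] assms(2-4) this] show ?thesis by (rule gens_fg[OF assms(2)])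
qed

lemma fg_iso:
 assumes "fgm A X" "lmod A Y" "mod_iso A X Y" shows "fgm A Y"
proof -
 obtain f where f: "iso A X Y f" using mod_isoE[OF assms(3) fg_lmod[OF assms(1)]] .
 show ?thesis by (rule fg_surj[OF assms(1,2) isoD(1)[OF f] isoD(3)[OF f]])
qed

text \<open>Modules generated by a submodule and a lift of generators of the quotient.\<close>

lemma fg_extension:
 assumes X: "lmod A X" and Y: "lmod A Y" and f: "lin A X Y f" "f ` carrier X = carrier Y"
  and k: "fgm A (sub X (ker X Y f))" and Yfg: "fgm A Y"
 shows "fgm A X"
proof -
 interpret X: left_module A X by fact
 interpret Y: left_module A Y by fact
 let ?K = "sub X (ker X Y f)"
 have K: "lmod A ?K" using k by (rule fg_lmod)
 obtain n z where z: "gens A ?K {..<n::nat} z" using fg_obtain[OF k] .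
 obtain m y where y: "gens A Y {..<m::nat} y" using fg_obtain[OF Yfg] .
 define w where "w i = inv_into (carrier X) f (y i)" for i
 have w: "w i \<in>[X]" "f (w i) = y i" if "i < m" for i
 proof -
  have "y i : f ` carrier X" unfolding f(2) using gensD(3)[OF y, of i] that by simp
  thus "w i \<in>[X]" "f (w i) = y i" unfolding w_def by (rule inv_into_into, rule f_inv_into_f)
 qed
 have zk: "z : {..<n} \<rightarrow> ker X Y f" using gensD(2)[OF z] by simp
 hence zc: "z : {..<n} \<rightarrow> carrier X" by (auto simp: ker_def)
 let ?S = "z ` {..<n} \<union> w ` {..<m}"
 have "N = carrier X" if N: "submodule N A X" "?S <= N" for N
 proof (intro equalityI subsetI)
  fix x assume x: "x \<in>[X]"
  obtain c where c: "c \<in>[free A {..<m}]" "f x = lincomb Y {..<m} y c"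
   using gens_expand[OF y lin_cl[OF f(1) x]] .
  have c': "c : {..<m} \<rightarrow> carrier A" using c(1) by (auto simp: PiE_iff)
  have wc: "w : {..<m} \<rightarrow> carrier X" using w by auto
  let ?u = "lincomb X {..<m} w c"
  have u: "?u \<in>[X]" by (rule lincomb_closed[OF X wc c'])
  have "f ?u = lincomb Y {..<m} (%j. f (w j)) c" by (rule lin_lincomb_image[OF X Y f(1) _ wc c']) simp
  also have "... = f x" unfolding c(2) lincomb_def
   by (rule Y.finsum_cong') (use w gensD(3)[OF y] c' in "auto simp: Pi_def")
  finally have "x -[X] ?u : ker X Y f" using ker_iff_diff[OF X Y f(1) x u] by simp
  then obtain b where b: "b \<in>[free A {..<n}]" "x -[X] ?u = lincomb ?K {..<n} z b"
   using gens_expand[OF z, of "x -[X] ?u"] by auto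
  have b': "b : {..<n} \<rightarrow> carrier A" using b(1) by (auto simp: PiE_iff)
  have "lincomb ?K {..<n} z b = lincomb X {..<n} z b"
   using lin_lincomb_image[OF K X lin_incl _ _ b', of z] zk by (auto simp: ker_def)
  hence "x -[X] ?u : N" using b(2) lincomb_in_submodule[OF X N(1) _ _ b', of z] N(2) by auto
  moreover have "?u : N" using lincomb_in_submodule[OF X N(1) _ _ c', of w] N(2) by auto
  ultimately have "(x -[X] ?u) +[X] ?u : N" using X.subm(3)[OF N(1)] by auto
  moreover have "(x -[X] ?u) +[X] ?u = x" using x u by algebra
  ultimately show "x : N" by simp
 qed (use X.subm(1)[OF N(1)] in auto)
 moreover have "?S <= carrier X" using zc w by auto
 ultimately show ?thesis unfolding fg_module_def using X by (intro conjI exI[of _ ?S]) auto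
qed

lemma fg_direct_sum:
 assumes "fgm A X" "fgm A Y" shows "fgm A (dirsum X Y)"
proof -
 note XY = assms[THEN fg_lmod]
 interpret X: left_module A X by (rule XY)
 have [simp]: "snd ` (carrier X \<times> carrier Y) = carrier Y" using X.zero_closed by (auto intro: rev_image_eqI)
 have sm: "submodule (ker (dirsum X Y) Y snd) A (dirsum X Y)"
  by (intro ker_submodule dsum_lmod XY lin_snd)
 have "fgm A (sub (dirsum X Y) (ker (dirsum X Y) Y snd))"
  by (rule fg_surj[OF assms(1) sub_lmod[OF dsum_lmod[OF XY] sm], of "%x. (x, 0[Y])"])
    (auto simp: lin_def ker_def lmodD[OF XY(2)])
 thus ?thesis
  by (intro fg_extension[OF dsum_lmod[OF XY] XY(2) lin_snd]) (auto simp: assms)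
qed

lemma fg_zero:
 assumes "lmod A X" "carrier X = {0[X]}" shows "fgm A X"
proof -
 interpret X: left_module A X by fact
 have "N = carrier X" if "submodule N A X" for N
  using X.subm[OF that] assms(2) by auto
 thus ?thesis using assms by (auto simp: fg_module_def intro!: exI[of _ "{}"])
qed

lemma fg_msum:
 assumes "ring A" "finite J" "!!j. j : J ==> fgm A (X j)" shows "fgm A (msum J X)"
 using assms(2,3)
proof (induct J)
 case empty
 show ?case by (rule fg_zero) (auto intro: msum_lmod assms(1))
next
 case (insert j J)
 have m: "lmod A (msum (insert j J) X)" using insert(4) by (intro msum_lmod assms(1) fg_lmod) auto
 have "fgm A (dirsum (X j) (msum J X))" using insert by (intro fg_direct_sum) auto
 moreover have "mod_iso A (dirsum (X j) (msum J X)) (msum (insert j J) X)"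
  by (rule mod_iso_sym[OF m fg_lmod[OF calculation] mod_isoI[OF m iso_msum_insert[OF insert(2)]]])
 ultimately show ?case using m fg_iso by blast
qed

lemma fg_regular: "ring A ==> fgm A (reg_mod A)"
proof -
 assume r: "ring A"
 interpret ring A by fact
 have "gens A (reg_mod A) {()} (%_. 1[A])"
 proof (rule gensI[OF regular_lmod[OF r]])
  fix x assume "x \<in>[reg_mod A]"
  thus "\<exists>c\<in>{()} \<rightarrow> carrier A. x = lincomb (reg_mod A) {()} (%_. 1[A]) c"
   by (intro bexI[of _ "%_. x"]) (auto simp: lincomb_def regular_finsum)
 qed auto
 thus ?thesis by (rule gens_fg[OF regular_lmod[OF r]])
qed

lemma fg_free: "ring A ==> finite J ==> fgm A (free A J)"
 by (intro fg_msum fg_regular)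

text \<open>
 Every quotient of a finitely generated module has a copy in the universe: an element \<open>x + N\<close> is
 represented by the set of coefficient tuples whose linear combination lies in it.
\<close>

lemma quotient_exists:
 assumes fg: "fgm A X" and N: "submodule N A X"
 obtains Q :: "'a umod" and q where "fgm (A :: ('a, 'c) ring_scheme) Q" "lin A X Q q"
  "q ` carrier X = carrier Q" "ker X Q q = N"
proof -
 have X: "lmod A X" using fg by (rule fg_lmod)
 interpret X: left_module A X by fact
 note N' = X.subm[OF N]
 obtain n z where z: "gens A X {..<n::nat} z" using fg_obtain[OF fg] .
 have zc: "z : {..<n} \<rightarrow> carrier X" using gensD(2)[OF z] .
 define \<phi> where "\<phi> x = {c \<in> carrier (free A {..<n}). lincomb X {..<n} z c -[X] x : N}" for x
 have phi: "\<phi> x = \<phi> y \<longleftrightarrow> x -[X] y : N" if xy: "x \<in>[X]" "y \<in>[X]" for x y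
 proof
  assume e: "\<phi> x = \<phi> y"
  obtain c where c: "c \<in>[free A {..<n}]" "x = lincomb X {..<n} z c" using gens_expand[OF z xy(1)] .
  have "x -[X] x = 0[X]" using xy(1) by algebra
  hence "c : \<phi> x" unfolding \<phi>_def using c N'(2) by simp
  thus "x -[X] y : N" unfolding e using c(2) by (auto simp: \<phi>_def)
 next
  assume d: "x -[X] y : N"
  have "u -[X] x : N \<longleftrightarrow> u -[X] y : N" if u: "u \<in>[X]" for u
  proof -
   have "(u -[X] x) +[X] (x -[X] y) = u -[X] y" "(u -[X] y) -[X] (x -[X] y) = u -[X] x"
    using xy u by algebra+
   thus ?thesis using N'(3,6) d by metis
  qed
  thus "\<phi> x = \<phi> y" unfolding \<phi>_def using lin_cl[OF lin_lincomb[OF X _ zc]] by auto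
 qed
 define s where "s u = (SOME x. x \<in>[X] & \<phi> x = u)" for u
 have s: "s (\<phi> x) \<in>[X]" "\<phi> (s (\<phi> x)) = \<phi> x" if "x \<in>[X]" for x
 proof -
  have "\<exists>y. y \<in>[X] & \<phi> y = \<phi> x" using that by auto
  from someI_ex[OF this] show "s (\<phi> x) \<in>[X]" "\<phi> (s (\<phi> x)) = \<phi> x" by (auto simp: s_def)
 qed
 define Q :: "'a umod" where "Q = \<lparr>carrier = \<phi> ` carrier X, monoid.mult = undefined, one = undefined,
   zero = \<phi> 0[X], add = (%u v. \<phi> (s u +[X] s v)), smult = (%a u. \<phi> (a .[X] s u))\<rparr>"
 have add: "\<phi> x +[Q] \<phi> y = \<phi> (x +[X] y)" if xy: "x \<in>[X]" "y \<in>[X]" for x y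
 proof -
  have "(s (\<phi> x) +[X] s (\<phi> y)) -[X] (x +[X] y) = (s (\<phi> x) -[X] x) +[X] (s (\<phi> y) -[X] y)"
   using xy s(1)[OF xy(1)] s(1)[OF xy(2)] by algebra
  moreover have "s (\<phi> x) -[X] x : N" "s (\<phi> y) -[X] y : N" using phi s xy by metis+
  ultimately have "\<phi> (s (\<phi> x) +[X] s (\<phi> y)) = \<phi> (x +[X] y)"
   using xy s(1) N'(3) by (subst phi) auto
  thus ?thesis by (simp add: Q_def)
 qed
 have smult: "a .[Q] \<phi> x = \<phi> (a .[X] x)" if xy: "a \<in>[A]" "x \<in>[X]" for a x
 proof -
  have "a .[X] s (\<phi> x) -[X] a .[X] x = a .[X] (s (\<phi> x) -[X] x)"
   using xy s(1)[OF xy(2)] by (simp add: X.minus_eq X.smult_r_distr X.smult_r_minus)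
  moreover have "s (\<phi> x) -[X] x : N" using phi s xy by metis
  ultimately have "\<phi> (a .[X] s (\<phi> x)) = \<phi> (a .[X] x)"
   using xy s(1) N'(4) by (subst phi) auto
  thus ?thesis by (simp add: Q_def)
 qed
 have c: "carrier Q = \<phi> ` carrier X" "0[Q] = \<phi> 0[X]" by (auto simp: Q_def)
 have Q: "lmod A Q"
  by (rule left_module_intro)
   (auto simp: c add smult X.A.ring_axioms X.a_ac X.smult_l_distr X.smult_r_distr X.smult_assoc)
 have l: "lin A X Q \<phi>" by (rule linI) (auto simp: c add smult)
 have k: "ker X Q \<phi> = N" using N'(1) phi[of _ "0[X]"] by (auto simp: ker_def c X.minus_eq X.minus_zero_module subset_iff)
 show ?thesis
  by (rule that[OF _ l _ k]) (use fg_surj[OF fg Q l] c in auto)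
qed

lemma universe_copy:
 assumes "fgm A X"
 obtains Y :: "'a umod" and f where "fgm (A :: ('a, 'c) ring_scheme) Y" "iso A X Y f"
proof -
 have X: "lmod A X" using assms by (rule fg_lmod)
 interpret X: left_module A X by fact
 have z: "submodule {0[X]} A X" by (rule X.submodule_intro) auto
 obtain Q :: "'a umod" and q where Q: "fgm A Q" "lin A X Q q" "q ` carrier X = carrier Q"
  "ker X Q q = {0[X]}" using quotient_exists[OF assms z] .
 have "iso A X Q q" using Q inj_on_iff_ker[OF X fg_lmod[OF Q(1)] Q(2)]
  by (auto simp: iso_def bij_betw_def)
 with Q(1) show ?thesis using that by blast
qed

section \<open>Noetherian modules\<close>

definition noeth :: "('a, 'c) ring_scheme => ('a, 'x) module => bool" where
 "noeth A X \<longleftrightarrow> lmod A X & (\<forall>N. submodule N A X \<longrightarrow> fgm A (sub X N))"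

lemma submodule_sub_iff:
 assumes "lmod A X" "submodule N A X"
 shows "submodule K A (sub X N) \<longleftrightarrow> submodule K A X & K <= N"
proof -
 interpret X: left_module A X by fact
 interpret N: left_module A "sub X N" by (rule sub_lmod[OF assms])
 show ?thesis
 proof
  assume K: "submodule K A (sub X N)"
  thus "submodule K A X & K <= N"
   using N.subm[OF K] X.subm(1)[OF assms(2)]
   by (auto intro!: X.submodule_intro)
 next
  assume "submodule K A X & K <= N"
  thus "submodule K A (sub X N)"
   using X.subm[of K] by (auto intro!: N.submodule_intro)
 qed
qed

lemma noeth_fg: "noeth A X ==> fgm A X"
 unfolding noeth_def using carrier_submodule[of A X] by (metis partial_object.surjective partial_object.update_convs(1))

lemma noeth_surj:
 assumes X: "noeth A X" and Y: "lmod A Y" and f: "lin A X Y f" "f ` carrier X = carrier Y"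
 shows "noeth A Y"
 unfolding noeth_def
proof (intro conjI allI impI Y)
 have Xm: "lmod A X" using X by (simp add: noeth_def)
 fix N assume N: "submodule N A Y"
 let ?M = "{x : carrier X. f x : N}"
 have "submodule ?M A X" by (rule vimage_submodule[OF Xm Y f(1) N])
 hence "fgm A (sub X ?M)" using X by (simp add: noeth_def)
 moreover have NY: "N <= carrier Y" by (rule left_module.subm(1)[OF Y N])
 moreover have "lin A (sub X ?M) (sub Y N) f" using f(1) by (auto simp: lin_def)
 moreover have "f ` ?M = N"
 proof (intro equalityI subsetI)
  fix y assume y: "y : N"
  hence "y : f ` carrier X" using NY f(2) by auto
  then obtain x where "x \<in>[X]" "y = f x" by (rule imageE)
  thus "y : f ` ?M" using y by simp
 qed auto
 ultimately show "fgm A (sub Y N)" by (intro fg_surj[OF _ sub_lmod[OF Y N]]) auto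
qed

lemma noeth_extension:
 assumes X: "lmod A X" and Y: "noeth A Y" and f: "lin A X Y f"
  and k: "noeth A (sub X (ker X Y f))"
 shows "noeth A X"
 unfolding noeth_def
proof (intro conjI allI impI X)
 have Ym: "lmod A Y" using Y by (simp add: noeth_def)
 fix N assume N: "submodule N A X"
 have NX: "N <= carrier X" by (rule left_module.subm(1)[OF X N])
 have fN: "submodule (f ` N) A Y" by (rule image_submodule[OF X Ym f N])
 note mN = sub_lmod[OF X N] and mfN = sub_lmod[OF Ym fN]
 have kk: "submodule (ker X Y f) A X" by (rule ker_submodule[OF X Ym f])
 have "submodule (N \<inter> ker X Y f) A (sub X (ker X Y f))"
  using inter_submodule[OF X N kk] submodule_sub_iff[OF X kk] by auto
 hence "fgm A (sub X (N \<inter> ker X Y f))" using k by (auto simp: noeth_def)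
 moreover have "ker (sub X N) (sub Y (f ` N)) f = N \<inter> ker X Y f" using NX by (auto simp: ker_def)
 moreover have "lin A (sub X N) (sub Y (f ` N)) f"
  using f NX by (auto simp: lin_def subset_iff)
 ultimately show "fgm A (sub X N)"
  using Y fN by (intro fg_extension[OF mN mfN, of f]) (auto simp: noeth_def)
qed

lemma noeth_direct_sum:
 assumes "noeth A X" "noeth A Y" shows "noeth A (dirsum X Y)"
proof -
 have XY: "lmod A X" "lmod A Y" using assms by (auto simp: noeth_def)
 have sm: "submodule (ker (dirsum X Y) Y snd) A (dirsum X Y)"
  by (intro ker_submodule dsum_lmod XY lin_snd)
 have "noeth A (sub (dirsum X Y) (ker (dirsum X Y) Y snd))"
  by (rule noeth_surj[OF assms(1) sub_lmod[OF dsum_lmod[OF XY] sm], of "%x. (x, 0[Y])"])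
    (auto simp: lin_def ker_def lmodD[OF XY(2)])
 thus ?thesis by (intro noeth_extension[OF dsum_lmod[OF XY] assms(2) lin_snd])
qed

lemma noeth_zero:
 assumes "lmod A X" "carrier X = {0[X]}" shows "noeth A X"
 unfolding noeth_def
proof (intro conjI allI impI assms(1))
 interpret X: left_module A X by fact
 fix N assume N: "submodule N A X"
 have "N = {0[X]}" using X.subm[OF N] assms(2) by auto
 thus "fgm A (sub X N)" by (intro fg_zero[OF sub_lmod[OF assms(1) N]]) simp
qed

lemma noeth_lmod: "noeth A X ==> lmod A X"
 by (simp add: noeth_def)

lemma noeth_iso:
 assumes "noeth A X" "lmod A Y" "mod_iso A X Y" shows "noeth A Y"
proof -
 obtain f where f: "iso A X Y f" using mod_isoE[OF assms(3) noeth_lmod[OF assms(1)]] .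
 show ?thesis by (rule noeth_surj[OF assms(1,2) isoD(1)[OF f] isoD(3)[OF f]])
qed

lemma noeth_msum:
 assumes "ring A" "finite J" "!!j. j : J ==> noeth A (X j)" shows "noeth A (msum J X)"
 using assms(2,3)
proof (induct J)
 case empty
 show ?case by (rule noeth_zero) (auto intro: msum_lmod assms(1))
next
 case (insert j J)
 have m: "lmod A (msum (insert j J) X)" using insert(4) by (intro msum_lmod assms(1)) (auto simp: noeth_def)
 have "noeth A (dirsum (X j) (msum J X))" using insert by (intro noeth_direct_sum) auto
 moreover from this have "lmod A (dirsum (X j) (msum J X))" by (simp add: noeth_def)
 hence "mod_iso A (dirsum (X j) (msum J X)) (msum (insert j J) X)"
  by (rule mod_iso_sym[OF m _ mod_isoI[OF m iso_msum_insert[OF insert(2)]]])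
 ultimately show ?case using m noeth_iso by blast
qed

lemma noeth_fg_module:
 assumes "noeth A (reg_mod A)" "fgm A X" shows "noeth A X"
proof -
 have X: "lmod A X" using assms(2) by (rule fg_lmod)
 interpret X: left_module A X by fact
 obtain n z where z: "gens A X {..<n::nat} z" using fg_obtain[OF assms(2)] .
 have "noeth A (free A {..<n})" by (intro noeth_msum X.A.ring_axioms assms(1)) auto
 thus ?thesis by (rule noeth_surj[OF _ X lin_lincomb[OF X gensD(1,2)[OF z]] gensD(4)[OF z]])
qed

lemma noeth_chain_stable:
 assumes "noeth A X" "!!i::nat. submodule (N i) A X" "!!i. N i <= N (Suc i)"
 obtains n where "!!i. n \<le> i ==> N i = N n"
proof -
 have X: "lmod A X" using assms(1) by (simp add: noeth_def)
 interpret X: left_module A X by fact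
 have mono: "i \<le> j ==> N i <= N j" for i j using lift_Suc_mono_le[of N, OF assms(3)] by blast
 have U: "submodule (\<Union>i. N i) A X"
 proof (rule X.submodule_intro)
  fix x y assume "x : (\<Union>i. N i)" "y : (\<Union>i. N i)"
  then obtain i j where "x : N i" "y : N j" by auto
  hence "x : N (max i j)" "y : N (max i j)" using mono[of i "max i j"] mono[of j "max i j"] by auto
  thus "x +[X] y : (\<Union>i. N i)" using X.subm(3)[OF assms(2)] by blast
 next
  show "(\<Union>i. N i) <= carrier X" using X.subm(1)[OF assms(2)] by blast
  show "0[X] : (\<Union>i. N i)" using X.subm(2)[OF assms(2)] by blast
  show "a .[X] x : (\<Union>i. N i)" if "a \<in>[A]" "x : (\<Union>i. N i)" for a x
   using X.subm(4)[OF assms(2)] that by blast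
 qed
 then obtain S where S: "S <= (\<Union>i. N i)" "finite S"
  "!!M. submodule M A (sub X (\<Union>i. N i)) ==> S <= M ==> M = (\<Union>i. N i)"
 proof -
  have "fgm A (sub X (\<Union>i. N i))" using assms(1) U by (simp add: noeth_def)
  thus ?thesis using that by (auto simp: fg_module_def)
 qed
 have "\<exists>n. S <= N n" using S(2,1)
 proof (induct S)
  case (insert x S)
  then obtain n m where "S <= N n" "x : N m" by auto
  thus ?case using mono[of n "max n m"] mono[of m "max n m"] by (intro exI[of _ "max n m"]) auto
 qed auto
 then obtain n where n: "S <= N n" by auto
 have "N n = (\<Union>i. N i)" using S(3)[of "N n"] n submodule_sub_iff[OF X U] assms(2) by auto
 hence "N i = N n" if "n \<le> i" for i using mono[OF that] by auto
 thus ?thesis using that by blast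
qed

lemma noeth_wf:
 assumes "noeth A X" shows "wf {(N', N). submodule N A X & submodule N' A X & N \<subset> N'}"
 unfolding wf_iff_no_infinite_down_chain
proof
 assume "\<exists>f. \<forall>i. (f (Suc i), f i) : {(N', N). submodule N A X & submodule N' A X & N \<subset> N'}"
 then obtain f where f0: "\<forall>i::nat. (f (Suc i), f i) : {(N', N). submodule N A X & submodule N' A X & N \<subset> N'}"
  by blast
 hence f: "!!i. submodule (f i) A X" "!!i. f i \<subset> f (Suc i)" by auto
 obtain n where n: "!!i. n \<le> i ==> f i = f n"
  using noeth_chain_stable[where N=f, OF assms f(1) psubset_imp_subset[OF f(2)]] by metis
 show False using f(2)[of n] n[of "Suc n"] by simp
qed

lemma noeth_maximal:
 assumes "noeth A X" "N0 : S" "!!N. N : S ==> submodule N A X"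
 obtains K where "K : S" "!!K'. [|K' : S; K <= K'|] ==> K' = K"
proof -
 show ?thesis
 proof (rule wfE_min[OF noeth_wf[OF assms(1)] assms(2)])
  fix K assume K: "K : S"
   "!!K'. (K', K) : {(N', N). submodule N A X & submodule N' A X & N \<subset> N'} ==> K' \<notin> S"
  have "K' = K" if "K' : S" "K <= K'" for K'
   using K(2)[of K'] assms(3)[OF K(1)] assms(3)[OF that(1)] that by auto
  thus thesis using that K(1) by blast
 qed
qed

lemma noeth_maximal_ex:
 assumes "noeth A X" "N0 : S" "!!N. N : S ==> submodule N A X"
 shows "\<exists>K\<in>S. \<forall>K'\<in>S. K <= K' \<longrightarrow> K' = K"
 by (rule noeth_maximal[OF assms]) auto

lemma Inter_submodule:
 assumes "lmod A X" "!!i. submodule (N i) A X" shows "submodule (\<Inter>i. N i) A X"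
proof -
 interpret X: left_module A X by fact
 note f = X.subm[OF assms(2)]
 show ?thesis
 proof (rule X.submodule_intro)
  show "(\<Inter>i. N i) <= carrier X" using f(1) by (rule INF_lower2[OF UNIV_I])
  show "0[X] : (\<Inter>i. N i)" using f(2) by simp
  show "x +[X] y : (\<Inter>i. N i)" if "x : (\<Inter>i. N i)" "y : (\<Inter>i. N i)" for x y using f(3) that by simp
  show "a .[X] x : (\<Inter>i. N i)" if "a \<in>[A]" "x : (\<Inter>i. N i)" for a x using f(4) that by simp
 qed
qed

lemma submodule_regular_iff:
 assumes "cring R" shows "submodule N R (reg_mod R) \<longleftrightarrow> ideal N R"
proof -
 interpret cring R by fact
 have M: "lmod R (reg_mod R)" by (rule regular_lmod[OF ring_axioms])
 show ?thesis
 proof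
  assume N: "submodule N R (reg_mod R)"
  note f = left_module.subm[OF M N]
  have "subgroup N (add_monoid R)"
   by (rule add.subgroupI)
    (use f in "auto simp: regular_minus[OF ring_axioms] subset_iff")
  thus "ideal N R"
  proof (rule idealI[OF ring_axioms])
   show r: "x *[R] a : N" if "a : N" "x \<in>[R]" for a x using f(4) that by simp
   show "a *[R] x : N" if "a : N" "x \<in>[R]" for a x
    using r[OF that] m_comm[of a x] f(1) that by (simp add: subset_iff)
  qed
 next
  assume N: "ideal N R"
  interpret N: ideal N R by fact
  show "submodule N R (reg_mod R)"
   by (rule left_module.submodule_intro[OF M]) (auto intro: N.I_l_closed)
 qed
qed

lemma noeth_regular:
 assumes "noetherian_ring R" "cring R" shows "noeth R (reg_mod R)"
proof -
 interpret noetherian_ring R by fact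
 interpret cring R by fact
 have M: "lmod R (reg_mod R)" by (rule regular_lmod[OF ring_axioms])
 note si = submodule_regular_iff[OF \<open>cring R\<close>]
 show ?thesis unfolding noeth_def
 proof (intro conjI allI impI M)
  fix N assume N: "submodule N R (reg_mod R)"
  then obtain S where S: "S <= carrier R" "finite S" "N = Idl\<^bsub>R\<^esub> S" using finetely_gen si by metis
  have "K = N" if "submodule K R (sub (reg_mod R) N)" "S <= K" for K
   using that submodule_sub_iff[OF M N] si S genideal_minimal[of K S] by auto
  thus "fgm R (sub (reg_mod R) N)"
   unfolding fg_module_def using sub_lmod[OF M N] S genideal_self[OF S(1)]
   by (intro conjI exI[of _ S]) auto
 qed
qed

section \<open>Algebras that are finite over a noetherian base ring\<close>

lemma rscal_simps [simp]:
 "carrier (rscal L X) = carrier X" "0[rscal L X] = 0[X]"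
 "x +[rscal L X] y = x +[X] y" "r .[rscal L X] x = (r .[L] 1[L]) .[X] x"
 by (auto simp: restrict_scalars_def)

lemma restrict_scalars_sub: "rscal L (sub X N) = sub (rscal L X) N"
 by (simp add: restrict_scalars_def)

locale noetherian_algebra = module_finite_algebra R L
 for R :: "('r, 'q) ring_scheme" (structure) and L :: "('r, 'l) module" (structure) +
 assumes noetherian_base: "noetherian_ring R"
begin

lemma base_lmod: "lmod R L"
 by (rule fg_lmod[OF fg_over_base])

definition scal :: "'r => 'l" where
 "scal r = r .[L] 1[L]"

lemma scal_closed [simp, intro]: "r \<in>[R] ==> scal r \<in>[L]"
 using lmodD(7)[OF base_lmod] by (simp add: scal_def)

lemma scal_mult:
 assumes "r \<in>[R]" "x \<in>[L]"
 shows "scal r *[L] x = r .[L] x" "x *[L] scal r = r .[L] x"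
 using assms smult_mult_left[of r "1[L]" x] smult_mult_right[of r x "1[L]"] by (auto simp: scal_def)

lemma scal_central: "r \<in>[R] ==> x \<in>[L] ==> scal r *[L] x = x *[L] scal r"
 by (simp add: scal_mult)

lemma scal_hom:
 assumes "r \<in>[R]" "s \<in>[R]"
 shows "scal (r +[R] s) = scal r +[L] scal s" "scal (r *[R] s) = scal r *[L] scal s"
 using assms lmodD[OF base_lmod] scal_mult(1)[of r "scal s"] by (auto simp: scal_def)

lemma scal_one_zero [simp]: "scal 1[R] = 1[L]" "scal 0[R] = 0[L]"
 using lmodD(11,12)[OF base_lmod, of "1[L]"] by (auto simp: scal_def)

lemma restrict_lmod:
 assumes "lmod L X" shows "lmod R (rscal L X)"
proof -
 interpret X: left_module L X by fact
 show ?thesis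
  by (rule left_module_intro)
   (auto simp: R.ring_axioms X.a_ac scal_hom X.smult_l_distr X.smult_r_distr X.smult_assoc simp flip: scal_def)
qed

lemma restrict_submodule:
 assumes "lmod L X" "submodule N L X" shows "submodule N R (rscal L X)"
 by (rule left_module.submodule_intro[OF restrict_lmod[OF assms(1)]])
  (use left_module.subm[OF assms] in "auto simp flip: scal_def")

lemma lin_restrict: "lin L X Y f ==> lin R (rscal L X) (rscal L Y) f"
 by (auto simp: lin_def simp flip: scal_def)

lemma restrict_fg:
 assumes "fgm L X" shows "fgm R (rscal L X)"
proof -
 have X: "lmod L X" using assms by (rule fg_lmod)
 interpret X: left_module L X by fact
 obtain n z where z: "gens L X {..<n::nat} z" using fg_obtain[OF assms] .
 note zl = lin_lincomb[OF X gensD(1,2)[OF z]]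
 let ?F = "msum {..<n} (%_. L)"
 have F: "fgm R ?F" by (intro fg_msum R.ring_axioms fg_over_base) auto
 have c: "carrier ?F = carrier (free L {..<n})" by simp
 have "lin R ?F (rscal L X) (lincomb X {..<n} z)"
 proof (rule linI)
  fix c c' assume "c : carrier ?F" "c' : carrier ?F"
  thus "lincomb X {..<n} z (c +[?F] c') =
    lincomb X {..<n} z c +[rscal L X] lincomb X {..<n} z c'"
   using lin_add[OF zl, of c c'] by simp
 next
  fix r c assume r: "r \<in>[R]" and c: "c : carrier ?F"
  have "r .[?F] c = scal r .[free L {..<n}] c" 
   unfolding msum_simps regular_module_simps
   by (rule restrict_ext) (use r c in "auto simp: scal_mult PiE_iff")
  thus "lincomb X {..<n} z (r .[?F] c) = r .[rscal L X] lincomb X {..<n} z c"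
   using lin_smult[OF zl, of "scal r" c] r c scal_closed[OF r] by (simp add: scal_def[symmetric])
 qed (use lin_cl[OF zl] in simp)
 thus ?thesis
  by (rule fg_surj[OF F restrict_lmod[OF X]]) (use gensD(4)[OF z] in simp)
qed

lemma fg_of_restrict:
 assumes "lmod L X" "fgm R (rscal L X)" shows "fgm L X"
proof -
 obtain S where "S <= carrier X" "finite S"
  "!!N. submodule N R (rscal L X) ==> S <= N ==> N = carrier X"
  using assms(2) by (auto simp: fg_module_def)
 thus ?thesis unfolding fg_module_def using assms(1) restrict_submodule[OF assms(1)]
  by (intro conjI exI[of _ S]) auto
qed

lemma base_noeth: "fgm R X ==> noeth R X"
 by (rule noeth_fg_module[OF noeth_regular[OF noetherian_base R.cring_axioms]])

lemma noeth_algebra: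
 assumes "fgm L X" shows "noeth L X"
 unfolding noeth_def
proof (intro conjI allI impI)
 show X: "lmod L X" by (rule fg_lmod[OF assms])
 fix N assume N: "submodule N L X"
 have "fgm R (rscal L (sub X N))"
  using base_noeth[OF restrict_fg[OF assms]] restrict_submodule[OF X N]
  by (simp add: noeth_def restrict_scalars_sub)
 thus "fgm L (sub X N)" by (rule fg_of_restrict[OF sub_lmod[OF X N]])
qed

definition hom_mod :: "('l, 'x) module => ('l, 'y) module => ('r, 'x => 'y) module" where
 "hom_mod X Y = \<lparr>carrier = mod_hom L X Y, monoid.mult = undefined, one = undefined,
   zero = zero_map X Y, add = (%f g. \<lambda>x\<in>carrier X. f x +[Y] g x),
   smult = (%r f. \<lambda>x\<in>carrier X. scal r .[Y] f x)\<rparr>"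

lemma hom_mod_simps [simp]:
 "carrier (hom_mod X Y) = mod_hom L X Y" "0[hom_mod X Y] = zero_map X Y"
 "f +[hom_mod X Y] g = (\<lambda>x\<in>carrier X. f x +[Y] g x)"
 "r .[hom_mod X Y] f = (\<lambda>x\<in>carrier X. scal r .[Y] f x)"
 by (auto simp: hom_mod_def)

lemma lin_scal:
 assumes "lmod L Y" "r \<in>[R]" shows "lin L Y Y (%y. scal r .[Y] y)"
proof -
 interpret Y: left_module L Y by fact
 show ?thesis using assms(2)
  by (auto simp: lin_def Y.smult_r_distr scal_central simp flip: Y.smult_assoc)
qed

lemma hom_mod_lmod:
 assumes X: "lmod L X" and Y: "lmod L Y" shows "lmod R (hom_mod X Y)"
proof -
 interpret X: left_module L X by fact
 interpret Y: left_module L Y by fact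
 note m = lin_mod_hom[OF X]
 have c: "f x \<in>[Y]" if "f : mod_hom L X Y" "x \<in>[X]" for f x
  using that by (auto simp: mod_hom_def)
 have e: "f x = undefined" if "f : mod_hom L X Y" "x \<notin> carrier X" for f x
  using that by (auto simp: mod_hom_def)
 show ?thesis
 proof (rule left_module_intro)
  show "f +[hom_mod X Y] g \<in>[hom_mod X Y]"
   if "f \<in>[hom_mod X Y]" "g \<in>[hom_mod X Y]" for f g
   using m[OF lin_plus[OF Y mod_hom_lin mod_hom_lin]] that by simp
  show "0[hom_mod X Y] \<in>[hom_mod X Y]"
   using m[OF lin_zero_map[OF Y]] by (simp add: zero_map_def)
  show "r .[hom_mod X Y] f \<in>[hom_mod X Y]"
   if "r \<in>[R]" "f \<in>[hom_mod X Y]" for r f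
   using m[OF lin_comp[OF mod_hom_lin lin_scal[OF Y]]] that by simp
  show "(r *[R] s) .[hom_mod X Y] f = r .[hom_mod X Y] (s .[hom_mod X Y] f)"
   if "r \<in>[R]" "s \<in>[R]" "f \<in>[hom_mod X Y]" for r s f
   using that by (auto simp: fun_eq_iff scal_hom c Y.smult_assoc)
 qed (auto simp: fun_eq_iff restrict_def c e Y.a_ac zero_map_def scal_hom Y.smult_l_distr Y.smult_r_distr R.ring_axioms)
qed

text \<open>Evaluation at finitely many generators embeds \<open>Hom(X, Y)\<close> into a power of \<open>Y\<close>.\<close>

lemma hom_mod_noeth:
 assumes X: "fgm L X" and Y: "fgm L Y" shows "noeth R (hom_mod X Y)"
proof -
 note XY = X[THEN fg_lmod] Y[THEN fg_lmod]
 interpret X: left_module L X by (rule XY)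
 interpret Y: left_module L Y by (rule XY)
 obtain n z where z: "gens L X {..<n::nat} z" using fg_obtain[OF X] .
 note H = hom_mod_lmod[OF XY]
 let ?P = "msum {..<n} (%_. rscal L Y)"
 have P: "noeth R ?P" by (intro noeth_msum R.ring_axioms base_noeth restrict_fg Y) auto
 have ev: "lin R (hom_mod X Y) (rscal L Y) (%f. f (z j))" if "j : {..<n}" for j
  using gensD(3)[OF z that] by (auto simp: lin_def scal_def mod_hom_def)
 let ?e = "%f. \<lambda>j\<in>{..<n}. f (z j)"
 have e: "lin R (hom_mod X Y) ?P ?e" by (rule lin_tuple[OF ev])
 have "ker (hom_mod X Y) ?P ?e = {0[hom_mod X Y]}"
 proof (intro equalityI subsetI)
  fix f assume "f : ker (hom_mod X Y) ?P ?e"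
  hence f: "f : mod_hom L X Y" and e0: "?e f = (\<lambda>j\<in>{..<n}. 0[Y])" by (auto simp: ker_def)
  have f0: "f (z j) = 0[Y]" if "j : {..<n}" for j using fun_cong[OF e0, of j] that by simp
  have "f x = 0[Y]" if x: "x \<in>[X]" for x
  proof -
   obtain c where c: "c \<in>[free L {..<n}]" "x = lincomb X {..<n} z c" using gens_expand[OF z x] .
   have c': "c : {..<n} \<rightarrow> carrier L" using c(1) by (auto simp: PiE_iff)
   have "f x = lincomb Y {..<n} (%j. f (z j)) c"
    unfolding c(2) by (rule lin_lincomb_image[OF XY mod_hom_lin[OF f] gensD(1,2)[OF z] c'])
   also have "... = finsum Y (%j. 0[Y]) {..<n}"
    unfolding lincomb_def by (rule Y.finsum_cong') (use f0 c' in "auto simp: Pi_def")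
   finally show ?thesis by simp
  qed
  hence "f = zero_map X Y" using f by (auto simp: mod_hom_def zero_map_def fun_eq_iff PiE_iff extensional_def)
  thus "f : {0[hom_mod X Y]}" by simp
 next
  fix f assume "f : {0[hom_mod X Y]}"
  hence "f = 0[hom_mod X Y]" by simp
  thus "f : ker (hom_mod X Y) ?P ?e"
   using lin_zero[OF H noeth_lmod[OF P] e] lmodD(2)[OF H] by (simp add: ker_def)
 qed
 hence "noeth R (sub (hom_mod X Y) (ker (hom_mod X Y) ?P ?e))"
  by (intro noeth_zero sub_lmod[OF H] ker_submodule[OF H noeth_lmod[OF P] e]) simp
 thus ?thesis by (rule noeth_extension[OF H P e])
qed

end

lemma End_ring_simps [simp]:
 "carrier (End_ring A X) = mod_hom A X X" "f *[End_ring A X] g = compose (carrier X) f g"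
 "1[End_ring A X] = (\<lambda>x\<in>carrier X. x)" "0[End_ring A X] = zero_map X X"
 "f +[End_ring A X] g = (\<lambda>x\<in>carrier X. f x +[X] g x)"
 by (auto simp: End_ring_def)

lemma mod_hom_closed: "f : mod_hom A X Y ==> x \<in>[X] ==> f x \<in>[Y]"
 by (auto simp: mod_hom_def)

lemma mod_hom_eqI:
 assumes "f : mod_hom A X Y" "g : mod_hom A X Y" "!!x. x \<in>[X] ==> f x = g x" shows "f = g"
 using assms PiE_ext[of f "carrier X" "%_. carrier Y" g] unfolding mod_hom_def by blast

lemma compose_mod_hom:
 assumes "lmod A X" "f : mod_hom A X Y" "g : mod_hom A Y Z"
 shows "compose (carrier X) g f : mod_hom A X Z"
 using lin_mod_hom[OF assms(1) lin_comp[OF assms(2,3)[THEN mod_hom_lin]]] by (simp add: compose_def)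

lemma End_ring_ring:
 assumes X: "lmod A X" shows "ring (End_ring A X)"
proof -
 interpret X: left_module A X by fact
 note m = lin_mod_hom[OF X]
 note c = mod_hom_closed[of _ A X X]
 have e: "f x = undefined" if "f : mod_hom A X X" "x \<notin> carrier X" for f x
  using that by (auto simp: mod_hom_def)
 have z: "zero_map X X : mod_hom A X X" using m[OF lin_zero_map[OF X]] by (simp add: zero_map_def)
 have p: "(\<lambda>x\<in>carrier X. f x +[X] g x) : mod_hom A X X" if "f : mod_hom A X X" "g : mod_hom A X X" for f g
  using m[OF lin_plus[OF X that[THEN mod_hom_lin]]] .
 have i: "(\<lambda>x\<in>carrier X. x) : mod_hom A X X" using m[OF lin_id] .
 note k = compose_mod_hom[OF X, of _ X _ X]
 show ?thesis
 proof (rule ringI)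
  show "abelian_group (End_ring A X)"
  proof (rule abelian_groupI)
   fix f assume f: "f \<in>[End_ring A X]"
   have l: "lin A X X (%x. 0[X] -[X] f x)"
    using f by (intro lin_subtract[OF X] lin_zero_map[OF X] mod_hom_lin) simp
   have g: "restrict (%x. 0[X] -[X] f x) (carrier X) : mod_hom A X X" by (rule m[OF l])
   show "\<exists>g\<in>carrier (End_ring A X). g +[End_ring A X] f = 0[End_ring A X]"
    using f g by (intro bexI[OF _ g[folded End_ring_simps(1)]])
     (auto simp: zero_map_def fun_eq_iff restrict_def c X.minus_eq X.l_neg)
  qed (use p z in "auto simp: c e X.a_ac zero_map_def intro!: ext")
  show "monoid (End_ring A X)"
  proof (rule monoidI)
   fix f assume "f \<in>[End_ring A X]"
   hence f: "f : mod_hom A X X" by simp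
   show "1[End_ring A X] *[End_ring A X] f = f" "f *[End_ring A X] 1[End_ring A X] = f"
    by (simp, rule mod_hom_eqI[OF k[OF f i] f] mod_hom_eqI[OF k[OF i f] f], simp add: compose_def c[OF f])+
  qed (use i k in "auto simp: compose_def c intro!: ext")
 next
  fix f g h assume "f \<in>[End_ring A X]" "g \<in>[End_ring A X]" "h \<in>[End_ring A X]"
  thus "(f +[End_ring A X] g) *[End_ring A X] h = f *[End_ring A X] h +[End_ring A X] g *[End_ring A X] h"
   "h *[End_ring A X] (f +[End_ring A X] g) = h *[End_ring A X] f +[End_ring A X] h *[End_ring A X] g"
   by (auto simp: compose_def fun_eq_iff restrict_def c lin_add[OF mod_hom_lin])
 qed
qed

section \<open>Modules over a complete noetherian local ring\<close>

definition idm :: "('r, 'q) ring_scheme => ('r, 'x) module => 'r set => 'x set" where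
 "idm R X I = \<Inter> {N. submodule N R X & (\<forall>r\<in>I. \<forall>x\<in>carrier X. r .[X] x : N)}"

lemma idm_least:
 assumes "submodule N R X" "!!r x. [|r : I; x \<in>[X]|] ==> r .[X] x : N"
 shows "idm R X I <= N"
 unfolding idm_def using assms by (intro Inter_lower) simp

lemma idm_memI: "[|r : I; x \<in>[X]|] ==> r .[X] x : idm R X I"
 by (simp add: idm_def)

lemma idm_submodule:
 assumes "lmod R X" "I <= carrier R" shows "submodule (idm R X I) R X"
proof -
 interpret X: left_module R X by fact
 let ?S = "{N. submodule N R X & (\<forall>r\<in>I. \<forall>x\<in>carrier X. r .[X] x : N)}"
 have c: "carrier X : ?S" using carrier_submodule[OF assms(1)] assms(2) by auto
 show ?thesis
 proof (rule X.submodule_intro)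
  show "idm R X I <= carrier X" unfolding idm_def by (rule Inter_lower[OF c])
  show "0[X] : idm R X I" unfolding idm_def using X.subm(2) by blast
  show "x +[X] y : idm R X I" if "x : idm R X I" "y : idm R X I" for x y
   using that X.subm(3) unfolding idm_def by blast
  show "a .[X] x : idm R X I" if "a \<in>[R]" "x : idm R X I" for a x
   using that X.subm(4) unfolding idm_def by blast
 qed
qed

lemma idm_mono: "I <= I' ==> idm R X I <= idm R X I'"
 unfolding idm_def by (intro Inter_anti_mono) blast

lemma idm_lincomb:
 assumes R: "cring R" and X: "lmod R X" and z: "gens R X J z" and I: "ideal I R" and x: "x : idm R X I"
 obtains c where "c : J \<rightarrow> I" "x = lincomb X J z c"
proof -
 interpret R: cring R by fact
 interpret I: ideal I R by fact
 interpret X: left_module R X by fact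
 note F = free_lmod[OF R.ring_axioms, of J]
 interpret F: left_module R "free R J" by (rule F)
 have P: "submodule (Pi\<^sub>E J (%_. I)) R (free R J)"
  by (rule F.submodule_intro) (auto simp: PiE_iff I.I_l_closed I.Icarr)
 note zl = lin_lincomb[OF X gensD(1,2)[OF z]]
 have sm: "submodule (lincomb X J z ` Pi\<^sub>E J (%_. I)) R X"
  by (rule image_submodule[OF F X zl P])
 have "idm R X I <= lincomb X J z ` Pi\<^sub>E J (%_. I)"
 proof (rule idm_least[OF sm])
  fix r x assume r: "r : I" and "x \<in>[X]"
  then obtain c where c: "c \<in>[free R J]" "x = lincomb X J z c" using gens_expand[OF z] by metis
  have "r .[X] x = lincomb X J z (r .[free R J] c)"
   using lin_smult[OF zl I.Icarr[OF r] c(1)] c(2) by simp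
  moreover have "r .[free R J] c : Pi\<^sub>E J (%_. I)" using c(1) r by (auto simp: PiE_iff I.I_r_closed)
  ultimately show "r .[X] x : lincomb X J z ` Pi\<^sub>E J (%_. I)" by (metis imageI)
 qed
 with x have "x : lincomb X J z ` Pi\<^sub>E J (%_. I)" by (rule subsetD[rotated])
 then obtain c where "x = lincomb X J z c" "c : Pi\<^sub>E J (%_. I)" by (rule imageE)
 thus ?thesis using that[of c] by (auto simp: PiE_iff)
qed

lemma idm_image:
 assumes "lmod R X" "lmod R Y" "lin R X Y f" "I <= carrier R" "x : idm R X I"
 shows "f x : idm R Y I"
proof -
 have "idm R X I <= {x : carrier X. f x : idm R Y I}"
 proof (rule idm_least[OF vimage_submodule[OF assms(1-3) idm_submodule[OF assms(2,4)]]])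
  fix r x assume rx: "r : I" "x \<in>[X]"
  hence r: "r \<in>[R]" using assms(4) by auto
  have "f (r .[X] x) = r .[Y] f x" by (rule lin_smult[OF assms(3) r rx(2)])
  also have "... : idm R Y I" by (rule idm_memI[OF rx(1) lin_cl[OF assms(3) rx(2)]])
  finally show "r .[X] x : {x : carrier X. f x : idm R Y I}"
   using lmodD(7)[OF assms(1) r rx(2)] by simp
 qed
 with assms(5) show ?thesis by auto
qed

lemma submodule_plus_image:
 assumes X: "lmod A X" and Y: "lmod A Y" and N: "submodule N A X" and g: "lin A Y X g"
  and K: "K = {n +[X] g y | n y. n : N & y \<in>[Y]}"
 shows "submodule K A X" "N <= K" "!!y. y \<in>[Y] ==> g y : K"
proof -
 interpret X: left_module A X by (rule X)
 note Nf = X.subm[OF N] and D = dsum_lmod[OF sub_lmod[OF X N] Y]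
 let ?f = "%p. fst p +[X] g (snd p)"
 have l: "lin A (dirsum (sub X N) Y) X ?f"
  by (intro lin_plus[OF X] lin_fst'[OF lin_incl[OF Nf(1)]] lin_snd'[OF g])
 have "K = ?f ` carrier (dirsum (sub X N) Y)" unfolding K by force
 thus "submodule K A X" using image_submodule[OF D X l carrier_submodule[OF D]] by simp
 have "\<exists>n' y. n = n' +[X] g y & n' : N & y \<in>[Y]" if "n : N" for n
  using that Nf(1) lin_zero[OF Y X g] lmodD(2)[OF Y]
  by (intro exI[of _ n] exI[of _ "0[Y]"]) (auto simp: subset_iff)
 thus "N <= K" unfolding K by blast
 show "g y : K" if "y \<in>[Y]" for y
  using that Nf(2) lin_cl[OF g that] unfolding K by (auto intro!: exI[of _ "0[X]"] exI[of _ y])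
qed

context noetherian_local_ring
begin

abbreviation "\<mm> \<equiv> max_ideal R"

lemma regular_noeth: "noeth R (reg_mod R)"
 by (rule noeth_regular[OF noetherian_ring_axioms cring_axioms])

lemma max_ideal_maximal: "maximalideal \<mm> R"
 unfolding max_ideal_def by (rule theI'[OF unique_maximalideal])

lemma max_ideal_ideal: "ideal \<mm> R"
 using max_ideal_maximal by (simp add: maximalideal_def)

lemma max_ideal_sub: "\<mm> <= carrier R"
 by (rule subsetI) (rule ideal.Icarr[OF max_ideal_ideal])

lemma one_notin_max_ideal: "\<one> \<notin> \<mm>"
 using max_ideal_maximal ideal.one_imp_carrier[OF max_ideal_ideal] by (auto simp: maximalideal_def maximalideal_axioms_def)

lemma unit_if_notin_max_ideal:
 assumes x: "x \<in>[R]" "x \<notin> \<mm>" shows "x : Units R"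
proof (rule ccontr)
 assume nu: "x \<notin> Units R"
 let ?S = "{I. ideal I R & x : I & \<one> \<notin> I}"
 have "\<one> \<notin> PIdl x"
 proof
  assume "\<one> : PIdl x"
  then obtain r where "r \<in>[R]" "\<one> = r \<otimes> x" by (auto simp: cgenideal_def)
  thus False using nu x(1) m_comm[of r x] by (auto simp: Units_def)
 qed
 hence "PIdl x : ?S" using cgenideal_ideal[OF x(1)] cgenideal_self[OF x(1)] by simp
 from noeth_maximal[OF regular_noeth this] submodule_regular_iff[OF cring_axioms]
 obtain K where K: "K : ?S" "!!K'. [|K' : ?S; K <= K'|] ==> K' = K" by blast
 have "maximalideal K R"
 proof (rule maximalidealI)
  show "ideal K R" "carrier R \<noteq> K" using K(1) by auto
  fix J assume J: "ideal J R" "K <= J" "J <= carrier R"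
  show "J = K \<or> J = carrier R"
  proof (cases "\<one> : J")
   case True thus ?thesis using ideal.one_imp_carrier[OF J(1)] by auto
  next
   case False
   hence "J : ?S" using J K(1) by auto
   thus ?thesis using K(2)[OF _ J(2)] by auto
  qed
 qed
 hence "K = \<mm>" using unique_maximalideal max_ideal_maximal by blast
 with K(1) x(2) show False by auto
qed

lemma one_minus_max_ideal_unit:
 assumes "c : \<mm>" shows "\<one> \<ominus> c : Units R"
proof (rule unit_if_notin_max_ideal)
 interpret m: ideal \<mm> R by (rule max_ideal_ideal)
 have c: "c \<in>[R]" using assms max_ideal_sub by auto
 thus "\<one> \<ominus> c \<in>[R]" by simp
 show "\<one> \<ominus> c \<notin> \<mm>"
 proof
  assume "\<one> \<ominus> c : \<mm>"
  hence "(\<one> \<ominus> c) \<oplus> c : \<mm>" using assms by (rule m.a_closed)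
  moreover have "(\<one> \<ominus> c) \<oplus> c = \<one>" using c by algebra
  ultimately show False using one_notin_max_ideal by simp
 qed
qed

text \<open>
 Nakayama's lemma, by discarding the last generator: its coefficient in an expansion of itself lies
 in the maximal ideal.
\<close>

lemma nakayama_zero:
 assumes Y: "lmod R Y" and y: "gens R Y {..<n::nat} y" and m: "carrier Y <= idm R Y \<mm>"
 shows "carrier Y = {0[Y]}"
 using y
proof (induct n)
 case 0
 interpret Y: left_module R Y by (rule Y)
 show ?case using gensD(4)[OF 0] by (simp add: lincomb_def)
next
 case (Suc n)
 interpret Y: left_module R Y by (rule Y)
 note y = Suc(2)
 have yc: "y : {..<n} \<rightarrow> carrier Y" "y n \<in>[Y]" using gensD(3)[OF y] by auto
 have "y n : idm R Y \<mm>" using m yc(2) by auto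
 then obtain c where c: "c : {..<Suc n} \<rightarrow> \<mm>" "y n = lincomb Y {..<Suc n} y c"
  using idm_lincomb[OF cring_axioms Y y max_ideal_ideal] by metis
 have cc: "c : {..<n} \<rightarrow> carrier R" "c n \<in>[R]" "c n : \<mm>" using c(1) max_ideal_sub by auto
 let ?w = "lincomb Y {..<n} y c"
 have w: "?w \<in>[Y]" by (rule lincomb_closed[OF Y yc(1) cc(1)])
 have e: "y n = c n .[Y] y n +[Y] ?w"
  using c(2) yc cc unfolding lincomb_def lessThan_Suc by (subst (asm) Y.finsum_insert) (auto simp: Pi_def)
 let ?u = "\<one> \<ominus> c n"
 have u: "?u : Units R" by (rule one_minus_max_ideal_unit[OF cc(3)])
 have "?u .[Y] y n = y n -[Y] c n .[Y] y n"
  using yc(2) cc(2) by (simp add: minus_eq Y.minus_eq Y.smult_l_distr Y.smult_l_minus)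
 also have "... = (c n .[Y] y n +[Y] ?w) -[Y] c n .[Y] y n" using e by simp
 also have "... = ?w"
 proof -
  have "c n .[Y] y n \<in>[Y]" using yc(2) cc(2) by simp
  thus ?thesis using w by algebra
 qed
 finally have "inv ?u .[Y] (?u .[Y] y n) = inv ?u .[Y] ?w" by simp
 hence yn: "y n = inv ?u .[Y] ?w"
  using u yc(2) cc(2) by (simp flip: Y.smult_assoc)
 let ?N = "lincomb Y {..<n} y ` carrier (free R {..<n})"
 have N: "submodule ?N R Y" by (rule span_submodule[OF Y _ yc(1)]) simp
 have yN: "y j : ?N" if "j < n" for j by (rule generator_in_span[OF Y _ yc(1)]) (use that in auto)
 hence "?w : ?N" by (intro lincomb_in_submodule[OF Y N _ _ cc(1)]) auto
 hence "y n : ?N" unfolding yn using u by (intro Y.subm(4)[OF N]) auto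
 with yN have yN': "y : {..<Suc n} \<rightarrow> ?N" using less_Suc_eq by auto
 have "carrier Y <= ?N"
  by (rule gens_subset[OF y], rule lincomb_in_submodule[OF Y N _ yN']) auto
 hence "gens R Y {..<n} y"
  unfolding gens_def using yc(1) Y.subm(1)[OF N] by (intro conjI equalityI) simp_all
 thus ?case by (rule Suc(1))
qed

lemma nakayama:
 assumes X: "fgm R X" and N: "submodule N R X"
  and m: "!!x. x \<in>[X] ==> \<exists>n\<in>N. x -[X] n : idm R X \<mm>"
 shows "N = carrier X"
proof -
 have Xm: "lmod R X" by (rule fg_lmod[OF X])
 interpret X: left_module R X by (rule Xm)
 obtain Q :: "'a umod" and q where Q: "fgm R Q" "lin R X Q q" "q ` carrier X = carrier Q" "ker X Q q = N"
  using quotient_exists[OF X N] .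
 have Qm: "lmod R Q" by (rule fg_lmod[OF Q(1)])
 interpret Q: left_module R Q by (rule Qm)
 have "carrier Q <= idm R Q \<mm>"
 proof
  fix u assume "u \<in>[Q]"
  hence "u : q ` carrier X" using Q(3) by simp
  then obtain x where x: "x \<in>[X]" "u = q x" by (rule imageE)
  obtain n where n: "n : N" "x -[X] n : idm R X \<mm>" using m[OF x(1)] by auto
  have nk: "n \<in>[X]" "q n = 0[Q]" using n(1) Q(4) by (auto simp: ker_def)
  have "q (x -[X] n) = u"
   using lin_diff[OF Xm Qm Q(2) x(1) nk(1)] nk x lin_cl[OF Q(2) x(1)]
   by (simp add: Q.minus_eq Q.minus_zero_module)
  thus "u : idm R Q \<mm>" using idm_image[OF Xm Qm Q(2) max_ideal_sub n(2)] by simp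
 qed
 moreover obtain n z where "gens R Q {..<n::nat} z" using fg_obtain[OF Q(1)] .
 ultimately have Q0: "carrier Q = {0[Q]}" using nakayama_zero[OF Qm] by blast
 have "carrier X <= N"
 proof
  fix x assume x: "x \<in>[X]"
  with lin_cl[OF Q(2) x] Q0 show "x : N" unfolding Q(4)[symmetric] ker_def by simp
 qed
 thus ?thesis using X.subm(1)[OF N] by auto
qed

definition mpow :: "nat => 'a set" where
 "mpow n = \<mm> [^]\<^bsub>ideals_set R\<^esub> n"

lemma mpow_ideal: "ideal (mpow n) R"
 and mpow_0: "mpow 0 = carrier R" and mpow_Suc: "mpow (Suc n) = mpow n \<cdot>\<^bsub>R\<^esub> \<mm>"
 and mpow_add: "mpow (i + j) = mpow i \<cdot>\<^bsub>R\<^esub> mpow j" and mpow_1: "mpow (Suc 0) = \<mm>"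
proof -
 interpret I: comm_monoid "ideals_set R" by (rule ideals_set_is_comm_monoid)
 have c: "carrier (ideals_set R) = {I. ideal I R}" "monoid.mult (ideals_set R) = ideal_prod R" "one (ideals_set R) = carrier R"
  by (auto simp: ideals_set_def)
 have m: "\<mm> \<in>[ideals_set R]" using max_ideal_ideal c by auto
 show "ideal (mpow n) R" using I.nat_pow_closed[OF m, of n] unfolding c mpow_def by simp
 show "mpow 0 = carrier R" using I.nat_pow_0[of \<mm>] unfolding c mpow_def .
 show "mpow (Suc n) = mpow n \<cdot>\<^bsub>R\<^esub> \<mm>" using I.nat_pow_Suc[of \<mm> n] unfolding c mpow_def .
 show "mpow (i + j) = mpow i \<cdot>\<^bsub>R\<^esub> mpow j" using I.nat_pow_mult[OF m, of i j] unfolding c mpow_def by simp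
 show "mpow (Suc 0) = \<mm>" using I.nat_pow_eone[OF m] unfolding mpow_def by simp
qed

lemma mpow_sub: "mpow n <= carrier R"
 by (rule subsetI) (rule ideal.Icarr[OF mpow_ideal])

lemma mpow_mult: "[|a : mpow i; b : mpow j|] ==> a \<otimes> b : mpow (i + j)"
 unfolding mpow_add by (rule ideal_prod.prod)

lemma mpow_add_subset:
 assumes "ideal J R" "!!x y. [|x : mpow i; y : mpow j|] ==> x \<otimes> y : J" shows "mpow (i + j) <= J"
proof
 interpret J: ideal J R by fact
 fix x assume "x : mpow (i + j)"
 hence "x : mpow i \<cdot>\<^bsub>R\<^esub> mpow j" by (simp add: mpow_add)
 thus "x : J" by induct (auto intro: assms(2))
qed

lemma mpow_mono: "i \<le> j ==> mpow j <= mpow i"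
proof -
 have "mpow (i + k) <= mpow i" for k
  unfolding mpow_add using ideal_prod_inter[OF mpow_ideal[of i] mpow_ideal[of k]] by blast
 thus "i \<le> j ==> mpow j <= mpow i" using le_Suc_ex by blast
qed

lemma set_add_memI: "[|a : H; b : K; x = a \<oplus> b|] ==> x : H <+> K"
 by (auto simp: set_add_def set_mult_def)

text \<open>
 Noetherian induction: for a maximal counterexample \<open>J\<close> and some \<open>b \<notin> J\<close> with \<open>b\<^sup>2 \<in> J\<close>, both \<open>J + (b)\<close> and \<open>(J : b)\<close> are
 larger, and the product of powers of \<open>\<mm>\<close> that they contain lies in \<open>J\<close>.
\<close>

lemma mpow_absorbed:
 assumes "ideal J R" "!!a. a : \<mm> ==> \<exists>n::nat. a [^] n : J"
 shows "\<exists>t. mpow t <= J"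
proof (rule ccontr)
 assume no: "\<not> (\<exists>t. mpow t <= J)"
 let ?S = "{J. ideal J R & (\<forall>a\<in>\<mm>. \<exists>n::nat. a [^] n : J) & \<not> (\<exists>t. mpow t <= J)}"
 have "J : ?S" using assms no by simp
 from noeth_maximal[OF regular_noeth this] submodule_regular_iff[OF cring_axioms]
 obtain K where K: "K : ?S" "!!K'. [|K' : ?S; K <= K'|] ==> K' = K" by blast
 interpret K: ideal K R using K(1) by simp
 have "\<not> \<mm> <= K" using K(1) unfolding mpow_1[symmetric] by blast
 then obtain a where a: "a : \<mm>" "a \<notin> K" by auto
 have ac: "a \<in>[R]" using a(1) max_ideal_sub by auto
 define n where "n = (LEAST n::nat. a [^] n : K)"
 have "\<exists>n::nat. a [^] n : K" using K(1) a(1) by simp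
 hence n: "a [^] n : K" unfolding n_def by (rule LeastI_ex)
 have least: "k < n ==> a [^] k \<notin> K" for k unfolding n_def by (rule not_less_Least)
 have "n \<noteq> 0"
 proof
  assume "n = 0"
  hence "\<one> : K" using n by simp
  hence "mpow 0 <= K" using K.one_imp_carrier mpow_0 by simp
  thus False using K(1) by auto
 qed
 moreover have "n \<noteq> 1" using n a(2) ac by auto
 ultimately obtain k where k: "n = Suc (Suc k)" by (metis One_nat_def not0_implies_Suc)
 define b where "b = a [^] Suc k"
 have b: "b \<notin> K" "b \<in>[R]" using least[of "Suc k"] k ac unfolding b_def by auto
 have "b \<otimes> b = a [^] (Suc k + Suc k)" unfolding b_def by (rule nat_pow_mult[OF ac])
 also have "Suc k + Suc k = n + k" using k by simp
 also have "a [^] (n + k) = a [^] n \<otimes> a [^] k" by (rule nat_pow_mult[OF ac, symmetric])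
 finally have "b \<otimes> b = a [^] n \<otimes> a [^] k" .
 hence bb: "b \<otimes> b : K" using n ac by (simp add: K.I_r_closed)
 let ?C = "{r : carrier R. r \<otimes> b : K}"
 have "submodule ?C R (reg_mod R)"
  by (rule left_module.submodule_intro[OF regular_lmod[OF ring_axioms]])
   (use b(2) in "auto simp: l_distr m_assoc K.I_l_closed")
 hence C: "ideal ?C R" by (simp add: submodule_regular_iff[OF cring_axioms])
 let ?B = "K <+>\<^bsub>R\<^esub> PIdl b"
 have B: "ideal ?B R" by (rule add_ideals[OF K.is_ideal cgenideal_ideal[OF b(2)]])
 have KC: "K <= ?C" using b(2) by (auto simp: K.I_r_closed K.Icarr)
 have pI: "\<zero> : PIdl b" "b : PIdl b" 
  using additive_subgroup.zero_closed[OF ideal.axioms(1)[OF cgenideal_ideal[OF b(2)]]] cgenideal_self[OF b(2)] by auto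
 have KB: "K <= ?B"
 proof
  fix x assume x: "x : K"
  show "x : ?B" by (rule set_add_memI[OF x pI(1)]) (use K.Icarr[OF x] in simp)
 qed
 have bB: "b : ?B" by (rule set_add_memI[OF K.zero_closed pI(2)]) (use b(2) in simp)
 have ex: "\<exists>t. mpow t <= K'" if "ideal K' R" "K <= K'" "b : K'" for K'
 proof (rule ccontr)
  assume "\<not> (\<exists>t. mpow t <= K')"
  hence "K' : ?S" using that(1,2) K(1) by blast
  hence "K' = K" using K(2) that(2) by blast
  with that(3) b(1) show False by simp
 qed
 obtain t where t: "mpow t <= ?C" using ex[OF C KC] b(2) bb by (auto)
 obtain s where s: "mpow s <= ?B" using ex[OF B KB bB] by auto
 have "mpow (s + t) <= K"
 proof (rule mpow_add_subset[OF K.is_ideal])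
  fix x y assume x: "x : mpow s" and y: "y : mpow t"
  have y': "y \<in>[R]" "y \<otimes> b : K" using y t by auto
  have "x : ?B" using x s by auto
  then obtain j r where jr: "j : K" "r \<in>[R]" "x = j \<oplus> r \<otimes> b"
   unfolding set_add_def set_mult_def cgenideal_def by auto
  have jc: "j \<in>[R]" using jr(1) by (rule K.Icarr)
  have "x \<otimes> y = j \<otimes> y \<oplus> r \<otimes> (y \<otimes> b)"
   unfolding jr(3) using jc jr(2) y'(1) b(2) by algebra
  thus "x \<otimes> y : K" using jr(1,2) y' by (simp add: K.I_r_closed K.I_l_closed)
 qed
 thus False using K(1) by blast
qed

text \<open>
 Krull's intersection theorem. A submodule \<open>K\<close> maximal with \<open>K \<inter> N = \<mm>N\<close> contains some \<open>\<mm>\<^sup>t X\<close>,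
 because each \<open>a \<in> \<mm>\<close> satisfies \<open>a\<^sup>n X \<subseteq> K\<close> once the chain of submodules \<open>{x. a\<^sup>n x \<in> K}\<close> is stationary.
\<close>

theorem krull_intersection:
 assumes X: "noeth R X" and x: "!!n. x : idm R X (mpow n)"
 shows "x = 0[X]"
proof -
 have Xm: "lmod R X" by (rule noeth_lmod[OF X])
 interpret X: left_module R X by (rule Xm)
 note F = idm_submodule[OF Xm mpow_sub]
 note Ff = X.subm[OF F]
 define N where "N = (\<Inter>n. idm R X (mpow n))"
 have N: "submodule N R X" unfolding N_def
  by (rule Inter_submodule[OF Xm F])
 note Nf = X.subm[OF N]
 have Nm: "lmod R (sub X N)" by (rule sub_lmod[OF Xm N])
 have Nfg: "fgm R (sub X N)" using X N by (simp add: noeth_def)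
 define mN where "mN = idm R (sub X N) \<mm>"
 have "submodule mN R (sub X N)" unfolding mN_def by (rule idm_submodule[OF Nm max_ideal_sub])
 hence mN: "submodule mN R X" "mN <= N" using submodule_sub_iff[OF Xm N] by auto
 have mNI: "r .[X] y : mN" if "r : \<mm>" "y : N" for r y
  using idm_memI[of r \<mm> y "sub X N" R] that by (simp add: mN_def)
 let ?S = "{K. submodule K R X & K \<inter> N = mN}"
 have "mN : ?S" using mN by auto
 from noeth_maximal_ex[OF X this]
 obtain K where K0: "K : ?S" "\<forall>K'\<in>?S. K <= K' \<longrightarrow> K' = K" by auto
 hence K: "submodule K R X" "K \<inter> N = mN"
  and Kmax: "!!K'. [|submodule K' R X; K' \<inter> N = mN; K <= K'|] ==> K' = K" by simp_all
 note Kf = X.subm[OF K(1)]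
 let ?J = "{r : carrier R. \<forall>y\<in>carrier X. r .[X] y : K}"
 have "submodule ?J R (reg_mod R)"
  by (rule left_module.submodule_intro[OF regular_lmod[OF ring_axioms]])
   (use Kf in "auto simp: X.smult_l_distr X.smult_assoc")
 hence J: "ideal ?J R" by (simp add: submodule_regular_iff[OF cring_axioms])
 have "\<exists>n::nat. a [^] n : ?J" if a: "a : \<mm>" for a
 proof -
  have ac: "a \<in>[R]" using a max_ideal_sub by auto
  have l: "lin R X X (%y. (a [^] n) .[X] y)" for n :: nat
   using ac by (auto simp: lin_def X.smult_r_distr m_comm simp flip: X.smult_assoc)
  define V where "V n = {y : carrier X. (a [^] n) .[X] y : K}" for n :: nat
  have V: "submodule (V n) R X" for n unfolding V_def by (rule vimage_submodule[OF Xm Xm l K(1)])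
  have pS: "(a [^] Suc n) .[X] y = a .[X] ((a [^] n) .[X] y)" if "y \<in>[X]" for n :: nat and y
   using ac that by (simp add: m_comm flip: X.smult_assoc)
  have "V n <= V (Suc n)" for n unfolding V_def using pS Kf(4)[OF ac] by auto
  with noeth_chain_stable[where N=V, OF X V] obtain n where nn: "!!i. n \<le> i ==> V i = V n" by metis
  have n: "V (Suc n) = V n" by (rule nn) simp
  let ?K' = "{k +[X] (a [^] n) .[X] y | k y. k : K & y \<in>[X]}"
  note K' = submodule_plus_image[OF Xm Xm K(1) l refl]
  have "?K' \<inter> N = mN"
  proof (intro equalityI subsetI)
   fix w assume w: "w : ?K' \<inter> N"
   then obtain k y where ky: "k : K" "y \<in>[X]" "w = k +[X] (a [^] n) .[X] y" "w : N" by blast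
   have kc: "k \<in>[X]" using ky(1) Kf(1) by auto
   have any: "(a [^] n) .[X] y \<in>[X]" using ac ky(2) by simp
   have "a .[X] w : K" using mNI[OF a ky(4)] K(2) by auto
   moreover have "a .[X] k : K" using Kf(4)[OF ac ky(1)] .
   ultimately have "a .[X] w -[X] a .[X] k : K" by (rule Kf(6))
   moreover have "a .[X] w -[X] a .[X] k = a .[X] ((a [^] n) .[X] y)"
   proof -
    have "a .[X] k \<in>[X]" "a .[X] ((a [^] n) .[X] y) \<in>[X]" using ac kc any by auto
    moreover have "a .[X] w = a .[X] k +[X] a .[X] ((a [^] n) .[X] y)"
     unfolding ky(3) using ac kc any by (simp add: X.smult_r_distr)
    ultimately show ?thesis by (simp add: X.minus_eq X.a_ac X.r_neg1 X.r_neg2 X.r_neg X.l_neg)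
   qed
   ultimately have "y : V (Suc n)" using ky(2) pS[OF ky(2), of n] unfolding V_def by simp
   hence "(a [^] n) .[X] y : K" unfolding n by (simp add: V_def)
   hence "w : K" unfolding ky(3) using ky(1) by (intro Kf(3))
   thus "w : mN" using ky(4) K(2) by auto
  next
   fix w assume "w : mN"
   thus "w : ?K' \<inter> N" using K'(2) K(2) by blast
  qed
  hence "?K' = K" by (rule Kmax[OF K'(1) _ K'(2)])
  hence "(a [^] n) .[X] y : K" if "y \<in>[X]" for y using K'(3)[of y n] that by simp
  thus ?thesis using ac by (intro exI[of _ n]) simp
 qed
 then obtain t where t: "mpow t <= ?J" using mpow_absorbed[OF J] by blast
 have "idm R X (mpow t) <= K" by (rule idm_least[OF K(1)]) (use t in blast)
 hence "N <= mN" using K(2) unfolding N_def by blast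
 hence c: "carrier (sub X N) <= idm R (sub X N) \<mm>" by (simp add: mN_def)
 obtain n z where z: "gens R (sub X N) {..<n::nat} z" using fg_obtain[OF Nfg] .
 have "carrier (sub X N) = {0[sub X N]}" by (rule nakayama_zero[OF Nm z c])
 moreover have "x : N" using x by (simp add: N_def)
 ultimately show ?thesis by simp
qed

end

section \<open>Idempotents of algebras that are finite over a complete local ring\<close>

locale complete_algebra = RR?: complete_regular_local_ring R + noetherian_algebra R L
 for R :: "('r, 'q) ring_scheme" (structure) and L :: "('r, 'l) module" (structure)

locale commutative_complete_algebra = complete_algebra R L + LL?: cring L
 for R :: "('r, 'q) ring_scheme" and L :: "('r, 'l) module" (structure)
begin

definition F :: "nat => 'l set" where
 "F n = idm R L (mpow n)"

lemma F_submodule: "submodule (F n) R L"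
 unfolding F_def by (rule idm_submodule[OF base_lmod mpow_sub])

lemmas F_facts = left_module.subm[OF base_lmod F_submodule]

lemma F_closed [simp]: "x : F n ==> x \<in>[L]"
 using F_facts(1) by auto

lemma F_mono: "i \<le> j ==> F j <= F i"
 unfolding F_def by (rule idm_mono[OF mpow_mono])

lemma lin_mult: "x \<in>[L] ==> lin R L L (%y. x \<otimes> y)"
 by (auto simp: lin_def L.r_distr smult_mult_right)

lemma F_ideal: "[|x \<in>[L]; y : F j|] ==> x \<otimes> y : F j"
 unfolding F_def by (rule idm_image[OF base_lmod base_lmod lin_mult mpow_sub])

lemma F_mult:
 assumes "x : F i" "y : F j" shows "y \<otimes> x : F (i + j)"
proof -
 note least = idm_least[OF vimage_submodule[OF base_lmod base_lmod lin_mult F_submodule]]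
 have s: "r \<odot> y : F (i + j)" if r: "r : mpow i" for r
 proof -
  have rc: "r \<in>[R]" using r mpow_sub by auto
  have "F j <= {y : carrier L. scal r \<otimes> y : F (i + j)}" unfolding F_def[of j]
  proof (rule least)
   fix s w assume s: "s : mpow j" "w \<in>[L]"
   hence sc: "s \<in>[R]" using mpow_sub by auto
   have "(r *[R] s) \<odot> w : F (i + j)" unfolding F_def by (rule idm_memI[OF mpow_mult[OF r s(1)] s(2)])
   thus "s \<odot> w : {y : carrier L. scal r \<otimes> y : F (i + j)}"
    using s(2) sc rc lmodD(7,10)[OF base_lmod] by (simp add: scal_mult)
  qed (use rc in simp)
  thus ?thesis using assms(2) rc by (auto simp: scal_mult)
 qed
 have yc: "y \<in>[L]" using assms(2) by simp
 have "F i <= {x : carrier L. y \<otimes> x : F (i + j)}" unfolding F_def[of i]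
 proof (rule least[OF yc])
  fix r x assume r: "r : mpow i" "x \<in>[L]"
  hence rc: "r \<in>[R]" using mpow_sub by auto
  have "x \<otimes> (r \<odot> y) : F (i + j)" by (rule F_ideal[OF r(2) s[OF r(1)]])
  thus "r \<odot> x : {x : carrier L. y \<otimes> x : F (i + j)}"
   using r(2) rc yc lmodD(7)[OF base_lmod]
   by (simp add: smult_mult_right m_comm[of y x])
 qed
 thus ?thesis using assms(1) by auto
qed

text \<open>
 By Nakayama, \<open>(1 - w) L = L\<close>.
\<close>

lemma one_minus_unit:
 assumes w: "w : F 1" shows "\<one> \<ominus> w : Units L"
proof -
 have wc: "w \<in>[L]" using w by simp
 hence uc: "\<one> \<ominus> w \<in>[L]" by simp
 have "(%x. (\<one> \<ominus> w) \<otimes> x) ` carrier L = carrier L"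
 proof (rule nakayama[OF fg_over_base image_submodule[OF base_lmod base_lmod
     lin_mult[OF uc] carrier_submodule[OF base_lmod]]])
  fix x assume x: "x \<in>[L]"
  have "x \<ominus> (\<one> \<ominus> w) \<otimes> x = x \<otimes> w" using wc x by algebra
  hence "x \<ominus> (\<one> \<ominus> w) \<otimes> x : idm R L \<mm>" using F_ideal[OF x w] mpow_1 by (simp add: F_def)
  thus "\<exists>n\<in>(%x. (\<one> \<ominus> w) \<otimes> x) ` carrier L. x \<ominus> n : idm R L \<mm>" using x by blast
 qed
 then obtain a where "a \<in>[L]" "(\<one> \<ominus> w) \<otimes> a = \<one>" using L.one_closed by (metis imageE)
 thus ?thesis using unit_factor[of "\<one> \<ominus> w" a] uc by simp
qed

lemma add_sub_cancel_middle:
 "[|a \<in>[L]; b \<in>[L]; c \<in>[L]|] ==> (a \<oplus> (b \<oplus> c)) \<ominus> (a \<oplus> c) = b"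
 by algebra

text \<open>
 Cauchy sequences in \<open>L\<close> converge: the coefficients of the increments with respect to finitely many
 generators form Cauchy sequences in \<open>R\<close>.
\<close>

lemma F_limit:
 assumes x: "!!n. x n \<in>[L]" "!!n. x (Suc n) \<ominus> x n : F n"
 obtains y where "y \<in>[L]" "!!n. y \<ominus> x n : F n"
proof -
 interpret M: left_module R L by (rule base_lmod)
 obtain k z where z: "gens R L {..<k::nat} z" using fg_obtain[OF fg_over_base] .
 note zl = lin_lincomb[OF base_lmod gensD(1,2)[OF z]]
 have "\<exists>c. c : {..<k} \<rightarrow> mpow n & x (Suc n) \<ominus> x n = lincomb L {..<k} z c" for n
  using idm_lincomb[OF RR.cring_axioms base_lmod z mpow_ideal x(2)[unfolded F_def]] by metis
 then obtain c where c: "!!n. c n : {..<k} \<rightarrow> mpow n" "!!n. x (Suc n) \<ominus> x n = lincomb L {..<k} z (c n)" by metis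
 define s where "s n = rec_nat (\<lambda>j\<in>{..<k}. 0[R]) (%n s. \<lambda>j\<in>{..<k}. s j +[R] c n j) n" for n
 have s0: "s 0 = (\<lambda>j\<in>{..<k}. 0[R])" and sS: "s (Suc n) = (\<lambda>j\<in>{..<k}. s n j +[R] c n j)" for n by (simp_all add: s_def)
 have cc: "j < k ==> c n j \<in>[R]" for n j using c(1)[of n] mpow_sub[of n] by auto
 have sc: "s n \<in>[free R {..<k}]" for n
 proof (induct n)
  case 0 show ?case unfolding s0 msum_simps restrict_PiE_iff by simp
 next
  case (Suc n)
  hence "\<forall>j<k. s n j \<in>[R]" by (auto simp: PiE_iff)
  thus ?case unfolding sS msum_simps restrict_PiE_iff using cc by simp
 qed
 hence scj: "j < k ==> s n j \<in>[R]" for n j by (auto simp: PiE_iff)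
 have xs: "x n = x 0 \<oplus> lincomb L {..<k} z (s n)" for n
 proof (induct n)
  case 0
  have "lincomb L {..<k} z (s 0) = \<zero>"
   using lin_zero[OF free_lmod[OF RR.ring_axioms] base_lmod zl] s0 by simp
  thus ?case using x(1) by simp
 next
  case (Suc n)
  have cf: "restrict (c n) {..<k} \<in>[free R {..<k}]" using cc by auto
  have "s (Suc n) = s n +[free R {..<k}] restrict (c n) {..<k}" by (auto simp: sS fun_eq_iff)
  hence "lincomb L {..<k} z (s (Suc n)) = lincomb L {..<k} z (s n) \<oplus> lincomb L {..<k} z (restrict (c n) {..<k})"
   using lin_add[OF zl sc[of n] cf] by simp
  also have "lincomb L {..<k} z (restrict (c n) {..<k}) = x (Suc n) \<ominus> x n"
   unfolding c(2) using cc gensD(2)[OF z] by (intro lincomb_restrict[OF base_lmod]) auto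
  finally have "x 0 \<oplus> lincomb L {..<k} z (s (Suc n)) = x n \<oplus> (x (Suc n) \<ominus> x n)"
   using Suc x(1) lin_cl[OF zl sc[of n]] by (simp add: L.a_assoc)
  also have "... = x (Suc n)" using x(1)[of n] x(1)[of "Suc n"] by algebra
  finally show ?case by simp
 qed
 have "\<exists>y\<in>carrier R. \<forall>n. y -[R] s n j : mpow n" if j: "j < k" for j
  unfolding mpow_def
 proof (rule complete)
  show "s n j \<in>[R]" for n using scj[OF j] .
  fix n
  have "s (Suc n) j -[R] s n j = c n j"
   unfolding sS using j scj[OF j, of n] cc[OF j, of n] by simp algebra
  thus "s (Suc n) j -[R] s n j : \<mm> [^]\<^bsub>ideals_set R\<^esub> n"
   using c(1)[of n] j unfolding mpow_def by auto
 qed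
 then obtain y where y: "!!j. j < k ==> y j \<in>[R]" "!!j n. j < k ==> y j -[R] s n j : mpow n"
  by metis
 let ?y = "restrict y {..<k}"
 have yf: "?y \<in>[free R {..<k}]" using y(1) by auto
 let ?z = "x 0 \<oplus> lincomb L {..<k} z ?y"
 have "?z \<ominus> x n : F n" for n
 proof -
  interpret Fr: left_module R "free R {..<k}" by (rule free_lmod[OF RR.ring_axioms])
  let ?d = "\<lambda>j\<in>{..<k}. y j -[R] s n j"
  have d: "?d \<in>[free R {..<k}]" using y(1) scj by auto
  have "?d +[free R {..<k}] s n = ?y"
  proof -
   have "(y j -[R] s n j) +[R] s n j = y j" if "j < k" for j
    using y(1)[OF that] scj[OF that, of n] by algebra
   thus ?thesis by (auto simp: fun_eq_iff)
  qed
  hence "lincomb L {..<k} z ?y = lincomb L {..<k} z ?d \<oplus> lincomb L {..<k} z (s n)"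
   using lin_add[OF zl d sc[of n]] by simp
  hence "?z \<ominus> x n = (x 0 \<oplus> (lincomb L {..<k} z ?d \<oplus> lincomb L {..<k} z (s n)))
    \<ominus> (x 0 \<oplus> lincomb L {..<k} z (s n))" using xs[of n] by simp
  also have "... = lincomb L {..<k} z ?d"
   using add_sub_cancel_middle[OF x(1) lin_cl[OF zl d] lin_cl[OF zl sc]] .
  finally have e: "?z \<ominus> x n = lincomb L {..<k} z ?d" .
  have "lincomb L {..<k} z ?d : F n"
   unfolding lincomb_def
   by (rule finsum_in_submodule[OF base_lmod F_submodule])
    (use y(2) gensD(3)[OF z] in "auto simp: F_def intro: idm_memI")
  thus ?thesis using e by simp
 qed
 thus ?thesis using that[of ?z] x(1)[of 0] lin_cl[OF zl yf] by simp
qed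

lemma F_separated: "(!!n. x : F n) ==> x = \<zero>"
 unfolding F_def by (rule krull_intersection[OF base_noeth[OF fg_over_base]])

text \<open>Newton's iteration \<open>e \<mapsto> 3e\<^sup>2 - 2e\<^sup>3\<close> lifts an idempotent modulo \<open>\<mm>L\<close> to an idempotent.\<close>

lemma newton_step:
 assumes x: "x \<in>[L]" and t: "t = x \<otimes> x \<ominus> x" and u: "u = \<one> \<ominus> (x \<oplus> x)"
 shows "(x \<oplus> u \<otimes> t) \<otimes> (x \<oplus> u \<otimes> t) \<ominus> (x \<oplus> u \<otimes> t) = (t \<oplus> t \<oplus> t \<oplus> t \<ominus> \<one> \<ominus> \<one> \<ominus> \<one>) \<otimes> (t \<otimes> t)"
proof -
 have c: "t \<in>[L]" "u \<in>[L]" using x by (auto simp: t u)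
 have uu: "u \<otimes> u = \<one> \<oplus> (t \<oplus> t \<oplus> t \<oplus> t)" unfolding t u using x by algebra
 have ux: "x \<oplus> x \<ominus> \<one> = \<ominus> u" unfolding u using x by algebra
 have "(x \<oplus> u \<otimes> t) \<otimes> (x \<oplus> u \<otimes> t) \<ominus> (x \<oplus> u \<otimes> t)
  = (x \<otimes> x \<ominus> x) \<oplus> (u \<otimes> (x \<oplus> x \<ominus> \<one>)) \<otimes> t \<oplus> (u \<otimes> u) \<otimes> (t \<otimes> t)"
  using x c by algebra
 also have "... = t \<ominus> (u \<otimes> u) \<otimes> t \<oplus> (u \<otimes> u) \<otimes> (t \<otimes> t)"
  unfolding t[symmetric] ux using c by algebra
 also have "... = (t \<oplus> t \<oplus> t \<oplus> t \<ominus> \<one> \<ominus> \<one> \<ominus> \<one>) \<otimes> (t \<otimes> t)"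
  unfolding uu using c by algebra
 finally show ?thesis .
qed

lemma idempotent_lift:
 assumes e0: "e0 \<in>[L]" "e0 \<otimes> e0 \<ominus> e0 : F 1"
 obtains e where "e \<in>[L]" "e \<otimes> e = e" "e \<ominus> e0 : F 1"
proof -
 define \<nu> where "\<nu> x = x \<oplus> (\<one> \<ominus> (x \<oplus> x)) \<otimes> (x \<otimes> x \<ominus> x)" for x
 define e where "e n = (\<nu> ^^ n) e0" for n
 have eS: "e (Suc n) = \<nu> (e n)" and e0': "e 0 = e0" for n by (simp_all add: e_def)
 have ec: "e n \<in>[L]" for n by (induct n) (auto simp: e0' eS e0 \<nu>_def)
 have t: "e n \<otimes> e n \<ominus> e n : F (Suc n)" for n
 proof (induct n)
  case 0 thus ?case using e0 by (simp add: e0')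
 next
  case (Suc n)
  let ?t = "e n \<otimes> e n \<ominus> e n"
  have tc: "?t \<in>[L]" using ec by simp
  have "?t \<otimes> ?t : F (Suc n + Suc n)" by (rule F_mult[OF Suc Suc])
  hence tt: "?t \<otimes> ?t : F (Suc (Suc n))" using F_mono[of "Suc (Suc n)" "Suc n + Suc n"] by auto
  have "\<nu> (e n) \<otimes> \<nu> (e n) \<ominus> \<nu> (e n) = (?t \<oplus> ?t \<oplus> ?t \<oplus> ?t \<ominus> \<one> \<ominus> \<one> \<ominus> \<one>) \<otimes> (?t \<otimes> ?t)"
   unfolding \<nu>_def by (rule newton_step[OF ec refl refl])
  also have "... : F (Suc (Suc n))" by (rule F_ideal[OF _ tt]) (use tc in simp)
  finally show ?case by (simp add: eS)
 qed
 have d: "e (Suc n) \<ominus> e n : F (Suc n)" for n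
 proof -
  have "e (Suc n) \<ominus> e n = (\<one> \<ominus> (e n \<oplus> e n)) \<otimes> (e n \<otimes> e n \<ominus> e n)"
   unfolding eS \<nu>_def using ec[of n] by algebra
  also have "... : F (Suc n)" by (rule F_ideal[OF _ t]) (use ec in simp)
  finally show ?thesis .
 qed
 hence "e (Suc n) \<ominus> e n : F n" for n using F_mono[of n "Suc n"] by auto
 with F_limit[of e, OF ec] obtain y where y: "y \<in>[L]" "!!n. y \<ominus> e n : F n" by metis
 have "y \<otimes> y \<ominus> y : F n" for n
 proof -
  have "y \<otimes> y \<ominus> y = (y \<oplus> e n \<ominus> \<one>) \<otimes> (y \<ominus> e n) \<oplus> (e n \<otimes> e n \<ominus> e n)"
   using y(1) ec[of n] by algebra
  moreover have "e n \<otimes> e n \<ominus> e n : F n" using t[of n] F_mono[of n "Suc n"] by auto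
  ultimately show ?thesis
   using F_facts(3)[OF F_ideal[OF _ y(2)[of n]]] y(1) ec[of n] by simp
 qed
 hence "y \<otimes> y \<ominus> y = \<zero>" by (rule F_separated)
 hence "y \<otimes> y = y" using y(1) left_module.minus_eq_zero_iff[OF base_lmod, of "y \<otimes> y" y] by simp
 moreover have "y \<ominus> e0 : F 1"
 proof -
  have "y \<ominus> e0 = (y \<ominus> e 1) \<oplus> (e (Suc 0) \<ominus> e 0)"
   using y(1) ec[of 1] e0(1) e0' by (simp, algebra)
  thus ?thesis using F_facts(3)[OF y(2)[of 1]] d[of 0] by simp
 qed
 ultimately show ?thesis using that y(1) by blast
qed

text \<open>
 Modulo \<open>\<mm>L\<close> every element satisfies \<open>x\<^sup>s = x\<^sup>s\<^sup>+\<^sup>1 h\<close>: divide an integral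
 equation of \<open>x\<close> by its first coefficient that is a unit.
\<close>

lemma stable_power:
 assumes x: "x \<in>[L]"
 obtains s :: nat and h where "h \<in>[L]" "x [^] s \<ominus> x [^] Suc s \<otimes> h : F 1"
proof -
 interpret M: left_module R L by (rule base_lmod)
 let ?p = "%i::nat. x [^] i"
 define G where "G k = {n \<oplus> ?p k \<otimes> h | n h. n : F 1 & h \<in>[L]}" for k
 have p: "?p k \<in>[L]" for k :: nat using x by simp
 note Gs = submodule_plus_image[OF base_lmod base_lmod F_submodule lin_mult[OF p] G_def]
 note Gf = M.subm[OF Gs(1)]
 have pG: "?p i : G k" if "k \<le> i" for i k
 proof -
  have "?p i = ?p k \<otimes> ?p (i - k)" using L.nat_pow_mult[OF x, of k "i - k"] that by simp
  thus ?thesis using Gs(3) p by simp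
 qed
 let ?N = "%k. lincomb L {..<k} ?p ` carrier (free R {..<k})"
 have pc: "?p : {..<k} \<rightarrow> carrier L" for k :: nat using x by auto
 have N: "submodule (?N k) R L" for k by (rule span_submodule[OF base_lmod _ pc]) simp
 have pN: "?p j : ?N k" if "j < k" for j k
  by (rule generator_in_span[OF base_lmod _ pc]) (use that in auto)
 have "?N k <= ?N (Suc k)" for k
 proof
  fix y assume "y : ?N k"
  then obtain c where c: "y = lincomb L {..<k} ?p c" "c \<in>[free R {..<k}]" by (rule imageE)
  show "y : ?N (Suc k)" unfolding c(1)
   by (rule lincomb_in_submodule[OF base_lmod N]) (use c(2) pN in auto)
 qed
 with noeth_chain_stable[where N="?N", OF base_noeth[OF fg_over_base] N] obtain n where nn: "!!i. n \<le> i ==> ?N i = ?N n"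
  by metis
 have "?N (Suc n) = ?N n" by (rule nn) simp
 hence "?p n : ?N n" using pN[of n "Suc n"] by blast
 then obtain c where c: "?p n = lincomb L {..<n} ?p c" "c \<in>[free R {..<n}]" by (rule imageE)
 define b where "b i = (if i < n then c i else -[R] 1[R])" for i
 have bc: "b i \<in>[R]" for i using c(2) by (auto simp: b_def)
 have bp: "b i \<odot> ?p i \<in>[L]" for i using bc p by simp
 have "finsum L (%i. b i \<odot> ?p i) {..<Suc n} = b n \<odot> ?p n \<oplus> finsum L (%i. b i \<odot> ?p i) {..<n}"
  unfolding lessThan_Suc using bp by (intro L.finsum_insert) auto
 also have "finsum L (%i. b i \<odot> ?p i) {..<n} = ?p n"
  unfolding c(1) lincomb_def using c(2) p by (intro L.finsum_cong') (auto simp: b_def PiE_iff)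
 also have "b n \<odot> ?p n \<oplus> ?p n = \<zero>" using p[of n] by (simp add: b_def M.smult_l_minus L.l_neg)
 finally have rel: "finsum L (%i. b i \<odot> ?p i) {..<Suc n} = \<zero>" .
 define s where "s = (LEAST i. b i \<notin> \<mm>)"
 have bn: "b n \<notin> \<mm>"
 proof
  assume "b n : \<mm>"
  hence "-[R] 1[R] : \<mm>" by (simp add: b_def)
  hence "1[R] : \<mm>"
   using additive_subgroup.a_inv_closed[OF ideal.axioms(1)[OF max_ideal_ideal]] RR.minus_minus[OF RR.one_closed] by metis
  thus False using one_notin_max_ideal by simp
 qed
 hence sn: "s \<le> n" and s: "b s \<notin> \<mm>" unfolding s_def by (rule Least_le, rule LeastI)
 have u: "b s : Units R" by (rule unit_if_notin_max_ideal[OF bc s])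
 have g: "b i \<odot> ?p i : G (Suc s)" if "i \<noteq> s" for i
 proof (cases "i < s")
  case True
  hence "b i : mpow 1" using not_less_Least[of i] mpow_1 unfolding s_def by auto
  hence "b i \<odot> ?p i : F 1" unfolding F_def by (rule idm_memI[OF _ p])
  thus ?thesis using Gs(2) by blast
 qed (use pG[of "Suc s" i] that Gf(4)[OF bc] in auto)
 let ?r = "finsum L (%i. b i \<odot> ?p i) ({..<Suc n} - {s})"
 have r: "?r : G (Suc s)" by (rule finsum_in_submodule[OF base_lmod Gs(1)]) (auto intro: g)
 have "finsum L (%i. b i \<odot> ?p i) (insert s ({..<Suc n} - {s})) = b s \<odot> ?p s \<oplus> ?r"
  using bp by (intro L.finsum_insert) auto
 hence "b s \<odot> ?p s \<oplus> ?r = \<zero>" using rel sn by (simp add: insert_absorb)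
 hence "b s \<odot> ?p s = \<ominus> ?r" using L.minus_equality[of "b s \<odot> ?p s" ?r] bp[of s] subsetD[OF Gf(1) r] by simp
 hence "inv\<^bsub>R\<^esub> b s \<odot> (b s \<odot> ?p s) : G (Suc s)" using Gf(4)[OF _ Gf(5)[OF r]] RR.Units_inv_closed[OF u] by simp
 moreover have "inv\<^bsub>R\<^esub> b s \<odot> (b s \<odot> ?p s) = ?p s"
  using M.smult_assoc[of "inv\<^bsub>R\<^esub> b s" "b s" "?p s"] RR.Units_l_inv[OF u] RR.Units_inv_closed[OF u] bc x by simp
 ultimately have "?p s : G (Suc s)" by metis
 then obtain n h where h: "?p s = n \<oplus> ?p (Suc s) \<otimes> h" "n : F 1" "h \<in>[L]" unfolding G_def by blast
 have "?p s \<ominus> ?p (Suc s) \<otimes> h = n" unfolding h(1) using F_closed[OF h(2)] p[of "Suc s"] h(3) by algebra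
 with h(2) have "?p s \<ominus> ?p (Suc s) \<otimes> h : F 1" by (simp only:)
 thus ?thesis by (rule that[OF h(3)])
qed

text \<open>
 With \<open>x\<^sup>s \<equiv> x\<^sup>s\<^sup>+\<^sup>1 h\<close>, the power \<open>(x h)\<^sup>s\<^sup>+\<^sup>1\<close> is an idempotent modulo \<open>\<mm>L\<close>. If it lifts to \<open>1\<close>, then \<open>x\<close> is a unit; if it
 lifts to \<open>0\<close>, then \<open>x\<close> is nilpotent modulo \<open>\<mm>L\<close>, and \<open>1 - x\<close> is a unit.
\<close>

theorem unit_or_one_minus_unit_comm:
 assumes idem: "!!e. [|e \<in>[L]; e \<otimes> e = e|] ==> e = \<zero> \<or> e = \<one>"
  and x: "x \<in>[L]"
 shows "x : Units L \<or> \<one> \<ominus> x : Units L"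
proof -
 obtain s :: nat and h where h: "h \<in>[L]" "x [^] s \<ominus> x [^] Suc s \<otimes> h : F 1" using stable_power[OF x] .
 define p y t where "p = x [^] s" and "y = x \<otimes> h" and "t = Suc s"
 have c: "p \<in>[L]" "y \<in>[L]" "y [^] (k::nat) \<in>[L]" for k using x h(1) by (auto simp: p_def y_def)
 have one: "p \<otimes> (\<one> \<ominus> y) : F 1"
 proof -
  have "p \<otimes> (\<one> \<ominus> y) = x [^] s \<ominus> x [^] Suc s \<otimes> h" unfolding L.nat_pow_Suc y_def p_def[symmetric]
   using c(1) x h(1) by algebra
  thus ?thesis using h(2) by simp
 qed
 have py: "p \<otimes> (\<one> \<ominus> y [^] k) : F 1" for k :: nat
 proof (induct k)
  case 0
  thus ?case using c(1) F_facts(2) by (simp add: L.minus_eq L.r_neg)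
 next
  case (Suc k)
  have "p \<otimes> (\<one> \<ominus> y [^] Suc k) = p \<otimes> (\<one> \<ominus> y [^] k) \<oplus> y [^] k \<otimes> (p \<otimes> (\<one> \<ominus> y))"
   unfolding L.nat_pow_Suc using c(1,2) c(3)[of k] by algebra
  thus ?case using F_facts(3)[OF Suc F_ideal[OF c(3) one]] by simp
 qed
 define e0 where "e0 = y [^] t"
 have yt: "e0 = (x \<otimes> h [^] t) \<otimes> p" "e0 = x \<otimes> (h \<otimes> y [^] s)"
  unfolding e0_def t_def p_def L.nat_pow_Suc
  unfolding y_def nat_pow_distrib[OF x h(1)] using x h(1) L.nat_pow_closed[OF x, of s] L.nat_pow_closed[OF h(1), of s]
  by algebra+
 have ec: "e0 \<in>[L]" using c(3) by (simp add: e0_def)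
 have a: "(\<ominus> (x \<otimes> h [^] t)) \<otimes> (p \<otimes> (\<one> \<ominus> e0)) : F 1"
  using F_ideal[OF _ py[of t]] x h(1) by (simp add: e0_def)
 have "e0 \<otimes> e0 \<ominus> e0 = (\<ominus> (x \<otimes> h [^] t \<otimes> p)) \<otimes> (\<one> \<ominus> e0)"
  unfolding yt(1)[symmetric] using ec by algebra
 also have "... = (\<ominus> (x \<otimes> h [^] t)) \<otimes> (p \<otimes> (\<one> \<ominus> e0))"
  using ec c(1) x L.nat_pow_closed[OF h(1), of t] by algebra
 finally have "e0 \<otimes> e0 \<ominus> e0 : F 1" using a by simp
 then obtain e where e: "e \<in>[L]" "e \<otimes> e = e" "e \<ominus> e0 : F 1" using idempotent_lift[OF ec] by metis
 from idem[OF e(1,2)] show ?thesis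
 proof
  assume "e = \<one>"
  hence u: "\<one> \<ominus> (\<one> \<ominus> e0) : Units L" using e(3) by (intro one_minus_unit) simp
  have "\<one> \<ominus> (\<one> \<ominus> e0) = x \<otimes> (h \<otimes> y [^] s)" unfolding yt(2)[symmetric] using ec by algebra
  thus ?thesis using unit_factor[of x "h \<otimes> y [^] s"] u x h(1) c(3) by simp
 next
  assume "e = \<zero>"
  hence "\<ominus> (\<zero> \<ominus> e0) : F 1" using e(3) F_facts(5) by blast
  hence eF: "e0 : F 1" using ec by (simp add: L.minus_eq)
  have "p = p \<otimes> (\<one> \<ominus> e0) \<oplus> p \<otimes> e0" using c(1) ec by algebra
  hence "p : F 1" using F_facts(3)[OF py[of t] F_ideal[OF c(1) eF]] by (simp add: e0_def)
  hence u: "\<one> \<ominus> p : Units L" by (rule one_minus_unit)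
  have "\<exists>g\<in>carrier L. \<one> \<ominus> x [^] k = (\<one> \<ominus> x) \<otimes> g" for k :: nat
  proof (induct k)
   case 0
   show ?case using x by (intro bexI[of _ "\<zero>"]) (auto simp: L.minus_eq L.r_neg)
  next
   case (Suc k)
   then obtain g where g: "g \<in>[L]" "\<one> \<ominus> x [^] k = (\<one> \<ominus> x) \<otimes> g" by blast
   have pk: "x [^] k \<in>[L]" using x by simp
   have "\<one> \<ominus> x [^] Suc k = (\<one> \<ominus> x [^] k) \<oplus> (\<one> \<ominus> x) \<otimes> x [^] k"
    unfolding L.nat_pow_Suc using pk x by algebra
   also have "... = (\<one> \<ominus> x) \<otimes> (g \<oplus> x [^] k)" unfolding g(2) using pk x g(1) by algebra
   finally show ?case using g(1) pk by (intro bexI[of _ "g \<oplus> x [^] k"]) simp_all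
  qed
  then obtain g where "g \<in>[L]" "\<one> \<ominus> p = (\<one> \<ominus> x) \<otimes> g" unfolding p_def by blast
  thus ?thesis using unit_factor[of "\<one> \<ominus> x" g] u x by simp
 qed
qed

end

text \<open>
 In general, the elements commuting with everything that commutes with \<open>x\<close> form a commutative
 subalgebra containing \<open>x\<close>, to which the commutative case applies.
\<close>

theorem (in complete_algebra) unit_or_one_minus_unit:
 assumes idem: "!!e. [|e \<in>[L]; e *[L] e = e|] ==> e = 0[L] \<or> e = 1[L]"
  and x: "x \<in>[L]"
 shows "x : Units L \<or> 1[L] -[L] x : Units L"
proof -
 let ?B = "{z : carrier L. x *[L] z = z *[L] x}"
 define S where "S = {y : carrier L. \<forall>z\<in>?B. y *[L] z = z *[L] y}"
 have xS: "x : S" and Sc: "S <= carrier L" using x by (auto simp: S_def)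
 have SB: "S <= ?B" using x by (fastforce simp: S_def)
 hence comm: "y *[L] z = z *[L] y" if "y : S" "z : S" for y z using that by (auto simp: S_def)
 have oneS: "1[L] : S" by (auto simp: S_def)
 have mult: "y *[L] y' : S" if "y : S" "y' : S" for y y'
 proof -
  have "(y *[L] y') *[L] z = z *[L] (y *[L] y')" if z: "z : ?B" for z
  proof -
   have c: "y \<in>[L]" "y' \<in>[L]" "z \<in>[L]" using z Sc \<open>y : S\<close> \<open>y' : S\<close> by auto
   have "(y *[L] y') *[L] z = y *[L] (z *[L] y')"
    using c z \<open>y' : S\<close> by (simp add: L.m_assoc S_def)
   also have "... = (z *[L] y) *[L] y'" using c z \<open>y : S\<close> by (simp add: S_def flip: L.m_assoc)
   finally show ?thesis using c by (simp add: L.m_assoc)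
  qed
  thus ?thesis using that Sc by (auto simp: S_def)
 qed
 interpret M: left_module R L by (rule base_lmod)
 have S: "submodule S R L"
  by (rule M.submodule_intro) (auto simp: S_def L.l_distr L.r_distr smult_mult_left smult_mult_right)
 let ?S = "sub L S"
 note Sm = sub_lmod[OF base_lmod S]
 have ring: "cring ?S"
  by (intro cringI lmodD(15)[OF Sm] comm_monoidI)
   (use Sc mult oneS in "auto simp: L.m_assoc L.l_distr subset_iff intro: comm")
 have "fgm R ?S" using base_noeth[OF fg_over_base] S by (simp add: noeth_def)
 hence "module_finite_algebra R ?S"
  using ring Sc by (intro module_finite_algebra.intro module_finite_algebra_axioms.intro RR.cring_axioms)
   (auto simp: cring_def smult_mult_left smult_mult_right subset_iff)
 then interpret S: commutative_complete_algebra R ?S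
  by (intro commutative_complete_algebra.intro complete_algebra.intro noetherian_algebra.intro
    noetherian_algebra_axioms.intro complete_regular_local_ring_axioms noetherian_base ring)
 have "x : Units ?S \<or> 1[?S] -[?S] x : Units ?S"
  by (rule S.unit_or_one_minus_unit_comm) (use idem xS Sc in auto)
 moreover have "Units ?S <= Units L" using Sc by (auto simp: Units_def)
 moreover have "1[?S] -[?S] x = 1[L] -[L] x"
  using lin_diff[OF Sm base_lmod lin_incl[OF Sc], of "1[L]" x] oneS xS by simp
 ultimately show ?thesis by auto
qed

section \<open>Local endomorphism rings\<close>

lemma iso_cong:
 assumes "lmod A X" "iso A X Y f" "!!x. x \<in>[X] ==> f x = g x" shows "iso A X Y g"
 using assms lin_cong[of A X Y f g] bij_betw_cong[of "carrier X" f g] unfolding iso_def by metis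

lemma ring_cong:
 assumes "ring A" "carrier B = carrier A" "monoid.mult B = monoid.mult A" "one B = one A" "zero B = zero A" "add B = add A"
 shows "ring B"
proof -
 interpret ring A by fact
 show ?thesis
  by (intro ringI abelian_groupI monoidI)
   (auto simp: assms(2-6) a_ac m_assoc l_distr r_distr intro: bexI[of _ "-[A] x" for x] l_neg)
qed

lemma fg_cong:
 assumes "fgm A X" "carrier Y = carrier X" "zero Y = zero X" "add Y = add X" "smult Y = smult X"
 shows "fgm A Y"
proof -
 have X: "lmod A X" by (rule fg_lmod[OF assms(1)])
 interpret X: left_module A X by fact
 have Y: "lmod A Y"
  by (rule left_module_intro) (auto simp: assms(2-5) X.A.ring_axioms X.a_ac X.smult_l_distr X.smult_r_distr X.smult_assoc)
 show ?thesis by (rule fg_surj[OF assms(1) Y, of "%x. x"]) (auto simp: lin_def assms(2-5))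
qed

lemma fg_summand:
 assumes "fgm A X" "lmod A Y" "lmod A Z" "mod_iso A X (dirsum Y Z)"
 shows "fgm A Y" "fgm A Z"
proof -
 have "fgm A (dirsum Y Z)" by (rule fg_iso[OF assms(1) dsum_lmod[OF assms(2,3)] assms(4)])
 moreover have "fst ` carrier (dirsum Y Z) = carrier Y" "snd ` carrier (dirsum Y Z) = carrier Z"
  using lmodD(2)[OF assms(2)] lmodD(2)[OF assms(3)] by (auto intro: rev_image_eqI)
 ultimately show "fgm A Y" "fgm A Z"
  using fg_surj[OF _ assms(2) lin_fst] fg_surj[OF _ assms(3) lin_snd] by blast+
qed

lemma is_zero_iso:
 assumes "mod_iso A X Y" "lmod A X" "lmod A Y"
 shows "is_zero_module X \<longleftrightarrow> is_zero_module Y"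
proof -
 obtain f where f: "iso A X Y f" using mod_isoE[OF assms(1,2)] .
 have z: "f 0[X] = 0[Y]" by (rule lin_zero[OF assms(2,3) isoD(1)[OF f]])
 show ?thesis unfolding is_zero_module_def
 proof
  assume "carrier X = {0[X]}"
  thus "carrier Y = {0[Y]}" using isoD(3)[OF f] z by auto
 next
  assume y: "carrier Y = {0[Y]}"
  have "x : {0[X]}" if "x \<in>[X]" for x
   using inj_onD[OF isoD(2)[OF f], of x "0[X]"] lin_cl[OF isoD(1)[OF f] that] y z that lmodD(2)[OF assms(2)] by simp
  thus "carrier X = {0[X]}" using lmodD(2)[OF assms(2)] by blast
 qed
qed

lemma is_zero_direct_sum:
 assumes "lmod A X" "lmod A Y"
 shows "is_zero_module (dirsum X Y) \<longleftrightarrow> is_zero_module X & is_zero_module Y"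
 using lmodD(2)[OF assms(1)] lmodD(2)[OF assms(2)] by (auto simp: is_zero_module_def)

lemma mod_iso_zero_sum:
 assumes X: "lmod A X" and Y: "lmod A Y" and z: "is_zero_module X"
 shows "mod_iso A (dirsum X Y) Y"
proof -
 interpret Y: left_module A Y by fact
 have "iso A (dirsum X Y) Y snd"
  by (rule isoI[OF lin_snd lin_inr[OF X]]) (use z in "auto simp: is_zero_module_def")
 thus ?thesis by (rule mod_isoI[OF dsum_lmod[OF X Y]])
qed

context complete_algebra
begin

definition end_alg :: "('l, 'x) module => ('r, 'x => 'x) module" where
 "end_alg X = \<lparr>carrier = mod_hom L X X, monoid.mult = (%f g. compose (carrier X) f g),
   one = (\<lambda>x\<in>carrier X. x), zero = zero_map X X, add = (%f g. \<lambda>x\<in>carrier X. f x +[X] g x),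
   smult = (%r f. \<lambda>x\<in>carrier X. scal r .[X] f x)\<rparr>"

lemma end_alg_simps [simp]:
 "carrier (end_alg X) = mod_hom L X X" "f *[end_alg X] g = compose (carrier X) f g"
 "1[end_alg X] = (\<lambda>x\<in>carrier X. x)" "0[end_alg X] = zero_map X X"
 "f +[end_alg X] g = (\<lambda>x\<in>carrier X. f x +[X] g x)"
 "r .[end_alg X] f = (\<lambda>x\<in>carrier X. scal r .[X] f x)"
 by (auto simp: end_alg_def)

lemma end_alg_complete:
 assumes X: "fgm L X" shows "complete_algebra R (end_alg X)"
proof -
 have Xm: "lmod L X" by (rule fg_lmod[OF X])
 interpret X: left_module L X by fact
 note c = mod_hom_closed[of _ L X X]
 have r: "ring (end_alg X)"
  by (rule ring_cong[OF End_ring_ring[OF Xm]]) (auto simp: end_alg_def End_ring_def)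
 have f: "fgm R (end_alg X)"
  by (rule fg_cong[OF noeth_fg[OF hom_mod_noeth[OF X X]]]) (auto simp: end_alg_def hom_mod_def)
 have s: "(\<lambda>x\<in>carrier X. scal r .[X] f (g x)) = (\<lambda>x\<in>carrier X. f (if x \<in>[X] then scal r .[X] g x else undefined))"
  if "r \<in>[R]" "f : mod_hom L X X" "g : mod_hom L X X" for r f g
  by (rule restrict_ext) (use that c[OF that(3)] lin_smult[OF mod_hom_lin[OF that(2)]] in auto)
 have "module_finite_algebra R (end_alg X)"
 proof (intro module_finite_algebra.intro module_finite_algebra_axioms.intro RR.cring_axioms r f)
  fix r f g assume "r \<in>[R]" "f \<in>[end_alg X]" "g \<in>[end_alg X]"
  hence fg: "r \<in>[R]" "f : mod_hom L X X" "g : mod_hom L X X" by auto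
  show "(r .[end_alg X] f) *[end_alg X] g = r .[end_alg X] (f *[end_alg X] g)"
   unfolding end_alg_simps compose_def by (rule restrict_ext) (use c[OF fg(3)] in auto)
  show "f *[end_alg X] (r .[end_alg X] g) = r .[end_alg X] (f *[end_alg X] g)"
   unfolding end_alg_simps compose_def
   by (rule restrict_ext) (use fg c[OF fg(3)] lin_smult[OF mod_hom_lin[OF fg(2)]] in auto)
 qed
 thus ?thesis
  by (intro complete_algebra.intro noetherian_algebra.intro noetherian_algebra_axioms.intro
    complete_regular_local_ring_axioms noetherian_base)
qed

lemma unit_end_alg_iso:
 assumes X: "lmod L X" and u: "f : Units (end_alg X)" shows "iso L X X f"
proof -
 obtain g where fg: "f : mod_hom L X X" "g : mod_hom L X X"
  and e: "compose (carrier X) g f = (\<lambda>x\<in>carrier X. x)" "compose (carrier X) f g = (\<lambda>x\<in>carrier X. x)"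
  using u by (auto simp: Units_def)
 have "g (f x) = x" "f (g x) = x" if "x \<in>[X]" for x
  using fun_cong[OF e(1), of x] fun_cong[OF e(2), of x] that by (auto simp: compose_def)
 thus ?thesis by (intro isoI[OF mod_hom_lin[OF fg(1)] mod_hom_lin[OF fg(2)]])
qed

text \<open>
 An idempotent endomorphism splits \<open>X\<close> into its image and its kernel, so an indecomposable \<open>X\<close> has only
 trivial ones.
\<close>

lemma indecomposable_local:
 assumes X: "fgm L X" and ind: "indecomposable L X" and f: "lin L X X f"
 shows "iso L X X f \<or> iso L X X (%x. x -[X] f x)"
proof -
 have Xm: "lmod L X" by (rule fg_lmod[OF X])
 interpret X: left_module L X by fact
 interpret E: complete_algebra R "end_alg X" by (rule end_alg_complete[OF X])
 have idem: "e = 0[end_alg X] \<or> e = 1[end_alg X]"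
  if "e \<in>[end_alg X]" "e *[end_alg X] e = e" for e
 proof -
  have e: "e : mod_hom L X X" "compose (carrier X) e e = e" using that by auto
  have el: "lin L X X e" by (rule mod_hom_lin[OF e(1)])
  have ee: "e (e x) = e x" if "x \<in>[X]" for x using fun_cong[OF e(2), of x] that by (simp add: compose_def)
  let ?I = "sub X (e ` carrier X)"
  have sI: "submodule (e ` carrier X) L X" by (rule image_submodule[OF Xm Xm el carrier_submodule[OF Xm]])
  have Im: "lmod L ?I" by (rule sub_lmod[OF Xm sI])
  have IX: "e ` carrier X <= carrier X" using lin_cl[OF el] by auto
  have eI: "lin L X ?I e" using el by (simp add: lin_into_sub[OF IX])
  have iso: "mod_iso L X (dirsum ?I (sub X (ker X ?I e)))"
   by (rule split_iso[OF Im Xm lin_incl[OF IX] eI]) (use ee in auto)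
  have sK: "submodule (ker X ?I e) L X" by (rule ker_submodule[OF Xm Im eI])
  have "fgm L ?I" "fgm L (sub X (ker X ?I e))"
   using noeth_algebra[OF X] sI sK by (auto simp: noeth_def)
  hence "is_zero_module ?I \<or> is_zero_module (sub X (ker X ?I e))"
   using ind iso by (auto simp: indecomposable_def fg_modules_def)
  thus ?thesis
  proof
   assume "is_zero_module ?I"
   hence I0: "e ` carrier X = {0[X]}" by (simp add: is_zero_module_def)
   have ex: "e x = 0[X]" if "x \<in>[X]" for x using imageI[OF that, of e] unfolding I0 by simp
   have z: "zero_map X X : mod_hom L X X" using E.L.zero_closed by simp
   have "e = zero_map X X" by (rule mod_hom_eqI[OF e(1) z]) (simp add: ex zero_map_def)
   thus ?thesis by simp
  next
   assume "is_zero_module (sub X (ker X ?I e))"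
   hence k: "ker X X e = {0[X]}" by (simp add: is_zero_module_def ker_def)
   have ex: "e x = x" if "x \<in>[X]" for x
    using inj_onD[OF iffD2[OF inj_on_iff_ker[OF Xm Xm el] k], of "e x" x] ee[OF that] that lin_cl[OF el that] by simp
   have z: "(\<lambda>x\<in>carrier X. x) : mod_hom L X X" using E.L.one_closed by simp
   have "e = (\<lambda>x\<in>carrier X. x)" by (rule mod_hom_eqI[OF e(1) z]) (simp add: ex)
   thus ?thesis by simp
  qed
 qed
 let ?f = "restrict f (carrier X)"
 have fm: "?f \<in>[end_alg X]" using lin_mod_hom[OF Xm f] by simp
 note g = iso_cong[OF Xm]
 from E.unit_or_one_minus_unit[OF idem fm] show ?thesis
 proof
  assume "?f : Units (end_alg X)"
  from unit_end_alg_iso[OF Xm this] have "iso L X X f" by (rule g) simp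
  thus ?thesis ..
 next
  assume u: "1[end_alg X] -[end_alg X] ?f : Units (end_alg X)"
  define h where "h = 1[end_alg X] -[end_alg X] ?f"
  note u = u[folded h_def]
  have hm: "h : mod_hom L X X" using E.L.Units_closed[OF u] by simp
  have "h +[end_alg X] ?f = 1[end_alg X]"
   unfolding h_def using fm E.L.one_closed by (simp only: E.L.minus_eq E.L.a_assoc E.L.a_inv_closed E.L.l_neg E.L.r_zero)
  hence e: "(h +[end_alg X] ?f) x = (1[end_alg X]) x" for x by (rule fun_cong)
  have hx: "h x +[X] f x = x" if "x \<in>[X]" for x using e[of x] that by simp
  have "h x = x -[X] f x" if "x \<in>[X]" for x
  proof -
   have "h x \<in>[X]" "f x \<in>[X]" using mod_hom_closed[OF hm that] lin_cl[OF f that] by auto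
   hence "h x = (h x +[X] f x) -[X] f x" by (simp add: X.minus_eq X.a_assoc X.r_neg)
   thus ?thesis using hx[OF that] by simp
  qed
  with unit_end_alg_iso[OF Xm u] have "iso L X X (%x. x -[X] f x)" by (rule g)
  thus ?thesis ..
 qed
qed

end

section \<open>The Krull-Schmidt theorem\<close>

text \<open>
 If \<open>p: C \<oplus> D \<rightarrow> Z\<close> restricts to a split epimorphism on \<open>C\<close>, then a complement of \<open>Z\<close> in \<open>C \<oplus> D\<close>
 is \<open>ker (p|C) \<oplus> D\<close>.
\<close>

lemma exchange_half:
 fixes C :: "('a, 'c) module"
 assumes Z: "lmod A Z" and C: "lmod A C" and D: "lmod A D"
  and p: "lin A (dirsum C D) Z p" and s: "lin A Z C s" and i: "iso A Z Z (%z. p (s z, 0[D]))"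
 obtains C' :: "('a, 'c) module" where "lmod A C'" "mod_iso A C (dirsum Z C')"
  "mod_iso A (sub (dirsum C D) (ker (dirsum C D) Z p)) (dirsum C' D)"
proof -
 interpret Z: left_module A Z by fact
 interpret C: left_module A C by fact
 interpret D: left_module A D by fact
 note CD = dsum_lmod[OF C D]
 define p1 where "p1 c = p (c, 0[D])" for c
 define p2 where "p2 d = p (0[C], d)" for d
 have p1: "lin A C Z p1" unfolding p1_def by (rule lin_comp[OF lin_inl[OF D] p])
 have p2: "lin A D Z p2" unfolding p2_def by (rule lin_comp[OF lin_inr[OF C] p])
 have pe: "p (c, d) = p1 c +[Z] p2 d" if "c \<in>[C]" "d \<in>[D]" for c d
  using lin_add[OF p, of "(c, 0[D])" "(0[C], d)"] that by (simp add: p1_def p2_def)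
 obtain q where q: "iso A Z Z q" "!!z. z \<in>[Z] ==> q (p1 (s z)) = z" "!!z. z \<in>[Z] ==> p1 (s (q z)) = z"
  using iso_inverse[OF Z Z i] unfolding p1_def by metis
 define \<sigma> where "\<sigma> z = s (q z)" for z
 have sg: "lin A Z C \<sigma>" unfolding \<sigma>_def by (rule lin_comp[OF isoD(1)[OF q(1)] s])
 have ps: "p1 (\<sigma> z) = z" if "z \<in>[Z]" for z using q(3)[OF that] by (simp add: \<sigma>_def)
 let ?C' = "sub C (ker C Z p1)"
 have C': "lmod A ?C'" by (rule sub_lmod[OF C ker_submodule[OF C Z p1]])
 have kC: "ker C Z p1 <= carrier C" by (auto simp: ker_def)
 let ?K = "ker (dirsum C D) Z p"
 have K: "lmod A (sub (dirsum C D) ?K)"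
  by (rule sub_lmod[OF CD ker_submodule[OF CD Z p]])
 have kCD: "?K <= carrier (dirsum C D)" by (auto simp: ker_def)
 have cl: "p2 d \<in>[Z]" "\<sigma> (p2 d) \<in>[C]" if "d \<in>[D]" for d
  using lin_cl[OF p2 that] lin_cl[OF sg] by auto
 let ?f = "%x. (fst x +[C] \<sigma> (p2 (snd x)), snd x)"
 let ?g = "%x. (fst x -[C] \<sigma> (p2 (snd x)), snd x)"
 have f0: "lin A (dirsum C D) C (%x. fst x +[C] \<sigma> (p2 (snd x)))"
  by (intro lin_plus[OF C] lin_fst lin_snd'[OF lin_comp[OF p2 sg]])
 have f1: "fst x +[C] \<sigma> (p2 (snd x)) : ker C Z p1" if xK: "x : ?K" for x
 proof -
  obtain c d where x: "x = (c, d)" "c \<in>[C]" "d \<in>[D]" "p (c, d) = 0[Z]"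
   using xK by (cases x) (auto simp: ker_def)
  thus ?thesis using cl[OF x(3)] pe[OF x(2,3)] ps by (simp add: ker_def lin_add[OF p1])
 qed
 have f: "lin A (sub (dirsum C D) ?K) (dirsum ?C' D) ?f"
 proof (rule lin_pair)
  show "lin A (sub (dirsum C D) ?K) ?C' (%x. fst x +[C] \<sigma> (p2 (snd x)))"
   unfolding lin_into_sub[OF kC] using lin_from_sub[OF f0 kCD] f1 by auto
  show "lin A (sub (dirsum C D) ?K) D snd" by (rule lin_from_sub[OF lin_snd kCD])
 qed
 have g: "lin A (dirsum ?C' D) (sub (dirsum C D) ?K) ?g"
  unfolding lin_into_sub[OF kCD]
 proof
  show "lin A (dirsum ?C' D) (dirsum C D) ?g"
   by (intro lin_pair lin_subtract[OF C] lin_fst'[OF lin_incl[OF kC]] lin_snd lin_snd'[OF lin_comp[OF p2 sg]])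
  show "?g ` carrier (dirsum ?C' D) <= ?K"
  proof
   fix y assume "y : ?g ` carrier (dirsum ?C' D)"
   then obtain c d where y: "y = (c -[C] \<sigma> (p2 d), d)" "c \<in>[C]" "p1 c = 0[Z]" "d \<in>[D]"
    by (auto simp: ker_def)
   have "p y = 0[Z]" using y cl[OF y(4)]
    by (simp add: pe lin_diff[OF C Z p1] ps Z.minus_eq Z.l_neg)
   thus "y : ?K" using y cl[OF y(4)] by (simp add: ker_def)
  qed
 qed
 have "iso A (sub (dirsum C D) ?K) (dirsum ?C' D) ?f"
 proof (rule isoI[OF f g])
  fix x assume "x \<in>[sub (dirsum C D) ?K]"
  hence x: "fst x \<in>[C]" "snd x \<in>[D]" by (auto simp: ker_def)
  have "(fst x +[C] \<sigma> (p2 (snd x))) -[C] \<sigma> (p2 (snd x)) = fst x"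
   using x(1) cl(2)[OF x(2)] by (simp add: C.minus_eq C.a_assoc C.r_neg)
  thus "?g (?f x) = x" by simp
 next
  fix y assume "y \<in>[dirsum ?C' D]"
  hence x: "fst y \<in>[C]" "snd y \<in>[D]" by (auto simp: ker_def)
  have "(fst y -[C] \<sigma> (p2 (snd y))) +[C] \<sigma> (p2 (snd y)) = fst y"
   using x(1) cl(2)[OF x(2)] by (simp add: C.minus_eq C.a_assoc C.l_neg)
  thus "?f (?g y) = y" by simp
 qed
 from mod_isoI[OF K this] split_iso[OF Z C sg p1 ps] C' show ?thesis by (intro that)
qed

text \<open>
 The two components \<open>Z \<rightarrow> C \<rightarrow> Z\<close> and \<open>Z \<rightarrow> D \<rightarrow> Z\<close> of the identity of \<open>Z\<close> sum to the identity, so one of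
 them is an isomorphism.
\<close>

lemma exchange:
 fixes C :: "('a, 'c) module" and D :: "('a, 'd) module"
 assumes Z: "lmod A Z" and B: "lmod A B" and C: "lmod A C" and D: "lmod A D"
  and loc: "!!f. lin A Z Z f ==> iso A Z Z f \<or> iso A Z Z (%x. x -[Z] f x)"
  and i: "mod_iso A (dirsum Z B) (dirsum C D)"
 shows "(\<exists>C' :: ('a, 'c) module. lmod A C' & mod_iso A C (dirsum Z C') & mod_iso A B (dirsum C' D)) \<or>
  (\<exists>D' :: ('a, 'd) module. lmod A D' & mod_iso A D (dirsum Z D') & mod_iso A B (dirsum D' C))"
proof -
 interpret Z: left_module A Z by fact
 interpret B: left_module A B by fact
 interpret C: left_module A C by fact
 interpret D: left_module A D by fact
 note ZB = dsum_lmod[OF Z B] and CD = dsum_lmod[OF C D] and DC = dsum_lmod[OF D C]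
 obtain \<psi> where psi: "iso A (dirsum Z B) (dirsum C D) \<psi>" using mod_isoE[OF i ZB] .
 obtain \<theta> where th: "iso A (dirsum C D) (dirsum Z B) \<theta>"
  "!!x. x \<in>[dirsum Z B] ==> \<theta> (\<psi> x) = x" "!!x. x \<in>[dirsum C D] ==> \<psi> (\<theta> x) = x"
  using iso_inverse[OF ZB CD psi] by metis
 define p where "p x = fst (\<theta> x)" for x
 have p: "lin A (dirsum C D) Z p" unfolding p_def by (rule lin_comp[OF isoD(1)[OF th(1)] lin_fst])
 define s where "s z = \<psi> (z, 0[B])" for z
 have s: "lin A Z (dirsum C D) s" unfolding s_def by (rule lin_comp[OF lin_inl[OF B] isoD(1)[OF psi]])
 have ps: "p (s z) = z" if "z \<in>[Z]" for z unfolding p_def s_def using th(2)[of "(z, 0[B])"] that by simp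
 have s1: "lin A Z C (%z. fst (s z))" and s2: "lin A Z D (%z. snd (s z))"
  by (rule lin_comp[OF s lin_fst], rule lin_comp[OF s lin_snd])
 \<comment> \<open>the complement \<open>B\<close> is the kernel of \<open>p\<close>\<close>
 let ?K = "ker (dirsum C D) Z p"
 have kCD: "?K <= carrier (dirsum C D)" by (auto simp: ker_def)
 have BK: "mod_iso A B (sub (dirsum C D) ?K)"
 proof -
  have l: "lin A B (dirsum C D) (%b. \<psi> (0[Z], b))" by (rule lin_comp[OF lin_inr[OF Z] isoD(1)[OF psi]])
  have "iso A B (sub (dirsum C D) ?K) (%b. \<psi> (0[Z], b))"
  proof (rule isoI[of _ _ _ _ "%x. snd (\<theta> x)"])
   show "lin A B (sub (dirsum C D) ?K) (%b. \<psi> (0[Z], b))"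
    unfolding lin_into_sub[OF kCD]
   proof (intro conjI l image_subsetI)
    fix b assume b: "b \<in>[B]"
    thus "\<psi> (0[Z], b) : ?K"
     using lin_cl[OF l b] th(2)[of "(0[Z], b)"] by (simp add: ker_def p_def)
   qed
   show "lin A (sub (dirsum C D) ?K) B (%x. snd (\<theta> x))"
    by (rule lin_from_sub[OF lin_comp[OF isoD(1)[OF th(1)] lin_snd] kCD])
   show "snd (\<theta> (\<psi> (0[Z], b))) = b" if "b \<in>[B]" for b using th(2)[of "(0[Z], b)"] that by simp
   show "\<psi> (0[Z], snd (\<theta> y)) = y" if "y \<in>[sub (dirsum C D) ?K]" for y
   proof -
    have y: "y \<in>[dirsum C D]" "fst (\<theta> y) = 0[Z]" using that by (auto simp: ker_def p_def)
    have "(0[Z], snd (\<theta> y)) = \<theta> y" using y(2) by (metis prod.collapse)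
    thus ?thesis using th(3)[OF y(1)] by simp
   qed
  qed
  thus ?thesis by (rule mod_isoI[OF B])
 qed
 let ?\<phi> = "%z. p (fst (s z), 0[D])"
 have phi: "lin A Z Z ?\<phi>" by (rule lin_comp[OF s1 lin_comp[OF lin_inl[OF D] p]])
 have phi2: "z -[Z] ?\<phi> z = p (0[C], snd (s z))" if z: "z \<in>[Z]" for z
 proof -
  have c: "fst (s z) \<in>[C]" "snd (s z) \<in>[D]" using lin_cl[OF s1 z] lin_cl[OF s2 z] by auto
  have pc: "p (fst (s z), 0[D]) \<in>[Z]" "p (0[C], snd (s z)) \<in>[Z]" using c by (auto intro: lin_cl[OF p])
  have "p (s z) = p (fst (s z), 0[D]) +[Z] p (0[C], snd (s z))"
   using lin_add[OF p, of "(fst (s z), 0[D])" "(0[C], snd (s z))"] c by simp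
  hence "z = p (fst (s z), 0[D]) +[Z] p (0[C], snd (s z))" using ps[OF z] by simp
  hence "z -[Z] ?\<phi> z = (p (fst (s z), 0[D]) +[Z] p (0[C], snd (s z))) -[Z] ?\<phi> z" by metis
  also have "... = p (0[C], snd (s z))" using pc by (simp add: Z.minus_eq Z.a_ac Z.r_neg2 Z.r_neg)
  finally show ?thesis .
 qed
 have Km: "lmod A (sub (dirsum C D) ?K)" by (rule sub_lmod[OF CD ker_submodule[OF CD Z p]])
 from loc[OF phi] show ?thesis
 proof
  assume "iso A Z Z ?\<phi>"
  then obtain C' :: "('a, 'c) module" where C': "lmod A C'" "mod_iso A C (dirsum Z C')"
   "mod_iso A (sub (dirsum C D) ?K) (dirsum C' D)"
   using exchange_half[OF Z C D p s1] by metis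
  thus ?thesis using mod_iso_trans[OF B Km BK C'(3)] by blast
 next
  assume i2: "iso A Z Z (%z. z -[Z] ?\<phi> z)"
  let ?p = "%x. p (snd x, fst x)"
  have pl: "lin A (dirsum D C) Z ?p" by (rule lin_comp[OF lin_pair[OF lin_snd lin_fst] p])
  have "iso A Z Z (%z. p (0[C], snd (s z)))"
   by (rule iso_cong[OF Z i2 phi2])
  then obtain D' :: "('a, 'd) module" where D': "lmod A D'" "mod_iso A D (dirsum Z D')"
   "mod_iso A (sub (dirsum D C) (ker (dirsum D C) Z ?p)) (dirsum D' C)"
   using exchange_half[OF Z D C pl s2] by auto
  have kDC: "ker (dirsum D C) Z ?p <= carrier (dirsum D C)" by (auto simp: ker_def)
  have sw: "iso A (sub (dirsum C D) ?K) (sub (dirsum D C) (ker (dirsum D C) Z ?p)) (%x. (snd x, fst x))"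
   by (rule isoI[of _ _ _ _ "%x. (snd x, fst x)"]) (auto simp: lin_def ker_def)
  have K2: "lmod A (sub (dirsum D C) (ker (dirsum D C) Z ?p))"
   by (rule sub_lmod[OF DC ker_submodule[OF DC Z pl]])
  have "mod_iso A B (dirsum D' C)"
   by (rule mod_iso_trans[OF B K2 mod_iso_trans[OF B Km BK mod_isoI[OF Km sw]] D'(3)])
  thus ?thesis using D'(1,2) by blast
 qed
qed

definition iso_class :: "('a, 'c) ring_scheme => 'a umod => 'a umod set" where
 "iso_class A X = {Y : fg_modules A. mod_iso A X Y}"

lemma iso_class_eq_iff:
 assumes "fgm A X" "fgm A Y" shows "iso_class A X = iso_class A Y \<longleftrightarrow> mod_iso A X Y"
proof -
 note XY = assms[THEN fg_lmod]
 show ?thesis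
 proof
  assume "iso_class A X = iso_class A Y"
  moreover have "Y : iso_class A Y" using assms mod_iso_refl[OF XY(2)] by (simp add: iso_class_def fg_modules_def)
  ultimately have "Y : iso_class A X" by simp
  thus "mod_iso A X Y" by (simp add: iso_class_def)
 next
  assume i: "mod_iso A X Y"
  have "mod_iso A X W \<longleftrightarrow> mod_iso A Y W" if "W : fg_modules A" for W
   using mod_iso_trans[OF XY i, of W] mod_iso_trans[OF XY(2,1) mod_iso_sym[OF XY i], of W] by blast
  thus "iso_class A X = iso_class A Y" by (auto simp: iso_class_def)
 qed
qed

lemma subcategory_summand:
 assumes C: "subcategory A C" and X: "X : C" and "fgm A Y" "fgm A W" "mod_iso A X (dirsum Y W)"
 shows "Y : C" "W : C"
proof -
 have "\<forall>X\<in>fg_modules A. \<forall>Y\<in>fg_modules A. \<forall>Z\<in>fg_modules A.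
   mod_iso A Z (dirsum X Y) \<longrightarrow> (X : C & Y : C \<longleftrightarrow> Z : C)"
  using C unfolding subcategory_def by (elim conjE)
 moreover have "C <= fg_modules A" using C unfolding subcategory_def by (elim conjE)
 hence "X : fg_modules A" using X by (rule subsetD)
 moreover have "Y : fg_modules A" "W : fg_modules A" using assms(3,4) by (auto simp: fg_modules_def)
 ultimately have "Y : C & W : C" using assms(5) X by metis
 thus "Y : C" "W : C" by auto
qed

inductive decomp :: "('a, 'c) ring_scheme => 'a umod => 'a umod set multiset => bool" for A where
 decomp_zero: "[|fgm A X; is_zero_module X|] ==> decomp A X {#}"
| decomp_add: "[|fgm A X; fgm A Y; indecomposable A Y; decomp A X' M; fgm A X';
   mod_iso A X (dirsum Y X')|] ==> decomp A X (add_mset (iso_class A Y) M)"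

lemma decomp_fg: "decomp A X M ==> fgm A X"
 by (erule decomp.cases) auto

lemma decomp_iso:
 assumes "decomp A X M" "fgm A X'" "mod_iso A X' X" shows "decomp A X' M"
 using assms
proof (cases rule: decomp.cases)
 case decomp_zero
 thus ?thesis using assms(2,3) is_zero_iso[OF assms(3)] fg_lmod decomp.decomp_zero by metis
next
 case (decomp_add Y X'' M')
 have "mod_iso A X' (dirsum Y X'')"
  by (rule mod_iso_trans[OF fg_lmod[OF assms(2)] fg_lmod[OF decomp_add(2)] assms(3) decomp_add(7)])
 thus ?thesis unfolding decomp_add(1) by (rule decomp.decomp_add[OF assms(2) decomp_add(3-6)])
qed

lemma decomp_sum:
 assumes "decomp A X M" "decomp A Y N" "fgm A Z" "mod_iso A Z (dirsum X Y)"
 shows "decomp A Z (M + N)"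
 using assms
proof (induct arbitrary: Z rule: decomp.induct)
 case (decomp_zero X)
 note l = fg_lmod[OF decomp_zero(1)] fg_lmod[OF decomp_fg[OF decomp_zero(3)]] fg_lmod[OF decomp_zero(4)]
 have "mod_iso A Z Y"
  by (rule mod_iso_trans[OF l(3) dsum_lmod[OF l(1,2)] decomp_zero(5) mod_iso_zero_sum[OF l(1,2) decomp_zero(2)]])
 thus ?case using decomp_iso[OF decomp_zero(3,4)] by simp
next
 case (decomp_add X U X' M)
 have Y: "fgm A Y" by (rule decomp_fg[OF decomp_add(8)])
 obtain W :: "'a umod" and f where W: "fgm A W" "iso A (dirsum X' Y) W f"
  using universe_copy[OF fg_direct_sum[OF decomp_add(6) Y]] .
 note l = fg_lmod[OF decomp_add(1)] fg_lmod[OF decomp_add(2)] fg_lmod[OF decomp_add(6)]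
  fg_lmod[OF Y] fg_lmod[OF W(1)] fg_lmod[OF decomp_add(9)]
 have i: "mod_iso A (dirsum X' Y) W" by (rule mod_isoI[OF dsum_lmod[OF l(3,4)] W(2)])
 have "decomp A W (M + N)"
  by (rule decomp_add(5)[OF decomp_add(8) W(1) mod_iso_sym[OF dsum_lmod[OF l(3,4)] l(5) i]])
 moreover have "mod_iso A Z (dirsum U W)"
 proof -
  note d = dsum_lmod
  have 1: "mod_iso A (dirsum X Y) (dirsum (dirsum U X') Y)"
   by (rule mod_iso_direct_sum[OF l(1,4) decomp_add(7) mod_iso_refl[OF l(4)]])
  have 2: "mod_iso A (dirsum (dirsum U X') Y) (dirsum U (dirsum X' Y))"
   by (rule mod_iso_direct_sum_assoc[OF l(2,3,4)])
  have 3: "mod_iso A (dirsum U (dirsum X' Y)) (dirsum U W)"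
   by (rule mod_iso_direct_sum[OF l(2) d[OF l(3,4)] mod_iso_refl[OF l(2)] i])
  show ?thesis
   by (rule mod_iso_trans[OF l(6) d[OF l(1,4)] decomp_add(10)
      mod_iso_trans[OF d[OF l(1,4)] d[OF d[OF l(2,3)] l(4)] 1
      mod_iso_trans[OF d[OF d[OF l(2,3)] l(4)] d[OF l(2) d[OF l(3,4)]] 2 3]]])
 qed
 ultimately show ?case using decomp.decomp_add[OF decomp_add(9,2,3) _ W(1)] by simp
qed

lemma zero_umodule:
 assumes "ring A" obtains Z0 :: "'a umod" where "fgm (A :: ('a, 'c) ring_scheme) Z0" "is_zero_module Z0"
proof -
 have F: "fgm A (free A ({} :: nat set))" by (rule fg_free[OF assms]) simp
 obtain Z0 :: "'a umod" and f where Z0: "fgm A Z0" "iso A (free A ({} :: nat set)) Z0 f" using universe_copy[OF F] .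
 have "is_zero_module (free A ({} :: nat set))" by (simp add: is_zero_module_def restrict_def)
 hence "is_zero_module Z0"
  using is_zero_iso[OF mod_isoI[OF fg_lmod[OF F] Z0(2)] fg_lmod[OF F] fg_lmod[OF Z0(1)]] by simp
 with Z0(1) show ?thesis using that by blast
qed

lemma decomp_indecomposable:
 assumes "fgm A Y" "indecomposable A Y" shows "decomp A Y {#iso_class A Y#}"
proof -
 have Y: "lmod A Y" by (rule fg_lmod[OF assms(1)])
 obtain Z0 :: "'a umod" where Z0: "fgm A Z0" "is_zero_module Z0"
  using zero_umodule[OF lmodD(14)[OF Y]] .
 have Zm: "lmod A Z0" by (rule fg_lmod[OF Z0(1)])
 have "mod_iso A Y (dirsum Y Z0)"
  by (rule mod_iso_sym[OF dsum_lmod[OF Y Zm] Y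
    mod_iso_trans[OF dsum_lmod[OF Y Zm] dsum_lmod[OF Zm Y]
     mod_iso_direct_sum_comm[OF Y Zm] mod_iso_zero_sum[OF Zm Y Z0(2)]]])
 from decomp_add[OF assms(1,1,2) decomp_zero[OF Z0] Z0(1) this] show ?thesis .
qed

text \<open>
 Existence of decompositions, by noetherian induction on the kernel of an epimorphism \<open>X \<rightarrow> Y\<close>.
\<close>

lemma decomp_exists:
 assumes X: "noeth A (X :: 'a umod)" shows "\<exists>M. decomp (A :: ('a, 'c) ring_scheme) X M"
proof -
 have Xm: "lmod A X" by (rule noeth_lmod[OF X])
 let ?r = "{(N', N). submodule N A X & submodule N' A X & N \<subset> N'}"
 have "\<exists>M. decomp A Y M" if "lin A X Y q" "q ` carrier X = carrier Y" "ker X Y q = N" "lmod A Y"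
  for N q and Y :: "'a umod"
  using noeth_wf[OF X] that
 proof (induct N arbitrary: Y q rule: wf_induct_rule)
  case (less N)
  have Y: "fgm A Y" by (rule fg_surj[OF noeth_fg[OF X] less(5,2,3)])
  show ?case
  proof (cases "is_zero_module Y \<or> indecomposable A Y")
   case True
   thus ?thesis using decomp_zero[OF Y] decomp_indecomposable[OF Y] by blast
  next
   case False
   then obtain Y1 Y2 :: "'a umod" where Y12: "fgm A Y1" "fgm A Y2" "mod_iso A Y (dirsum Y1 Y2)"
    "\<not> is_zero_module Y1" "\<not> is_zero_module Y2"
    by (auto simp: indecomposable_def fg_modules_def)
   note l = fg_lmod[OF Y12(1)] fg_lmod[OF Y12(2)]
   obtain f where f: "iso A Y (dirsum Y1 Y2) f" using mod_isoE[OF Y12(3) less(5)] .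
   note fl = isoD(1)[OF f]
   have kq: "submodule N A X" using ker_submodule[OF Xm less(5,2)] less(4) by simp
   have part: "\<exists>M. decomp A Y' M"
    if Y': "lmod A Y'" and g: "lin A (dirsum Y1 Y2) Y' g" "g ` carrier (dirsum Y1 Y2) = carrier Y'"
     and w: "w \<in>[dirsum Y1 Y2]" "w \<noteq> (0[Y1], 0[Y2])" "g w = 0[Y']" for Y' :: "'a umod" and g w
   proof -
    let ?h = "%x. g (f (q x))"
    have h: "lin A X Y' ?h" by (rule lin_comp[OF lin_comp[OF less(2) fl] g(1)])
    have "?h ` carrier X = g ` f ` q ` carrier X" by (simp add: image_image)
    hence hs: "?h ` carrier X = carrier Y'" by (simp only: less(3) isoD(3)[OF f] g(2))
    have sub: "N <= ker X Y' ?h"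
     unfolding less(4)[symmetric]
     using lin_zero[OF less(5) dsum_lmod[OF l] fl] lin_zero[OF dsum_lmod[OF l] Y' g(1)]
     by (auto simp: ker_def)
    have "w : f ` q ` carrier X" unfolding less(3) isoD(3)[OF f] by (rule w(1))
    then obtain x where x: "w = f (q x)" "x \<in>[X]" by (elim imageE) blast
    have "x : ker X Y' ?h" using x w(3) by (simp add: ker_def)
    moreover have "x \<notin> N"
    proof
     assume "x : N"
     hence "q x = 0[Y]" unfolding less(4)[symmetric] by (simp add: ker_def)
     thus False using x(1) w(2) lin_zero[OF less(5) dsum_lmod[OF l] fl] by simp
    qed
    ultimately have "N \<subset> ker X Y' ?h" using sub by blast
    hence "(ker X Y' ?h, N) : ?r" using kq ker_submodule[OF Xm Y' h] by simp
    from less(1)[OF this h hs refl Y'] show ?thesis .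
   qed
   obtain a b where ab: "a \<in>[Y1]" "a \<noteq> 0[Y1]" "b \<in>[Y2]" "b \<noteq> 0[Y2]"
    using Y12(4,5) lmodD(2)[OF l(1)] lmodD(2)[OF l(2)] unfolding is_zero_module_def by blast
   have "\<exists>M. decomp A Y1 M"
    by (rule part[OF l(1) lin_fst, of "(0[Y1], b)"])
     (use ab lmodD(2)[OF l(1)] lmodD(2)[OF l(2)] in "auto intro: rev_image_eqI")
   moreover have "\<exists>M. decomp A Y2 M"
    by (rule part[OF l(2) lin_snd, of "(a, 0[Y2])"])
     (use ab lmodD(2)[OF l(1)] lmodD(2)[OF l(2)] in "auto intro: rev_image_eqI")
   ultimately show ?thesis using decomp_sum[OF _ _ Y Y12(3)] by blast
  qed
 qed
 from this[OF lin_id _ refl Xm] show ?thesis by simp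
qed

lemma indecomposable_summand:
 assumes "indecomposable A Y" "fgm A Y" "lmod A Z" "lmod A C" "mod_iso A Y (dirsum Z C)"
  "\<not> is_zero_module Z"
 shows "is_zero_module (C :: 'a umod)" "mod_iso (A :: ('a, 'c) ring_scheme) Y (Z :: 'a umod)"
proof -
 note f = fg_summand[OF assms(2-5)]
 show z: "is_zero_module C" using assms(1,5,6) f by (auto simp: indecomposable_def fg_modules_def)
 note d = dsum_lmod[OF assms(3,4)] dsum_lmod[OF assms(4,3)]
 show "mod_iso A Y Z"
  by (rule mod_iso_trans[OF fg_lmod[OF assms(2)] d(1) assms(5)
    mod_iso_trans[OF d mod_iso_direct_sum_comm[OF assms(3,4)] mod_iso_zero_sum[OF assms(4,3) z]]])
qed

lemma decomp_select:
 assumes "decomp A X M" "c \<in># M"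
 shows "\<exists>Y W. fgm A Y & indecomposable A Y & c = iso_class A Y & fgm A W &
  mod_iso A X (dirsum Y W) & decomp A W (M - {#c#})"
 using assms
proof (induct rule: decomp.induct)
 case (decomp_add X U X' M)
 show ?case
 proof (cases "c = iso_class A U")
  case True thus ?thesis using decomp_add by auto
 next
  case False
  hence "c \<in># M" using decomp_add(8) by simp
  then obtain Y W where YW: "fgm A Y" "indecomposable A Y" "c = iso_class A Y" "fgm A W"
   "mod_iso A X' (dirsum Y W)" "decomp A W (M - {#c#})" using decomp_add(5) by blast
  obtain V :: "'a umod" and f where V: "fgm A V" "iso A (dirsum U W) V f"
   using universe_copy[OF fg_direct_sum[OF decomp_add(2) YW(4)]] .
  note l = fg_lmod[OF decomp_add(1)] fg_lmod[OF decomp_add(2)] fg_lmod[OF decomp_add(6)]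
   fg_lmod[OF YW(1)] fg_lmod[OF YW(4)] fg_lmod[OF V(1)]
  note d = dsum_lmod
  have UW: "mod_iso A (dirsum U W) V" by (rule mod_isoI[OF d[OF l(2,5)] V(2)])
  have "decomp A V (add_mset (iso_class A U) (M - {#c#}))"
   by (rule decomp.decomp_add[OF V(1) decomp_add(2,3) YW(6,4) mod_iso_sym[OF d[OF l(2,5)] l(6) UW]])
  moreover have "mod_iso A X (dirsum Y V)"
  proof -
   have 1: "mod_iso A (dirsum U X') (dirsum U (dirsum Y W))"
    by (rule mod_iso_direct_sum[OF l(2,3) mod_iso_refl[OF l(2)] YW(5)])
   have 2: "mod_iso A (dirsum U (dirsum Y W)) (dirsum (dirsum Y W) U)"
    by (rule mod_iso_direct_sum_comm[OF l(2) d[OF l(4,5)]])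
   have 3: "mod_iso A (dirsum (dirsum Y W) U) (dirsum Y (dirsum W U))"
    by (rule mod_iso_direct_sum_assoc[OF l(4,5,2)])
   have 4: "mod_iso A (dirsum Y (dirsum W U)) (dirsum Y V)"
    by (rule mod_iso_direct_sum[OF l(4) d[OF l(5,2)] mod_iso_refl[OF l(4)]
      mod_iso_trans[OF d[OF l(5,2)] d[OF l(2,5)] mod_iso_direct_sum_comm[OF l(5,2)] UW]])
   note t = mod_iso_trans
   show ?thesis
    by (rule t[OF l(1) d[OF l(2,3)] decomp_add(7) t[OF d[OF l(2,3)] d[OF l(2) d[OF l(4,5)]] 1
      t[OF d[OF l(2) d[OF l(4,5)]] d[OF d[OF l(4,5)] l(2)] 2
      t[OF d[OF d[OF l(4,5)] l(2)] d[OF l(4) d[OF l(5,2)]] 3 4]]]])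
  qed
  moreover have "add_mset (iso_class A U) M - {#c#} = add_mset (iso_class A U) (M - {#c#})"
   using \<open>c \<in># M\<close> by simp
  ultimately show ?thesis using YW(1-3) V(1) by metis
 qed
qed simp

lemma decomp_same_iso:
 assumes "decomp A X M" "decomp A Y M" shows "mod_iso A X Y"
 using assms
proof (induct arbitrary: Y rule: decomp.induct)
 case (decomp_zero X)
 from decomp_zero(3) have "is_zero_module Y" by (cases rule: decomp.cases) auto
 note l = fg_lmod[OF decomp_zero(1)] fg_lmod[OF decomp_fg[OF decomp_zero(3)]]
 have "iso A X Y (%x. 0[Y])"
  using lin_zero_map[OF l(2), of X] decomp_zero(2) \<open>is_zero_module Y\<close>
  by (auto simp: iso_def bij_betw_def is_zero_module_def)
 thus ?case by (rule mod_isoI[OF l(1)])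
next
 case (decomp_add X U X' M)
 have "iso_class A U \<in># add_mset (iso_class A U) M" by simp
 from decomp_select[OF decomp_add(8) this] obtain V W where V: "fgm A V" "indecomposable A V"
  "iso_class A U = iso_class A V" "fgm A W" "mod_iso A Y (dirsum V W)" "decomp A W M"
  by auto
 have "mod_iso A X' W" by (rule decomp_add(5)[OF V(6)])
 moreover have "mod_iso A U V" using iso_class_eq_iff[OF decomp_add(2) V(1)] V(3) by simp
 note l = fg_lmod[OF decomp_add(1)] fg_lmod[OF decomp_add(2)] fg_lmod[OF decomp_add(6)]
   fg_lmod[OF V(1)] fg_lmod[OF V(4)] fg_lmod[OF decomp_fg[OF decomp_add(8)]]
 note d = dsum_lmod
 have "mod_iso A (dirsum U X') (dirsum V W)"
  by (rule mod_iso_direct_sum[OF l(2,3) \<open>mod_iso A U V\<close> \<open>mod_iso A X' W\<close>])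
 from mod_iso_trans[OF l(1) d[OF l(4,5)] mod_iso_trans[OF l(1) d[OF l(2,3)] decomp_add(7) this]
   mod_iso_sym[OF l(6) d[OF l(4,5)] V(5)]] show ?case .
qed

context complete_algebra
begin

text \<open>An indecomposable summand of \<open>X\<close> occurs in every decomposition of \<open>X\<close>, by the exchange lemma.\<close>

lemma decomp_remove:
 assumes "decomp L X M" "fgm L Y" "indecomposable L Y" "fgm L W" "mod_iso L X (dirsum Y W)"
 shows "\<exists>N. M = add_mset (iso_class L Y) N & decomp L W N"
 using assms
proof (induct arbitrary: W rule: decomp.induct)
 case (decomp_zero X)
 have "is_zero_module Y"
  using is_zero_iso[OF decomp_zero(6)] is_zero_direct_sum decomp_zero fg_lmod dsum_lmod by metis
 thus ?case using decomp_zero(4) by (simp add: indecomposable_def)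
next
 case (decomp_add X U X' M)
 note l = fg_lmod[OF decomp_add(1)] fg_lmod[OF decomp_add(2)] fg_lmod[OF decomp_add(6)]
  fg_lmod[OF decomp_add(8)] fg_lmod[OF decomp_add(10)]
 note d = dsum_lmod
 have nz: "\<not> is_zero_module Y" using decomp_add(9) by (simp add: indecomposable_def)
 have "mod_iso L (dirsum Y W) (dirsum U X')"
  by (rule mod_iso_trans[OF d[OF l(4,5)] l(1) mod_iso_sym[OF l(1) d[OF l(4,5)] decomp_add(11)] decomp_add(7)])
 from exchange[OF l(4,5,2,3) indecomposable_local[OF decomp_add(8,9)] this]
 consider (a) C' :: "'l umod" where "lmod L C'" "mod_iso L U (dirsum Y C')" "mod_iso L W (dirsum C' X')"
  | (b) D' :: "'l umod" where "lmod L D'" "mod_iso L X' (dirsum Y D')" "mod_iso L W (dirsum D' U)"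
  by blast
 thus ?case
 proof cases
  case a
  note s = indecomposable_summand[OF decomp_add(3,2) l(4) a(1,2) nz]
  have "mod_iso L W X'"
   by (rule mod_iso_trans[OF l(5) d[OF a(1) l(3)] a(3) mod_iso_zero_sum[OF a(1) l(3) s(1)]])
  hence "decomp L W M" by (rule decomp_iso[OF decomp_add(4,10)])
  moreover have "iso_class L U = iso_class L Y" using s(2) iso_class_eq_iff[OF decomp_add(2,8)] by simp
  ultimately show ?thesis by auto
 next
  case b
  have D': "fgm L D'" by (rule fg_summand(2)[OF decomp_add(6) l(4) b(1,2)])
  obtain N where N: "M = add_mset (iso_class L Y) N" "decomp L D' N"
   using decomp_add(5)[OF decomp_add(8,9) D' b(2)] by blast
  have "mod_iso L W (dirsum U D')"
   by (rule mod_iso_trans[OF l(5) d[OF b(1) l(2)] b(3) mod_iso_direct_sum_comm[OF b(1) l(2)]])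
  from decomp.decomp_add[OF decomp_add(10,2,3) N(2) D' this] show ?thesis using N(1) by auto
 qed
qed

theorem krull_schmidt:
 assumes "decomp L X M" "decomp L Y N" "mod_iso L X Y" shows "M = N"
 using assms
proof (induct arbitrary: Y N rule: decomp.induct)
 case (decomp_zero X)
 note l = fg_lmod[OF decomp_zero(1)] fg_lmod[OF decomp_fg[OF decomp_zero(3)]]
 have z: "is_zero_module Y" using is_zero_iso[OF decomp_zero(4) l] decomp_zero(2) by simp
 from decomp_zero(3) show ?case
 proof (cases rule: decomp.cases)
  case (decomp_add U X' M)
  note m = fg_lmod[OF decomp_add(3)] fg_lmod[OF decomp_add(6)]
  have "is_zero_module U"
   using is_zero_iso[OF decomp_add(7) l(2) dsum_lmod[OF m]] is_zero_direct_sum[OF m] z by simp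
  thus ?thesis using decomp_add(4) by (simp add: indecomposable_def)
 qed simp
next
 case (decomp_add X U X' M)
 note l = fg_lmod[OF decomp_add(1)] fg_lmod[OF decomp_add(2)] fg_lmod[OF decomp_add(6)]
  fg_lmod[OF decomp_fg[OF decomp_add(8)]]
 have "mod_iso L Y (dirsum U X')"
  by (rule mod_iso_trans[OF l(4,1) mod_iso_sym[OF l(1,4) decomp_add(9)] decomp_add(7)])
 from decomp_remove[OF decomp_add(8,2,3,6) this] obtain N' where "N = add_mset (iso_class L U) N'" "decomp L X' N'" by blast
 with decomp_add(5)[OF this(2) mod_iso_refl[OF l(3)]] show ?case by simp
qed

definition dec :: "('l, 'x) module => 'l umod set multiset" where
 "dec X = (THE M. \<exists>Y. mod_iso L X Y & decomp L Y M)"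

lemma dec_eqI:
 assumes "lmod L X" "mod_iso L X Y" "decomp L Y M" shows "dec X = M"
 unfolding dec_def
proof (rule the_equality)
 show "\<exists>Y. mod_iso L X Y & decomp L Y M" using assms by blast
 fix N assume "\<exists>Y. mod_iso L X Y & decomp L Y N"
 then obtain Z where Z: "mod_iso L X Z" "decomp L Z N" by blast
 have Y: "lmod L Y" by (rule fg_lmod[OF decomp_fg[OF assms(3)]])
 have "mod_iso L Y Z" by (rule mod_iso_trans[OF Y assms(1) mod_iso_sym[OF assms(1) Y assms(2)] Z(1)])
 from krull_schmidt[OF assms(3) Z(2) this] show "N = M" by simp
qed

lemma dec_obtain:
 assumes "fgm L X" obtains Y where "mod_iso L X Y" "decomp L Y (dec X)"
proof -
 obtain Y :: "'l umod" and f where Y: "fgm L Y" "iso L X Y f" using universe_copy[OF assms] .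
 obtain M where M: "decomp L Y M" using decomp_exists[OF noeth_algebra[OF Y(1)]] by blast
 have i: "mod_iso L X Y" by (rule mod_isoI[OF fg_lmod[OF assms] Y(2)])
 show ?thesis using that[OF i] M dec_eqI[OF fg_lmod[OF assms] i M] by simp
qed

lemma dec_iso:
 assumes "fgm L X" "lmod L Y" "mod_iso L X Y" shows "dec X = dec Y"
proof -
 have X: "lmod L X" by (rule fg_lmod[OF assms(1)])
 obtain Z where Z: "mod_iso L X Z" "decomp L Z (dec X)" using dec_obtain[OF assms(1)] .
 have "mod_iso L Y Z" by (rule mod_iso_trans[OF assms(2) X mod_iso_sym[OF X assms(2,3)] Z(1)])
 from dec_eqI[OF assms(2) this Z(2)] show ?thesis by simp
qed

lemma dec_inj:
 assumes "fgm L X" "fgm L Y" "dec X = dec Y" shows "mod_iso L X Y"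
proof -
 note l = fg_lmod[OF assms(1)] fg_lmod[OF assms(2)]
 obtain Z where Z: "mod_iso L X Z" "decomp L Z (dec X)" using dec_obtain[OF assms(1)] .
 obtain W where W: "mod_iso L Y W" "decomp L W (dec X)" using dec_obtain[OF assms(2)] assms(3) by metis
 note m = fg_lmod[OF decomp_fg[OF Z(2)]] fg_lmod[OF decomp_fg[OF W(2)]]
 show ?thesis
  by (rule mod_iso_trans[OF l(1) m(1) Z(1) mod_iso_trans[OF m decomp_same_iso[OF Z(2) W(2)] mod_iso_sym[OF l(2) m(2) W(1)]]])
qed

lemma dec_sum:
 assumes "fgm L X" "fgm L Y" shows "dec (dirsum X Y) = dec X + dec Y"
proof -
 note l = fg_lmod[OF assms(1)] fg_lmod[OF assms(2)]
 obtain Z where Z: "mod_iso L X Z" "decomp L Z (dec X)" using dec_obtain[OF assms(1)] .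
 obtain W where W: "mod_iso L Y W" "decomp L W (dec Y)" using dec_obtain[OF assms(2)] .
 note d = dsum_lmod
 have f: "fgm L (dirsum X Y)" by (rule fg_direct_sum[OF assms])
 obtain V :: "'l umod" and f where V: "fgm L V" "iso L (dirsum X Y) V f" using universe_copy[OF f] .
 have i: "mod_iso L (dirsum X Y) V" by (rule mod_isoI[OF d[OF l] V(2)])
 have "mod_iso L V (dirsum Z W)"
  by (rule mod_iso_trans[OF fg_lmod[OF V(1)] d[OF l] mod_iso_sym[OF d[OF l] fg_lmod[OF V(1)] i]
    mod_iso_direct_sum[OF l Z(1) W(1)]])
 from dec_eqI[OF d[OF l] i decomp_sum[OF Z(2) W(2) V(1) this]] show ?thesis .
qed

lemma dec_zero: "[|lmod L X; is_zero_module X|] ==> dec X = {#}"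
proof -
 assume X: "lmod L X" and z: "is_zero_module X"
 have f: "fgm L X" by (rule fg_zero[OF X]) (use z in "simp add: is_zero_module_def")
 obtain V :: "'l umod" and f where V: "fgm L V" "iso L X V f" using universe_copy[OF f] .
 have i: "mod_iso L X V" by (rule mod_isoI[OF X V(2)])
 have "is_zero_module V" using is_zero_iso[OF i X fg_lmod[OF V(1)]] z by simp
 from dec_eqI[OF X i decomp_zero[OF V(1) this]] show ?thesis .
qed

lemma dec_indecomposable: "[|fgm L X; indecomposable L X|] ==> dec X = {#iso_class L X#}"
 using dec_eqI[OF fg_lmod mod_iso_refl[OF fg_lmod] decomp_indecomposable] by blast

lemma dec_member:
 assumes "fgm L X" "c \<in># dec X"
 obtains Y and W :: "'l umod" where "fgm L Y" "indecomposable L Y" "c = iso_class L Y"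
  "fgm L W" "mod_iso L X (dirsum Y W)"
proof -
 obtain Z where Z: "mod_iso L X Z" "decomp L Z (dec X)" using dec_obtain[OF assms(1)] .
 obtain Y and W :: "'l umod" where YW: "fgm L Y" "indecomposable L Y" "c = iso_class L Y"
  "fgm L W" "mod_iso L Z (dirsum Y W)"
  using decomp_select[OF Z(2) assms(2)] by blast
 have "mod_iso L X (dirsum Y W)"
  by (rule mod_iso_trans[OF fg_lmod[OF assms(1)] fg_lmod[OF decomp_fg[OF Z(2)]] Z(1) YW(5)])
 with YW show ?thesis using that by blast
qed

lemma dec_msum:
 assumes "finite J" "!!j. j : J ==> fgm L (X j)" shows "dec (msum J X) = (\<Sum>j\<in>J. dec (X j))"
 using assms
proof (induct J)
 case empty
 have "dec (msum {} X) = {#}"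
  by (rule dec_zero) (auto intro: msum_lmod L.ring_axioms simp: is_zero_module_def)
 thus ?case by simp
next
 case (insert j J)
 have m: "fgm L (msum (insert j J) X)" using insert by (intro fg_msum L.ring_axioms) auto
 have m2: "fgm L (msum J X)" using insert by (intro fg_msum L.ring_axioms) auto
 have d: "fgm L (dirsum (X j) (msum J X))" using insert m2 by (intro fg_direct_sum) auto
 have "dec (msum (insert j J) X) = dec (dirsum (X j) (msum J X))"
  by (rule dec_iso[OF m fg_lmod[OF d] mod_isoI[OF fg_lmod[OF m] iso_msum_insert[OF insert(2)]]])
 also have "... = dec (X j) + dec (msum J X)" using insert m2 by (intro dec_sum) auto
 finally show ?case using insert by simp
qed

lemma dec_summand:
 assumes "fgm L X" "lmod L Y" "lmod L Z" "mod_iso L X (dirsum Y Z)"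
 shows "dec Y <=# dec X"
proof -
 note f = fg_summand[OF assms]
 have "dec X = dec Y + dec Z"
  using dec_iso[OF assms(1) dsum_lmod[OF assms(2,3)] assms(4)] dec_sum[OF f] by simp
 thus ?thesis by simp
qed

lemma dec_subcategory:
 assumes C: "subcategory L C" and X: "X : C" shows "set_mset (dec X) <= ind L C"
proof
 fix c assume c: "c \<in># dec X"
 have fX: "fgm L X" using C X by (auto simp: subcategory_def fg_modules_def)
 obtain Y and W :: "'l umod" where YW: "fgm L Y" "indecomposable L Y" "c = iso_class L Y"
  "fgm L W" "mod_iso L X (dirsum Y W)"
  using dec_member[OF fX c] .
 hence "Y : C" using subcategory_summand[OF C X] by blast
 thus "c : ind L C" using YW by (auto simp: ind_def iso_class_def)
qed

end

section \<open>Projective modules\<close>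

lemma copower_simps [simp]:
 "carrier (copower X I) = {f : I \<rightarrow>\<^sub>E carrier X. finite {i : I. f i \<noteq> 0[X]}}"
 "0[copower X I] = (\<lambda>i\<in>I. 0[X])" "f +[copower X I] g = (\<lambda>i\<in>I. f i +[X] g i)"
 "a .[copower X I] f = (\<lambda>i\<in>I. a .[X] f i)"
 by (auto simp: copower_def)

lemma copower_lmod:
 assumes X: "lmod A X" shows "lmod A (copower X I)"
proof -
 interpret X: left_module A X by fact
 interpret S: left_module A "msum I (%_. X)" by (rule msum_lmod[OF X.A.ring_axioms X])
 let ?N = "carrier (copower X I)"
 have "submodule ?N A (msum I (%_. X))"
 proof (rule S.submodule_intro)
  fix f g assume f: "f : ?N" and g: "g : ?N"
  have "finite ({i : I. f i \<noteq> 0[X]} \<union> {i : I. g i \<noteq> 0[X]})" using f g by simp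
  hence "finite {i : I. f i +[X] g i \<noteq> 0[X]}" by (rule rev_finite_subset) auto
  thus "f +[msum I (%_. X)] g : ?N" using f g by (simp add: PiE_iff cong: conj_cong)
 next
  fix a f assume a: "a \<in>[A]" and f: "f : ?N"
  hence "finite {i : I. f i \<noteq> 0[X]}" by simp
  hence "finite {i : I. a .[X] f i \<noteq> 0[X]}" by (rule rev_finite_subset) (use a in auto)
  thus "a .[msum I (%_. X)] f : ?N" using a f by (simp add: PiE_iff cong: conj_cong)
 qed (auto simp: PiE_iff extensional_def cong: conj_cong)
 from sub_lmod[OF S.left_module_axioms this] have "lmod A (sub (msum I (%_. X)) ?N)" .
 moreover have "copower X I = sub (msum I (%_. X)) ?N" by (simp add: copower_def msum_def)
 ultimately show ?thesis by simp
qed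

text \<open>Retracts of the free module on \<open>I\<close>; these are the projective modules.\<close>

definition rfree :: "('a, 'c) ring_scheme => 'i set => ('a, 'p) module => bool" where
 "rfree A I P \<longleftrightarrow> lmod A P & (\<exists>s r. lin A P (copower (reg_mod A) I) s &
   lin A (copower (reg_mod A) I) P r & (\<forall>x\<in>carrier P. r (s x) = x))"

lemma rfree_lmod: "rfree A I P ==> lmod A P"
 by (simp add: rfree_def)

lemma rfree_retract:
 assumes P: "rfree A I P" and K: "lmod A K" and s: "lin A K P s" and r: "lin A P K r"
  and rs: "!!x. x \<in>[K] ==> r (s x) = x"
 shows "rfree A I K"
proof -
 obtain u v where "lin A P (copower (reg_mod A) I) u" "lin A (copower (reg_mod A) I) P v"
  "\<forall>x\<in>carrier P. v (u x) = x"
  using P by (auto simp: rfree_def)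
 thus ?thesis unfolding rfree_def using K rs lin_cl[OF s]
  by (intro conjI exI[of _ "%x. u (s x)"] exI[of _ "%y. r (v y)"] ballI lin_comp[OF s] lin_comp[OF _ r]) auto
qed

lemma rfree_free: "ring A ==> finite J ==> rfree A J (free A J)"
 unfolding rfree_def copower_finite
 by (intro conjI free_lmod exI[of _ "%x. x"]) (auto intro: lin_id)

lemma projective_rfree:
 assumes "projective_module A (P :: ('a, 'p) module)" shows "\<exists>I :: 'p set. rfree A I P"
proof -
 obtain I :: "'p set" and Q :: "('a, 'p => 'a) module" where P: "lmod A P" and Q: "lmod A Q"
  and i: "mod_iso A (dirsum P Q) (copower (reg_mod A) I)"
  using assms by (auto simp: projective_module_def)
 note PQ = dsum_lmod[OF P Q]
 have F: "lmod A (copower (reg_mod A) I)"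
  by (rule copower_lmod[OF regular_lmod[OF lmodD(14)[OF P]]])
 obtain f where f: "iso A (dirsum P Q) (copower (reg_mod A) I) f" using mod_isoE[OF i PQ] .
 obtain g where g: "iso A (copower (reg_mod A) I) (dirsum P Q) g"
  "!!x. x \<in>[dirsum P Q] ==> g (f x) = x"
  using iso_inverse[OF PQ F f] by metis
 have "rfree A I P" unfolding rfree_def
 proof (intro conjI P exI ballI)
  show "lin A P (copower (reg_mod A) I) (%x. f (x, 0[Q]))" by (rule lin_comp[OF lin_inl[OF Q] isoD(1)[OF f]])
  show "lin A (copower (reg_mod A) I) P (%y. fst (g y))" by (rule lin_comp[OF isoD(1)[OF g(1)] lin_fst])
  show "fst (g (f (x, 0[Q]))) = x" if "x \<in>[P]" for x
   using g(2)[of "(x, 0[Q])"] that lmodD(2)[OF Q] by simp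
 qed
 thus ?thesis ..
qed

lemma copower_expand:
 assumes A: "ring A" and X: "lmod A X" and f: "lin A (copower (reg_mod A) I) X f"
  and J: "finite J" "J <= I" and c: "c \<in>[copower (reg_mod A) I]" "!!i. i : I - J ==> c i = 0[A]"
 shows "f c = finsum X (%j. c j .[X] f (\<lambda>i\<in>I. if i = j then 1[A] else 0[A])) J"
 using J c
proof (induct J arbitrary: c)
 case empty
 interpret A: ring A by fact
 have "c = 0[copower (reg_mod A) I]" using empty(2,3) by (auto simp: PiE_iff extensional_def fun_eq_iff)
 hence "f c = 0[X]" by (simp only: lin_zero[OF copower_lmod[OF regular_lmod[OF A]] X f])
 also have "0[X] = finsum X (%j. c j .[X] f (\<lambda>i\<in>I. if i = j then 1[A] else 0[A])) {}"
  using lmodD(15)[OF X] by (simp only: abelian_monoid.finsum_empty abelian_group.axioms)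
 finally show ?case .
next
 case (insert j J)
 interpret A: ring A by fact
 interpret X: left_module A X by fact
 let ?F = "copower (reg_mod A) I"
 let ?d = "%j. \<lambda>i\<in>I. if i = j then 1[A] else 0[A]"
 let ?c = "\<lambda>i\<in>I. if i = j then 0[A] else c i"
 have j: "j : I" using insert(4) by simp
 have cc: "!!i. i : I ==> c i \<in>[A]" using insert(5) by auto
 have dF: "?d k : carrier ?F" for k
 proof -
  have "finite {i : I. ?d k i \<noteq> 0[A]}" by (rule finite_subset[of _ "{k}"]) auto
  thus ?thesis by simp
 qed
 have "finite {i : I. c i \<noteq> 0[A]}" using insert(5) by simp
 hence "finite {i : I. ?c i \<noteq> 0[A]}" by (rule rev_finite_subset) auto
 hence cF: "?c : carrier ?F" using cc by simp
 have e: "c = c j .[?F] ?d j +[?F] ?c"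
 proof
  fix i show "c i = (c j .[?F] ?d j +[?F] ?c) i"
   using insert(5) cc j by (cases "i : I") auto
 qed
 have fd: "f (?d k) \<in>[X]" for k by (rule lin_cl[OF f dF])
 have sF: "c j .[?F] ?d j : carrier ?F"
  by (rule lmodD(7)[OF copower_lmod[OF regular_lmod[OF A]] cc[OF j] dF])
 have "f c = c j .[X] f (?d j) +[X] f ?c"
  by (subst e) (simp only: lin_add[OF f sF cF] lin_smult[OF f cc[OF j] dF])
 also have "f ?c = finsum X (%k. ?c k .[X] f (?d k)) J"
  by (rule insert(3)[OF _ cF]) (use insert(4,6) in auto)
 also have "... = finsum X (%k. c k .[X] f (?d k)) J"
  by (rule X.finsum_cong') (use insert(2,4) fd cc in "auto simp: subset_iff")
 also have "c j .[X] f (?d j) +[X] ... = finsum X (%k. c k .[X] f (?d k)) (insert j J)"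
  by (rule X.finsum_insert[symmetric]) (use insert(1,2,4) fd cc in "auto simp: subset_iff")
 finally show ?case .
qed

text \<open>
 The lifting property, from values chosen on the basis of the free module.
\<close>

lemma rfree_lift:
 assumes P: "rfree A I P" and X: "lmod A X" and Y: "lmod A Y"
  and e: "lin A Y X e" "e ` carrier Y = carrier X" and g: "lin A P X g"
 obtains h where "lin A P Y h" "!!p. p \<in>[P] ==> e (h p) = g p"
proof -
 interpret X: left_module A X by fact
 interpret Y: left_module A Y by fact
 let ?F = "copower (reg_mod A) I"
 let ?d = "%j. \<lambda>i\<in>I. if i = j then 1[A] else 0[A]"
 note Fm = copower_lmod[OF regular_lmod[OF X.A.ring_axioms], of I]
 obtain s r where sr: "lin A P ?F s" "lin A ?F P r" "!!x. x \<in>[P] ==> r (s x) = x"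
  using P by (auto simp: rfree_def)
 have gr: "lin A ?F X (%c. g (r c))" by (rule lin_comp[OF sr(2) g])
 have dF: "?d k : carrier ?F" for k
 proof -
  have "finite {i : I. ?d k i \<noteq> 0[A]}" by (rule finite_subset[of _ "{k}"]) auto
  thus ?thesis by simp
 qed
 define y where "y i = inv_into (carrier Y) e (g (r (?d i)))" for i
 have y: "y i \<in>[Y]" "e (y i) = g (r (?d i))" for i
 proof -
  have "g (r (?d i)) : e ` carrier Y" unfolding e(2) by (rule lin_cl[OF gr dF])
  thus "y i \<in>[Y]" "e (y i) = g (r (?d i))" unfolding y_def by (rule inv_into_into, rule f_inv_into_f)
 qed
 define S where "S c = {i : I. c i \<noteq> 0[A]}" for c :: "_ => _"
 have fS: "finite (S c)" "!!i. i : I ==> c i \<in>[A]" "S c <= I" if "c : carrier ?F" for c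
  using that by (auto simp: S_def)
 define k where "k c = finsum Y (%i. c i .[Y] y i) (S c)" for c
 have kJ: "k c = finsum Y (%i. c i .[Y] y i) J" if c: "c : carrier ?F" and J: "finite J" "J <= I" "S c <= J" for c J
  unfolding k_def
  by (rule Y.add.finprod_mono_neutral_cong_left) (use fS[OF c] J y in "auto simp: S_def")
 have kl: "lin A ?F Y k"
 proof (rule linI)
  fix c assume c: "c : carrier ?F"
  show "k c \<in>[Y]" unfolding k_def using fS[OF c] y by (intro Y.finsum_closed) auto
  fix c' assume c': "c' : carrier ?F"
  let ?J = "S c \<union> S c'"
  have J: "finite ?J" "?J <= I" using fS[OF c] fS[OF c'] by auto
  have cc': "c +[?F] c' : carrier ?F" by (rule lmodD(1)[OF Fm c c'])
  have "k (c +[?F] c') = finsum Y (%i. (c +[?F] c') i .[Y] y i) ?J"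
   by (rule kJ[OF cc' J]) (auto simp: S_def)
  also have "... = finsum Y (%i. c i .[Y] y i +[Y] c' i .[Y] y i) ?J"
   by (rule Y.finsum_cong') (use J fS[OF c] fS[OF c'] y in "auto simp: Y.smult_l_distr subset_iff")
  also have "... = finsum Y (%i. c i .[Y] y i) ?J +[Y] finsum Y (%i. c' i .[Y] y i) ?J"
   by (rule Y.finsum_addf) (use J fS[OF c] fS[OF c'] y in "auto simp: subset_iff")
  also have "... = k c +[Y] k c'" using kJ[OF c J] kJ[OF c' J] by simp
  finally show "k (c +[?F] c') = k c +[Y] k c'" .
 next
  fix a c assume a: "a \<in>[A]" and c: "c : carrier ?F"
  have ac: "a .[?F] c : carrier ?F" by (rule lmodD(7)[OF Fm a c])
  have "k (a .[?F] c) = finsum Y (%i. (a .[?F] c) i .[Y] y i) (S c)"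
   by (rule kJ[OF ac fS(1,3)[OF c]]) (use a in "auto simp: S_def")
  also have "... = finsum Y (%i. a .[Y] (c i .[Y] y i)) (S c)"
   by (rule Y.finsum_cong') (use a fS[OF c] y in "auto simp: Y.smult_assoc subset_iff")
  also have "... = a .[Y] k c" unfolding k_def
   by (rule Y.smult_finsum[symmetric]) (use a fS[OF c] y in "auto simp: subset_iff")
  finally show "k (a .[?F] c) = a .[Y] k c" .
 qed
 have ek: "e (k c) = g (r c)" if c: "c : carrier ?F" for c
 proof -
  have "e (k c) = finsum X (%i. e (c i .[Y] y i)) (S c)"
   unfolding k_def using fS[OF c] y by (intro lin_finsum[OF Y X e(1)]) (auto simp: subset_iff)
  also have "... = finsum X (%i. c i .[X] g (r (?d i))) (S c)"
   by (rule X.finsum_cong') (use fS[OF c] y lin_smult[OF e(1)] lin_cl[OF gr dF] in "auto simp: subset_iff")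
  also have "... = g (r c)"
   by (rule copower_expand[OF X.A.ring_axioms X gr fS(1,3)[OF c] c, symmetric]) (auto simp: S_def)
  finally show ?thesis .
 qed
 show ?thesis
  by (rule that[of "%p. k (s p)"]) (use sr ek lin_cl[OF sr(1)] in "auto intro: lin_comp[OF sr(1) kl]")
qed

definition fproj :: "('a, 'c) ring_scheme => ('a, 'p) module => bool" where
 "fproj A P \<longleftrightarrow> fgm A P & (\<exists>n::nat. rfree A {..<n} P)"

lemma rfree_fg_section:
 assumes P: "rfree A I P" and z: "gens A P J z"
 obtains h where "lin A P (free A J) h" "!!p. p \<in>[P] ==> lincomb P J z (h p) = p"
 using rfree_lift[OF P rfree_lmod[OF P] free_lmod[OF lmodD(14)[OF rfree_lmod[OF P]]]
   lin_lincomb[OF rfree_lmod[OF P] gensD(1,2)[OF z]] gensD(4)[OF z] lin_id] by blast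

lemma fprojI:
 assumes "fgm A P" "rfree A I P" shows "fproj A P"
proof -
 note P = fg_lmod[OF assms(1)]
 obtain n z where z: "gens A P {..<n::nat} z" using fg_obtain[OF assms(1)] .
 obtain h where "lin A P (free A {..<n}) h" "!!p. p \<in>[P] ==> lincomb P {..<n} z (h p) = p"
  using rfree_fg_section[OF assms(2) z] by blast
 hence "rfree A {..<n} P"
  by (intro rfree_retract[OF rfree_free[OF lmodD(14)[OF P] finite_lessThan] P _ lin_lincomb[OF P gensD(1,2)[OF z]]]) auto
 thus ?thesis using assms(1) by (auto simp: fproj_def)
qed

lemma fproj_sum:
 assumes P: "fproj A P" and Q: "fproj A Q" shows "fproj A (dirsum P Q)"
proof -
 have fg: "fgm A P" "fgm A Q" using assms by (auto simp: fproj_def)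
 note l = fg[THEN fg_lmod]
 note d = dsum_lmod[OF l]
 obtain m n where r: "rfree A {..<m::nat} P" "rfree A {..<n::nat} Q" using assms by (auto simp: fproj_def)
 obtain k z where z: "gens A (dirsum P Q) {..<k::nat} z" using fg_obtain[OF fg_direct_sum[OF fg]] .
 let ?F = "free A {..<k}"
 have A: "ring A" by (rule lmodD(14)[OF l(1)])
 note F = free_lmod[OF A, of "{..<k}"]
 note zl = lin_lincomb[OF d gensD(1,2)[OF z]]
 obtain h1 where h1: "lin A P ?F h1" "!!p. p \<in>[P] ==> lincomb (dirsum P Q) {..<k} z (h1 p) = (p, 0[Q])"
  using rfree_lift[OF r(1) d F zl gensD(4)[OF z] lin_inl[OF l(2)]] by blast
 obtain h2 where h2: "lin A Q ?F h2" "!!q. q \<in>[Q] ==> lincomb (dirsum P Q) {..<k} z (h2 q) = (0[P], q)"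
  using rfree_lift[OF r(2) d F zl gensD(4)[OF z] lin_inr[OF l(1)]] by blast
 have "rfree A {..<k} (dirsum P Q)"
 proof (rule rfree_retract[OF rfree_free[OF A finite_lessThan] d _ zl])
  show "lin A (dirsum P Q) ?F (%x. h1 (fst x) +[?F] h2 (snd x))"
   by (intro lin_plus[OF F] lin_fst'[OF h1(1)] lin_snd'[OF h2(1)])
  fix x assume "x \<in>[dirsum P Q]"
  hence x: "fst x \<in>[P]" "snd x \<in>[Q]" by auto
  show "lincomb (dirsum P Q) {..<k} z (h1 (fst x) +[?F] h2 (snd x)) = x"
   unfolding lin_add[OF zl lin_cl[OF h1(1) x(1)] lin_cl[OF h2(1) x(2)]] h1(2)[OF x(1)] h2(2)[OF x(2)]
   using x lmodD(5,6)[OF l(1)] lmodD(5,6)[OF l(2)] by simp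
 qed
 thus ?thesis by (rule fprojI[OF fg_direct_sum[OF fg]])
qed

text \<open>
 The index set in the definition of a projective module has to consist of elements of the module. The
 images of the basis serve, unless the ring is zero.
\<close>

lemma free_projective:
 assumes A: "ring A" and f: "iso A (free A {..<n::nat}) (P :: ('a, 'p) module) f" and P: "lmod A P"
 shows "projective_module A P"
proof -
 interpret A: ring A by fact
 let ?F = "free A {..<n}"
 let ?R = "reg_mod A"
 note Rm = regular_lmod[OF A]
 have F: "lmod A ?F" by (rule free_lmod[OF A])
 let ?Q = "free A ({} :: 'p set)"
 have Q: "lmod A ?Q" by (rule free_lmod[OF A])
 note PQ = dsum_lmod[OF P Q]
 have Qz: "is_zero_module ?Q" by (simp add: is_zero_module_def restrict_def)
 have PQP: "mod_iso A (dirsum P ?Q) P"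
  by (rule mod_iso_trans[OF PQ dsum_lmod[OF Q P] mod_iso_direct_sum_comm[OF P Q] mod_iso_zero_sum[OF Q P Qz]])
 have PF: "mod_iso A P ?F" by (rule mod_iso_sym[OF F P mod_isoI[OF F f]])
 have "\<exists>I :: 'p set. mod_iso A ?F (copower ?R I)"
 proof (cases "1[A] = 0[A]")
  case True
  hence z: "carrier A = {0[A]}" using A.one_zeroD by blast
  have "iso A ?F ?Q (%x. 0[?Q])"
   by (rule isoI[OF lin_zero_map[OF Q] lin_zero_map[OF F]])
    (auto simp: z PiE_iff extensional_def fun_eq_iff)
  thus ?thesis using mod_isoI[OF F] copower_finite[of "{}" ?R] by (metis finite.emptyI)
 next
  case False
  let ?d = "%j. \<lambda>i\<in>{..<n}. if i = j then 1[A] else 0[A]"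
  have inj: "inj_on (%j. f (?d j)) {..<n}"
  proof (rule inj_onI)
   fix j k assume jk: "j : {..<n}" "k : {..<n}" "f (?d j) = f (?d k)"
   have "?d j : carrier ?F" "?d k : carrier ?F" by auto
   with jk(3) inj_onD[OF isoD(2)[OF f]] have "?d j = ?d k" by blast
   from fun_cong[OF this, of j] jk(1) False show "j = k" by (auto split: if_splits)
  qed
  define b where "b j = f (?d j)" for j
  define I where "I = b ` {..<n}"
  define g where "g = inv_into {..<n} b"
  have inj: "inj_on b {..<n}" using inj unfolding b_def .
  have g: "g i : {..<n}" "b (g i) = i" if "i : I" for i
   using inv_into_into[of i b "{..<n}"] f_inv_into_f[of i b "{..<n}"] that unfolding I_def g_def by blast+
  have gb: "g (b j) = j" if "j < n" for j using inv_into_f_f[OF inj] that unfolding g_def by simp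
  have "iso A ?F (free A I) (%c. \<lambda>i\<in>I. c (g i))"
  proof (rule isoI[of _ _ _ _ "%c. \<lambda>j\<in>{..<n}. c (b j)"])
   show "lin A ?F (free A I) (%c. \<lambda>i\<in>I. c (g i))" by (rule lin_tuple, rule lin_proj, rule g(1))
   show "lin A (free A I) ?F (%c. \<lambda>j\<in>{..<n}. c (b j))" by (rule lin_tuple, rule lin_proj) (simp add: I_def)
   show "(\<lambda>j\<in>{..<n}. (\<lambda>i\<in>I. c (g i)) (b j)) = c" if "c : carrier ?F" for c
    using that gb by (auto simp: I_def fun_eq_iff PiE_iff extensional_def)
   show "(\<lambda>i\<in>I. (\<lambda>j\<in>{..<n}. c (b j)) (g i)) = c" if "c \<in>[free A I]" for c
   proof
    fix i show "(\<lambda>i\<in>I. (\<lambda>j\<in>{..<n}. c (b j)) (g i)) i = c i"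
     using g[of i] that by (cases "i : I") (auto simp: PiE_iff extensional_def)
   qed
  qed
  thus ?thesis using mod_isoI[OF F] copower_finite[of I ?R] by (metis I_def finite_imageI finite_lessThan)
 qed
 then obtain I :: "'p set" where I: "mod_iso A ?F (copower ?R I)" ..
 have "mod_iso A (dirsum P ?Q) (copower ?R I)"
  by (rule mod_iso_trans[OF PQ P PQP mod_iso_trans[OF P F PF I]])
 thus ?thesis unfolding projective_module_def using P Q by blast
qed

definition pres :: "('a, 'c) ring_scheme => ('a, 'p) module => ('p => 'x) => ('a, 'x) module => bool" where
 "pres A P e X \<longleftrightarrow> fproj A P & lin A P X e & e ` carrier P = carrier X"

lemma presD:
 assumes "pres A P e X"
 shows "fgm A P" "lmod A P" "lin A P X e" "e ` carrier P = carrier X" "\<exists>n::nat. rfree A {..<n} P"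
 using assms fg_lmod by (auto simp: pres_def fproj_def)

lemma presentation_exists:
 assumes X: "fgm A X"
 obtains P :: "'a umod" and e where "pres (A :: ('a, 'c) ring_scheme) P e X" "projective_module A P"
proof -
 note Xm = fg_lmod[OF X]
 have A: "ring A" by (rule lmodD(14)[OF Xm])
 obtain n z where z: "gens A X {..<n::nat} z" using fg_obtain[OF X] .
 let ?F = "free A {..<n}"
 have F: "fgm A ?F" by (rule fg_free[OF A]) simp
 obtain P :: "'a umod" and f where P: "fgm A P" "iso A ?F P f" using universe_copy[OF F] .
 obtain g where g: "iso A P ?F g" "!!x. x : carrier ?F ==> g (f x) = x" "!!x. x \<in>[P] ==> f (g x) = x"
  using iso_inverse[OF fg_lmod[OF F] fg_lmod[OF P(1)] P(2)] by metis
 note zl = lin_lincomb[OF Xm gensD(1,2)[OF z]]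
 have "rfree A {..<n} P"
  by (rule rfree_retract[OF rfree_free[OF A finite_lessThan] fg_lmod[OF P(1)] isoD(1)[OF g(1)] isoD(1)[OF P(2)]]) (rule g(3))
 hence fp: "fproj A P" using P(1) by (auto simp: fproj_def)
 have "(%x. lincomb X {..<n} z (g x)) ` carrier P = lincomb X {..<n} z ` g ` carrier P" by (simp add: image_image)
 also have "... = carrier X" unfolding isoD(3)[OF g(1)] by (rule gensD(4)[OF z])
 finally have "pres A P (%x. lincomb X {..<n} z (g x)) X"
  unfolding pres_def using fp lin_comp[OF isoD(1)[OF g(1)] zl] by simp
 thus ?thesis using that free_projective[OF A P(2) fg_lmod[OF P(1)]] by blast
qed

section \<open>Vanishing of extension groups\<close>

definition extends :: "('a, 'c) ring_scheme => ('a, 'p) module => 'p set => ('a, 'y) module => bool" where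
 "extends A P K Y \<longleftrightarrow> (\<forall>h. lin A (sub P K) Y h \<longrightarrow> (\<exists>g. lin A P Y g & (\<forall>x\<in>K. g x = h x)))"

text \<open>
 \<open>X'\<close> is a retract of \<open>X\<close> up to maps that factor through a projective module, and hence through
 the given projective presentation \<open>e: P \<rightarrow> X'\<close>. This relation passes to syzygies, so it compares arbitrary
 projective resolutions one step at a time.
\<close>

definition sretr :: "('a, 'c) ring_scheme => ('a, 'p) module => ('p => 'y) => ('a, 'y) module => ('a, 'x) module => bool" where
 "sretr A P e X' X \<longleftrightarrow> (\<exists>a b c. lin A X' X a & lin A X X' b & lin A X' P c &
   (\<forall>x\<in>carrier X'. b (a x) = x +[X'] e (c x)))"

text \<open>
 Lifting the maps \<open>a\<close> and \<open>b\<close> of a stable retraction to the projective modules; \<open>v u\<close> differs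
 from the identity by a map of \<open>P'\<close> into its own syzygy, so the restrictions to the syzygies form a stable retraction again.
\<close>

lemma sretr_lift:
 assumes X': "lmod A X'" and X: "lmod A X" and s: "sretr A P' e' X' X"
  and P': "rfree A I' P'" "lin A P' X' e'" "e' ` carrier P' = carrier X'"
  and P: "rfree A I P" "lin A P X e" "e ` carrier P = carrier X"
 obtains u v t where "lin A P' P u" "lin A P P' v" "lin A P' (sub P' (ker P' X' e')) t"
  "u ` ker P' X' e' <= ker P X e" "v ` ker P X e <= ker P' X' e'"
  "!!k. k : ker P' X' e' ==> v (u k) = k +[P'] t k"
proof -
 note Pm = rfree_lmod[OF P(1)] and P'm = rfree_lmod[OF P'(1)]
 interpret X': left_module A X' by fact
 interpret P': left_module A P' by (rule P'm)
 obtain a b c where abc: "lin A X' X a" "lin A X X' b" "lin A X' P' c"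
  "!!x. x \<in>[X'] ==> b (a x) = x +[X'] e' (c x)"
  using s by (auto simp: sretr_def)
 obtain u where u: "lin A P' P u" "!!p. p \<in>[P'] ==> e (u p) = a (e' p)"
  using rfree_lift[OF P'(1) X Pm P(2,3) lin_comp[OF P'(2) abc(1)]] by metis
 obtain v where v: "lin A P P' v" "!!p. p \<in>[P] ==> e' (v p) = b (e p)"
  using rfree_lift[OF P(1) X' P'm P'(2,3) lin_comp[OF P(2) abc(2)]] by metis
 let ?t = "%p. (v (u p) -[P'] p) -[P'] c (e' p)"
 have t0: "lin A P' P' ?t"
  by (intro lin_subtract[OF P'm] lin_comp[OF u(1) v(1)] lin_id lin_comp[OF P'(2) abc(3)])
 have kP: "ker P' X' e' <= carrier P'" by (auto simp: ker_def)
 have tk: "?t p : ker P' X' e'" if p: "p \<in>[P']" for p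
 proof -
  have c: "v (u p) \<in>[P']" "e' p \<in>[X']" "c (e' p) \<in>[P']" "e' (c (e' p)) \<in>[X']"
   by (intro lin_cl[OF v(1)] lin_cl[OF u(1)] p) (intro lin_cl[OF P'(2)] lin_cl[OF abc(3)] p)+
  have "e' (?t p) = (e' (v (u p)) -[X'] e' p) -[X'] e' (c (e' p))"
   using p c by (simp add: lin_diff[OF P'm X' P'(2)])
  also have "e' (v (u p)) = e' p +[X'] e' (c (e' p))"
   using v(2)[OF lin_cl[OF u(1) p]] u(2)[OF p] abc(4)[OF c(2)] by simp
  also have "((e' p +[X'] e' (c (e' p))) -[X'] e' p) -[X'] e' (c (e' p)) = 0[X']"
   using c by (simp add: X'.minus_eq X'.a_ac X'.r_neg X'.r_neg2)
  finally show ?thesis using lin_cl[OF t0 p] by (simp add: ker_def)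
 qed
 have t: "lin A P' (sub P' (ker P' X' e')) ?t" unfolding lin_into_sub[OF kP] using t0 tk by auto
 have az: "a 0[X'] = 0[X]" "b 0[X] = 0[X']" "c 0[X'] = 0[P']"
  using lin_zero[OF X' X abc(1)] lin_zero[OF X X' abc(2)] lin_zero[OF X' P'm abc(3)] by auto
 show ?thesis
 proof (rule that[OF u(1) v(1) t])
  show "u ` ker P' X' e' <= ker P X e" using u lin_cl[OF u(1)] az by (auto simp: ker_def)
  show "v ` ker P X e <= ker P' X' e'" using v lin_cl[OF v(1)] az by (auto simp: ker_def)
  fix k assume "k : ker P' X' e'"
  hence k: "k \<in>[P']" "e' k = 0[X']" by (auto simp: ker_def)
  have "v (u k) \<in>[P']" by (intro lin_cl[OF v(1)] lin_cl[OF u(1)] k)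
  thus "v (u k) = k +[P'] ?t k" using k az(3)
   by (simp add: P'.minus_eq P'.minus_zero_module P'.a_ac P'.r_neg2 P'.r_neg)
 qed
qed

lemma sretr_syzygy:
 assumes X': "lmod A X'" and X: "lmod A X" and s: "sretr A P' e' X' X"
  and P': "rfree A I' P'" "lin A P' X' e'" "e' ` carrier P' = carrier X'"
  and P: "rfree A I P" "lin A P X e" "e ` carrier P = carrier X"
  and Q: "lmod A Q" "lin A Q (sub P' (ker P' X' e')) q" "q ` carrier Q = ker P' X' e'"
 shows "sretr A Q q (sub P' (ker P' X' e')) (sub P (ker P X e))"
proof -
 note Pm = rfree_lmod[OF P(1)] and P'm = rfree_lmod[OF P'(1)]
 obtain u v t where uvt: "lin A P' P u" "lin A P P' v" "lin A P' (sub P' (ker P' X' e')) t"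
  "u ` ker P' X' e' <= ker P X e" "v ` ker P X e <= ker P' X' e'"
  "!!k. k : ker P' X' e' ==> v (u k) = k +[P'] t k"
  using sretr_lift[OF X' X s P' P] by blast
 have k: "ker P' X' e' <= carrier P'" "ker P X e <= carrier P" by (auto simp: ker_def)
 have K': "lmod A (sub P' (ker P' X' e'))" by (rule sub_lmod[OF P'm ker_submodule[OF P'm X' P'(2)]])
 obtain w where w: "lin A P' Q w" "!!p. p \<in>[P'] ==> q (w p) = t p"
  using rfree_lift[OF P'(1) K' Q(1,2) _ uvt(3)] Q(3) by auto
 show ?thesis unfolding sretr_def
 proof (intro exI conjI ballI)
  show "lin A (sub P' (ker P' X' e')) (sub P (ker P X e)) u"
   unfolding lin_into_sub[OF k(2)] using lin_from_sub[OF uvt(1) k(1)] uvt(4) by simp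
  show "lin A (sub P (ker P X e)) (sub P' (ker P' X' e')) v"
   unfolding lin_into_sub[OF k(1)] using lin_from_sub[OF uvt(2) k(2)] uvt(5) by simp
  show "lin A (sub P' (ker P' X' e')) Q w" by (rule lin_from_sub[OF w(1) k(1)])
  fix x assume "x \<in>[sub P' (ker P' X' e')]"
  thus "v (u x) = x +[sub P' (ker P' X' e')] q (w x)" using uvt(6) w(2) k(1) by auto
 qed
qed

lemma sretr_extends:
 assumes X': "lmod A X'" and X: "lmod A X" and Y: "lmod A Y" and s: "sretr A P' e' X' X"
  and P': "rfree A I' P'" "lin A P' X' e'" "e' ` carrier P' = carrier X'"
  and P: "rfree A I P" "lin A P X e" "e ` carrier P = carrier X"
  and ext: "extends A P (ker P X e) Y"
 shows "extends A P' (ker P' X' e') Y"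
 unfolding extends_def
proof (intro allI impI)
 note Pm = rfree_lmod[OF P(1)] and P'm = rfree_lmod[OF P'(1)]
 interpret Y: left_module A Y by fact
 fix h assume h: "lin A (sub P' (ker P' X' e')) Y h"
 obtain u v t where uvt: "lin A P' P u" "lin A P P' v" "lin A P' (sub P' (ker P' X' e')) t"
  "u ` ker P' X' e' <= ker P X e" "v ` ker P X e <= ker P' X' e'"
  "!!k. k : ker P' X' e' ==> v (u k) = k +[P'] t k"
  using sretr_lift[OF X' X s P' P] by blast
 have k: "ker P' X' e' <= carrier P'" "ker P X e <= carrier P" by (auto simp: ker_def)
 have "lin A (sub P (ker P X e)) (sub P' (ker P' X' e')) v"
  unfolding lin_into_sub[OF k(1)] using lin_from_sub[OF uvt(2) k(2)] uvt(5) by simp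
 from lin_comp[OF this h] obtain g where g: "lin A P Y g" "!!x. x : ker P X e ==> g x = h (v x)"
  using ext unfolding extends_def by blast
 let ?g = "%p. g (u p) -[Y] h (t p)"
 have "lin A P' Y ?g" by (intro lin_subtract[OF Y] lin_comp[OF uvt(1) g(1)] lin_comp[OF uvt(3) h])
 moreover have "?g x = h x" if x: "x : ker P' X' e'" for x
 proof -
  have tx: "t x : ker P' X' e'" using lin_cl[OF uvt(3), of x] x k(1) by auto
  have hc: "h x \<in>[Y]" "h (t x) \<in>[Y]" using lin_cl[OF h] x tx by auto
  have "u x : ker P X e" using uvt(4) x by auto
  hence "g (u x) = h (x +[P'] t x)" using g(2) uvt(6)[OF x] by simp
  also have "... = h x +[Y] h (t x)" using lin_add[OF h, of x "t x"] x tx by simp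
  finally show ?thesis using hc by (simp add: Y.minus_eq Y.a_assoc Y.r_neg)
 qed
 ultimately show "\<exists>g. lin A P' Y g & (\<forall>x\<in>ker P' X' e'. g x = h x)" by blast
qed

lemma sretr_refl:
 assumes "lmod A X" "lmod A P" "lin A P X e" shows "sretr A P e X X"
 unfolding sretr_def
 by (rule exI[of _ "%x. x"], rule exI[of _ "%x. x"], rule exI[of _ "%x. 0[P]"])
  (use lin_zero[OF assms(2,1,3)] lmodD(6)[OF assms(1)] in "auto intro: lin_id lin_zero_map assms")

text \<open>
 \<open>ext_vanish A i X Y\<close> is the vanishing of \<open>Ext\<^sup>i\<^sup>+\<^sup>1(X, Y)\<close>, expressed through all presentations of the iterated
 syzygies.
\<close>

primrec ext_vanish :: "('a, 'c) ring_scheme => ('a, 'y) module => nat => 'a umod => bool" where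
 "ext_vanish A Y 0 = (%X. \<forall>(P :: 'a umod) e. pres A P e X \<longrightarrow> extends A P (ker P X e) Y)"
| "ext_vanish A Y (Suc i) = (%X. \<forall>(P :: 'a umod) e. pres A P e X \<longrightarrow> ext_vanish A Y i (sub P (ker P X e)))"

lemma a_kernel_ker: "a_kernel X Y f = ker X Y f"
 by (simp add: a_kernel_def kernel_def ker_def)

text \<open>
 A cocycle of \<open>Hom(P, Y)\<close> is a linear map on the image of the next differential; it is a coboundary if and
 only if this map extends.
\<close>

lemma Ext_from_trivial_iff:
 assumes res: "resolution A P d e X" and Y: "lmod A Y"
 shows "trivial_group (Ext_from A P d Y (Suc j)) \<longleftrightarrow> extends A (P j) (d j ` carrier (P (Suc j))) Y"
proof -
 have Pm: "lmod A (P i)" and dm: "d i : mod_hom A (P (Suc i)) (P i)" for i using res by (auto simp: resolution_def)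
 note d = mod_hom_lin[OF dm]
 interpret Y: left_module A Y by fact
 let ?i = "Suc j"
 let ?Z = "cocycles A P d Y ?i" and ?B = "coboundaries A P d Y ?i"
 let ?G = "(hom_group A (P ?i) Y)\<lparr>carrier := ?Z\<rparr>"
 have ex: "d (Suc j) ` carrier (P (Suc (Suc j))) = ker (P (Suc j)) (P j) (d j)"
  using res by (simp add: resolution_def a_kernel_ker)
 have Zi: "f : ?Z \<longleftrightarrow> f : mod_hom A (P ?i) Y & (\<forall>x\<in>ker (P (Suc j)) (P j) (d j). f x = 0[Y])" for f
  unfolding cocycles_def ex[symmetric] by (auto simp: compose_def zero_map_def fun_eq_iff restrict_def)
 have Bi: "?B = (%g. compose (carrier (P ?i)) g (d j)) ` mod_hom A (P j) Y" by (simp add: coboundaries_def)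
 have kc: "ker (P (Suc j)) (P j) (d j) <= carrier (P ?i)" by (auto simp: ker_def)
 have BZ: "?B <= ?Z"
 proof
  fix f assume "f : ?B"
  then obtain g where g: "g : mod_hom A (P j) Y" "f = compose (carrier (P ?i)) g (d j)" unfolding Bi by (elim imageE) blast
  show "f : ?Z" unfolding Zi g(2) using compose_mod_hom[OF Pm dm g(1)] lin_zero[OF Pm Y mod_hom_lin[OF g(1)]]
   by (auto simp: compose_def ker_def)
 qed
 have add: "(\<lambda>x\<in>carrier (P i). f x +[Y] g x) : mod_hom A (P i) Y"
  if "f : mod_hom A (P i) Y" "g : mod_hom A (P i) Y" for i f g
  using lin_mod_hom[OF Pm lin_plus[OF Y that[THEN mod_hom_lin]]] .
 have neg: "(\<lambda>x\<in>carrier (P i). 0[Y] -[Y] f x) : mod_hom A (P i) Y" if "f : mod_hom A (P i) Y" for i f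
  using lin_mod_hom[OF Pm lin_subtract[OF Y lin_zero_map[OF Y] mod_hom_lin[OF that]]] .
 have zm: "zero_map (P i) Y : mod_hom A (P i) Y" for i
  using lin_mod_hom[OF Pm lin_zero_map[OF Y]] by (simp add: zero_map_def)
 have c: "f x \<in>[Y]" if "f : mod_hom A (P i) Y" "x \<in>[P i]" for f x i using mod_hom_closed[OF that] .
 have xt: "f x = undefined" if "f : mod_hom A (P i) Y" "x \<notin> carrier (P i)" for f x i using that by (auto simp: mod_hom_def)
 have G: "comm_group ?G"
 proof (rule comm_groupI)
  fix f assume f: "f : carrier ?G"
  hence f': "f : mod_hom A (P ?i) Y" by (simp add: Zi)
  show "1[?G] *[?G] f = f" using c[OF f'] xt[OF f'] by (auto simp: hom_group_def zero_map_def fun_eq_iff)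
  have "(\<lambda>x\<in>carrier (P ?i). 0[Y] -[Y] f x) : carrier ?G" using f neg[OF f'] kc by (auto simp: Zi Y.minus_eq)
  thus "\<exists>g\<in>carrier ?G. g *[?G] f = 1[?G]"
   by (rule bexI[rotated]) (use c[OF f'] in \<open>auto simp: hom_group_def zero_map_def fun_eq_iff Y.minus_eq Y.l_neg\<close>)
 next
  fix f g assume "f : carrier ?G" "g : carrier ?G"
  hence fg: "f : ?Z" "g : ?Z" by simp_all
  hence fg': "f : mod_hom A (P ?i) Y" "g : mod_hom A (P ?i) Y" by (simp_all add: Zi)
  show "f *[?G] g : carrier ?G" using fg add[OF fg'] kc by (auto simp: Zi hom_group_def)
  show "f *[?G] g = g *[?G] f" using c[OF fg'(1)] c[OF fg'(2)] by (auto simp: hom_group_def fun_eq_iff Y.a_comm)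
  fix h assume "h : carrier ?G"
  hence h': "h : mod_hom A (P ?i) Y" by (simp add: Zi)
  show "f *[?G] g *[?G] h = f *[?G] (g *[?G] h)"
   using c[OF fg'(1)] c[OF fg'(2)] c[OF h'] by (auto simp: hom_group_def fun_eq_iff Y.a_assoc)
 next
  show "1[?G] : carrier ?G" using zm kc by (auto simp: hom_group_def Zi zero_map_def)
 qed
 interpret G: comm_group ?G by (rule G)
 have dc: "d j x \<in>[P j]" if "x \<in>[P ?i]" for x by (rule lin_cl[OF d that])
 have zB: "1[?G] : ?B" unfolding Bi
  by (rule image_eqI[OF _ zm]) (use dc in "auto simp: hom_group_def compose_def zero_map_def fun_eq_iff")
 have H: "subgroup ?B ?G"
 proof (rule G.subgroupI)
  show "?B <= carrier ?G" using BZ by simp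
  show "?B \<noteq> {}" using zB by blast
  fix f assume fB: "f : ?B"
  then obtain g where g: "f = compose (carrier (P ?i)) g (d j)" "g : mod_hom A (P j) Y" unfolding Bi by (elim imageE)
  let ?g = "\<lambda>x\<in>carrier (P j). 0[Y] -[Y] g x"
  have "compose (carrier (P ?i)) ?g (d j) : ?B" unfolding Bi by (rule imageI[OF neg[OF g(2)]])
  moreover have "compose (carrier (P ?i)) ?g (d j) *[?G] f = 1[?G]"
   unfolding g(1) using dc c[OF g(2)]
   by (auto simp: hom_group_def compose_def zero_map_def fun_eq_iff Y.minus_eq Y.l_neg)
  ultimately show "inv\<^bsub>?G\<^esub> f : ?B" using G.inv_equality[of _ f] BZ fB by (auto simp: subset_iff)
  fix f' assume "f' : ?B"
  then obtain g' where g': "f' = compose (carrier (P ?i)) g' (d j)" "g' : mod_hom A (P j) Y" unfolding Bi by (elim imageE)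
  show "f *[?G] f' : ?B" unfolding Bi
   by (rule image_eqI[OF _ add[OF g(2) g'(2)]]) (use dc in "auto simp: hom_group_def g(1) g'(1) compose_def fun_eq_iff")
 qed
 have N: "?B \<lhd> ?G" by (rule G.subgroup_imp_normal[OF H])
 have fold: "Ext_from A P d Y ?i = ?G Mod ?B" by (simp add: Ext_from_def)
 have "trivial_group (?G Mod ?B) \<longleftrightarrow> ?Z <= ?B"
 proof
  assume t: "trivial_group (?G Mod ?B)"
  show "?Z <= ?B"
  proof
   fix f assume f: "f : ?Z"
   have "?B #>\<^bsub>?G\<^esub> f \<in>[?G Mod ?B]" using f by (auto simp: FactGroup_def RCOSETS_def)
   hence e: "?B #>\<^bsub>?G\<^esub> f = ?B" using t by (simp add: trivial_group_def FactGroup_def)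
   have "1[?G] *[?G] f : ?B #>\<^bsub>?G\<^esub> f" using zB unfolding r_coset_def by blast
   moreover have "1[?G] *[?G] f = f" by (rule G.l_one) (use f in simp)
   ultimately show "f : ?B" using e by simp
  qed
 next
  assume ZB: "?Z <= ?B"
  have "carrier (?G Mod ?B) = {?B}"
  proof (intro equalityI subsetI)
   fix c assume "c \<in>[?G Mod ?B]"
   then obtain f where f: "f : ?Z" "c = ?B #>\<^bsub>?G\<^esub> f" by (auto simp: FactGroup_def RCOSETS_def)
   thus "c : {?B}" using G.coset_join2[OF _ H, of f] ZB by auto
  next
   fix c assume "c : {?B}"
   hence "c = ?B #>\<^bsub>?G\<^esub> 1[?G]" using G.coset_join2[OF G.one_closed H zB] by simp
   thus "c \<in>[?G Mod ?B]" using G.one_closed unfolding FactGroup_def RCOSETS_def by auto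
  qed
  thus "trivial_group (?G Mod ?B)"
   using normal.factorgroup_is_group[OF N] by (simp add: trivial_group_def FactGroup_def)
 qed
 also have "?Z <= ?B \<longleftrightarrow> extends A (P j) (d j ` carrier (P ?i)) Y"
 proof
  let ?K = "d j ` carrier (P ?i)"
  have sK: "submodule ?K A (P j)" by (rule image_submodule[OF Pm Pm d carrier_submodule[OF Pm]])
  note Km = sub_lmod[OF Pm sK]
  have KP: "?K <= carrier (P j)" using dc by auto
  have dK: "lin A (P ?i) (sub (P j) ?K) (d j)" unfolding lin_into_sub[OF KP] using d by simp
  {
   assume ZB: "?Z <= ?B"
   show "extends A (P j) ?K Y" unfolding extends_def
   proof (intro allI impI)
    fix h assume h: "lin A (sub (P j) ?K) Y h"
    let ?f = "restrict (%x. h (d j x)) (carrier (P ?i))"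
    have "?f : ?Z" unfolding Zi using lin_mod_hom[OF Pm lin_comp[OF dK h]] lin_zero[OF Km Y h] by (auto simp: ker_def)
    hence "?f : ?B" using ZB by blast
    then obtain g where g: "?f = compose (carrier (P ?i)) g (d j)" "g : mod_hom A (P j) Y" unfolding Bi by (elim imageE)
    have "g (d j x) = h (d j x)" if "x \<in>[P ?i]" for x using fun_cong[OF g(1), of x] that by (simp add: compose_def)
    thus "\<exists>g. lin A (P j) Y g & (\<forall>x\<in>?K. g x = h x)" using mod_hom_lin[OF g(2)] by auto
   qed
  }
  {
   assume ext: "extends A (P j) ?K Y"
   show "?Z <= ?B"
   proof
    fix f assume "f : ?Z"
    hence f: "f : mod_hom A (P ?i) Y" "!!x. x : ker (P (Suc j)) (P j) (d j) ==> f x = 0[Y]" by (auto simp: Zi)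
    obtain h where h: "lin A (sub (P j) ?K) Y h" "!!x. x \<in>[P ?i] ==> h (d j x) = f x"
    proof (rule factor_surj[OF Pm Km Y dK _ mod_hom_lin[OF f(1)]])
     show "d j ` carrier (P ?i) = carrier (sub (P j) ?K)" by simp
     show "ker (P ?i) (sub (P j) ?K) (d j) <= ker (P ?i) Y f" using f(2) by (auto simp: ker_def)
    qed blast
    obtain g where g: "lin A (P j) Y g" "!!x. x : ?K ==> g x = h x" using ext h(1) unfolding extends_def by metis
    have "f = compose (carrier (P ?i)) (restrict g (carrier (P j))) (d j)"
     using h(2) g(2) dc xt[OF f(1)] by (auto simp: compose_def fun_eq_iff)
    thus "f : ?B" unfolding Bi using lin_mod_hom[OF Pm g(1)] by blast
   qed
  }
 qed
 finally show ?thesis unfolding fold .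
qed

context noetherian_algebra
begin

lemma ker_fg:
 assumes "fgm L X" "lmod L Y" "lin L X Y f" shows "fgm L (sub X (ker X Y f))"
 using noeth_algebra[OF assms(1)] ker_submodule[OF fg_lmod[OF assms(1)] assms(2,3)] by (simp add: noeth_def)

lemma pres_syzygy:
 assumes "pres L P e X" "lmod L X" shows "fgm L (sub P (ker P X e))"
 by (rule ker_fg[OF presD(1)[OF assms(1)] assms(2) presD(3)[OF assms(1)]])

lemma resolution_exists:
 fixes X :: "'l umod"
 assumes X: "fgm L X"
 shows "\<exists>(P :: nat => 'l umod) d e. projective_resolution L P d e X"
proof -
 define cov :: "'l umod => 'l umod \<times> ((nat => 'l) set => (nat => 'l) set)"
  where "cov K = (SOME p. pres L (fst p) (snd p) K & projective_module L (fst p))" for K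
 have cov: "pres L (fst (cov K)) (snd (cov K)) K" "projective_module L (fst (cov K))" if K: "fgm L K" for K :: "'l umod"
 proof -
  obtain P :: "'l umod" and e where "pres L P e K" "projective_module L P" using presentation_exists[OF K] .
  hence "pres L (fst (P, e)) (snd (P, e)) K & projective_module L (fst (P, e))" by simp
  hence "pres L (fst (cov K)) (snd (cov K)) K & projective_module L (fst (cov K))" unfolding cov_def by (rule someI)
  thus "pres L (fst (cov K)) (snd (cov K)) K" "projective_module L (fst (cov K))" by auto
 qed
 define K where "K = rec_nat X (%_ K. sub (fst (cov K)) (ker (fst (cov K)) K (snd (cov K))))"
 define P where "P n = fst (cov (K n))" for n
 define ee where "ee n = snd (cov (K n))" for n
 have K0: "K 0 = X" and KS: "K (Suc n) = sub (P n) (ker (P n) (K n) (ee n))" for n by (simp_all add: K_def P_def ee_def)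
 have fgK: "fgm L (K n)" for n
 proof (induct n)
  case (Suc n)
  show ?case unfolding KS P_def ee_def by (rule pres_syzygy[OF cov(1)[OF Suc] fg_lmod[OF Suc]])
 qed (simp add: K0 X)
 have p: "pres L (P n) (ee n) (K n)" and pp: "projective_module L (P n)" for n
  unfolding P_def ee_def using cov[OF fgK] by auto
 note Pm = presD(2)[OF p] and im = presD(4)[OF p]
 define d where "d n = restrict (ee (Suc n)) (carrier (P (Suc n)))" for n
 define e where "e = restrict (ee 0) (carrier (P 0))"
 have kr: "ker U V (restrict f (carrier U)) = ker U V f" for U V :: "'l umod" and f by (auto simp: ker_def)
 have "resolution L P d e X" unfolding resolution_def a_kernel_ker
 proof (intro conjI allI)
  fix i
  show "lmod L (P i)" by (rule Pm)
  show "e : mod_hom L (P 0) X" unfolding e_def using lin_mod_hom[OF Pm presD(3)[OF p[of 0]]] by (simp add: K0)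
  have k: "ker (P i) (K i) (ee i) <= carrier (P i)" by (auto simp: ker_def)
  have "lin L (P (Suc i)) (P i) (ee (Suc i))"
   using presD(3)[OF p[of "Suc i"]] unfolding KS lin_into_sub[OF k] by simp
  thus "d i : mod_hom L (P (Suc i)) (P i)" unfolding d_def by (rule lin_mod_hom[OF Pm])
  show "e ` carrier (P 0) = carrier X" using im[of 0] by (simp add: e_def K0)
  show "d 0 ` carrier (P (Suc 0)) = ker (P 0) X e" using im[of "Suc 0"] by (simp add: d_def e_def kr KS K0)
  show "d (Suc i) ` carrier (P (Suc (Suc i))) = ker (P (Suc i)) (P i) (d i)"
   using im[of "Suc (Suc i)"] by (simp add: d_def kr KS) (simp add: ker_def)
 qed
 thus ?thesis using pp by (auto simp: projective_resolution_def)
qed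

lemma ext_vanish_resolution:
 fixes X X' :: "'l umod" and P' :: "nat => 'l umod"
 assumes Y: "lmod L Y" and X: "fgm L X" and X': "lmod L X'"
  and res: "resolution L P' d' e' X'" and P': "!!i. \<exists>I :: (nat => 'l) set set. rfree L I (P' i)"
  and s: "sretr L (P' 0) e' X' X" and s': "!!(P :: 'l umod) e. pres L P e X ==> sretr L P e X X'"
 shows "extends L (P' i) (d' i ` carrier (P' (Suc i))) Y \<longleftrightarrow> ext_vanish L Y i X"
 using X X' res P' s s'
proof (induct i arbitrary: X X' P' d' e')
 case (0 X X' P' d' e')
 note Xm = fg_lmod[OF 0(1)]
 have e': "lin L (P' 0) X' e'" "e' ` carrier (P' 0) = carrier X'" "d' 0 ` carrier (P' (Suc 0)) = ker (P' 0) X' e'"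
  using 0(3) mod_hom_lin[of e'] unfolding resolution_def a_kernel_ker by auto
 obtain I :: "(nat => 'l) set set" where I: "rfree L I (P' 0)" using 0(4) by blast
 have "extends L P (ker P X e) Y" if p: "pres L P e X" and x: "extends L (P' 0) (ker (P' 0) X' e') Y" for P :: "'l umod" and e
 proof -
  obtain n where n: "rfree L {..<n::nat} P" using presD(5)[OF p] ..
  show ?thesis by (rule sretr_extends[OF Xm 0(2) Y 0(6)[OF p] n presD(3,4)[OF p] I e'(1,2) x])
 qed
 moreover have "extends L (P' 0) (ker (P' 0) X' e') Y" if v: "ext_vanish L Y 0 X"
 proof -
  obtain P :: "'l umod" and e where p: "pres L P e X" using presentation_exists[OF 0(1)] .
  obtain n where n: "rfree L {..<n::nat} P" using presD(5)[OF p] ..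
  have "extends L P (ker P X e) Y" using v p by simp
  from sretr_extends[OF 0(2) Xm Y 0(5) I e'(1,2) n presD(3,4)[OF p] this] show ?thesis .
 qed
 ultimately show ?case unfolding e'(3) by (simp only: ext_vanish.simps) blast
next
 case (Suc i X X' P' d' e')
 note Xm = fg_lmod[OF Suc(2)]
 have e': "lin L (P' 0) X' e'" "e' ` carrier (P' 0) = carrier X'" "d' 0 ` carrier (P' (Suc 0)) = ker (P' 0) X' e'"
  and P'm: "!!i. lmod L (P' i)" and d: "d' 0 : mod_hom L (P' (Suc 0)) (P' 0)"
  using Suc(4) mod_hom_lin[of e'] unfolding resolution_def a_kernel_ker by auto
 let ?X = "sub (P' 0) (ker (P' 0) X' e')"
 have k: "ker (P' 0) X' e' <= carrier (P' 0)" by (auto simp: ker_def)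
 have X'm: "lmod L ?X" by (rule sub_lmod[OF P'm ker_submodule[OF P'm Suc(3) e'(1)]])
 have d': "d' 0 : mod_hom L (P' (Suc 0)) ?X" using d unfolding mod_hom_iff_lin lin_into_sub[OF k] by (simp add: e'(3))
 have res: "resolution L (%i. P' (Suc i)) (%i. d' (Suc i)) (d' 0) ?X"
  using Suc(4) d' e'(3) unfolding resolution_def a_kernel_ker by (simp add: ker_def)
 have step: "extends L (P' (Suc i)) (d' (Suc i) ` carrier (P' (Suc (Suc i)))) Y \<longleftrightarrow> ext_vanish L Y i (sub P (ker P X e))"
  if p: "pres L P e X" for P :: "'l umod" and e
 proof -
  obtain n where n: "rfree L {..<n::nat} P" using presD(5)[OF p] ..
  obtain I :: "(nat => 'l) set set" where I: "rfree L I (P' 0)" using Suc(5) by blast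
  have s1: "sretr L (P' (Suc 0)) (d' 0) ?X (sub P (ker P X e))"
   by (rule sretr_syzygy[OF Suc(3) Xm Suc(6) I e'(1,2) n presD(3,4)[OF p] P'm mod_hom_lin[OF d'] e'(3)])
  have s2: "sretr L Q q (sub P (ker P X e)) ?X" if q: "pres L Q q (sub P (ker P X e))" for Q :: "'l umod" and q
   by (rule sretr_syzygy[OF Xm Suc(3) Suc(7)[OF p] n presD(3,4)[OF p] I e'(1,2) presD(2,3)[OF q]]) (use presD(4)[OF q] in simp)
  show ?thesis using Suc(1)[OF pres_syzygy[OF p Xm] X'm res Suc(5) s1 s2] .
 qed
 obtain P :: "'l umod" and e where "pres L P e X" using presentation_exists[OF Suc(2)] .
 with step show ?case by (simp only: ext_vanish.simps) blast
qed

lemma ext_vanish_sretr: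
 fixes X X' :: "'l umod"
 assumes Y: "lmod L Y" and X: "fgm L X" and X': "fgm L X'"
  and s: "!!(P :: 'l umod) e. pres L P e X ==> sretr L P e X X'" and v: "ext_vanish L Y i X'"
 shows "ext_vanish L Y i X"
 using X X' s v
proof (induct i arbitrary: X X')
 case (0 X X')
 show ?case unfolding ext_vanish.simps
 proof (intro allI impI)
  fix P :: "'l umod" and e assume p: "pres L P e X"
  obtain P' :: "'l umod" and e' where p': "pres L P' e' X'" using presentation_exists[OF 0(2)] .
  obtain n n' where n: "rfree L {..<n::nat} P" "rfree L {..<n'::nat} P'" using presD(5)[OF p] presD(5)[OF p'] by auto
  have v: "extends L P' (ker P' X' e') Y" using 0(4) p' by simp
  show "extends L P (ker P X e) Y"
   by (rule sretr_extends[OF fg_lmod[OF 0(1)] fg_lmod[OF 0(2)] Y 0(3)[OF p] n(1) presD(3,4)[OF p] n(2) presD(3,4)[OF p'] v])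
 qed
next
 case (Suc i X X')
 note m = Suc(2,3)[THEN fg_lmod]
 show ?case unfolding ext_vanish.simps
 proof (intro allI impI)
  fix P :: "'l umod" and e assume p: "pres L P e X"
  obtain P' :: "'l umod" and e' where p': "pres L P' e' X'" using presentation_exists[OF Suc(3)] .
  obtain n n' where n: "rfree L {..<n::nat} P" "rfree L {..<n'::nat} P'" using presD(5)[OF p] presD(5)[OF p'] by auto
  show "ext_vanish L Y i (sub P (ker P X e))"
  proof (rule Suc(1)[OF pres_syzygy[OF p m(1)] pres_syzygy[OF p' m(2)]])
   fix Q :: "'l umod" and q assume q: "pres L Q q (sub P (ker P X e))"
   show "sretr L Q q (sub P (ker P X e)) (sub P' (ker P' X' e'))"
    by (rule sretr_syzygy[OF m Suc(4)[OF p] n(1) presD(3,4)[OF p] n(2) presD(3,4)[OF p'] presD(2,3)[OF q]])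
     (use presD(4)[OF q] in simp)
  next
   show "ext_vanish L Y i (sub P' (ker P' X' e'))" using Suc(5) p' by simp
  qed
 qed
qed

lemma ext_vanish_0_pres:
 fixes X P :: "'l umod"
 assumes Y: "lmod L Y" and X: "lmod L X" and p: "pres L P e X" and ext: "extends L P (ker P X e) Y"
 shows "ext_vanish L Y 0 X"
 unfolding ext_vanish.simps
proof (intro allI impI)
 fix P' :: "'l umod" and e' assume p': "pres L P' e' X"
 obtain n n' where n: "rfree L {..<n::nat} P" "rfree L {..<n'::nat} P'" using presD(5)[OF p] presD(5)[OF p'] by auto
 show "extends L P' (ker P' X e') Y"
  by (rule sretr_extends[OF X X Y sretr_refl[OF X presD(2,3)[OF p']] n(2) presD(3,4)[OF p'] n(1) presD(3,4)[OF p] ext])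
qed

lemma ext_vanish_Suc_pres:
 fixes X P :: "'l umod"
 assumes Y: "lmod L Y" and X: "lmod L X" and p: "pres L P e X" and v: "ext_vanish L Y i (sub P (ker P X e))"
 shows "ext_vanish L Y (Suc i) X"
 unfolding ext_vanish.simps
proof (intro allI impI)
 fix P' :: "'l umod" and e' assume p': "pres L P' e' X"
 obtain n n' where n: "rfree L {..<n::nat} P" "rfree L {..<n'::nat} P'" using presD(5)[OF p] presD(5)[OF p'] by auto
 show "ext_vanish L Y i (sub P' (ker P' X e'))"
 proof (rule ext_vanish_sretr[OF Y pres_syzygy[OF p' X] pres_syzygy[OF p X] _ v])
  fix Q :: "'l umod" and q assume q: "pres L Q q (sub P' (ker P' X e'))"
  show "sretr L Q q (sub P' (ker P' X e')) (sub P (ker P X e))"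
   by (rule sretr_syzygy[OF X X sretr_refl[OF X presD(2,3)[OF p']] n(2) presD(3,4)[OF p'] n(1) presD(3,4)[OF p] presD(2,3)[OF q]])
    (use presD(4)[OF q] in simp)
 qed
qed

lemma Ext_trivial_iff:
 fixes X :: "'l umod"
 assumes X: "fgm L X" and Y: "lmod L Y"
 shows "trivial_group (Ext L (Suc i) X Y) \<longleftrightarrow> ext_vanish L Y i X"
proof -
 note Xm = fg_lmod[OF X]
 let ?S = "SOME (P :: nat => 'l umod, d, e). projective_resolution L P d e X"
 obtain P :: "nat => 'l umod" and d e where S: "?S = (P, d, e)" using prod_cases3 by blast
 have "\<exists>x. case x of (P :: nat => 'l umod, d, e) => projective_resolution L P d e X"
  using resolution_exists[OF X] by auto
 from someI_ex[OF this] have "case ?S of (P :: nat => 'l umod, d, e) => projective_resolution L P d e X" .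
 hence r: "resolution L P d e X" "!!i. projective_module L (P i)" unfolding S by (auto simp: projective_resolution_def)
 have e: "Ext L (Suc i) X Y = Ext_from L P d Y (Suc i)" unfolding Ext_def S by simp
 have l: "lmod L (P 0)" "lin L (P 0) X e" using r(1) mod_hom_lin by (auto simp: resolution_def)
 show ?thesis unfolding e Ext_from_trivial_iff[OF r(1) Y]
  by (rule ext_vanish_resolution[OF Y X Xm r(1) projective_rfree[OF r(2)] sretr_refl[OF Xm l] sretr_refl[OF Xm presD(2,3)]])
qed

lemma Ext_perp_1_iff:
 fixes X :: "'l umod"
 assumes "fgm L X" "lmod L Y" shows "Ext_perp L 1 X Y \<longleftrightarrow> ext_vanish L Y 0 X"
proof -
 have "i = Suc 0" if "i > 0" "enat i \<le> 1" for i using that by (simp add: one_enat_def)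
 moreover have "enat (Suc 0) \<le> 1" by (simp add: one_enat_def)
 ultimately show ?thesis unfolding Ext_perp_def Ext_trivial_iff[OF assms, symmetric] by (metis zero_less_Suc)
qed

lemma Ext_perp_infinity_iff:
 fixes X :: "'l umod"
 assumes "fgm L X" "lmod L Y" shows "Ext_perp L \<infinity> X Y \<longleftrightarrow> (\<forall>i. ext_vanish L Y i X)"
 unfolding Ext_perp_def Ext_trivial_iff[OF assms, symmetric] by (metis enat_ord_code(3) gr0_conv_Suc zero_less_Suc)

text \<open>
 The vanishing of \<open>Ext\<^sup>1\<close> extends maps along every epimorphism onto \<open>X\<close>, by comparing it with a
 projective presentation.
\<close>

lemma ext_vanish_0_extends:
 fixes X :: "'l umod"
 assumes Y: "lmod L Y" and X: "fgm L X" and v: "ext_vanish L Y 0 X"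
  and E: "lmod L E" and e: "lin L E X e" "e ` carrier E = carrier X"
 shows "extends L E (ker E X e) Y"
 unfolding extends_def
proof (intro allI impI)
 note Xm = fg_lmod[OF X]
 interpret Y: left_module L Y by fact
 interpret X: left_module L X by (rule Xm)
 interpret E: left_module L E by fact
 fix h assume h: "lin L (sub E (ker E X e)) Y h"
 obtain P :: "'l umod" and p where p: "pres L P p X" using presentation_exists[OF X] .
 obtain n where n: "rfree L {..<n::nat} P" using presD(5)[OF p] ..
 note Pm = presD(2)[OF p]
 obtain u where u: "lin L P E u" "!!x. x \<in>[P] ==> e (u x) = p x"
  using rfree_lift[OF n Xm E e presD(3)[OF p]] by blast
 have kE: "ker E X e <= carrier E" and kP: "ker P X p <= carrier P" by (auto simp: ker_def)
 have uk: "u x : ker E X e" if "x : ker P X p" for x using that u lin_cl[OF u(1)] by (auto simp: ker_def)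
 have "lin L (sub P (ker P X p)) (sub E (ker E X e)) u"
  unfolding lin_into_sub[OF kE] using lin_from_sub[OF u(1) kP] uk by auto
 from lin_comp[OF this h] have "lin L (sub P (ker P X p)) Y (%x. h (u x))" .
 moreover have "extends L P (ker P X p) Y" using v p by simp
 ultimately obtain g where g: "lin L P Y g" "!!x. x : ker P X p ==> g x = h (u x)" unfolding extends_def by blast
 let ?K = "sub E (ker E X e)"
 have K: "lmod L ?K" by (rule sub_lmod[OF E ker_submodule[OF E Xm e(1)]])
 let ?S = "dirsum ?K P"
 let ?f = "%z. fst z +[E] u (snd z)" and ?g = "%z. h (fst z) +[Y] g (snd z)"
 have f: "lin L ?S E ?f" by (intro lin_plus[OF E] lin_fst'[OF lin_incl[OF kE]] lin_snd'[OF u(1)])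
 have gl: "lin L ?S Y ?g" by (intro lin_plus[OF Y] lin_fst'[OF h] lin_snd'[OF g(1)])
 have surj: "?f ` carrier ?S = carrier E"
 proof (intro equalityI subsetI)
  fix y assume y: "y \<in>[E]"
  have "e y : p ` carrier P" unfolding presD(4)[OF p] by (rule lin_cl[OF e(1) y])
  then obtain x where x: "x \<in>[P]" "e y = p x" by (elim imageE)
  note ux = lin_cl[OF u(1) x(1)]
  have px: "p x \<in>[X]" by (rule lin_cl[OF presD(3)[OF p] x(1)])
  have "e (y -[E] u x) = 0[X]" unfolding lin_diff[OF E Xm e(1) y ux] using x(2) u(2)[OF x(1)] px by (simp add: X.minus_eq X.r_neg)
  hence "y -[E] u x : ker E X e" using y ux by (simp add: ker_def)
  thus "y : ?f ` carrier ?S" using x(1) y ux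
   by (intro image_eqI[of _ _ "(y -[E] u x, x)"]) (auto simp: E.minus_eq E.a_assoc E.l_neg)
 next
  fix y assume "y : ?f ` carrier ?S"
  thus "y \<in>[E]" using lin_cl[OF f] by (elim imageE) simp
 qed
 have kk: "ker ?S E ?f <= ker ?S Y ?g"
 proof
  fix z assume "z : ker ?S E ?f"
  hence z: "fst z : ker E X e" "snd z \<in>[P]" "fst z +[E] u (snd z) = 0[E]" "z : carrier ?S"
   by (simp_all add: ker_def mem_Times_iff)
  note us = lin_cl[OF u(1) z(2)]
  have fz: "fst z \<in>[E]" using z(1) kE by blast
  have "e (fst z) +[X] e (u (snd z)) = 0[X]" using lin_add[OF e(1) fz us] z(3) lin_zero[OF E Xm e(1)] by simp
  hence "p (snd z) = 0[X]" using z(1) u(2)[OF z(2)] lin_cl[OF presD(3)[OF p] z(2)] by (simp add: ker_def)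
  hence sk: "snd z : ker P X p" using z(2) by (simp add: ker_def)
  have "h (fst z) +[Y] g (snd z) = h (fst z +[E] u (snd z))" using lin_add[OF h, of "fst z" "u (snd z)"] z(1) uk[OF sk] g(2)[OF sk] by simp
  also have "... = 0[Y]" using z(3) lin_zero[OF K Y h] by simp
  finally show "z : ker ?S Y ?g" using z(4) by (simp add: ker_def)
 qed
 obtain g' where g': "lin L E Y g'" "!!z. z : carrier ?S ==> g' (?f z) = ?g z"
  using factor_surj[OF dsum_lmod[OF K Pm] E Y f surj gl kk] by blast
 have "g' x = h x" if x: "x : ker E X e" for x
  using g'(2)[of "(x, 0[P])"] x kE lin_zero[OF Pm E u(1)] lin_zero[OF Pm Y g(1)] lmodD(2)[OF Pm] lin_cl[OF h, of x] by auto
 thus "\<exists>g. lin L E Y g & (\<forall>x\<in>ker E X e. g x = h x)" using g'(1) by blast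
qed

lemma ext_vanish_projective:
 fixes X :: "'l umod"
 assumes Y: "lmod L Y" and X: "fproj L X" shows "ext_vanish L Y i X"
 using X
proof (induct i arbitrary: X)
 case (0 X)
 hence X: "lmod L X" and p: "pres L X (%x. x) X" using fg_lmod by (auto simp: fproj_def pres_def lin_id)
 interpret Y: left_module L Y by fact
 have K: "lmod L (sub X (ker X X (%x. x)))" by (rule sub_lmod[OF X ker_submodule[OF X X lin_id]])
 have "extends L X (ker X X (%x. x)) Y" unfolding extends_def
 proof (intro allI impI exI conjI ballI)
  show "lin L X Y (%_. 0[Y])" by (rule lin_zero_map[OF Y])
  fix h x assume "lin L (sub X (ker X X (%x. x))) Y h" "x : ker X X (%x. x)"
  thus "0[Y] = h x" using lin_zero[OF K Y, of h] by (simp add: ker_def)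
 qed
 thus ?case by (rule ext_vanish_0_pres[OF Y X p])
next
 case (Suc i X)
 hence X: "lmod L X" and p: "pres L X (%x. x) X" using fg_lmod by (auto simp: fproj_def pres_def lin_id)
 obtain n where n: "rfree L {..<n::nat} X" using presD(5)[OF p] ..
 let ?K = "sub X (ker X X (%x. x))"
 have K: "fgm L ?K" by (rule pres_syzygy[OF p X])
 have "rfree L {..<n} ?K"
  by (rule rfree_retract[OF n fg_lmod[OF K] lin_incl lin_zero_map[OF fg_lmod[OF K]]]) (auto simp: ker_def)
 with Suc(1)[of ?K] K show ?case by (intro ext_vanish_Suc_pres[OF Y X p]) (auto simp: fproj_def)
qed

definition ses :: "'l umod => 'l umod => 'l umod => (_ => _) => (_ => _) => bool" where
 "ses U V W f g \<longleftrightarrow> fgm L U & fgm L V & fgm L W & lin L U V f & lin L V W g &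
   inj_on f (carrier U) & g ` carrier V = carrier W & f ` carrier U = ker V W g"

text \<open>
 The middle term is the kernel of the composite \<open>Q \<rightarrow> V \<rightarrow> W\<close>, which is mapped onto \<open>U\<close> by \<open>e\<close>.
\<close>

lemma ses_rotate:
 assumes s: "ses U V W f g" and p: "pres L Q e V"
 obtains k where "pres L Q (%x. g (e x)) W"
  "ses (sub Q (ker Q V e)) (sub Q (ker Q W (%x. g (e x)))) U (%x. x) k"
proof -
 have fg: "fgm L U" "fgm L V" "fgm L W" and f: "lin L U V f" and g: "lin L V W g"
  and inj: "inj_on f (carrier U)" and gs: "g ` carrier V = carrier W" and fk: "f ` carrier U = ker V W g"
  using s by (auto simp: ses_def)
 note m = fg[THEN fg_lmod]
 have ge: "lin L Q W (%x. g (e x))" by (rule lin_comp[OF presD(3)[OF p] g])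
 have "(%x. g (e x)) ` carrier Q = g ` e ` carrier Q" by (simp add: image_image)
 hence pW: "pres L Q (%x. g (e x)) W" using p ge gs by (simp add: pres_def)
 let ?W = "ker Q W (%x. g (e x))"
 have WQ: "?W <= carrier Q" by (auto simp: ker_def)
 have fW: "fgm L (sub Q ?W)" by (rule pres_syzygy[OF pW m(3)])
 have eW: "e x : ker V W g" if "x : ?W" for x using that lin_cl[OF presD(3)[OF p]] by (auto simp: ker_def)
 obtain k where k: "lin L (sub Q ?W) U k" "!!x. x \<in>[sub Q ?W] ==> f (k x) = e x"
 proof (rule factor_inj[OF m(1,2) fg_lmod[OF fW] f inj lin_from_sub[OF presD(3)[OF p] WQ]])
  show "e ` carrier (sub Q ?W) <= f ` carrier U" unfolding fk using eW by auto
 qed blast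
 have z: "k x = 0[U] \<longleftrightarrow> e x = 0[V]" if "x : ?W" for x
  using k(2)[of x] that inj_onD[OF inj, of "k x" "0[U]"] lin_zero[OF m(1,2) f] lin_cl[OF k(1), of x] lmodD(2)[OF m(1)]
  by auto
 have kk: "ker Q V e = ker (sub Q ?W) U k"
  using z lin_zero[OF m(2,3) g] by (fastforce simp: ker_def)
 have "k ` ?W = carrier U"
 proof (intro equalityI subsetI)
  fix u assume u: "u \<in>[U]"
  have fu: "f u : ker V W g" using u fk by blast
  hence "f u : e ` carrier Q" unfolding presD(4)[OF p] by (simp add: ker_def)
  then obtain x where x: "x \<in>[Q]" "f u = e x" by (elim imageE)
  have xW: "x : ?W" using x fu by (simp add: ker_def)
  hence "f (k x) = f u" using k(2)[of x] x by simp
  from inj_onD[OF inj this] have "k x = u" using lin_cl[OF k(1), of x] xW u by simp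
  thus "u : k ` ?W" using xW by blast
 next
  fix u assume "u : k ` ?W"
  thus "u \<in>[U]" using lin_cl[OF k(1)] by (elim imageE) simp
 qed
 hence "ses (sub Q (ker Q V e)) (sub Q ?W) U (%x. x) k"
  unfolding ses_def using k(1) fW fg(1) pres_syzygy[OF p m(2)] kk[symmetric]
  by (simp add: lin_def) (auto simp: kk ker_def)
 thus ?thesis using that pW by blast
qed

text \<open>
 Two pieces of the long exact sequence. Rotating \<open>0 \<rightarrow> U \<rightarrow> V \<rightarrow> W \<rightarrow> 0\<close> to \<open>0 \<rightarrow> \<Omega>V \<rightarrow> \<Omega>W \<rightarrow> U \<rightarrow> 0\<close>
 turns each of them, one degree higher, into the other one.
\<close>

lemma ext_vanish_ses:
 assumes Y: "lmod L Y"
 shows "ses U V W f g ==> ext_vanish L Y i V ==> ext_vanish L Y (Suc i) W ==> ext_vanish L Y i U"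
  and "ses U V W f g ==> ext_vanish L Y i U ==> ext_vanish L Y i W ==> ext_vanish L Y i V"
proof (induct i arbitrary: U V W f g)
 case 0
 interpret Y: left_module L Y by fact
 {
  case (1 U V W f g)
  hence fg: "fgm L U" "fgm L V" "fgm L W" by (auto simp: ses_def)
  note m = fg[THEN fg_lmod]
  obtain Q :: "'l umod" and e where p: "pres L Q e V" using presentation_exists[OF fg(2)] .
  obtain k where k: "pres L Q (%x. g (e x)) W"
   "ses (sub Q (ker Q V e)) (sub Q (ker Q W (%x. g (e x)))) U (%x. x) k" using ses_rotate[OF 1(1) p] .
  let ?W = "sub Q (ker Q W (%x. g (e x)))" and ?V = "sub Q (ker Q V e)"
  have fW: "fgm L ?W" and fV: "fgm L ?V" using k(2) by (auto simp: ses_def)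
  note Wm = fg_lmod[OF fW] and Vm = fg_lmod[OF fV]
  obtain P :: "'l umod" and e' where p': "pres L P e' ?W" using presentation_exists[OF fW] .
  obtain k' where k': "pres L P (%x. k (e' x)) U"
   "ses (sub P (ker P ?W e')) (sub P (ker P U (%x. k (e' x)))) ?V (%x. x) k'" using ses_rotate[OF k(2) p'] .
  let ?U = "ker P U (%x. k (e' x))"
  have UP: "?U <= carrier P" by (auto simp: ker_def)
  have Um: "lmod L (sub P ?U)" using k'(2) fg_lmod by (auto simp: ses_def)
  have e'l: "lin L P Q e'" using presD(3)[OF p'] lin_into_sub[of "ker Q W (%x. g (e x))" Q L P e'] by (auto simp: ker_def)
  have e'V: "e' x : ker Q V e" if "x : ?U" for x
  proof -
   have "ker Q V e = ker ?W U k" using k(2) by (simp add: ses_def)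
   thus ?thesis using that lin_cl[OF presD(3)[OF p'], of x] by (auto simp: ker_def)
  qed
  have "extends L P ?U Y" unfolding extends_def
  proof (intro allI impI)
   fix h assume h: "lin L (sub P ?U) Y h"
   have sU: "ker P ?W e' <= ?U" using k'(2) by (auto simp: ses_def ker_def)
   have "lin L (sub (sub P ?U) (ker P ?W e')) Y h" by (rule lin_from_sub[OF h]) (use sU in simp)
   hence h1: "lin L (sub P (ker P ?W e')) Y h" by simp
   have "ext_vanish L Y 0 ?W" using 1(3) k(1) by simp
   hence "extends L P (ker P ?W e') Y" using p' by simp
   then obtain g1 where g1: "lin L P Y g1" "!!x. x : ker P ?W e' ==> g1 x = h x" using h1 unfolding extends_def by blast
   let ?h = "%x. h x -[Y] g1 x"
   have hl: "lin L (sub P ?U) Y ?h" by (rule lin_subtract[OF Y h lin_from_sub[OF g1(1) UP]])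
   have eUV: "lin L (sub P ?U) ?V e'"
    using lin_from_sub[OF e'l UP] e'V lin_into_sub[of "ker Q V e" Q L "sub P ?U" e'] by (auto simp: ker_def)
   have surj: "e' ` carrier (sub P ?U) = carrier ?V"
   proof (intro equalityI subsetI)
    fix y assume y: "y : carrier ?V"
    have "ker Q V e = ker ?W U k" using k(2) by (simp add: ses_def)
    hence yk: "y : ker ?W U k" using y by simp
    hence "y : e' ` carrier P" unfolding presD(4)[OF p'] by (simp add: ker_def)
    then obtain x where "x \<in>[P]" "y = e' x" by (elim imageE)
    thus "y : e' ` carrier (sub P ?U)" using yk by (intro image_eqI[of _ _ x]) (auto simp: ker_def)
   qed (use e'V in auto)
   have kk: "ker (sub P ?U) ?V e' <= ker (sub P ?U) Y ?h"
   proof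
    fix x assume x: "x : ker (sub P ?U) ?V e'"
    hence "x : ker P ?W e'" by (auto simp: ker_def)
    thus "x : ker (sub P ?U) Y ?h" using g1(2)[of x] x lin_cl[OF h, of x] by (simp add: ker_def Y.minus_eq Y.r_neg)
   qed
   obtain h' where h': "lin L ?V Y h'" "!!x. x \<in>[sub P ?U] ==> h' (e' x) = ?h x"
    using factor_surj[OF Um Vm Y eUV surj hl kk] by blast
   have "extends L Q (ker Q V e) Y" using 1(2) p by simp
   then obtain g2 where g2: "lin L Q Y g2" "!!x. x : ker Q V e ==> g2 x = h' x" using h'(1) unfolding extends_def by blast
   have "g2 (e' x) +[Y] g1 x = h x" if x: "x : ?U" for x
   proof -
    have "g2 (e' x) = h x -[Y] g1 x" using g2(2)[OF e'V[OF x]] h'(2)[of x] x by simp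
    moreover have "h x \<in>[Y]" "g1 x \<in>[Y]" using lin_cl[OF h, of x] lin_cl[OF g1(1), of x] x UP by auto
    ultimately show ?thesis by (simp add: Y.minus_eq Y.a_assoc Y.l_neg)
   qed
   thus "\<exists>g. lin L P Y g & (\<forall>x\<in>?U. g x = h x)" using lin_plus[OF Y lin_comp[OF e'l g2(1)] g1(1)] by blast
  qed
  thus ?case by (rule ext_vanish_0_pres[OF Y m(1) k'(1)])
 next
  case (2 U V W f g)
  hence fg: "fgm L U" "fgm L V" "fgm L W" by (auto simp: ses_def)
  note m = fg[THEN fg_lmod]
  obtain Q :: "'l umod" and e where p: "pres L Q e V" using presentation_exists[OF fg(2)] .
  obtain k where k: "pres L Q (%x. g (e x)) W"
   "ses (sub Q (ker Q V e)) (sub Q (ker Q W (%x. g (e x)))) U (%x. x) k" using ses_rotate[OF 2(1) p] .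
  let ?W = "sub Q (ker Q W (%x. g (e x)))"
  have kl: "lmod L ?W" "lin L ?W U k" "k ` carrier ?W = carrier U" and kk: "ker Q V e = ker ?W U k"
   using k(2) fg_lmod by (auto simp: ses_def)
  have e1: "extends L ?W (ker Q V e) Y" unfolding kk by (rule ext_vanish_0_extends[OF Y fg(1) 2(2) kl])
  have e2: "extends L Q (ker Q W (%x. g (e x))) Y" using 2(3) k(1) by simp
  have "extends L Q (ker Q V e) Y" unfolding extends_def
  proof (intro allI impI)
   fix h assume "lin L (sub Q (ker Q V e)) Y h"
   hence "lin L (sub ?W (ker Q V e)) Y h" by simp
   then obtain g1 where g1: "lin L ?W Y g1" "!!x. x : ker Q V e ==> g1 x = h x" using e1 unfolding extends_def by blast
   then obtain g2 where g2: "lin L Q Y g2" "!!x. x : ker Q W (%x. g (e x)) ==> g2 x = g1 x" using e2 unfolding extends_def by blast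
   have "x : ker Q W (%x. g (e x))" if "x : ker Q V e" for x using that unfolding kk by (simp add: ker_def)
   thus "\<exists>g. lin L Q Y g & (\<forall>x\<in>ker Q V e. g x = h x)" using g1(2) g2 by metis
  qed
  thus ?case by (rule ext_vanish_0_pres[OF Y m(2) p])
 }
next
 case (Suc i)
 {
  case (1 U V W f g)
  hence fg: "fgm L U" "fgm L V" "fgm L W" by (auto simp: ses_def)
  note m = fg[THEN fg_lmod]
  obtain Q :: "'l umod" and e where p: "pres L Q e V" using presentation_exists[OF fg(2)] .
  obtain k where k: "pres L Q (%x. g (e x)) W"
   "ses (sub Q (ker Q V e)) (sub Q (ker Q W (%x. g (e x)))) U (%x. x) k" using ses_rotate[OF 1(1) p] .
  let ?W = "sub Q (ker Q W (%x. g (e x)))"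
  have fW: "fgm L ?W" using k(2) by (auto simp: ses_def)
  obtain P :: "'l umod" and e' where p': "pres L P e' ?W" using presentation_exists[OF fW] .
  obtain k' where k': "pres L P (%x. k (e' x)) U"
   "ses (sub P (ker P ?W e')) (sub P (ker P U (%x. k (e' x)))) (sub Q (ker Q V e)) (%x. x) k'"
   using ses_rotate[OF k(2) p'] .
  have "ext_vanish L Y (Suc i) ?W" using 1(3) k(1) by simp
  hence "ext_vanish L Y i (sub P (ker P ?W e'))" using p' by simp
  moreover have "ext_vanish L Y i (sub Q (ker Q V e))" using 1(2) p by simp
  ultimately have "ext_vanish L Y i (sub P (ker P U (%x. k (e' x))))" by (rule Suc(2)[OF k'(2)])
  thus ?case by (rule ext_vanish_Suc_pres[OF Y m(1) k'(1)])
 next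
  case (2 U V W f g)
  hence fg: "fgm L U" "fgm L V" "fgm L W" by (auto simp: ses_def)
  note m = fg[THEN fg_lmod]
  obtain Q :: "'l umod" and e where p: "pres L Q e V" using presentation_exists[OF fg(2)] .
  obtain k where k: "pres L Q (%x. g (e x)) W"
   "ses (sub Q (ker Q V e)) (sub Q (ker Q W (%x. g (e x)))) U (%x. x) k" using ses_rotate[OF 2(1) p] .
  have "ext_vanish L Y i (sub Q (ker Q W (%x. g (e x))))" using 2(3) k(1) by simp
  from Suc(1)[OF k(2) this 2(2)] show ?case by (rule ext_vanish_Suc_pres[OF Y m(2) p])
 }
qed

end

section \<open>Kernels and cokernels of orthogonal maps\<close>

text \<open>
 Every map from the two-term complex \<open>u\<close> to the shift of the two-term complex \<open>v\<close> is null-homotopic.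
\<close>

definition orth :: "('a, 'c) ring_scheme => ('a, 'p) module => ('a, 'q) module => ('p => 'q) =>
  ('a, 'p2) module => ('a, 'q2) module => ('p2 => 'q2) => bool" where
 "orth A P Q u P' Q' v \<longleftrightarrow> (\<forall>h. lin A P Q' h \<longrightarrow> (\<exists>b c. lin A Q Q' b & lin A P P' c &
   (\<forall>x\<in>carrier P. h x = b (u x) +[Q'] v (c x))))"

definition arr :: "('a, 'c) ring_scheme => ('a, 'p) module => ('a, 'q) module => ('p => 'q) => bool" where
 "arr A P Q f \<longleftrightarrow> fgm A P & fgm A Q & lin A P Q f"

lemma arrD:
 assumes "arr A P Q f"
 shows "fgm A P" "fgm A Q" "lin A P Q f" "lmod A P" "lmod A Q"
 using assms fg_lmod by (auto simp: arr_def)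

lemma arr_sum:
 assumes "arr A P Q f" "arr A P' Q' g"
 shows "arr A (dirsum P P') (dirsum Q Q') (%x. (f (fst x), g (snd x)))"
 using arrD[OF assms(1)] arrD[OF assms(2)] unfolding arr_def
 by (intro conjI fg_direct_sum lin_pair lin_fst' lin_snd')

lemma arr_pair: "[|arr A P Q f; arr A P Q' g|] ==> arr A P (dirsum Q Q') (%x. (f x, g x))"
 unfolding arr_def by (intro conjI fg_direct_sum lin_pair) auto

lemma shear_iso:
 assumes U: "lmod A U" and t: "lin A V U t"
 shows "iso A (dirsum U V) (dirsum U V) (%z. (fst z +[U] t (snd z), snd z))" (is "iso A ?S ?S ?f")
  and "iso A (dirsum U V) (dirsum U V) (%z. (fst z -[U] t (snd z), snd z))" (is "iso A ?S ?S ?g")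
proof -
 interpret U: left_module A U by fact
 have l: "lin A ?S ?S ?f" "lin A ?S ?S ?g"
  by (intro lin_pair lin_snd lin_fst lin_plus[OF U] lin_subtract[OF U] lin_snd'[OF t])+
 have e: "(fst z +[U] t (snd z)) -[U] t (snd z) = fst z" "(fst z -[U] t (snd z)) +[U] t (snd z) = fst z"
  if "z : carrier ?S" for z
  using that lin_cl[OF t] by (auto simp: U.minus_eq U.a_assoc U.r_neg U.l_neg)
 show "iso A ?S ?S ?f" by (rule isoI[OF l]) (simp_all add: e)
 show "iso A ?S ?S ?g" by (rule isoI[OF l(2,1)]) (simp_all add: e)
qed

context complete_algebra
begin

definition coker :: "('l, 'x) module => 'x set => 'l umod" where
 "coker Q N = (SOME C. \<exists>q. fgm L C & lin L Q C q & q ` carrier Q = carrier C & ker Q C q = N)"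

text \<open>
 The kernel and the cokernel are recorded together, since the block matrix argument does not
 separate them.
\<close>

definition kc :: "('l, 'p) module => ('l, 'y) module => ('p => 'y) => 'l umod set multiset" where
 "kc P Q f = dec (sub P (ker P Q f)) + dec (coker Q (f ` carrier P))"

lemma coker_obtain:
 assumes f: "arr L P Q f"
 obtains C :: "'l umod" and q where "fgm L C" "lin L Q C q" "q ` carrier Q = carrier C" "ker Q C q = f ` carrier P"
  "kc P Q f = dec (sub P (ker P Q f)) + dec C"
proof -
 note f' = arrD[OF f]
 have "submodule (f ` carrier P) L Q" by (rule image_submodule[OF f'(4,5,3) carrier_submodule[OF f'(4)]])
 from quotient_exists[OF f'(2) this] have "\<exists>(C :: 'l umod) q. fgm L C & lin L Q C q & q ` carrier Q = carrier C & ker Q C q = f ` carrier P"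
  by metis
 hence "\<exists>q. fgm L (coker Q (f ` carrier P)) & lin L Q (coker Q (f ` carrier P)) q &
   q ` carrier Q = carrier (coker Q (f ` carrier P)) & ker Q (coker Q (f ` carrier P)) q = f ` carrier P"
  unfolding coker_def by (rule someI_ex)
 then obtain q where q: "fgm L (coker Q (f ` carrier P))" "lin L Q (coker Q (f ` carrier P)) q"
   "q ` carrier Q = carrier (coker Q (f ` carrier P))" "ker Q (coker Q (f ` carrier P)) q = f ` carrier P" by (elim exE conjE)
 show ?thesis by (rule that[OF q kc_def])
qed

lemma kc_eqI:
 assumes f: "arr L P Q f" and C: "lmod L C" "lin L Q C q" "q ` carrier Q = carrier C" "ker Q C q = f ` carrier P"
 shows "kc P Q f = dec (sub P (ker P Q f)) + dec C"
proof -
 note f' = arrD[OF f]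
 obtain C' :: "'l umod" and q' where C': "fgm L C'" "lin L Q C' q'" "q' ` carrier Q = carrier C'" "ker Q C' q' = f ` carrier P"
  "kc P Q f = dec (sub P (ker P Q f)) + dec C'" using coker_obtain[OF f] .
 have "mod_iso L C' C"
  by (rule surj_same_kernel_iso[OF f'(5) fg_lmod[OF C'(1)] C(1) C'(2,3) C(2,3)]) (simp add: C(4) C'(4))
 thus ?thesis using dec_iso[OF C'(1) C(1)] C'(5) by simp
qed

lemma kc_cong:
 assumes f: "arr L P Q f" and f': "arr L P' Q' f'" and a: "iso L P P' a" and b: "iso L Q Q' b"
  and c: "!!x. x \<in>[P] ==> b (f x) = f' (a x)"
 shows "kc P Q f = kc P' Q' f'"
proof -
 note F = arrD[OF f] and F' = arrD[OF f']
 obtain C :: "'l umod" and q where C: "fgm L C" "lin L Q' C q" "q ` carrier Q' = carrier C" "ker Q' C q = f' ` carrier P'"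
  "kc P' Q' f' = dec (sub P' (ker P' Q' f')) + dec C" using coker_obtain[OF f'] .
 have fb: "f x \<in>[Q]" if "x \<in>[P]" for x by (rule lin_cl[OF F(3) that])
 have k: "a x : ker P' Q' f' \<longleftrightarrow> x : ker P Q f" if x: "x \<in>[P]" for x
  using inj_onD[OF isoD(2)[OF b], of "f x" "0[Q]"] fb[OF x] c[OF x] lin_zero[OF F(5) F'(5) isoD(1)[OF b]] lmodD(2)[OF F(5)]
   x lin_cl[OF isoD(1)[OF a] x] by (auto simp: ker_def)
 have kP: "ker P Q f <= carrier P" "ker P' Q' f' <= carrier P'" by (auto simp: ker_def)
 have "iso L (sub P (ker P Q f)) (sub P' (ker P' Q' f')) a"
  unfolding iso_def bij_betw_def
 proof (intro conjI)
  show "lin L (sub P (ker P Q f)) (sub P' (ker P' Q' f')) a"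
   unfolding lin_into_sub[OF kP(2)] using lin_from_sub[OF isoD(1)[OF a] kP(1)] k kP(1) by auto
  show "inj_on a (carrier (sub P (ker P Q f)))" using inj_on_subset[OF isoD(2)[OF a] kP(1)] by simp
  have "y : a ` ker P Q f" if y: "y : ker P' Q' f'" for y
  proof -
   have "y : a ` carrier P" unfolding isoD(3)[OF a] using y kP(2) by blast
   then obtain x where x: "x \<in>[P]" "y = a x" by (elim imageE)
   thus ?thesis using k[OF x(1)] y by blast
  qed
  thus "a ` carrier (sub P (ker P Q f)) = carrier (sub P' (ker P' Q' f'))" using k kP(1) by auto
 qed
 moreover have fk: "fgm L (sub P (ker P Q f))" by (rule ker_fg[OF F(1,5,3)])
 moreover have "lmod L (sub P' (ker P' Q' f'))" by (rule sub_lmod[OF F'(4) ker_submodule[OF F'(4,5,3)]])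
 ultimately have d: "dec (sub P (ker P Q f)) = dec (sub P' (ker P' Q' f'))" using dec_iso mod_isoI fg_lmod by blast
 have "kc P Q f = dec (sub P (ker P Q f)) + dec C"
 proof (rule kc_eqI[OF f fg_lmod[OF C(1)] lin_comp[OF isoD(1)[OF b] C(2)]])
  have "(%x. q (b x)) ` carrier Q = q ` b ` carrier Q" by (simp add: image_image)
  thus "(%x. q (b x)) ` carrier Q = carrier C" by (simp add: isoD(3)[OF b] C(3))
  have "f' ` carrier P' = (%x. f' (a x)) ` carrier P" unfolding isoD(3)[OF a, symmetric] by (simp add: image_image)
  also have "... = b ` f ` carrier P" using c by (simp add: image_image)
  finally have i: "f' ` carrier P' = b ` f ` carrier P" .
  have "q (b y) = 0[C] \<longleftrightarrow> y : f ` carrier P" if y: "y \<in>[Q]" for y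
  proof -
   have "q (b y) = 0[C] \<longleftrightarrow> b y : ker Q' C q" using lin_cl[OF isoD(1)[OF b] y] by (simp add: ker_def)
   also have "... \<longleftrightarrow> y : f ` carrier P" unfolding C(4) i
    by (rule inj_on_image_mem_iff[OF isoD(2)[OF b] y]) (use fb in auto)
   finally show ?thesis .
  qed
  thus "ker Q C (%x. q (b x)) = f ` carrier P" using fb by (auto simp: ker_def)
 qed
 thus ?thesis using d C(5) by simp
qed

lemma kc_iso:
 assumes f: "arr L P Q f" and i: "iso L P Q f" shows "kc P Q f = {#}"
proof -
 note F = arrD[OF f]
 have k: "ker P Q f = {0[P]}" using inj_on_iff_ker[OF F(4,5,3)] isoD(2)[OF i] by simp
 have A: "ring L" by (rule lmodD(14)[OF F(4)])
 obtain Z :: "'l umod" where Z: "fgm L Z" "is_zero_module Z" using zero_umodule[OF A] .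
 note Zm = fg_lmod[OF Z(1)]
 have "kc P Q f = dec (sub P (ker P Q f)) + dec Z"
  by (rule kc_eqI[OF f Zm lin_zero_map[OF Zm]]) (use Z(2) lmodD(2)[OF F(5)] in "auto simp: ker_def isoD(3)[OF i] is_zero_module_def")
 also have "dec Z = {#}" by (rule dec_zero[OF Zm Z(2)])
 also have "dec (sub P (ker P Q f)) = {#}"
  by (rule dec_zero[OF fg_lmod[OF ker_fg[OF F(1,5,3)]]]) (simp add: is_zero_module_def k)
 finally show ?thesis by simp
qed

lemma kc_sum:
 assumes f: "arr L P Q f" and g: "arr L P' Q' g"
 shows "kc (dirsum P P') (dirsum Q Q') (%x. (f (fst x), g (snd x))) = kc P Q f + kc P' Q' g"
proof -
 note F = arrD[OF f] and G = arrD[OF g]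
 let ?h = "%x. (f (fst x), g (snd x))"
 obtain C :: "'l umod" and q where C: "fgm L C" "lin L Q C q" "q ` carrier Q = carrier C" "ker Q C q = f ` carrier P"
  "kc P Q f = dec (sub P (ker P Q f)) + dec C" using coker_obtain[OF f] .
 obtain D :: "'l umod" and r where D: "fgm L D" "lin L Q' D r" "r ` carrier Q' = carrier D" "ker Q' D r = g ` carrier P'"
  "kc P' Q' g = dec (sub P' (ker P' Q' g)) + dec D" using coker_obtain[OF g] .
 note m = fg_lmod[OF C(1)] fg_lmod[OF D(1)]
 have s: "sub (dirsum P P') (ker (dirsum P P') (dirsum Q Q') ?h) = dirsum (sub P (ker P Q f)) (sub P' (ker P' Q' g))"
  by (auto simp: direct_sum_def ker_def)
 have i: "(%x. (a (fst x), b (snd x))) ` (S \<times> S') = (a ` S) \<times> (b ` S')"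
  for a :: "_ => _" and b :: "_ => _" and S S' by (force simp: image_iff)
 have "kc (dirsum P P') (dirsum Q Q') ?h =
  dec (sub (dirsum P P') (ker (dirsum P P') (dirsum Q Q') ?h)) + dec (dirsum C D)"
 proof (rule kc_eqI[OF arr_sum[OF f g] dsum_lmod[OF m]])
  show "lin L (dirsum Q Q') (dirsum C D) (%x. (q (fst x), r (snd x)))" by (intro lin_pair lin_fst'[OF C(2)] lin_snd'[OF D(2)])
  show "(%x. (q (fst x), r (snd x))) ` carrier (dirsum Q Q') = carrier (dirsum C D)" by (simp add: i C(3) D(3))
  have "ker (dirsum Q Q') (dirsum C D) (%x. (q (fst x), r (snd x))) = ker Q C q \<times> ker Q' D r" by (auto simp: ker_def)
  thus "ker (dirsum Q Q') (dirsum C D) (%x. (q (fst x), r (snd x))) = ?h ` carrier (dirsum P P')"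
   by (simp add: i C(4) D(4))
 qed
 also have "... = kc P Q f + kc P' Q' g"
  unfolding s dec_sum[OF ker_fg[OF F(1,5,3)] ker_fg[OF G(1,5,3)]] dec_sum[OF C(1) D(1)] C(5) D(5) by simp
 finally show ?thesis .
qed

lemma arr_msum:
 assumes "finite J" "!!j. j : J ==> arr L (P j) (Q j) (f j)"
 shows "arr L (msum J P) (msum J Q) (%p. \<lambda>j\<in>J. f j (p j))"
 using arrD[OF assms(2)] assms(1) L.ring_axioms unfolding arr_def
 by (intro conjI fg_msum lin_tuple lin_comp[OF lin_proj]) auto

lemma kc_msum:
 assumes J: "finite J" and f: "!!j. j : J ==> arr L (P j) (Q j) (f j)"
 shows "kc (msum J P) (msum J Q) (%p. \<lambda>j\<in>J. f j (p j)) = (\<Sum>j\<in>J. kc (P j) (Q j) (f j))"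
proof -
 note F = arrD[OF f]
 let ?f = "%p. \<lambda>j\<in>J. f j (p j)"
 have "\<exists>(C :: 'l umod) q. fgm L C & lin L (Q j) C q & q ` carrier (Q j) = carrier C & ker (Q j) C q = f j ` carrier (P j) &
  kc (P j) (Q j) (f j) = dec (sub (P j) (ker (P j) (Q j) (f j))) + dec C" if "j : J" for j
  using coker_obtain[OF f[OF that]] by metis
 then obtain C :: "_ => 'l umod" and q where C: "!!j. j : J ==> fgm L (C j)" "!!j. j : J ==> lin L (Q j) (C j) (q j)"
  "!!j. j : J ==> q j ` carrier (Q j) = carrier (C j)" "!!j. j : J ==> ker (Q j) (C j) (q j) = f j ` carrier (P j)"
  "!!j. j : J ==> kc (P j) (Q j) (f j) = dec (sub (P j) (ker (P j) (Q j) (f j))) + dec (C j)" by metis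
 have k: "ker (msum J X) (msum J Y) (%p. \<lambda>j\<in>J. g j (p j)) = (\<Pi>\<^sub>E j\<in>J. ker (X j) (Y j) (g j))"
  for X :: "_ => ('l, 'y) module" and Y :: "_ => ('l, 'z) module" and g
 proof -
  have "restrict a J = restrict b J \<longleftrightarrow> (\<forall>j\<in>J. a j = b j)" for a b :: "_ => 'z" by (metis restrict_apply' restrict_ext)
  thus ?thesis by (auto simp: ker_def PiE_iff extensional_def)
 qed
 have im: "(%p. \<lambda>j\<in>J. g j (p j)) ` Pi\<^sub>E J S = (\<Pi>\<^sub>E j\<in>J. g j ` S j)" for g :: "_ => 'y => 'z" and S
 proof (intro equalityI subsetI)
  fix p assume p: "p : (\<Pi>\<^sub>E j\<in>J. g j ` S j)"
  let ?s = "\<lambda>j\<in>J. inv_into (S j) (g j) (p j)"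
  have "?s : Pi\<^sub>E J S" "!!j. j : J ==> g j (?s j) = p j" using p inv_into_into[of "p _" "g _" "S _"] f_inv_into_f[of "p _" "g _" "S _"] by (auto simp: PiE_iff)
  thus "p : (%p. \<lambda>j\<in>J. g j (p j)) ` Pi\<^sub>E J S" using p
   by (intro image_eqI[of _ _ ?s]) (auto simp: PiE_iff extensional_def fun_eq_iff)
 qed auto
 have s: "sub (msum J P) (ker (msum J P) (msum J Q) ?f) = msum J (%j. sub (P j) (ker (P j) (Q j) (f j)))"
  unfolding k by (simp add: msum_def)
 have "kc (msum J P) (msum J Q) ?f = dec (sub (msum J P) (ker (msum J P) (msum J Q) ?f)) + dec (msum J C)"
 proof (rule kc_eqI)
  show "arr L (msum J P) (msum J Q) ?f" by (rule arr_msum[OF J f])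
  show "lmod L (msum J C)" by (rule msum_lmod[OF L.ring_axioms fg_lmod[OF C(1)]])
  show "lin L (msum J Q) (msum J C) (%p. \<lambda>j\<in>J. q j (p j))"
   by (rule lin_tuple, rule lin_comp, erule lin_proj, erule C(2))
  show "(%p. \<lambda>j\<in>J. q j (p j)) ` carrier (msum J Q) = carrier (msum J C)"
   unfolding msum_simps im by (rule PiE_cong) (rule C(3))
  show "ker (msum J Q) (msum J C) (%p. \<lambda>j\<in>J. q j (p j)) = ?f ` carrier (msum J P)"
   unfolding k msum_simps im by (rule PiE_cong) (rule C(4))
 qed
 also have "dec (msum J C) = (\<Sum>j\<in>J. dec (C j))" by (rule dec_msum[OF J C(1)])
 also have "dec (sub (msum J P) (ker (msum J P) (msum J Q) ?f)) = (\<Sum>j\<in>J. dec (sub (P j) (ker (P j) (Q j) (f j))))"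
  unfolding s by (rule dec_msum[OF J]) (rule ker_fg[OF F(1,5,3)])
 finally show ?thesis by (simp only: sum.distrib[symmetric] C(5) cong: sum.cong)
qed

text \<open>
 Row and column operations remove an off-diagonal entry of the form \<open>s v + u t\<close>.
\<close>

lemma kc_triangular:
 assumes u: "arr L U1 U0 u" and v: "arr L V1 V0 v" and s: "lin L V0 U0 s" and t: "lin L V1 U1 t"
  and x: "!!y. y \<in>[V1] ==> x y = s (v y) +[U0] u (t y)"
 shows "kc (dirsum U1 V1) (dirsum U0 V0) (%z. (u (fst z) +[U0] x (snd z), v (snd z))) = kc U1 U0 u + kc V1 V0 v"
proof -
 note U = arrD[OF u] and V = arrD[OF v]
 interpret U0: left_module L U0 by (rule U(5))
 have xl: "lin L V1 U0 x"
  by (rule lin_cong[OF lin_plus[OF U(5) lin_comp[OF V(3) s] lin_comp[OF t U(3)]] x[symmetric] V(4)])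
 have A: "arr L (dirsum U1 V1) (dirsum U0 V0) (%z. (u (fst z) +[U0] x (snd z), v (snd z)))"
  unfolding arr_def using U V
  by (intro conjI fg_direct_sum lin_pair lin_plus[OF U(5)] lin_fst'[OF U(3)] lin_snd'[OF V(3)] lin_snd'[OF xl])
 have "kc (dirsum U1 V1) (dirsum U0 V0) (%z. (u (fst z) +[U0] x (snd z), v (snd z))) =
   kc (dirsum U1 V1) (dirsum U0 V0) (%z. (u (fst z), v (snd z)))"
 proof (rule kc_cong[OF A arr_sum[OF u v] shear_iso(1)[OF U(4) t] shear_iso(2)[OF U(5) s]])
  fix z assume "z \<in>[dirsum U1 V1]"
  hence z: "fst z \<in>[U1]" "snd z \<in>[V1]" by auto
  have c: "u (fst z) \<in>[U0]" "s (v (snd z)) \<in>[U0]" "t (snd z) \<in>[U1]" "u (t (snd z)) \<in>[U0]"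
   by (intro lin_cl[OF U(3)] z lin_cl[OF s] lin_cl[OF V(3)] lin_cl[OF t])+
  have "(u (fst z) +[U0] (s (v (snd z)) +[U0] u (t (snd z)))) -[U0] s (v (snd z)) = u (fst z) +[U0] u (t (snd z))"
  proof -
   have "u (fst z) +[U0] (s (v (snd z)) +[U0] u (t (snd z))) = (u (fst z) +[U0] u (t (snd z))) +[U0] s (v (snd z))"
    using c by (simp add: U0.a_ac)
   thus ?thesis using c by (simp add: U0.minus_eq U0.a_assoc U0.r_neg)
  qed
  thus "(fst (u (fst z) +[U0] x (snd z), v (snd z)) -[U0] s (snd (u (fst z) +[U0] x (snd z), v (snd z))),
     snd (u (fst z) +[U0] x (snd z), v (snd z))) =
     (u (fst (fst z +[U1] t (snd z), snd z)), v (snd (fst z +[U1] t (snd z), snd z)))"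
   using x[OF z(2)] lin_add[OF U(3) z(1) c(3)] by simp
 qed
 also have "... = kc U1 U0 u + kc V1 V0 v" by (rule kc_sum[OF u v])
 finally show ?thesis .
qed

text \<open>
 For \<open>\<Theta>\<close> split epi, in a way that \<open>w\<close> respects: the matrix of \<open>(f \<Theta>, w) \<oplus> id\<close> becomes that of \<open>(\<Theta>, w) \<oplus> f\<close> with an off-diagonal
 entry by row and column operations.
\<close>

lemma kc_through:
 assumes f: "arr L P Q f" and w: "arr L W1 W0 w" and T: "lin L W1 P \<Theta>"
  and t: "lin L P W1 t" and s: "lin L Q W0 s"
  and Tt: "!!y. y \<in>[P] ==> \<Theta> (t y) = y" and ws: "!!y. y \<in>[P] ==> w (t y) = s (f y)"
 shows "kc W1 (dirsum Q W0) (%p. (f (\<Theta> p), w p)) = kc W1 (dirsum P W0) (%p. (\<Theta> p, w p)) + kc P Q f"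
proof -
 note F = arrD[OF f] and W = arrD[OF w]
 interpret P: left_module L P by (rule F(4))
 interpret Q: left_module L Q by (rule F(5))
 interpret W0: left_module L W0 by (rule W(5))
 have aT: "arr L W1 P \<Theta>" using W F T by (simp add: arr_def)
 have afT: "arr L W1 Q (%p. f (\<Theta> p))" using W F lin_comp[OF T F(3)] by (simp add: arr_def)
 have aid: "arr L P P (%x. x)" using F lin_id by (auto simp: arr_def)
 note M = arr_pair[OF aT w] and N = arr_pair[OF afT w]
 note T' = lin_cl[OF T] and F' = lin_cl[OF F(3)] and W' = lin_cl[OF W(3)]
 let ?x = "%y. (-[P] y, 0[W0])"
 have neg: "lin L X X (%y. -[X] y)" if X: "lmod L X" for X :: "('l, 'y) module"
 proof -
  interpret X: left_module L X by fact
  show ?thesis by (rule linI) (auto simp: X.minus_add X.smult_r_minus X.a_comm)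
 qed
 let ?N = "%z. ((f (\<Theta> (fst z)), w (fst z)), snd z)"
 let ?Z = "%z. ((\<Theta> (fst z), w (fst z)) +[dirsum P W0] ?x (snd z), f (snd z))"
 have aZ: "arr L (dirsum W1 P) (dirsum (dirsum P W0) Q) ?Z"
  unfolding arr_def using F W arrD[OF M] arrD[OF N]
  by (intro conjI fg_direct_sum lin_pair lin_plus dsum_lmod lin_fst'[OF T] lin_fst'[OF W(3)] lin_snd'[OF F(3)]
   lin_snd'[OF neg[OF F(4)]] lin_zero_map)
 have "kc W1 (dirsum Q W0) (%p. (f (\<Theta> p), w p)) =
   kc W1 (dirsum Q W0) (%p. (f (\<Theta> p), w p)) + kc P P (%x. x)"
  using kc_iso[OF aid iso_id] by simp
 also have "... = kc (dirsum W1 P) (dirsum (dirsum Q W0) P) ?N" by (rule kc_sum[OF N aid, symmetric])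
 also have "... = kc (dirsum W1 P) (dirsum (dirsum P W0) Q) ?Z"
 proof (rule kc_cong[OF arr_sum[OF N aid] aZ])
  show "iso L (dirsum W1 P) (dirsum W1 P) (%z. (fst z, \<Theta> (fst z) -[P] snd z))" (is "iso L ?S ?S ?a")
  proof (rule isoI[of _ _ _ _ ?a])
   show "lin L ?S ?S ?a" by (intro lin_pair lin_fst lin_subtract[OF F(4)] lin_fst'[OF T] lin_snd)
   thus "lin L ?S ?S ?a" .
   fix z assume "z : carrier ?S"
   thus "?a (?a z) = z" using T' by (auto simp: P.minus_eq P.minus_add P.minus_minus P.r_neg2)
   thus "?a (?a z) = z" .
  qed
  let ?b = "%z. ((snd z, snd (fst z)), fst (fst z) -[Q] f (snd z))"
  let ?c = "%z. ((snd z +[Q] f (fst (fst z)), snd (fst z)), fst (fst z))"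
  let ?B = "dirsum (dirsum Q W0) P" and ?C = "dirsum (dirsum P W0) Q"
  show "iso L ?B ?C ?b"
  proof (rule isoI[of _ _ _ _ ?c])
   show "lin L ?B ?C ?b"
    by (intro lin_pair lin_subtract[OF F(5)] lin_snd lin_snd'[OF F(3)] lin_fst'[OF lin_fst] lin_fst'[OF lin_snd])
   show "lin L ?C ?B ?c"
    by (intro lin_pair lin_plus[OF F(5)] lin_snd lin_fst'[OF lin_fst'[OF F(3)]] lin_fst'[OF lin_fst] lin_fst'[OF lin_snd])
  qed (use F' in "auto simp: Q.minus_eq Q.a_assoc Q.l_neg Q.r_neg")
  fix z assume "z \<in>[dirsum W1 P]"
  then obtain a y where z: "z = (a, y)" "a \<in>[W1]" "y \<in>[P]" by auto
  have "f (\<Theta> a) -[Q] f y = f (\<Theta> a -[P] y)" using lin_diff[OF F(4,5,3) T'[OF z(2)] z(3)] by simp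
  moreover have "y = \<Theta> a +[P] -[P] (\<Theta> a -[P] y)" using T'[OF z(2)] z(3) by (simp add: P.minus_eq P.minus_add P.minus_minus P.r_neg2)
  ultimately show "?b (?N z) = ?Z (?a z)" using W'[OF z(2)] by (simp add: z(1))
 qed
 also have "... = kc W1 (dirsum P W0) (%p. (\<Theta> p, w p)) + kc P Q f"
 proof (rule kc_triangular[OF M f])
  show "lin L Q (dirsum P W0) (%q. (0[P], s q))" by (intro lin_pair lin_zero_map F(4) s)
  show "lin L P W1 (%y. -[W1] t y)" by (rule lin_comp[OF t neg[OF W(4)]])
  fix y assume y: "y \<in>[P]"
  have ty: "t y \<in>[W1]" "s (f y) \<in>[W0]" using lin_cl[OF t y] lin_cl[OF s F'[OF y]] by auto
  show "?x y = (0[P], s (f y)) +[dirsum P W0] (\<Theta> (-[W1] t y), w (-[W1] t y))"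
   using ty y by (simp add: lin_minus[OF W(4) F(4) T] lin_minus[OF W(4,5,3)] Tt ws W0.r_neg)
 qed
 finally show ?thesis .
qed

text \<open>
 Both \<open>(f \<Theta>, w) \<oplus> w\<close> and \<open>(f' \<Theta>, w) \<oplus> w\<close> become, by an operation with entries \<open>f' \<Theta>\<close> or \<open>f \<Theta>\<close> off the
 diagonal, the same matrix up to the order of its rows and columns. Cancelling \<open>w\<close> and then \<open>(\<Theta>, w)\<close> leaves \<open>f\<close> and
 \<open>f'\<close>.
\<close>

lemma kc_cancel:
 assumes f: "arr L P Q f" and f': "arr L P Q f'" and w: "arr L W1 W0 w" and T: "lin L W1 P \<Theta>"
  and t: "lin L P W1 t" "lin L Q W0 s" "!!y. y \<in>[P] ==> \<Theta> (t y) = y" "!!y. y \<in>[P] ==> w (t y) = s (f y)"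
  and t': "lin L P W1 t'" "lin L Q W0 s'" "!!y. y \<in>[P] ==> \<Theta> (t' y) = y" "!!y. y \<in>[P] ==> w (t' y) = s' (f' y)"
  and b: "lin L W0 Q b" "lin L W1 W1 \<tau>" "lin L W0 W0 \<sigma>"
   "!!p. p \<in>[W1] ==> f' (\<Theta> p) = b (w p) +[Q] f (\<Theta> (\<tau> p))" "!!p. p \<in>[W1] ==> w (\<tau> p) = \<sigma> (w p)"
  and b': "lin L W0 Q b'" "lin L W1 W1 \<tau>'" "lin L W0 W0 \<sigma>'"
   "!!p. p \<in>[W1] ==> f (\<Theta> p) = b' (w p) +[Q] f' (\<Theta> (\<tau>' p))" "!!p. p \<in>[W1] ==> w (\<tau>' p) = \<sigma>' (w p)"
 shows "kc P Q f = kc P Q f'"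
proof -
 note F = arrD[OF f] and F' = arrD[OF f'] and W = arrD[OF w]
 interpret Q: left_module L Q by (rule F(5))
 interpret W0: left_module L W0 by (rule W(5))
 let ?N = "%f p. (f (\<Theta> p), w p)"
 have N: "arr L W1 (dirsum Q W0) (?N g)" if "arr L P Q g" for g
  using W arrD[OF that] lin_comp[OF T] by (intro arr_pair w) (auto simp: arr_def)
 let ?Z = "%f f' z. (?N f (fst z) +[dirsum Q W0] (f' (\<Theta> (snd z)), 0[W0]), w (snd z))"
 let ?S = "dirsum W1 W1" and ?D = "dirsum (dirsum Q W0) W0"
 have Z: "kc ?S ?D (?Z g g') = kc W1 (dirsum Q W0) (?N g) + kc W1 W0 w" "arr L ?S ?D (?Z g g')"
  if g: "arr L P Q g" "arr L P Q g'" and b: "lin L W0 Q b" "lin L W1 W1 \<tau>" "lin L W0 W0 \<sigma>"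
   "!!p. p \<in>[W1] ==> g' (\<Theta> p) = b (w p) +[Q] g (\<Theta> (\<tau> p))" "!!p. p \<in>[W1] ==> w (\<tau> p) = \<sigma> (w p)"
  for g g' b \<tau> \<sigma>
 proof -
  show "arr L ?S ?D (?Z g g')" unfolding arr_def
   by (intro conjI fg_direct_sum W F lin_pair lin_plus dsum_lmod lin_fst'[OF lin_comp[OF T]] lin_fst'[OF W(3)]
    lin_snd'[OF W(3)] lin_snd'[OF lin_comp[OF T]] lin_zero_map arrD(3)[OF g(1)] arrD(3)[OF g(2)])
  show "kc ?S ?D (?Z g g') = kc W1 (dirsum Q W0) (?N g) + kc W1 W0 w"
  proof (rule kc_triangular[OF N[OF g(1)] w _ b(2)])
   show "lin L W0 (dirsum Q W0) (%c. (b c, 0[W0] -[W0] \<sigma> c))"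
    by (intro lin_pair b lin_subtract lin_zero_map W)
   fix p assume p: "p \<in>[W1]"
   have "\<sigma> (w p) \<in>[W0]" by (rule lin_cl[OF b(3) lin_cl[OF W(3) p]])
   thus "(g' (\<Theta> p), 0[W0]) = (b (w p), 0[W0] -[W0] \<sigma> (w p)) +[dirsum Q W0] ?N g (\<tau> p)"
    using b(4,5)[OF p] by (simp add: W0.minus_eq W0.l_neg)
  qed
 qed
 note Z1 = Z[OF f f' b] and Z2 = Z[OF f' f b']
 have "kc ?S ?D (?Z f f') = kc ?S ?D (?Z f' f)"
 proof (rule kc_cong[OF Z1(2) Z2(2)])
  show "iso L ?S ?S (%z. (snd z, fst z))" by (rule isoI[of _ _ _ _ "%z. (snd z, fst z)"]) (auto intro!: lin_pair lin_fst lin_snd)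
  let ?d = "%z. ((fst (fst z), snd z), snd (fst z))"
  show "iso L ?D ?D ?d"
   by (rule isoI[of _ _ _ _ ?d]) (auto intro!: lin_pair lin_fst'[OF lin_fst] lin_fst'[OF lin_snd] lin_snd)
  fix z assume "z : carrier ?S"
  hence z: "fst z \<in>[W1]" "snd z \<in>[W1]" by auto
  have "f (\<Theta> (fst z)) \<in>[Q]" "f' (\<Theta> (snd z)) \<in>[Q]" "w (fst z) \<in>[W0]" "w (snd z) \<in>[W0]"
   by (intro lin_cl[OF F(3)] lin_cl[OF F'(3)] lin_cl[OF T] lin_cl[OF W(3)] z)+
  thus "?d (?Z f f' z) = ?Z f' f (snd z, fst z)" by (simp add: Q.a_comm)
 qed
 hence "kc W1 (dirsum Q W0) (?N f) = kc W1 (dirsum Q W0) (?N f')" using Z1(1) Z2(1) by simp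
 thus ?thesis using kc_through[OF f w T t] kc_through[OF f' w T t'] by simp
qed

lemma finsum_restrict_scalars:
 assumes X: "lmod L X" and J: "finite J" "g : J \<rightarrow> carrier X"
 shows "finsum (rscal L X) g J = finsum X g J"
proof -
 interpret X: left_module L X by fact
 interpret Y: left_module R "rscal L X" by (rule restrict_lmod[OF X])
 show ?thesis using J by (induct J) auto
qed

text \<open>
 \<open>End P\<close> is finitely generated over \<open>R\<close>, and scalars commute with all linear maps; this is what
 makes the finite block matrices of the next theorem possible.
\<close>

lemma endomorphism_gens:
 assumes P: "fgm L P"
 obtains n and \<theta> :: "nat => 'p => 'p" where "!!j. j < n ==> lin L P P (\<theta> j)"
  "!!\<phi>. lin L P (P :: ('l, 'p) module) \<phi> ==> \<exists>r. (\<forall>j<n. r j \<in>[R]) &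
   (\<forall>y\<in>carrier P. \<phi> y = finsum P (%j. \<theta> j (scal (r j) .[P] y)) {..<n})"
proof -
 note Pm = fg_lmod[OF P]
 interpret P: left_module L P by (rule Pm)
 note H = hom_mod_lmod[OF Pm Pm]
 obtain n \<theta> where g: "gens R (hom_mod P P) {..<n::nat} \<theta>" using fg_obtain[OF noeth_fg[OF hom_mod_noeth[OF P P]]] .
 have th: "lin L P P (\<theta> j)" if "j < n" for j using gensD(3)[OF g, of j] that mod_hom_lin by simp
 show ?thesis
 proof (rule that[OF th])
  fix \<phi> assume \<phi>: "lin L P P \<phi>"
  have "restrict \<phi> (carrier P) \<in>[hom_mod P P]" using lin_mod_hom[OF Pm \<phi>] by simp
  then obtain c where c: "c \<in>[free R {..<n}]" "restrict \<phi> (carrier P) = lincomb (hom_mod P P) {..<n} \<theta> c"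
   using gens_expand[OF g] by metis
  have cR: "c j \<in>[R]" if "j < n" for j using c(1) that by auto
  have "\<phi> y = finsum P (%j. \<theta> j (scal (c j) .[P] y)) {..<n}" if y: "y \<in>[P]" for y
  proof -
   have ev: "lin R (hom_mod P P) (rscal L P) (%\<phi>. \<phi> y)"
    by (rule linI) (use y in "auto simp: scal_def dest: mod_hom_closed")
   have "\<phi> y = lincomb (hom_mod P P) {..<n} \<theta> c y" using fun_cong[OF c(2), of y] y by simp
   also have "... = finsum (rscal L P) (%j. (c j .[hom_mod P P] \<theta> j) y) {..<n}"
    unfolding lincomb_def
    by (rule lin_finsum[OF H restrict_lmod[OF Pm] ev]) (use cR gensD(3)[OF g] lmodD(7)[OF H] in auto)
   also have "... = finsum P (%j. \<theta> j (scal (c j) .[P] y)) {..<n}"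
    by (subst finsum_restrict_scalars[OF Pm]) (use cR y lin_cl[OF th] lin_smult[OF th] in "auto intro!: P.finsum_cong'")
   finally show ?thesis .
  qed
  thus "\<exists>r. (\<forall>j<n. r j \<in>[R]) & (\<forall>y\<in>carrier P. \<phi> y = finsum P (%j. \<theta> j (scal (r j) .[P] y)) {..<n})"
   using cR by blast
 qed
qed

definition block :: "(bool \<times> nat) set => ('l, 'y) module => bool => (nat => 'r) => 'y => bool \<times> nat => 'y" where
 "block I X e r y = (\<lambda>l\<in>I. if fst l = e then scal (r (snd l)) .[X] y else 0[X])"

lemma lin_block:
 assumes X: "lmod L X" and r: "!!k. k : I ==> r (snd k) \<in>[R]"
 shows "lin L X (msum I (%_. X)) (block I X e r)"
proof -
 have "lin L X (msum I (%_. X)) (%y. \<lambda>l\<in>I. if fst l = e then scal (r (snd l)) .[X] y else 0[X])"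
 proof (rule lin_tuple)
  fix l assume "l : I"
  thus "lin L X X (%y. if fst l = e then scal (r (snd l)) .[X] y else 0[X])"
   using lin_scal[OF X r] lin_zero_map[OF X] by (cases "fst l = e") auto
 qed
 thus ?thesis unfolding block_def .
qed

text \<open>
 Take \<open>w\<close> to be a diagonal matrix with entries \<open>f\<close> and \<open>f'\<close>, one of each for every generator \<open>\<theta>\<close> of \<open>End P\<close>, and
 let \<open>\<Theta>\<close> be the row of these generators. Orthogonality writes each entry \<open>f' \<theta>\<close> of \<open>f' \<Theta>\<close> as \<open>b f + f c\<close> and as \<open>b f' + f c\<close>. Expanding
 \<open>c\<close> in the generators gives \<open>f' \<Theta> = b w + f \<Theta> \<tau>\<close> with a matrix \<open>\<tau>\<close> of scalars, which commutes with \<open>w\<close>.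
\<close>

theorem kc_orth:
 assumes f: "arr L P Q f" and f': "arr L P Q f'"
  and o: "orth L P Q f P Q f" "orth L P Q f P Q f'" "orth L P Q f' P Q f" "orth L P Q f' P Q f'"
 shows "kc P Q f = kc P Q f'"
proof -
 note F = arrD[OF f]
 interpret P: left_module L P by (rule F(4))
 interpret Q: left_module L Q by (rule F(5))
 obtain n \<theta> where th: "!!j. j < (n::nat) ==> lin L P P (\<theta> j)"
  "!!\<phi>. lin L P P \<phi> ==> \<exists>r. (\<forall>j<n. r j \<in>[R]) &
   (\<forall>y\<in>carrier P. \<phi> y = finsum P (%j. \<theta> j (scal (r j) .[P] y)) {..<n})"
  by (rule endomorphism_gens[OF F(1)]) (rule that)
 define g where "g e = (if e then f else f')" for e
 have g: "lin L P Q (g e)" and og: "orth L P Q (g e) P Q (g e')" for e e'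
  using F(3) arrD(3)[OF f'] o by (auto simp: g_def)
 define I where "I = (UNIV :: bool set) \<times> {..<n}"
 have I: "finite I" "!!k. k : I ==> snd k < n" by (auto simp: I_def)
 define W1 where "W1 = msum I (%_. P)"
 define W0 where "W0 = msum I (%_. Q)"
 define w where "w = (%p. \<lambda>k\<in>I. g (fst k) (p k))"
 define \<Theta> where "\<Theta> p = finsum P (%k. \<theta> (snd k) (p k)) I" for p
 have w: "arr L W1 W0 w" unfolding W1_def W0_def w_def
  by (rule arr_msum[OF I(1)]) (use F g in "auto simp: arr_def")
 have wl: "lin L W1 W0 w" and Wm: "lmod L W1" "lmod L W0" using arrD[OF w] by auto
 have T: "lin L W1 P \<Theta>" unfolding \<Theta>_def W1_def by (rule lin_cotuple[OF F(4) I(1) th(1)[OF I(2)]])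
 have wb: "w (block I P e r y) = block I Q e r (g e y)" if "!!j. j < n ==> r j \<in>[R]" "y \<in>[P]" for e r y
  using that I(2) lin_smult[OF g[of e]] lin_zero[OF F(4,5) g] by (auto simp: w_def block_def fun_eq_iff)
 have Tb: "\<Theta> (block I P e r y) = finsum P (%j. \<theta> j (scal (r j) .[P] y)) {..<n}"
  if r: "!!j. j < n ==> r j \<in>[R]" and y: "y \<in>[P]" for e r y
 proof -
  have c: "\<theta> j (scal (r j) .[P] y) \<in>[P]" if "j < n" for j using lin_cl[OF th(1)[OF that]] r[OF that] y by simp
  have "finsum P (%j. \<theta> j (scal (r j) .[P] y)) {..<n} = finsum P (%k. \<theta> (snd k) (scal (r (snd k)) .[P] y)) (Pair e ` {..<n})"
   by (subst P.add.finprod_reindex) (use c in "auto simp: inj_on_def")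
  also have "... = finsum P (%k. \<theta> (snd k) (block I P e r y k)) I"
   by (rule P.add.finprod_mono_neutral_cong_left)
    (use I c lin_zero[OF F(4,4) th(1)] in "auto simp: block_def I_def image_iff")
  finally show ?thesis by (simp add: \<Theta>_def)
 qed
 obtain r where r: "!!j. j < n ==> r j \<in>[R]" "!!y. y \<in>[P] ==> y = finsum P (%j. \<theta> j (scal (r j) .[P] y)) {..<n}"
  using th(2)[OF lin_id] by metis
 have t: "lin L P W1 (block I P e r)" "lin L Q W0 (block I Q e r)" for e
  unfolding W1_def W0_def by (intro lin_block F r(1) I(2); assumption)+
 have t2: "\<Theta> (block I P e r y) = y" "w (block I P e r y) = block I Q e r (g e y)" if "y \<in>[P]" for e y
  using Tb[OF r(1) that] wb[OF r(1) that] r(2)[OF that] by auto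
 have B: "\<exists>b \<tau> \<sigma>. lin L W0 Q b & lin L W1 W1 \<tau> & lin L W0 W0 \<sigma> &
  (\<forall>p\<in>carrier W1. g e1 (\<Theta> p) = b (w p) +[Q] g e0 (\<Theta> (\<tau> p))) & (\<forall>p\<in>carrier W1. w (\<tau> p) = \<sigma> (w p))" for e0 e1
 proof -
  define good where "good k b c r \<longleftrightarrow> lin L Q Q b & lin L P P c & (\<forall>j<n. r j \<in>[R]) &
   (\<forall>y\<in>carrier P. g e1 (\<theta> (snd k) y) = b (g (fst k) y) +[Q] g e0 (c y)) &
   (\<forall>y\<in>carrier P. c y = finsum P (%j. \<theta> j (scal (r j) .[P] y)) {..<n})" for k b c r
  have "\<exists>b c r. good k b c r" if k: "k : I" for k
  proof -
   have "lin L P Q (%y. g e1 (\<theta> (snd k) y))" by (rule lin_comp[OF th(1)[OF I(2)[OF k]] g])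
   then obtain b c where "lin L Q Q b" "lin L P P c" "\<forall>y\<in>carrier P. g e1 (\<theta> (snd k) y) = b (g (fst k) y) +[Q] g e0 (c y)"
    using og[of "fst k" e0] unfolding orth_def by blast
   with th(2)[of c] show ?thesis unfolding good_def by blast
  qed
  then obtain b c r where "!!k. k : I ==> good k (b k) (c k) (r k)" by metis
  hence b: "!!k. k : I ==> lin L Q Q (b k)" and c: "!!k. k : I ==> lin L P P (c k)"
   and r: "!!k j. k : I ==> j < n ==> r k j \<in>[R]"
   and bc: "!!k y. k : I ==> y \<in>[P] ==> g e1 (\<theta> (snd k) y) = b k (g (fst k) y) +[Q] g e0 (c k y)"
   and cr: "!!k y. k : I ==> y \<in>[P] ==> c k y = finsum P (%j. \<theta> j (scal (r k j) .[P] y)) {..<n}"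
   by (simp_all add: good_def)
  let ?b = "%q. finsum Q (%k. b k (q k)) I"
  let ?t = "%p. finsum W1 (%k. block I P (fst k) (r k) (p k)) I"
  let ?s = "%q. finsum W0 (%k. block I Q (fst k) (r k) (q k)) I"
  have bl: "lin L W0 Q ?b" unfolding W0_def by (rule lin_cotuple[OF F(5) I(1) b])
  have bP: "lin L P W1 (block I P (fst k) (r k))" "lin L Q W0 (block I Q (fst k) (r k))" if "k : I" for k
   unfolding W1_def W0_def by (intro lin_block F r[OF that] I(2); assumption)+
  have tl: "lin L W1 W1 ?t" using lin_cotuple[OF Wm(1) I(1) bP(1)] by (simp add: W1_def)
  have sl: "lin L W0 W0 ?s" using lin_cotuple[OF Wm(2) I(1) bP(2)] by (simp add: W0_def)
  have "g e1 (\<Theta> p) = ?b (w p) +[Q] g e0 (\<Theta> (?t p)) & w (?t p) = ?s (w p)" if p: "p \<in>[W1]" for p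
  proof
   have pk: "p k \<in>[P]" if "k : I" for k using p that by (auto simp: W1_def)
   have gp: "b k (g e (p k)) \<in>[Q]" "g e (c k (p k)) \<in>[Q]" if "k : I" for k e
    by (intro lin_cl[OF b[OF that]] lin_cl[OF g] lin_cl[OF c[OF that]] pk that)+
   have "w (?t p) = finsum W0 (%k. w (block I P (fst k) (r k) (p k))) I"
    by (rule lin_finsum[OF Wm wl I(1)]) (use lin_cl[OF bP(1)] pk in auto)
   also have "... = ?s (w p)"
    by (rule abelian_monoid.finsum_cong'[OF abelian_group.axioms(1)[OF lmodD(15)[OF Wm(2)]]])
     (use wb[OF r] pk lin_cl[OF bP(2)] lin_cl[OF g] in "auto simp: w_def")
   finally show "w (?t p) = ?s (w p)" .
   have "\<Theta> (?t p) = finsum P (%k. \<Theta> (block I P (fst k) (r k) (p k))) I"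
    by (rule lin_finsum[OF Wm(1) F(4) T I(1)]) (use lin_cl[OF bP(1)] pk in auto)
   also have "... = finsum P (%k. c k (p k)) I"
    by (rule P.finsum_cong') (use Tb[OF r] pk cr lin_cl[OF c] in auto)
   finally have "g e0 (\<Theta> (?t p)) = finsum Q (%k. g e0 (c k (p k))) I"
    using lin_finsum[OF F(4,5) g I(1), of "%k. c k (p k)"] pk lin_cl[OF c] by simp
   moreover have "?b (w p) = finsum Q (%k. b k (g (fst k) (p k))) I"
    by (rule Q.finsum_cong') (use gp in "auto simp: w_def")
   ultimately have "?b (w p) +[Q] g e0 (\<Theta> (?t p)) = finsum Q (%k. b k (g (fst k) (p k)) +[Q] g e0 (c k (p k))) I"
    using gp by (subst Q.finsum_addf) auto
   also have "... = finsum Q (%k. g e1 (\<theta> (snd k) (p k))) I"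
    by (rule Q.finsum_cong') (use bc pk gp in "auto simp del: split_paired_All")
   also have "... = g e1 (\<Theta> p)" unfolding \<Theta>_def
    by (rule lin_finsum[OF F(4,5) g I(1), symmetric]) (use pk lin_cl[OF th(1)] I(2) in auto)
   finally show "g e1 (\<Theta> p) = ?b (w p) +[Q] g e0 (\<Theta> (?t p))" by simp
  qed
  thus ?thesis using bl tl sl by blast
 qed
 obtain b \<tau> \<sigma> where b: "lin L W0 Q b" "lin L W1 W1 \<tau>" "lin L W0 W0 \<sigma>"
  "!!p. p \<in>[W1] ==> f' (\<Theta> p) = b (w p) +[Q] f (\<Theta> (\<tau> p))" "!!p. p \<in>[W1] ==> w (\<tau> p) = \<sigma> (w p)"
  using B[of False True] by (auto simp: g_def)
 obtain b' \<tau>' \<sigma>' where b': "lin L W0 Q b'" "lin L W1 W1 \<tau>'" "lin L W0 W0 \<sigma>'"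
  "!!p. p \<in>[W1] ==> f (\<Theta> p) = b' (w p) +[Q] f' (\<Theta> (\<tau>' p))" "!!p. p \<in>[W1] ==> w (\<tau>' p) = \<sigma>' (w p)"
  using B[of True False] by (auto simp: g_def)
 show ?thesis
 proof (rule kc_cancel[OF f f' w T t(1)[of True] t(2)[of True] _ _ t(1)[of False] t(2)[of False] _ _ b(1-3) _ _ b'(1-3)])
  fix y assume y: "y \<in>[P]"
  show "\<Theta> (block I P True r y) = y" "\<Theta> (block I P False r y) = y" by (rule t2(1)[OF y])+
  show "w (block I P True r y) = block I Q True r (f y)" "w (block I P False r y) = block I Q False r (f' y)"
   using t2(2)[OF y] by (auto simp: g_def)
 qed (rule b(4,5) b'(4,5), assumption)+
qed

lemma orth_msum:
 assumes J: "finite J" and K: "finite K"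
  and u: "!!j. j : J ==> arr L (P j) (Q j) (u j)" and v: "!!k. k : K ==> arr L (P' k) (Q' k) (v k)"
  and o: "!!j k. [|j : J; k : K|] ==> orth L (P j) (Q j) (u j) (P' k) (Q' k) (v k)"
 shows "orth L (msum J P) (msum J Q) (%p. \<lambda>j\<in>J. u j (p j)) (msum K P') (msum K Q') (%p. \<lambda>k\<in>K. v k (p k))"
 unfolding orth_def
proof (intro allI impI)
 note U = arrD[OF u] and V = arrD[OF v]
 fix h assume h: "lin L (msum J P) (msum K Q') h"
 define good where "good j k b c \<longleftrightarrow> lin L (Q j) (Q' k) b & lin L (P j) (P' k) c &
  (\<forall>x\<in>carrier (P j). h (minj J P j x) k = b (u j x) +[Q' k] v k (c x))" for j k b c
 have "\<exists>b c. good j k b c" if jk: "j : J" "k : K" for j k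
 proof -
  have "lin L (P j) (Q' k) (%x. h (minj J P j x) k)"
   by (rule lin_comp[OF lin_comp[OF lin_minj h] lin_proj[OF jk(2)]]) (use U jk in auto)
  thus ?thesis using o[OF jk] unfolding orth_def good_def by blast
 qed
 then obtain b c where "!!j k. j : J ==> k : K ==> good j k (b j k) (c j k)" by metis
 hence b: "!!j k. j : J ==> k : K ==> lin L (Q j) (Q' k) (b j k)" and c: "!!j k. j : J ==> k : K ==> lin L (P j) (P' k) (c j k)"
  and bc: "!!j k x. j : J ==> k : K ==> x \<in>[P j] ==> h (minj J P j x) k = b j k (u j x) +[Q' k] v k (c j k x)"
  by (simp_all add: good_def)
 let ?b = "%q. \<lambda>k\<in>K. finsum (Q' k) (%j. b j k (q j)) J"
 let ?c = "%p. \<lambda>k\<in>K. finsum (P' k) (%j. c j k (p j)) J"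
 show "\<exists>b c. lin L (msum J Q) (msum K Q') b & lin L (msum J P) (msum K P') c &
  (\<forall>x\<in>carrier (msum J P). h x = b (\<lambda>j\<in>J. u j (x j)) +[msum K Q'] (\<lambda>k\<in>K. v k (c x k)))"
 proof (intro exI conjI ballI)
  show "lin L (msum J Q) (msum K Q') ?b" by (rule lin_tuple) (use J b V in "auto intro!: lin_cotuple")
  show "lin L (msum J P) (msum K P') ?c" by (rule lin_tuple) (use J c V in "auto intro!: lin_cotuple")
  fix x assume x: "x \<in>[msum J P]"
  hence xj: "x j \<in>[P j]" if "j : J" for j using that by auto
  have e: "h x k = finsum (Q' k) (%j. b j k (u j (x j))) J +[Q' k] v k (finsum (P' k) (%j. c j k (x j)) J)" if k: "k : K" for k
  proof -
   interpret Q': left_module L "Q' k" by (rule V(5)[OF k])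
   have cl: "b j k (u j (x j)) \<in>[Q' k]" "c j k (x j) \<in>[P' k]" "v k (c j k (x j)) \<in>[Q' k]" if "j : J" for j
    by (intro lin_cl[OF b] lin_cl[OF c] lin_cl[OF V(3)] lin_cl[OF U(3)] that k xj)+
   have "h x k = finsum (Q' k) (%j. h (minj J P j (x j)) k) J"
    by (rule lin_msum_expand[OF L.ring_axioms J U(4) V(5)[OF k] lin_comp[OF h lin_proj[OF k]] x])
   also have "... = finsum (Q' k) (%j. b j k (u j (x j)) +[Q' k] v k (c j k (x j))) J"
    by (rule Q'.finsum_cong') (use bc k xj cl in auto)
   also have "... = finsum (Q' k) (%j. b j k (u j (x j))) J +[Q' k] finsum (Q' k) (%j. v k (c j k (x j))) J"
    by (rule Q'.finsum_addf) (use cl in auto)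
   also have "finsum (Q' k) (%j. v k (c j k (x j))) J = v k (finsum (P' k) (%j. c j k (x j)) J)"
    by (rule lin_finsum[OF V(4)[OF k] V(5)[OF k] V(3)[OF k] J, symmetric]) (use cl in auto)
   finally show ?thesis .
  qed
  have "h x \<in>[msum K Q']" by (rule lin_cl[OF h x])
  hence "h x = (\<lambda>k\<in>K. h x k)" by (auto simp: PiE_iff extensional_def fun_eq_iff)
  also have "... = ?b (\<lambda>j\<in>J. u j (x j)) +[msum K Q'] (\<lambda>k\<in>K. v k (?c x k))"
  proof -
   have "finsum (Q' k) (%j. b j k ((\<lambda>j\<in>J. u j (x j)) j)) J = finsum (Q' k) (%j. b j k (u j (x j))) J" if "k : K" for k
    by (rule abelian_monoid.finsum_cong'[OF abelian_group.axioms(1)[OF lmodD(15)[OF V(5)[OF that]]]])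
     (use lin_cl[OF b] lin_cl[OF U(3)] xj that in auto)
   thus ?thesis using e by (auto simp: fun_eq_iff)
  qed
  finally show "h x = ?b (\<lambda>j\<in>J. u j (x j)) +[msum K Q'] (\<lambda>k\<in>K. v k (?c x k))" .
 qed
qed

lemma orth_id:
 assumes "arr L P Q u" "lmod L X"
 shows "orth L X X (%x. x) P Q u" "orth L P Q u X X (%x. x)"
proof -
 note U = arrD[OF assms(1)]
 interpret Q: left_module L Q by (rule U(5))
 interpret X: left_module L X by fact
 show "orth L X X (%x. x) P Q u" unfolding orth_def
 proof (intro allI impI)
  fix h assume h: "lin L X Q h"
  thus "\<exists>b c. lin L X Q b & lin L X P c & (\<forall>x\<in>carrier X. h x = b x +[Q] u (c x))"
   by (intro exI[of _ h] exI[of _ "%_. 0[P]"]) (auto simp: lin_zero_map U lin_zero[OF U(4,5,3)] lin_cl[OF h])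
 qed
 show "orth L P Q u X X (%x. x)" unfolding orth_def
 proof (intro allI impI)
  fix h assume h: "lin L P X h"
  thus "\<exists>b c. lin L Q X b & lin L P X c & (\<forall>x\<in>carrier P. h x = b (u x) +[X] c x)"
   by (intro exI[of _ h] exI[of _ "%_. 0[X]"]) (auto simp: lin_zero_map assms(2) lin_cl[OF h])
 qed
qed

lemma orth_iso:
 assumes o: "orth L P Q u P' Q' v" and u: "arr L P Q u" and v: "arr L P' Q' v"
  and i: "lmod L Z" "iso L Q Z i" and i': "lmod L Z'" "iso L Q' Z' i'"
 shows "orth L P Z (%x. i (u x)) P' Z' (%x. i' (v x))"
 unfolding orth_def
proof (intro allI impI)
 note U = arrD[OF u] and V = arrD[OF v]
 obtain j where j: "iso L Z Q j" "!!x. x \<in>[Q] ==> j (i x) = x" using iso_inverse[OF U(5) i] by metis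
 obtain j' where j': "iso L Z' Q' j'" "!!y. y \<in>[Z'] ==> i' (j' y) = y" using iso_inverse[OF V(5) i'] by metis
 fix h assume h: "lin L P Z' h"
 obtain b c where bc: "lin L Q Q' b" "lin L P P' c" "!!x. x \<in>[P] ==> j' (h x) = b (u x) +[Q'] v (c x)"
  using o lin_comp[OF h isoD(1)[OF j'(1)]] unfolding orth_def by blast
 have "h x = i' (b (j (i (u x)))) +[Z'] i' (v (c x))" if x: "x \<in>[P]" for x
 proof -
  have cl: "u x \<in>[Q]" "b (u x) \<in>[Q']" "v (c x) \<in>[Q']"
   by (intro lin_cl[OF U(3)] lin_cl[OF V(3)] lin_cl[OF bc(1)] lin_cl[OF bc(2)] x)+
  have "h x = i' (b (u x) +[Q'] v (c x))" using j'(2)[OF lin_cl[OF h x]] bc(3)[OF x] by simp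
  thus ?thesis using lin_add[OF isoD(1)[OF i'(2)] cl(2,3)] j(2)[OF cl(1)] by simp
 qed
 thus "\<exists>b c. lin L Z Z' b & lin L P P' c & (\<forall>x\<in>carrier P. h x = b (i (u x)) +[Z'] i' (v (c x)))"
  using lin_comp[OF lin_comp[OF isoD(1)[OF j(1)] bc(1)] isoD(1)[OF i'(2)]] bc(2) by blast
qed

end

text \<open>
 Fewer equations than unknowns, by elimination over the integers.
\<close>

lemma integer_dependency:
 fixes v :: "'i => 's => int"
 assumes "finite S" "finite I" "card S < card I"
 shows "\<exists>a. (\<exists>i\<in>I. a i \<noteq> 0) & (\<forall>s\<in>S. (\<Sum>i\<in>I. a i * v i s) = 0)"
 using assms
proof (induct S arbitrary: I v)
 case empty
 then obtain i where "i : I" by fastforce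
 thus ?case by (intro exI[of _ "%_. 1"]) auto
next
 case (insert s S)
 show ?case
 proof (cases "\<exists>p\<in>I. v p s \<noteq> 0")
  case False
  obtain a where "\<exists>i\<in>I. a i \<noteq> 0" "\<forall>t\<in>S. (\<Sum>i\<in>I. a i * v i t) = 0"
   using insert(3)[of I v] insert(1,2,4,5) by auto
  thus ?thesis using False by (intro exI[of _ a]) auto
 next
  case True
  then obtain p where p: "p : I" "v p s \<noteq> 0" by blast
  have "card S < card (I - {p})" using insert(1,2,4,5) p by simp
  from insert(3)[OF _ this, of "%i t. v p s * v i t - v i s * v p t"] insert(4)
  obtain a where a: "\<exists>i\<in>I - {p}. a i \<noteq> 0"
   "\<forall>t\<in>S. (\<Sum>i\<in>I - {p}. a i * (v p s * v i t - v i s * v p t)) = 0" by auto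
  define b where "b i = (if i = p then - (\<Sum>i\<in>I - {p}. a i * v i s) else a i * v p s)" for i
  have e: "(\<Sum>i\<in>I. b i * v i t) = (\<Sum>i\<in>I - {p}. a i * (v p s * v i t - v i s * v p t))" for t
  proof -
   have "(\<Sum>i\<in>I. b i * v i t) = b p * v p t + (\<Sum>i\<in>I - {p}. a i * v p s * v i t)"
    by (subst sum.remove[OF insert(4) p(1)]) (simp add: b_def)
   also have "b p * v p t = - (\<Sum>i\<in>I - {p}. a i * v i s * v p t)" by (simp add: b_def sum_distrib_right)
   finally show ?thesis by (simp add: sum_subtractf algebra_simps)
  qed
  have "(\<Sum>i\<in>I. b i * v i t) = 0" if "t : insert s S" for t using that a(2) e[of t] by auto
  moreover have "\<exists>i\<in>I. b i \<noteq> 0" using a(1) p(2) by (auto simp: b_def)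
  ultimately show ?thesis by blast
 qed
qed

context complete_algebra
begin

text \<open>
 A relation \<open>\<Sum>\<^sub>i a\<^sub>i (dec Q\<^sub>i - dec P\<^sub>i) = 0\<close> makes the two maps \<open>\<Oplus> |a\<^sub>i| P\<^sub>i \<rightarrow> \<dots>\<close> that use \<open>u\<^sub>i\<close> for \<open>a\<^sub>i > 0\<close> and the
 identity otherwise, or conversely, have isomorphic targets.
\<close>

theorem card_le_of_orth:
 fixes P Q :: "'i => 'l umod"
 assumes I: "finite I" and A: "!!i. i : I ==> arr L (P i) (Q i) (u i)"
  and c: "!!i. i : I ==> kc (P i) (Q i) (u i) = {#c i#}" "inj_on c I"
  and o: "!!i j. [|i : I; j : I|] ==> orth L (P i) (Q i) (u i) (P j) (Q j) (u j)"
  and S: "finite S" "!!i. i : I ==> set_mset (dec (P i)) <= S" "!!i. i : I ==> set_mset (dec (Q i)) <= S"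
 shows "card I \<le> card S"
proof (rule ccontr)
 assume "\<not> card I \<le> card S"
 define v where "v i s = int (count (dec (Q i)) s) - int (count (dec (P i)) s)" for i s
 obtain a where a: "\<exists>i\<in>I. a i \<noteq> 0" "!!s. s : S ==> (\<Sum>i\<in>I. a i * v i s) = 0"
  using integer_dependency[OF S(1) I, of v] \<open>\<not> card I \<le> card S\<close> by auto
 have a0: "(\<Sum>i\<in>I. a i * v i s) = 0" for s
 proof (cases "s : S")
  case False
  hence "v i s = 0" if "i : I" for i 
  proof -
   have "s \<notin># dec (P i)" "s \<notin># dec (Q i)" using S(2,3)[OF that] False by blast+
   thus ?thesis by (simp add: v_def not_in_iff)
  qed
  thus ?thesis by simp
 qed (rule a(2))
 define J where "J = Sigma I (%i. {..<nat \<bar>a i\<bar>})"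
 have J: "finite J" "!!j. j : J ==> fst j : I" "!!j. j : J ==> a (fst j) \<noteq> 0" using I unfolding J_def
  by (simp, elim SigmaE, simp, elim SigmaE, auto)
 have sumJ: "(\<Sum>j\<in>J. F (fst j)) = (\<Sum>i\<in>I. \<bar>a i\<bar> * F i)" for F :: "_ => int"
 proof -
  have "(\<Sum>i\<in>I. \<Sum>k\<in>{..<nat \<bar>a i\<bar>}. F i) = (\<Sum>j\<in>J. F (fst j))"
   unfolding J_def by (subst sum.Sigma) (use I in "auto simp: case_prod_unfold")
  thus ?thesis by simp
 qed
 define PP where "PP = msum J (%j. P (fst j))"
 define QQ where "QQ e j = (if (0 < a (fst j)) = e then Q (fst j) else P (fst j))" for e and j :: "'i \<times> nat"
 define g where "g e j = (if (0 < a (fst j)) = e then u (fst j) else (%x. x))" for e and j :: "'i \<times> nat"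
 define G where "G e = (%p. \<lambda>j\<in>J. g e j (p j))" for e
 have g: "arr L (P (fst j)) (QQ e j) (g e j)" if "j : J" for e j
  using A[OF J(2)[OF that]] lin_id by (auto simp: QQ_def g_def arr_def)
 have G: "arr L PP (msum J (QQ e)) (G e)" for e unfolding PP_def G_def by (rule arr_msum[OF J(1) g])
 have kcg: "kc (P (fst j)) (QQ e j) (g e j) = (if (0 < a (fst j)) = e then {#c (fst j)#} else {#})" if "j : J" for e j
 proof -
  have "arr L (P (fst j)) (P (fst j)) (%x. x)" using A[OF J(2)[OF that]] lin_id by (auto simp: arr_def)
  from kc_iso[OF this iso_id] show ?thesis using c(1)[OF J(2)[OF that]] by (auto simp: QQ_def g_def)
 qed
 have kcG: "kc PP (msum J (QQ e)) (G e) = (\<Sum>j\<in>J. if (0 < a (fst j)) = e then {#c (fst j)#} else {#})" for e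
  unfolding PP_def G_def by (subst kc_msum[OF J(1) g]) (use kcg in "auto intro!: sum.cong")
 have og: "orth L (P (fst j)) (QQ e j) (g e j) (P (fst k)) (QQ e' k) (g e' k)" if jk: "j : J" "k : J" for j k e e'
 proof -
  note l = arrD(4)[OF A[OF J(2)[OF jk(1)]]] arrD(4)[OF A[OF J(2)[OF jk(2)]]]
  consider "(0 < a (fst j)) = e" "(0 < a (fst k)) = e'" | "(0 < a (fst j)) \<noteq> e" | "(0 < a (fst k)) \<noteq> e'" by blast
  thus ?thesis
  proof cases
   case 1
   thus ?thesis using o[OF J(2)[OF jk(1)] J(2)[OF jk(2)]] by (simp add: QQ_def g_def)
  next
   case 2
   thus ?thesis using orth_id(1)[OF g[OF jk(2)] l(1)] by (simp add: QQ_def[of e] g_def[of e])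
  next
   case 3
   thus ?thesis using orth_id(2)[OF g[OF jk(1)] l(2)] by (simp add: QQ_def[of e'] g_def[of e'])
  qed
 qed
 have oG: "orth L PP (msum J (QQ e)) (G e) PP (msum J (QQ e')) (G e')" for e e'
  unfolding PP_def G_def by (rule orth_msum[OF J(1) J(1) g g og])
 have dQ: "dec (msum J (QQ e)) = (\<Sum>j\<in>J. dec (QQ e j))" for e by (rule dec_msum[OF J(1) arrD(2)[OF g]])
 have "dec (msum J (QQ True)) = dec (msum J (QQ False))"
 proof (rule multiset_eqI)
  fix s
  have "int (count (dec (msum J (QQ True))) s) - int (count (dec (msum J (QQ False))) s) =
   (\<Sum>j\<in>J. int (count (dec (QQ True j)) s) - int (count (dec (QQ False j)) s))"
   unfolding dQ by (simp add: count_sum sum_subtractf)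
  also have "... = (\<Sum>j\<in>J. sgn (a (fst j)) * v (fst j) s)"
   using J(3) by (intro sum.cong) (auto simp: QQ_def v_def sgn_if)
  also have "... = (\<Sum>i\<in>I. \<bar>a i\<bar> * (sgn (a i) * v i s))" by (rule sumJ)
  also have "... = (\<Sum>i\<in>I. a i * v i s)" by (intro sum.cong) (auto simp: abs_if sgn_if)
  finally show "count (dec (msum J (QQ True))) s = count (dec (msum J (QQ False))) s" using a0[of s] by simp
 qed
 then obtain i where i: "iso L (msum J (QQ False)) (msum J (QQ True)) i"
  using dec_inj[OF arrD(2)[OF G] arrD(2)[OF G]] mod_isoE[OF _ arrD(5)[OF G]] by metis
 let ?G = "%x. i (G False x)"
 have G': "arr L PP (msum J (QQ True)) ?G"
  using arrD[OF G[of False]] arrD[OF G[of True]] lin_comp[OF _ isoD(1)[OF i]] by (auto simp: arr_def)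
 have "kc PP (msum J (QQ True)) (G True) = kc PP (msum J (QQ True)) ?G"
  using orth_iso[OF oG G G arrD(5)[OF G] iso_id arrD(5)[OF G] i] orth_iso[OF oG G G arrD(5)[OF G] i arrD(5)[OF G] iso_id]
   orth_iso[OF oG G G arrD(5)[OF G] i arrD(5)[OF G] i]
  by (intro kc_orth[OF G G' oG])
 also have "... = kc PP (msum J (QQ False)) (G False)" by (rule kc_cong[OF G G' iso_id i, symmetric]) simp
 finally have k: "kc PP (msum J (QQ e)) (G e) = kc PP (msum J (QQ e')) (G e')" for e e' by (cases e; cases e') auto
 obtain i0 where i0: "i0 : I" "a i0 \<noteq> 0" using a(1) by blast
 define e where "e = (0 < a i0)"
 have j0: "(i0, 0) : J" using i0 by (simp add: J_def)
 have "c i0 \<in># kc PP (msum J (QQ e)) (G e)"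
  unfolding kcG using j0 J(1) by (auto simp: set_mset_sum e_def intro!: bexI[of _ "(i0, 0)"])
 hence "c i0 \<in># kc PP (msum J (QQ (\<not> e))) (G (\<not> e))" using k by metis
 then obtain j where j: "j : J" "(0 < a (fst j)) \<noteq> e" "c i0 = c (fst j)"
  unfolding kcG using J(1) by (auto simp: set_mset_sum split: if_splits)
 have "fst j = i0" using inj_onD[OF c(2) j(3) i0(1) J(2)[OF j(1)]] by simp
 thus False using j(2) e_def by simp
qed

end

section \<open>Relative resolutions of length one\<close>

context complete_algebra
begin

lemma regular_test:
 fixes F :: "('l, 'f) module" and X :: "('l, 'x) module"
 assumes F: "lmod L F" "mod_iso L (reg_mod L) F" and X: "lmod L X" and x: "x \<in>[X]"
 obtains z g where "z \<in>[F]" "g : mod_hom L F X" "g z = x" "\<forall>y\<in>carrier F. \<exists>a\<in>carrier L. g y = a .[X] x"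
proof -
 note Rm = regular_lmod[OF L.ring_axioms]
 obtain f where f: "iso L (reg_mod L) F f" using mod_isoE[OF F(2) Rm] .
 obtain s where s: "iso L F (reg_mod L) s" "!!x. x \<in>[reg_mod L] ==> s (f x) = x"
  using iso_inverse[OF Rm F(1) f] by metis
 let ?g = "restrict (%y. s y .[X] x) (carrier F)"
 have z: "f 1[L] \<in>[F]" by (rule lin_cl[OF isoD(1)[OF f]]) simp
 have g: "?g : mod_hom L F X" by (rule lin_mod_hom[OF F(1) lin_comp[OF isoD(1)[OF s(1)] lin_from_regular[OF X x]]])
 have gz: "?g (f 1[L]) = x" using z s(2)[of "1[L]"] lmodD(11)[OF X x] by simp
 have "\<forall>y\<in>carrier F. \<exists>a\<in>carrier L. ?g y = a .[X] x" using lin_cl[OF isoD(1)[OF s(1)]] by auto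
 with z g gz show ?thesis by (rule that)
qed

text \<open>
 The regular module represents the forgetful functor, so \<open>Hom(\<Lambda>, -)\<close>-exactness is exactness.
\<close>

lemma rel_resolution_exact:
 fixes C0 C1 F :: "'l umod" and X :: "'l umod"
 assumes m: "lmod L C0" "lmod L C1" "lmod L X"
  and F: "F : C" "lmod L F" "mod_iso L (reg_mod L) F"
  and f: "f1 : mod_hom L C1 C0" "f0 : mod_hom L C0 X" "compose (carrier C1) f0 f1 = zero_map C1 X"
  and ex: "\<forall>C'\<in>C. inj_on (%g. compose (carrier C') f1 g) (mod_hom L C' C1) &
     (%g. compose (carrier C') f1 g) ` mod_hom L C' C1 =
      {g : mod_hom L C' C0. compose (carrier C') f0 g = zero_map C' X} &
     (%g. compose (carrier C') f0 g) ` mod_hom L C' C0 = mod_hom L C' X"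
 shows "inj_on f1 (carrier C1)" "f1 ` carrier C1 = ker C0 X f0" "f0 ` carrier C0 = carrier X"
proof -
 note l = mod_hom_lin[OF f(1)] mod_hom_lin[OF f(2)]
 have i: "inj_on (%g. compose (carrier F) f1 g) (mod_hom L F C1)"
  and k: "(%g. compose (carrier F) f1 g) ` mod_hom L F C1 = {g : mod_hom L F C0. compose (carrier F) f0 g = zero_map F X}"
  and s: "(%g. compose (carrier F) f0 g) ` mod_hom L F C0 = mod_hom L F X"
  using ex F(1) by blast+
 have "x = 0[C1]" if x: "x : ker C1 C0 f1" for x
 proof -
  have x': "x \<in>[C1]" "f1 x = 0[C0]" using x by (auto simp: ker_def)
  obtain z g where zg: "z \<in>[F]" "g : mod_hom L F C1" "g z = x" "\<forall>y\<in>carrier F. \<exists>a\<in>carrier L. g y = a .[C1] x"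
   using regular_test[OF F(2,3) m(2) x'(1)] .
  have g0: "f1 (g y) = 0[C0]" if "y \<in>[F]" for y
   using zg(4) that lin_smult[OF l(1) _ x'(1)] x'(2) lmodD(13)[OF m(1)] by auto
  have z0: "zero_map F C1 : mod_hom L F C1"
   using lin_mod_hom[OF F(2) lin_zero_map[OF m(2)]] by (simp add: zero_map_def)
  have "compose (carrier F) f1 g = compose (carrier F) f1 (zero_map F C1)"
   unfolding compose_def by (rule restrict_ext) (use g0 lin_zero[OF m(2,1) l(1)] in "simp add: zero_map_def")
  from inj_onD[OF i this zg(2) z0] have "g = zero_map F C1" .
  thus ?thesis using zg(1,3) by (simp add: zero_map_def)
 qed
 hence "ker C1 C0 f1 <= {0[C1]}" by blast
 moreover have "0[C1] : ker C1 C0 f1" using lin_zero[OF m(2,1) l(1)] lmodD(2)[OF m(2)] by (simp add: ker_def)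
 ultimately have "ker C1 C0 f1 = {0[C1]}" by blast
 thus "inj_on f1 (carrier C1)" using inj_on_iff_ker[OF m(2,1) l(1)] by simp
 have "f0 (f1 x) = 0[X]" if "x \<in>[C1]" for x using fun_cong[OF f(3), of x] that by (simp add: compose_def zero_map_def)
 moreover have "y : f1 ` carrier C1" if y: "y : ker C0 X f0" for y
 proof -
  have y': "y \<in>[C0]" "f0 y = 0[X]" using y by (auto simp: ker_def)
  obtain z g where zg: "z \<in>[F]" "g : mod_hom L F C0" "g z = y" "\<forall>w\<in>carrier F. \<exists>a\<in>carrier L. g w = a .[C0] y"
   using regular_test[OF F(2,3) m(1) y'(1)] .
  have "f0 (g w) = 0[X]" if "w \<in>[F]" for w
   using zg(4) that lin_smult[OF l(2) _ y'(1)] y'(2) lmodD(13)[OF m(3)] by auto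
  hence "compose (carrier F) f0 g = zero_map F X" by (auto simp: compose_def zero_map_def fun_eq_iff)
  hence "g : (%g. compose (carrier F) f1 g) ` mod_hom L F C1" unfolding k using zg(2) by simp
  then obtain h where h: "g = compose (carrier F) f1 h" "h : mod_hom L F C1" by (elim imageE)
  have "y = f1 (h z)" using fun_cong[OF h(1), of z] zg(1,3) by (simp add: compose_def)
  thus ?thesis using mod_hom_closed[OF h(2) zg(1)] by blast
 qed
 ultimately show "f1 ` carrier C1 = ker C0 X f0" using lin_cl[OF l(1)] by (auto simp: ker_def)
 have "x : f0 ` carrier C0" if x: "x \<in>[X]" for x
 proof -
  obtain z g where zg: "z \<in>[F]" "g : mod_hom L F X" "g z = x" using regular_test[OF F(2,3) m(3) x] .
  hence "g : (%g. compose (carrier F) f0 g) ` mod_hom L F C0" unfolding s by simp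
  then obtain h where h: "g = compose (carrier F) f0 h" "h : mod_hom L F C0" by (elim imageE)
  have "x = f0 (h z)" using fun_cong[OF h(1), of z] zg(1,3) by (simp add: compose_def)
  thus ?thesis using mod_hom_closed[OF h(2) zg(1)] by blast
 qed
 thus "f0 ` carrier C0 = carrier X" using lin_cl[OF l(2)] by auto
qed

text \<open>
 Given \<open>h: C\<^sub>1 \<rightarrow> C\<^sub>0'\<close>, the composite \<open>C\<^sub>1 \<rightarrow> C\<^sub>0' \<rightarrow> X'\<close> extends to \<open>C\<^sub>0\<close> and lifts to some \<open>b: C\<^sub>0 \<rightarrow> C\<^sub>0'\<close>. Then \<open>h - b f\<^sub>1\<close> has
 values in the kernel of \<open>C\<^sub>0' \<rightarrow> X'\<close>, so it factors through \<open>C\<^sub>1'\<close>.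
\<close>

lemma orth_of_ext_vanish:
 fixes X :: "'l umod"
 assumes X: "fgm L X" and X': "lmod L X'" and v: "ext_vanish L X' 0 X"
  and m: "lmod L C0" "lmod L C1" "lmod L C0'" "lmod L C1'"
  and f: "lin L C1 C0 f1" "lin L C0 X f0" "inj_on f1 (carrier C1)" "f1 ` carrier C1 = ker C0 X f0" "f0 ` carrier C0 = carrier X"
  and f': "lin L C1' C0' f1'" "lin L C0' X' f0'" "inj_on f1' (carrier C1')" "f1' ` carrier C1' = ker C0' X' f0'"
  and lift: "!!k. lin L C0 X' k ==> \<exists>b. lin L C0 C0' b & (\<forall>x\<in>carrier C0. f0' (b x) = k x)"
 shows "orth L C1 C0 f1 C1' C0' f1'"
 unfolding orth_def
proof (intro allI impI)
 fix h assume h: "lin L C1 C0' h"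
 note Xm = fg_lmod[OF X]
 interpret C0': left_module L C0' by (rule m(3))
 let ?K = "sub C0 (ker C0 X f0)"
 have K: "lmod L ?K" by (rule sub_lmod[OF m(1) ker_submodule[OF m(1) Xm f(2)]])
 have kc: "ker C0 X f0 <= carrier C0" by (auto simp: ker_def)
 have f1K: "lin L C1 ?K f1" unfolding lin_into_sub[OF kc] using f(1,4) by simp
 have k1: "ker C1 ?K f1 <= ker C1 X' (%x. f0' (h x))"
  using inj_on_iff_ker[OF m(2,1) f(1)] f(3) lin_zero[OF m(2) X' lin_comp[OF h f'(2)]] lmodD(2)[OF m(2)] by (auto simp: ker_def)
 have s1: "f1 ` carrier C1 = carrier ?K" using f(4) by simp
 obtain h' where h': "lin L ?K X' h'" "!!x. x \<in>[C1] ==> h' (f1 x) = f0' (h x)"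
  using factor_surj[OF m(2) K X' f1K s1 lin_comp[OF h f'(2)] k1] by blast
 obtain k where k: "lin L C0 X' k" "!!x. x : ker C0 X f0 ==> k x = h' x"
  using ext_vanish_0_extends[OF X' X v m(1) f(2,5)] h'(1) unfolding extends_def by blast
 obtain b where b: "lin L C0 C0' b" "!!x. x \<in>[C0] ==> f0' (b x) = k x" using lift[OF k(1)] by blast
 let ?d = "%x. h x -[C0'] b (f1 x)"
 have d: "lin L C1 C0' ?d" by (rule lin_subtract[OF m(3) h lin_comp[OF f(1) b(1)]])
 have dk: "?d ` carrier C1 <= f1' ` carrier C1'"
 proof
  fix y assume "y : ?d ` carrier C1"
  then obtain x where x: "y = ?d x" "x \<in>[C1]" by (elim imageE)
  have fx: "f1 x : ker C0 X f0" "f1 x \<in>[C0]" using x(2) f(4) lin_cl[OF f(1)] by auto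
  have "f0' (b (f1 x)) = f0' (h x)" using b(2)[OF fx(2)] k(2)[OF fx(1)] h'(2)[OF x(2)] by simp
  hence "h x -[C0'] b (f1 x) : ker C0' X' f0'"
   using ker_iff_diff[OF m(3) X' f'(2) lin_cl[OF h x(2)] lin_cl[OF b(1) fx(2)]] by simp
  thus "y : f1' ` carrier C1'" unfolding x(1) f'(4) .
 qed
 obtain c where c: "lin L C1 C1' c" "!!x. x \<in>[C1] ==> f1' (c x) = ?d x"
  using factor_inj[OF m(4,3,2) f'(1,3) d dk] by blast
 have "h x = b (f1 x) +[C0'] f1' (c x)" if x: "x \<in>[C1]" for x
 proof -
  have "h x \<in>[C0']" "b (f1 x) \<in>[C0']" by (intro lin_cl[OF h] lin_cl[OF b(1)] lin_cl[OF f(1)] x)+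
  thus ?thesis using c(2)[OF x] by (simp add: C0'.minus_eq C0'.a_lcomm[of "b (f1 x)" "h x"] C0'.r_neg)
 qed
 thus "\<exists>b c. lin L C0 C0' b & lin L C1 C1' c & (\<forall>x\<in>carrier C1. h x = b (f1 x) +[C0'] f1' (c x))"
  using b(1) c(1) by blast
qed

lemma ecard_le_card:
 assumes "finite S" "!!T. [|finite T; T <= D|] ==> card T \<le> card S"
 shows "ecard D \<le> enat (card S)"
proof -
 have "finite D"
 proof (rule ccontr)
  assume "infinite D"
  then obtain T where "finite T" "card T = Suc (card S)" "T <= D" using infinite_arbitrarily_large by blast
  with assms(2)[of T] show False by simp
 qed
 thus ?thesis using assms(2)[of D] by (simp add: ecard_def)
qed

lemma ind_iso_class: "t : ind L D \<longleftrightarrow> (\<exists>X\<in>D. indecomposable L X & t = iso_class L X)"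
 by (auto simp: ind_def iso_class_def)

text \<open>
 Bounding a rigid class reduces to attaching to each member \<open>X\<close> an arrow with homology \<open>X\<close> between
 modules built from \<open>S\<close>, in such a way that any two of these arrows are orthogonal.
\<close>

lemma ecard_ind_le:
 fixes D :: "'l umod set" and G :: "'l umod => 'l umod => 'l umod => (_ => _) => bool"
 assumes S: "finite S" and D: "!!X. X : D ==> fgm L X"
  and ex: "!!X. X : D ==> \<exists>P Q f. G X P Q f"
  and G: "!!X P Q f. [|X : D; G X P Q f|] ==>
   arr L P Q f & kc P Q f = dec X & set_mset (dec P) <= S & set_mset (dec Q) <= S"
  and o: "!!X X' P Q f P' Q' f'. [|X : D; X' : D; G X P Q f; G X' P' Q' f'|] ==> orth L P Q f P' Q' f'"
 shows "ecard (ind L D) \<le> enat (card S)"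
proof (rule ecard_le_card[OF S])
 fix T assume T: "finite T" "T <= ind L D"
 have "\<exists>X P Q f. X : D & dec X = {#t#} & G X P Q f" if t: "t : T" for t
 proof -
  obtain X where X: "X : D" "indecomposable L X" "t = iso_class L X" using subsetD[OF T(2) t] unfolding ind_iso_class by blast
  thus ?thesis using dec_indecomposable[OF D] ex by metis
 qed
 then obtain X P Q f where g: "!!t. t : T ==> X t : D & dec (X t) = {#t#} & G (X t) (P t) (Q t) (f t)" by metis
 have a: "arr L (P t) (Q t) (f t) & kc (P t) (Q t) (f t) = {#t#} & set_mset (dec (P t)) <= S & set_mset (dec (Q t)) <= S"
  if "t : T" for t using G[of "X t" "P t" "Q t" "f t"] g[OF that] by simp
 have "orth L (P t) (Q t) (f t) (P t') (Q t') (f t')" if "t : T" "t' : T" for t t'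
  using o[of "X t" "X t'"] g[OF that(1)] g[OF that(2)] by blast
 thus "card T \<le> card S"
  by (intro card_le_of_orth[where c = "%t. t" and P = P and Q = Q and u = f, OF T(1)]) (use a S in auto)
qed

theorem rigid_card_le:
 assumes B: "B <= fg_modules L" and C: "subcategory L C" and reg: "belongs_to L (reg_mod L) C"
  and rd: "rel_dim_le_1 L C B" and D: "D <= B" "!!X Y. [|X : D; Y : D|] ==> Ext_perp L 1 X Y"
 shows "ecard (ind L D) \<le> ecard (ind L C)"
proof (cases "finite (ind L C)")
 case True
 have Cfg: "fgm L X" if "X : C" for X using C that by (auto simp: subcategory_def fg_modules_def)
 have Dfg: "fgm L X" if "X : D" for X using B D(1) that by (auto simp: fg_modules_def)
 obtain F where F: "F : C" "mod_iso L (reg_mod L) F" using reg by (auto simp: belongs_to_def)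
 define G where "G X C1 C0 f1 \<longleftrightarrow> C0 : C & C1 : C & lin L C1 C0 f1 & inj_on f1 (carrier C1) &
  (\<exists>f0. lin L C0 X f0 & f1 ` carrier C1 = ker C0 X f0 & f0 ` carrier C0 = carrier X &
   (\<forall>C'\<in>C. (%g. compose (carrier C') f0 g) ` mod_hom L C' C0 = mod_hom L C' X))" for X C1 C0 :: "'l umod" and f1
 have "ecard (ind L D) \<le> enat (card (ind L C))"
 proof (rule ecard_ind_le[where G = G, OF True Dfg])
  fix X assume X: "X : D"
  hence "X : B" using D(1) by blast
  from bspec[OF rd[unfolded rel_dim_le_1_def] this] obtain C0 C1 f1 f0 where c: "C0 : C" "C1 : C" and f: "f1 : mod_hom L C1 C0" "f0 : mod_hom L C0 X"
   "compose (carrier C1) f0 f1 = zero_map C1 X"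
   and ex: "\<forall>C'\<in>C. inj_on (%g. compose (carrier C') f1 g) (mod_hom L C' C1) &
    (%g. compose (carrier C') f1 g) ` mod_hom L C' C1 =
     {g : mod_hom L C' C0. compose (carrier C') f0 g = zero_map C' X} &
    (%g. compose (carrier C') f0 g) ` mod_hom L C' C0 = mod_hom L C' X"
   by (elim bexE conjE) (rule that)
  note m = Cfg[OF c(1), THEN fg_lmod] Cfg[OF c(2), THEN fg_lmod] Dfg[OF X, THEN fg_lmod]
  have "G X C1 C0 f1" unfolding G_def
   using c f(1,2)[THEN mod_hom_lin] ex rel_resolution_exact[OF m F(1) fg_lmod[OF Cfg[OF F(1)]] F(2) f ex]
   by (intro conjI exI[of _ f0]) simp_all
  thus "\<exists>P Q f. G X P Q f" by blast
 next
  fix X C1 C0 f1 assume X: "X : D" and g: "G X C1 C0 f1"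
  obtain f0 where c: "C0 : C" "C1 : C" and f: "lin L C1 C0 f1" "inj_on f1 (carrier C1)" "lin L C0 X f0"
   "f1 ` carrier C1 = ker C0 X f0" "f0 ` carrier C0 = carrier X" using g unfolding G_def by (elim conjE exE) (rule that)
  note m = fg_lmod[OF Cfg[OF c(1)]] fg_lmod[OF Cfg[OF c(2)]] fg_lmod[OF Dfg[OF X]]
  have a: "arr L C1 C0 f1" using Cfg c f(1) by (simp add: arr_def)
  have "ker C1 C0 f1 = {0[C1]}" using inj_on_iff_ker[OF m(2,1) f(1)] f(2) by simp
  hence "dec (sub C1 (ker C1 C0 f1)) = {#}"
   using dec_zero[OF fg_lmod[OF ker_fg[OF Cfg[OF c(2)] m(1) f(1)]]] by (simp add: is_zero_module_def)
  thus "arr L C1 C0 f1 & kc C1 C0 f1 = dec X & set_mset (dec C1) <= ind L C & set_mset (dec C0) <= ind L C"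
   using a kc_eqI[OF a m(3) f(3,5) f(4)[symmetric]] dec_subcategory[OF C] c by simp
 next
  fix X X' C1 C0 f1 C1' C0' f1' assume X: "X : D" "X' : D" and g: "G X C1 C0 f1" "G X' C1' C0' f1'"
  obtain f0 where c: "C0 : C" "C1 : C" and f: "lin L C1 C0 f1" "lin L C0 X f0" "inj_on f1 (carrier C1)"
   "f1 ` carrier C1 = ker C0 X f0" "f0 ` carrier C0 = carrier X" using g(1) unfolding G_def by (elim conjE exE) (rule that)
  obtain f0' where c': "C0' : C" "C1' : C" and f': "lin L C1' C0' f1'" "lin L C0' X' f0'" "inj_on f1' (carrier C1')"
   "f1' ` carrier C1' = ker C0' X' f0'"
   and lift: "\<forall>C'\<in>C. (%g. compose (carrier C') f0' g) ` mod_hom L C' C0' = mod_hom L C' X'" using g(2) unfolding G_def by (elim conjE exE) (rule that)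
  note m = fg_lmod[OF Cfg[OF c(1)]] fg_lmod[OF Cfg[OF c(2)]] fg_lmod[OF Cfg[OF c'(1)]] fg_lmod[OF Cfg[OF c'(2)]]
  note Xfg = Dfg[OF X(1)] and X'm = fg_lmod[OF Dfg[OF X(2)]]
  have v: "ext_vanish L X' 0 X" using D(2)[OF X] Ext_perp_1_iff[OF Xfg X'm] by simp
  show "orth L C1 C0 f1 C1' C0' f1'"
  proof (rule orth_of_ext_vanish[OF Xfg X'm v m f f'])
   fix k assume "lin L C0 X' k"
   hence "restrict k (carrier C0) : (%g. compose (carrier C0) f0' g) ` mod_hom L C0 C0'"
    unfolding bspec[OF lift c(1)] by (rule lin_mod_hom[OF m(1)])
   then obtain b where b: "restrict k (carrier C0) = compose (carrier C0) f0' b" "b : mod_hom L C0 C0'" by (elim imageE)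
   have "f0' (b x) = k x" if "x \<in>[C0]" for x using fun_cong[OF b(1), of x] that by (simp add: compose_def)
   thus "\<exists>b. lin L C0 C0' b & (\<forall>x\<in>carrier C0. f0' (b x) = k x)" using mod_hom_lin[OF b(2)] by blast
  qed
 qed
 thus ?thesis using True by (simp add: ecard_def)
qed (simp add: ecard_def)

lemma orth_number_le:
 assumes "!!D. [|subcategory L D; D <= B; !!X Y. [|X : D; Y : D|] ==> Ext_perp L 1 X Y|] ==> ecard (ind L D) \<le> b"
 shows "orth_number L B \<le> b"
 unfolding orth_number_def by (rule SUP_least) (use assms in auto)

section \<open>Maximal orthogonal subcategories\<close>

text \<open>
 For a right approximation \<open>C\<^sub>0 \<rightarrow> X\<close> with kernel \<open>K\<close>, the vanishing of \<open>Ext\<^sup>1(C, K)\<close> follows from that of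
 \<open>Ext\<^sup>1(C, C\<^sub>0)\<close> and the lifting of maps \<open>C \<rightarrow> X\<close>; and \<open>K\<close> is left perpendicular to \<open>T\<close> by the long exact sequence.
\<close>

lemma maximal_orthogonal_rel_dim:
 assumes T: "lmod L T" and C: "maximal_orthogonal L (left_perp L T) 1 C"
 shows "belongs_to L (reg_mod L) C" "rel_dim_le_1 L C (left_perp L T)"
proof -
 let ?B = "left_perp L T"
 have sub: "subcategory L C" and CB: "C <= ?B" and ff: "contravariantly_finite L ?B C"
  and right: "C = {X : ?B. \<forall>Y\<in>C. Ext_perp L 1 Y X}" and left: "C = {X : ?B. \<forall>Y\<in>C. Ext_perp L 1 X Y}"
  using C unfolding maximal_orthogonal_def functorially_finite_def by blast+
 have B: "X : ?B \<longleftrightarrow> fgm L X & (\<forall>i. ext_vanish L T i X)" for X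
  unfolding left_perp_def fg_modules_def using Ext_perp_infinity_iff[OF _ T] by auto
 have Cfg: "fgm L X" if "X : C" for X using CB that B by blast
 obtain F :: "'l umod" and \<phi> where F: "fgm L F" "iso L (reg_mod L) F \<phi>"
  using universe_copy[OF fg_regular[OF L.ring_axioms]] .
 note Rm = regular_lmod[OF L.ring_axioms] and Fm = fg_lmod[OF F(1)]
 have Fiso: "mod_iso L (reg_mod L) F" by (rule mod_isoI[OF Rm F(2)])
 obtain s where s: "iso L F (reg_mod L) s" "!!y. y \<in>[F] ==> \<phi> (s y) = y"
  using iso_inverse[OF Rm Fm F(2)] by metis
 have "rfree L {()} F"
 proof (rule rfree_retract[OF rfree_free[OF L.ring_axioms]])
  show "lin L F (free L {()}) (%y. \<lambda>j\<in>{()}. s y)" by (rule lin_tuple) (rule isoD(1)[OF s(1)])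
  show "lin L (free L {()}) F (%p. \<phi> (p ()))" using lin_comp[OF lin_proj[of "()" "{()}" L "%_. reg_mod L"] isoD(1)[OF F(2)]] by simp
 qed (use s Fm in auto)
 hence Fp: "fproj L F" by (rule fprojI[OF F(1)])
 have FC: "F : C"
 proof -
  have "Ext_perp L 1 F Y" if "Y : C" for Y
   unfolding Ext_perp_1_iff[OF F(1) fg_lmod[OF Cfg[OF that]]] by (rule ext_vanish_projective[OF fg_lmod[OF Cfg[OF that]] Fp])
  moreover have "F : ?B" unfolding B using F(1) ext_vanish_projective[OF T Fp] by blast
  ultimately show ?thesis by (subst left) simp
 qed
 thus "belongs_to L (reg_mod L) C" using Fiso by (auto simp: belongs_to_def)
 show "rel_dim_le_1 L C ?B" unfolding rel_dim_le_1_def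
 proof
  fix X assume X: "X : ?B"
  hence Xfg: "fgm L X" using B by blast
  note Xm = fg_lmod[OF Xfg]
  obtain C0 f where f: "C0 : C" "f : mod_hom L C0 X" and ap: "!!C'. C' : C ==> (%g. compose (carrier C') f g) ` mod_hom L C' C0 = mod_hom L C' X"
   using bspec[OF ff[unfolded contravariantly_finite_def] X] by (elim bexE) (rule that, assumption+, erule bspec)
  note C0fg = Cfg[OF f(1)] and C0m = fg_lmod[OF Cfg[OF f(1)]] and fl = mod_hom_lin[OF f(2)]
  have lift: "\<exists>h. lin L C' C0 h & (\<forall>x\<in>carrier C'. f (h x) = g x)" if C': "C' : C" and g: "lin L C' X g" for C' g
  proof -
   have "restrict g (carrier C') : (%g. compose (carrier C') f g) ` mod_hom L C' C0"
    unfolding ap[OF C'] by (rule lin_mod_hom[OF fg_lmod[OF Cfg[OF C']] g])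
   then obtain h where h: "restrict g (carrier C') = compose (carrier C') f h" "h : mod_hom L C' C0" by (elim imageE)
   have "f (h x) = g x" if "x \<in>[C']" for x using fun_cong[OF h(1), of x] that by (simp add: compose_def)
   thus ?thesis using mod_hom_lin[OF h(2)] by blast
  qed
  have surj: "f ` carrier C0 = carrier X"
  proof -
   have "x : f ` carrier C0" if x: "x \<in>[X]" for x
   proof -
    obtain z g where zg: "z \<in>[F]" "g : mod_hom L F X" "g z = x" using regular_test[OF Fm Fiso Xm x] .
    obtain h where "lin L F C0 h" "\<forall>y\<in>carrier F. f (h y) = g y" using lift[OF FC mod_hom_lin[OF zg(2)]] by blast
    hence "h z \<in>[C0]" "f (h z) = x" using zg(1,3) lin_cl by auto
    thus ?thesis by blast
   qed
   thus ?thesis using lin_cl[OF fl] by auto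
  qed
  let ?K = "sub C0 (ker C0 X f)"
  have kC: "ker C0 X f <= carrier C0" by (auto simp: ker_def)
  have Kfg: "fgm L ?K" by (rule ker_fg[OF C0fg Xm fl])
  note Km = fg_lmod[OF Kfg]
  have "ses ?K C0 X (%x. x) f" unfolding ses_def using Kfg C0fg Xfg fl surj lin_incl[OF kC] by (auto simp: inj_on_def)
  from ext_vanish_ses(1)[OF T this] have KB: "?K : ?B" unfolding B using Kfg X f(1) CB B by blast
  have "Ext_perp L 1 Y ?K" if Y: "Y : C" for Y
  proof -
   note Yfg = Cfg[OF Y] and Ym = fg_lmod[OF Cfg[OF Y]]
   obtain P :: "'l umod" and e where p: "pres L P e Y" using presentation_exists[OF Yfg] .
   note Pm = presD(2)[OF p]
   have kP: "ker P Y e <= carrier P" by (auto simp: ker_def)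
   interpret C0: left_module L C0 by (rule C0m)
   have "Ext_perp L 1 Y C0" using f(1) Y right by blast
   hence v: "extends L P (ker P Y e) C0" using Ext_perp_1_iff[OF Yfg C0m] p by simp
   have "extends L P (ker P Y e) ?K" unfolding extends_def
   proof (intro allI impI)
    fix h assume h: "lin L (sub P (ker P Y e)) ?K h"
    hence "lin L (sub P (ker P Y e)) C0 h" using lin_into_sub[OF kC] by blast
    then obtain g where g: "lin L P C0 g" "!!x. x : ker P Y e ==> g x = h x" using v unfolding extends_def by blast
    have kk: "ker P Y e <= ker P X (%x. f (g x))"
    proof
     fix x assume x: "x : ker P Y e"
     hence "h x : ker C0 X f" using lin_cl[OF h, of x] by simp
     thus "x : ker P X (%x. f (g x))" using g(2)[OF x] x kP by (auto simp: ker_def)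
    qed
    obtain y where y: "lin L Y X y" "!!x. x \<in>[P] ==> y (e x) = f (g x)"
     using factor_surj[OF Pm Ym Xm presD(3,4)[OF p] lin_comp[OF g(1) fl] kk] by blast
    obtain q where q: "lin L Y C0 q" "!!x. x \<in>[Y] ==> f (q x) = y x" using lift[OF Y y(1)] by blast
    let ?g = "%x. g x -[C0] q (e x)"
    have gl: "lin L P C0 ?g" by (rule lin_subtract[OF C0m g(1) lin_comp[OF presD(3)[OF p] q(1)]])
    have "?g x : ker C0 X f" if x: "x \<in>[P]" for x
     using ker_iff_diff[OF C0m Xm fl lin_cl[OF g(1) x] lin_cl[OF q(1) lin_cl[OF presD(3)[OF p] x]]]
      y(2)[OF x] q(2)[OF lin_cl[OF presD(3)[OF p] x]] by simp
    hence "lin L P ?K ?g" unfolding lin_into_sub[OF kC] using gl by auto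
    moreover have "?g x = h x" if x: "x : ker P Y e" for x
    proof -
     have "e x = 0[Y]" "x \<in>[P]" using x by (auto simp: ker_def)
     thus ?thesis using lin_zero[OF Ym C0m q(1)] g(2)[OF x] lin_cl[OF g(1), of x] by (simp add: C0.minus_eq C0.minus_zero_module)
    qed
    ultimately show "\<exists>g. lin L P ?K g & (\<forall>x\<in>ker P Y e. g x = h x)" by blast
   qed
   from ext_vanish_0_pres[OF Km Ym p this] show ?thesis unfolding Ext_perp_1_iff[OF Yfg Km] .
  qed
  hence KC: "?K : C" using KB by (subst right) simp
  have i: "restrict (%x. x) (carrier ?K) : mod_hom L ?K C0" by (rule lin_mod_hom[OF Km lin_incl[OF kC]])
  show "\<exists>C0\<in>C. \<exists>C1\<in>C. \<exists>f1\<in>mod_hom L C1 C0. \<exists>f0\<in>mod_hom L C0 X.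
    compose (carrier C1) f0 f1 = zero_map C1 X &
    (\<forall>C'\<in>C.
     inj_on (%g. compose (carrier C') f1 g) (mod_hom L C' C1) &
     (%g. compose (carrier C') f1 g) ` mod_hom L C' C1 =
      {g : mod_hom L C' C0. compose (carrier C') f0 g = zero_map C' X} &
     (%g. compose (carrier C') f0 g) ` mod_hom L C' C0 = mod_hom L C' X)"
  proof (rule bexI[OF _ f(1)], rule bexI[OF _ KC], rule bexI[OF _ i], rule bexI[OF _ f(2)], intro conjI ballI ap)
   let ?i = "restrict (%x. x) (carrier ?K)"
   show "compose (carrier ?K) f ?i = zero_map ?K X" by (auto simp: compose_def zero_map_def ker_def fun_eq_iff)
   fix C' assume C': "C' : C"
   have cg: "compose (carrier C') ?i g = g" if "g : mod_hom L C' ?K" for g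
    using that mod_hom_closed[OF that] by (auto simp: compose_def fun_eq_iff mod_hom_def PiE_iff extensional_def)
   have mm: "g : mod_hom L C' ?K \<longleftrightarrow> g : mod_hom L C' C0 & compose (carrier C') f g = zero_map C' X" for g
    unfolding mod_hom_iff_lin lin_into_sub[OF kC] by (auto simp: compose_def zero_map_def fun_eq_iff ker_def dest: lin_cl split: if_splits)
   show "inj_on (%g. compose (carrier C') ?i g) (mod_hom L C' ?K)"
   proof (rule inj_onI)
    fix g h assume gh: "g : mod_hom L C' ?K" "h : mod_hom L C' ?K" "compose (carrier C') ?i g = compose (carrier C') ?i h"
    show "g = h" using gh(3) unfolding cg[OF gh(1)] cg[OF gh(2)] .
   qed
   have "(%g. compose (carrier C') ?i g) ` mod_hom L C' ?K = mod_hom L C' ?K" using cg by simp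
   also have "... = {g : mod_hom L C' C0. compose (carrier C') f g = zero_map C' X}" using mm by blast
   finally show "(%g. compose (carrier C') ?i g) ` mod_hom L C' ?K = {g : mod_hom L C' C0. compose (carrier C') f g = zero_map C' X}" .
  qed
 qed
qed

theorem orth_number_maximal_orthogonal:
 assumes T: "lmod L T" and C: "maximal_orthogonal L (left_perp L T) 1 C"
 shows "orth_number L (left_perp L T) = ecard (ind L C)"
proof (rule antisym)
 have sub: "subcategory L C" "C <= left_perp L T" and right: "C = {X : left_perp L T. \<forall>Y\<in>C. Ext_perp L 1 Y X}"
  using C unfolding maximal_orthogonal_def by blast+
 have "left_perp L T <= fg_modules L" by (auto simp: left_perp_def)
 thus "orth_number L (left_perp L T) \<le> ecard (ind L C)"
  by (intro orth_number_le rigid_card_le[OF _ sub(1) maximal_orthogonal_rel_dim[OF T C]])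
 have "\<forall>X\<in>C. \<forall>Y\<in>C. Ext_perp L 1 X Y" using right by blast
 thus "ecard (ind L C) \<le> orth_number L (left_perp L T)"
  unfolding orth_number_def by (intro SUP_upper) (use sub in simp)
qed

end

section \<open>Endomorphism rings of global dimension at most three\<close>

lemma ker_sub: "ker X (sub Y N) f = ker X Y f"
 by (simp add: ker_def)

text \<open>
 Schanuel's lemma in the form of stable retractions: the third syzygy computed from any presentations
 is projective when some resolution has length three.
\<close>

lemma syzygy_section:
 fixes W :: "'a umod" and P :: "nat => 'a umod"
 assumes W: "lmod (A :: ('a, 'c) ring_scheme) W" and res: "projective_resolution A P d e W" and z: "is_zero_module (P 4)"
  and Q0: "rfree A I0 Q0" "lin A Q0 W \<pi>" "\<pi> ` carrier Q0 = carrier W"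
  and Q1: "rfree A I1 Q1" "lin A Q1 Q0 D" "D ` carrier Q1 = ker Q0 W \<pi>"
  and Q2: "rfree A I2 Q2" "lin A Q2 Q1 \<xi>" "\<xi> ` carrier Q2 = ker Q1 Q0 D"
  and Q3: "lmod A Q3" "lin A Q3 Q2 q" "q ` carrier Q3 = ker Q2 Q1 \<xi>"
 obtains \<sigma> where "lin A (sub Q2 (ker Q2 Q1 \<xi>)) Q3 \<sigma>" "!!x. x : ker Q2 Q1 \<xi> ==> q (\<sigma> x) = x"
proof -
 have r: "resolution A P d e W" and pP: "!!i. projective_module A (P i)" using res by (auto simp: projective_resolution_def)
 have Pm: "lmod A (P i)" and dm: "lin A (P (Suc i)) (P i) (d i)" for i
  using r mod_hom_lin[of "d i" A "P (Suc i)" "P i"] by (auto simp: resolution_def)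
 have e: "lin A (P 0) W e" "e ` carrier (P 0) = carrier W" "d 0 ` carrier (P (Suc 0)) = ker (P 0) W e"
  and ex: "!!i. d (Suc i) ` carrier (P (Suc (Suc i))) = ker (P (Suc i)) (P i) (d i)"
  using r mod_hom_lin[of e] by (auto simp: resolution_def a_kernel_ker)
 have "\<exists>I :: (nat => 'a) set set. rfree A I (P i)" for i by (rule projective_rfree[OF pP])
 then obtain I :: "nat => (nat => 'a) set set" where I: "!!i. rfree A (I i) (P i)" by metis
 note Q0m = rfree_lmod[OF Q0(1)] and Q1m = rfree_lmod[OF Q1(1)] and Q2m = rfree_lmod[OF Q2(1)]
 have into: "lin A X (sub Y N) f" if "lin A X Y f" "f ` carrier X = N" "N <= carrier Y"
  for X :: "('a, 'x) module" and Y :: "('a, 'y) module" and f N using lin_into_sub[of N Y A X f] that by blast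
 have kc: "ker X Y f <= carrier X" for X :: "('a, 'x) module" and Y :: "('a, 'y) module" and f by (auto simp: ker_def)
 have s0: "sretr A Q0 \<pi> W W" by (rule sretr_refl[OF W Q0m Q0(2)])
 let ?Y1 = "sub Q0 (ker Q0 W \<pi>)" and ?Z1 = "sub (P 0) (ker (P 0) W e)"
 have Y1: "lmod A ?Y1" "lmod A ?Z1"
  by (rule sub_lmod[OF Q0m ker_submodule[OF Q0m W Q0(2)]], rule sub_lmod[OF Pm ker_submodule[OF Pm W e(1)]])
 have D: "lin A Q1 ?Y1 D" by (rule lin_into_sub[THEN iffD2]) (use Q1 ker_def in "auto simp: ker_def")
 have d0: "lin A (P 1) ?Z1 (d 0)" by (rule lin_into_sub[THEN iffD2]) (use dm[of 0] e(3) in "auto simp: ker_def")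
 have s1: "sretr A Q1 D ?Y1 ?Z1" by (rule sretr_syzygy[OF W W s0 Q0 I e(1,2) Q1m D Q1(3)])
 let ?Y2 = "sub Q1 (ker Q1 Q0 D)" and ?Z2 = "sub (P 1) (ker (P 1) (P 0) (d 0))"
 have Y2: "lmod A ?Y2" "lmod A ?Z2"
  using sub_lmod[OF Q1m ker_submodule[OF Q1m Q0m Q1(2)]] sub_lmod[OF Pm ker_submodule[OF Pm Pm dm], of 0] by auto
 have X: "lin A Q2 ?Y2 \<xi>" by (rule lin_into_sub[THEN iffD2]) (use Q2 in "auto simp: ker_def")
 have d1: "lin A (P 2) ?Z2 (d 1)" by (rule lin_into_sub[THEN iffD2]) (use dm[of 1] ex[of 0] in "auto simp: ker_def numeral_2_eq_2")
 have "sretr A Q2 \<xi> (sub Q1 (ker Q1 ?Y1 D)) (sub (P 1) (ker (P 1) ?Z1 (d 0)))"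
  by (rule sretr_syzygy[OF Y1 s1 Q1(1) D _ I d0 _ Q2m]) (use Q1(3) Q2(3) X e(3) in "simp_all add: ker_sub")
 hence s2: "sretr A Q2 \<xi> ?Y2 ?Z2" by (simp add: ker_sub)
 let ?Y3 = "sub Q2 (ker Q2 Q1 \<xi>)" and ?Z3 = "sub (P 2) (ker (P 2) (P 1) (d 1))"
 have Y3: "lmod A ?Y3" "lmod A ?Z3"
  using sub_lmod[OF Q2m ker_submodule[OF Q2m Q1m Q2(2)]] sub_lmod[OF Pm ker_submodule[OF Pm Pm dm], of 1] by (auto simp: numeral_2_eq_2)
 have ql: "lin A Q3 ?Y3 q" by (rule lin_into_sub[THEN iffD2]) (use Q3 in "auto simp: ker_def")
 have "sretr A Q3 q (sub Q2 (ker Q2 ?Y2 \<xi>)) (sub (P 2) (ker (P 2) ?Z2 (d 1)))"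
  by (rule sretr_syzygy[OF Y2 s2 Q2(1) X _ I d1 _ Q3(1)])
   (use Q2(3) Q3(3) ql ex[of 0] in "simp_all add: ker_sub numeral_2_eq_2")
 hence s3: "sretr A Q3 q ?Y3 ?Z3" by (simp add: ker_sub)
 have d2: "lin A (P 3) ?Z3 (d 2)" by (rule lin_into_sub[THEN iffD2]) (use dm[of 2] ex[of 1] in "auto simp: ker_def numeral_2_eq_2 numeral_3_eq_3")
 have "ker (P 3) (P 2) (d 2) = d 3 ` carrier (P 4)" using ex[of 2] by (simp add: numeral_3_eq_3 eval_nat_numeral)
 also have "... = {0[P 3]}" using z lin_zero[OF Pm Pm dm, of 3] by (simp add: is_zero_module_def eval_nat_numeral)
 finally have "ker (P 3) ?Z3 (d 2) = {0[P 3]}" by (simp add: ker_sub[where Y = "P 2"] ker_def)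
 hence inj: "inj_on (d 2) (carrier (P 3))" using inj_on_iff_ker[OF Pm Y3(2) d2] by simp
 have "iso A (P 3) ?Z3 (d 2)" unfolding iso_def bij_betw_def using d2 inj ex[of 1] by (simp add: eval_nat_numeral)
 from iso_inverse[OF Pm Y3(2) this] obtain g where g: "iso A ?Z3 (P 3) g" "!!y. y : carrier ?Z3 ==> d 2 (g y) = y" by metis
 have Z3: "rfree A (I 3) ?Z3" by (rule rfree_retract[OF I Y3(2) isoD(1)[OF g(1)] d2 g(2)])
 obtain a b c where abc: "lin A ?Y3 ?Z3 a" "lin A ?Z3 ?Y3 b" "lin A ?Y3 Q3 c"
  "!!x. x : carrier ?Y3 ==> b (a x) = x +[?Y3] q (c x)" using s3 by (auto simp: sretr_def)
 have "q ` carrier Q3 = carrier ?Y3" using Q3(3) by simp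
 then obtain b' where b': "lin A ?Z3 Q3 b'" "!!x. x : carrier ?Z3 ==> q (b' x) = b x"
  using rfree_lift[OF Z3 Y3(1) Q3(1) ql _ abc(2)] by blast
 interpret Y3: left_module A ?Y3 by (rule Y3(1))
 show ?thesis
 proof (rule that[of "%x. b' (a x) -[Q3] c x"])
  show "lin A ?Y3 Q3 (%x. b' (a x) -[Q3] c x)" by (rule lin_subtract[OF Q3(1) lin_comp[OF abc(1) b'(1)] abc(3)])
  fix x assume x: "x : ker Q2 Q1 \<xi>"
  hence xc: "x : carrier ?Y3" by simp
  note cl = lin_cl[OF abc(1) xc] lin_cl[OF abc(3) xc]
  have "q (b' (a x) -[Q3] c x) = b (a x) -[?Y3] q (c x)"
   using lin_diff[OF Q3(1) Y3(1) ql lin_cl[OF b'(1) cl(1)] cl(2)] b'(2)[OF cl(1)] by simp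
  also have "... = (x +[?Y3] q (c x)) -[?Y3] q (c x)" by (simp only: abc(4)[OF xc])
  also have "... = x" using xc lin_cl[OF ql cl(2)] by (simp only: Y3.minus_eq Y3.a_assoc Y3.a_inv_closed Y3.r_neg Y3.r_zero)
  finally show "q (b' (a x) -[Q3] c x) = x" .
 qed
qed

lemma rfree_msum:
 assumes X: "rfree A I X" and f: "finite I" "finite C"
 shows "rfree A (C \<times> I) (msum C (%_. X))"
proof -
 note Xm = rfree_lmod[OF X]
 have A: "ring A" by (rule lmodD(14)[OF Xm])
 obtain s r where sr: "lin A X (free A I) s" "lin A (free A I) X r" "!!x. x \<in>[X] ==> r (s x) = x"
  using X copower_finite[OF f(1), of "reg_mod A"] unfolding rfree_def by auto
 show ?thesis
 proof (rule rfree_retract[OF rfree_free[OF A finite_cartesian_product[OF f(2,1)]] msum_lmod[OF A Xm]])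
  show "lin A (msum C (%_. X)) (free A (C \<times> I)) (%p. \<lambda>x\<in>C \<times> I. s (p (fst x)) (snd x))"
  proof (rule lin_tuple)
   fix x assume "x : C \<times> I"
   thus "lin A (msum C (%_. X)) (reg_mod A) (%p. s (p (fst x)) (snd x))"
    using lin_comp[OF lin_comp[OF lin_proj[of "fst x" C A "%_. X"] sr(1)] lin_proj[of "snd x" I A "%_. reg_mod A"]] by auto
  qed
  show "lin A (free A (C \<times> I)) (msum C (%_. X)) (%f. \<lambda>j\<in>C. r (\<lambda>i\<in>I. f (j, i)))"
  proof (rule lin_tuple)
   fix j assume j: "j : C"
   have "lin A (free A (C \<times> I)) (free A I) (%f. \<lambda>i\<in>I. f (j, i))" by (rule lin_tuple, rule lin_proj) (use j in simp)
   thus "lin A (free A (C \<times> I)) X (%f. r (\<lambda>i\<in>I. f (j, i)))" using lin_comp[OF _ sr(2)] by blast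
  qed
  fix p assume p: "p \<in>[msum C (%_. X)]"
  have e: "r (\<lambda>i\<in>I. (\<lambda>x\<in>C \<times> I. s (p (fst x)) (snd x)) (j, i)) = p j" if j: "j : C" for j
  proof -
   have pj: "p j \<in>[X]" using p j by auto
   have "(\<lambda>i\<in>I. (\<lambda>x\<in>C \<times> I. s (p (fst x)) (snd x)) (j, i)) = (\<lambda>i\<in>I. s (p j) i)" by (rule restrict_ext) (use j in simp)
   also have "... = s (p j)" using lin_cl[OF sr(1) pj] by (auto simp: PiE_iff extensional_def fun_eq_iff)
   finally show ?thesis by (simp only: sr(3)[OF pj])
  qed
  show "(\<lambda>j\<in>C. r (\<lambda>i\<in>I. (\<lambda>x\<in>C \<times> I. s (p (fst x)) (snd x)) (j, i))) = p"
  proof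
   fix j show "(\<lambda>j\<in>C. r (\<lambda>i\<in>I. (\<lambda>x\<in>C \<times> I. s (p (fst x)) (snd x)) (j, i))) j = p j"
   proof (cases "j : C")
    case False
    thus ?thesis using p by (auto simp: PiE_iff extensional_def)
   qed (simp only: restrict_apply' e)
  qed
 qed
qed

lemma finsum_same:
 assumes "abelian_group X" "abelian_group Y" "carrier Y = carrier X" "zero Y = zero X" "add Y = add X"
  and J: "finite J" "g : J \<rightarrow> carrier X"
 shows "finsum Y g J = finsum X g J"
proof -
 interpret X: abelian_group X by fact
 interpret Y: abelian_group Y by fact
 show ?thesis using J by (induct J) (auto simp: assms(3-5))
qed

lemma lincomb_sub:
 assumes X: "lmod A X" and N: "submodule N A X" and J: "finite J" "z : J \<rightarrow> N" "c : J \<rightarrow> carrier A"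
 shows "lincomb (sub X N) J z c = lincomb X J z c"
proof -
 note s = sub_lmod[OF X N]
 have g: "(%j. c j .[X] z j) : J \<rightarrow> N" using J lmodD(7)[OF s] by (auto simp: Pi_iff)
 have "finsum X (%j. c j .[X] z j) J = finsum (sub X N) (%j. c j .[X] z j) J" using J(1) g
 proof (induct J)
  case empty
  thus ?case using lmodD(15)[OF X] lmodD(15)[OF s]
   by (simp add: abelian_monoid.finsum_empty abelian_group.axioms)
 next
  case (insert j J)
  interpret X: left_module A X by fact
  interpret S: left_module A "sub X N" by (rule s)
  have "N <= carrier X" by (rule X.subm(1)[OF N])
  hence c: "c j .[X] z j : N" "(%j. c j .[X] z j) : J \<rightarrow> N" "(%j. c j .[X] z j) : J \<rightarrow> carrier X" "c j .[X] z j \<in>[X]"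
   using insert(4) by auto
  show ?case using insert(1-3) c by (simp add: X.finsum_insert S.finsum_insert)
 qed
 thus ?thesis by (simp add: lincomb_def)
qed

text \<open>\<open>M\<close> as a module over its endomorphism ring.\<close>

definition ev_module :: "('a, 'm) module => ('m => 'm, 'm) module" where
 "ev_module M = \<lparr>carrier = carrier M, monoid.mult = undefined, one = undefined, zero = zero M, add = add M, smult = (%\<phi> x. \<phi> x)\<rparr>"

lemma ev_module_simps [simp]:
 "carrier (ev_module M) = carrier M" "0[ev_module M] = 0[M]" "x +[ev_module M] y = x +[M] y" "\<phi> .[ev_module M] x = \<phi> x"
 by (simp_all add: ev_module_def)

lemma ev_lmod:
 assumes M: "lmod A M" shows "lmod (End_ring A M) (ev_module M)"
proof -
 interpret M: left_module A M by fact
 have l: "lin A M M \<phi>" if "\<phi> : mod_hom A M M" for \<phi> using mod_hom_lin[OF that] .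
 show ?thesis
  by (rule left_module_intro[OF End_ring_ring[OF M]])
   (auto simp: M.a_ac compose_def M.l_neg mod_hom_closed zero_map_def lin_add[OF l] intro!: bexI[of _ "-[M] _"])
qed

lemma ev_finsum:
 assumes "lmod A M" "finite J" "g : J \<rightarrow> carrier M"
 shows "finsum (ev_module M) g J = finsum M g J"
 by (rule finsum_same) (use assms lmodD(15)[OF assms(1)] lmodD(15)[OF ev_lmod[OF assms(1)]] in "auto simp: ev_module_def")

lemma left_module_ring_cong:
 assumes X: "lmod A X" and c: "carrier B = carrier A" "monoid.mult B = monoid.mult A" "one B = one A" "zero B = zero A" "add B = add A"
 shows "lmod B X"
proof -
 have "ring B" by (rule ring_cong[OF lmodD(14)[OF X] c])
 thus ?thesis using X unfolding left_module_def left_module_axioms_def by (simp add: c)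
qed

lemma noeth_ring_cong:
 assumes n: "noeth A X" and c: "carrier B = carrier A" "monoid.mult B = monoid.mult A" "one B = one A" "zero B = zero A" "add B = add A"
 shows "noeth B X"
proof -
 have s: "submodule N B Y \<longleftrightarrow> submodule N A Y" for N Y by (simp add: submodule_def submodule_axioms_def c)
 show ?thesis using n left_module_ring_cong[OF _ c] unfolding noeth_def fg_module_def s by blast
qed

context complete_algebra
begin

lemma End_noeth:
 assumes M: "fgm L M" and X: "fgm (End_ring L M) X"
 shows "noeth (End_ring L M) X"
proof -
 interpret E: complete_algebra R "end_alg M" by (rule end_alg_complete[OF M])
 have c: "carrier (end_alg M) = carrier (End_ring L M)" "monoid.mult (end_alg M) = monoid.mult (End_ring L M)"
  "one (end_alg M) = one (End_ring L M)" "zero (end_alg M) = zero (End_ring L M)" "add (end_alg M) = add (End_ring L M)"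
  by (simp_all add: end_alg_def End_ring_def)
 have s: "submodule N (end_alg M) X \<longleftrightarrow> submodule N (End_ring L M) X" for N by (simp add: submodule_def submodule_axioms_def c)
 have "fgm (end_alg M) X" using X left_module_ring_cong[OF _ c] unfolding fg_module_def s by blast
 from noeth_ring_cong[OF E.noeth_algebra[OF this] c[symmetric]] show ?thesis .
qed

text \<open>
 If \<open>L\<close> is a retract of \<open>M\<^sup>k\<close>, then \<open>M = Hom(L, M)\<close> is a retract of \<open>Hom(M\<^sup>k, M) = E\<^sup>k\<close>.
\<close>

lemma ev_rfree:
 assumes M: "lmod L M" and s: "lin L (reg_mod L) (msum {..<k::nat} (%_. M)) s"
  and r: "lin L (msum {..<k} (%_. M)) (reg_mod L) r" and rs: "r (s 1[L]) = 1[L]"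
 shows "rfree (End_ring L M) {..<k} (ev_module M)" "fgm (End_ring L M) (ev_module M)"
proof -
 interpret M: left_module L M by fact
 let ?E = "End_ring L M"
 note E = End_ring_ring[OF M] and ev = ev_lmod[OF M] and Rm = regular_lmod[OF L.ring_axioms]
 define m where "m = s 1[L]"
 have m: "m \<in>[msum {..<k} (%_. M)]" unfolding m_def by (rule lin_cl[OF s]) simp
 hence mj: "m j \<in>[M]" if "j < k" for j using that by auto
 define b where "b j = (%y. r (minj {..<k} (%_. M) j y))" for j
 have b: "lin L M (reg_mod L) (b j)" if "j < k" for j
  unfolding b_def by (rule lin_comp[OF lin_minj r]) (use that M in auto)
 have "finsum (reg_mod L) (%j. b j (m j)) {..<k} = 1[L]"
  using lin_msum_expand[OF L.ring_axioms _ M Rm r m] rs by (simp add: b_def m_def)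
 hence one: "finsum L (%j. b j (m j)) {..<k} = 1[L]" by (simp add: regular_finsum)
 have bc: "b j y \<in>[L]" if "j < k" "y \<in>[M]" for j y using lin_cl[OF b[OF that(1)] that(2)] by simp
 let ?s = "%x. \<lambda>j\<in>{..<k}. restrict (%y. b j y .[M] x) (carrier M)"
 have sx: "restrict (%y. b j y .[M] x) (carrier M) : mod_hom L M M" if "j < k" "x \<in>[M]" for j x
  by (rule lin_mod_hom[OF M lin_comp[OF b[OF that(1)] lin_from_regular[OF M that(2)]]])
 have mf: "m : {..<k} \<rightarrow> carrier (ev_module M)" using mj by auto
 note rl = lin_lincomb[OF ev finite_lessThan mf]
 have sl: "lin ?E (ev_module M) (free ?E {..<k}) ?s"
 proof (rule lin_tuple, rule linI)
  fix j x assume j: "j : {..<k}" and x: "x \<in>[ev_module M]"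
  show "restrict (%y. b j y .[M] x) (carrier M) \<in>[reg_mod ?E]" using sx j x by simp
  fix y assume "y \<in>[ev_module M]"
  thus "restrict (%z. b j z .[M] (x +[ev_module M] y)) (carrier M) =
   restrict (%z. b j z .[M] x) (carrier M) +[reg_mod ?E] restrict (%z. b j z .[M] y) (carrier M)"
   using x j bc by (auto simp: M.smult_r_distr cong: restrict_cong)
 next
  fix j \<phi> x assume j: "j : {..<k}" and p: "\<phi> : carrier ?E" and x: "x \<in>[ev_module M]"
  have "lin L M M \<phi>" using mod_hom_lin p by simp
  thus "restrict (%y. b j y .[M] (\<phi> .[ev_module M] x)) (carrier M) =
   \<phi> .[reg_mod ?E] restrict (%y. b j y .[M] x) (carrier M)"
   using x j bc by (auto simp: compose_def lin_smult cong: restrict_cong)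
 qed
 have rs': "lincomb (ev_module M) {..<k} m (?s x) = x" if x: "x \<in>[ev_module M]" for x
 proof -
  have "lincomb (ev_module M) {..<k} m (?s x) = finsum (ev_module M) (%j. b j (m j) .[M] x) {..<k}"
   unfolding lincomb_def
   by (rule abelian_monoid.finsum_cong'[OF abelian_group.axioms(1)[OF lmodD(15)[OF ev]]])
    (use mj bc x in auto)
  also have "... = finsum M (%j. b j (m j) .[M] x) {..<k}" by (rule ev_finsum[OF M]) (use mj bc x in auto)
  also have "... = finsum L (%j. b j (m j)) {..<k} .[M] x" by (rule M.finsum_smult[symmetric]) (use mj bc x in auto)
  finally show ?thesis using one x by simp
 qed
 show "rfree ?E {..<k} (ev_module M)"
  by (rule rfree_retract[OF rfree_free[OF E finite_lessThan] ev sl rl]) (rule rs')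
 have "lincomb (ev_module M) {..<k} m ` carrier (free ?E {..<k}) = carrier (ev_module M)"
 proof (intro equalityI subsetI)
  fix x assume x: "x \<in>[ev_module M]"
  show "x : lincomb (ev_module M) {..<k} m ` carrier (free ?E {..<k})"
   by (rule image_eqI[where x = "?s x"]) (rule rs'[OF x, symmetric], rule lin_cl[OF sl x])
 next
  fix x assume "x : lincomb (ev_module M) {..<k} m ` carrier (free ?E {..<k})"
  thus "x \<in>[ev_module M]" using lin_cl[OF rl] by (elim imageE) simp
 qed
 from fg_surj[OF fg_free[OF E finite_lessThan] ev rl this] show "fgm ?E (ev_module M)" .
qed

lemma proj_dim_le_3:
 fixes W :: "'a umod"
 assumes "gl_dim (A :: ('a, 'c) ring_scheme) \<le> 3" "lmod A W"
 obtains P :: "nat => 'a umod" and d e where "projective_resolution A P d e W" "is_zero_module (P 4)"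
proof -
 let ?S = "{enat n | n. \<exists>(P :: nat => 'a umod) d e. projective_resolution A P d e W & (\<forall>i>n. is_zero_module (P i))}"
 have "proj_dim A W \<le> gl_dim A" unfolding gl_dim_def by (rule SUP_upper) (use assms(2) in simp)
 also have "... < 4" using assms(1) by (rule le_less_trans) simp
 finally have "Inf ?S < 4" unfolding proj_dim_def .
 then obtain s where "s : ?S" "s < 4" unfolding Inf_less_iff by blast
 then obtain n and P :: "nat => 'a umod" and d e where n: "s = enat n" "projective_resolution A P d e W" "\<forall>i>n. is_zero_module (P i)" by blast
 have "n < 4" using \<open>s < 4\<close> by (simp add: n(1) numeral_eq_enat)
 thus ?thesis using that n(2,3) by blast
qed

text \<open>
 The complex \<open>X \<rightarrow> M\<^sup>n \<rightarrow> M\<^sup>N\<close> whose last map lands in the summand \<open>\<epsilon> M\<^sup>N\<close>, together with the exactness of its image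
 under \<open>Hom(-, M)\<close>.
\<close>

definition split_resolution ::
 "('l, 'm) module => ('l, 'x) module => nat => nat => ('x => nat => 'm) => ((nat => 'm) => nat => 'm) => ((nat => 'm) => nat => 'm) => bool"
where
 "split_resolution M X n N \<iota> p \<epsilon> \<longleftrightarrow> (let P = msum {..<n} (%_. M); Q = msum {..<N} (%_. M) in
  lin L X P \<iota> & lin L P Q p & lin L Q Q \<epsilon> &
  (\<forall>g. lin L X M g \<longrightarrow> (\<exists>g'. lin L P M g' & (\<forall>x\<in>carrier X. g x = g' (\<iota> x)))) &
  (\<forall>x\<in>carrier X. p (\<iota> x) = 0[Q]) &
  (\<forall>g. lin L P M g \<longrightarrow> (\<forall>x\<in>carrier X. g (\<iota> x) = 0[M]) \<longrightarrow> (\<exists>g'. lin L Q M g' & (\<forall>y\<in>carrier P. g y = g' (p y)))) &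
  (\<forall>y\<in>carrier Q. \<epsilon> (\<epsilon> y) = \<epsilon> y) & (\<forall>y\<in>carrier P. \<epsilon> (p y) = p y) &
  (\<forall>g. lin L Q M g \<longrightarrow> (\<forall>y\<in>carrier P. g (p y) = 0[M]) \<longrightarrow> (\<forall>y\<in>carrier Q. g (\<epsilon> y) = 0[M])))"

lemma split_resolutionD:
 assumes "split_resolution M X n N \<iota> p \<epsilon>"
 shows "lin L X (msum {..<n} (%_. M)) \<iota>" "lin L (msum {..<n} (%_. M)) (msum {..<N} (%_. M)) p"
  "lin L (msum {..<N} (%_. M)) (msum {..<N} (%_. M)) \<epsilon>"
  "!!g. lin L X M g ==> \<exists>g'. lin L (msum {..<n} (%_. M)) M g' & (\<forall>x\<in>carrier X. g x = g' (\<iota> x))"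
  "!!x. x \<in>[X] ==> p (\<iota> x) = 0[msum {..<N} (%_. M)]"
  "!!g. [|lin L (msum {..<n} (%_. M)) M g; !!x. x \<in>[X] ==> g (\<iota> x) = 0[M]|] ==>
   \<exists>g'. lin L (msum {..<N} (%_. M)) M g' & (\<forall>y\<in>carrier (msum {..<n} (%_. M)). g y = g' (p y))"
  "!!y. y \<in>[msum {..<N} (%_. M)] ==> \<epsilon> (\<epsilon> y) = \<epsilon> y"
  "!!y. y \<in>[msum {..<n} (%_. M)] ==> \<epsilon> (p y) = p y"
  "!!g y. [|lin L (msum {..<N} (%_. M)) M g; !!y. y \<in>[msum {..<n} (%_. M)] ==> g (p y) = 0[M];
   y \<in>[msum {..<N} (%_. M)]|] ==> g (\<epsilon> y) = 0[M]"
 using assms unfolding split_resolution_def Let_def by blast+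

text \<open>
 The functions \<open>X \<rightarrow> M\<close> form the kernel of a map between powers of \<open>M\<close>, hence a second syzygy over \<open>End M\<close>, for which
 the third one is projective. The idempotent \<open>\<epsilon>\<close> encodes a splitting of that last syzygy.
\<close>

lemma add_resolution:
 fixes M :: "('l, 'm) module"
 assumes M: "fgm L M" and X: "fgm L X" and gl: "gl_dim (End_ring L M) \<le> 3"
  and s: "lin L (reg_mod L) (msum {..<k::nat} (%_. M)) s"
  and r: "lin L (msum {..<k} (%_. M)) (reg_mod L) r" and rs: "r (s 1[L]) = 1[L]"
 shows "\<exists>n N \<iota> p \<epsilon>. split_resolution M X n N \<iota> p \<epsilon>"
proof -
 note Mm = fg_lmod[OF M] and Xm = fg_lmod[OF X]
 interpret M: left_module L M by (rule Mm)
 let ?E = "End_ring L M" and ?M = "ev_module M"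
 note E = End_ring_ring[OF Mm] and ev = ev_lmod[OF Mm] and evr = ev_rfree[OF Mm s r rs]
 have noE: "noeth ?E Y" if "fgm ?E Y" for Y using End_noeth[OF M that] .
 have Ml: "lin L M M \<phi>" if "\<phi> : mod_hom L M M" for \<phi> using mod_hom_lin[OF that] .
 have mhc: "\<phi> x \<in>[M]" if "\<phi> : mod_hom L M M" "x \<in>[M]" for \<phi> x using mod_hom_closed[OF that] .
 obtain a z where z: "gens L X {..<a::nat} z" using fg_obtain[OF X] .
 note zl = lin_lincomb[OF Xm gensD(1,2)[OF z]]
 have zX: "z i \<in>[X]" if "i < a" for i using gensD(3)[OF z] that by simp
 let ?F = "free L {..<a}"
 have F: "fgm L ?F" by (rule fg_free[OF L.ring_axioms finite_lessThan])
 note Fm = fg_lmod[OF F]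
 let ?K = "ker ?F X (lincomb X {..<a} z)"
 obtain b kk where kk: "gens L (sub ?F ?K) {..<b::nat} kk" using fg_obtain[OF ker_fg[OF F Xm zl]] .
 have kkK: "kk j : ?K" if "j < b" for j using gensD(3)[OF kk] that by simp
 have kkF: "kk j i \<in>[L]" if "j < b" "i < a" for j i using kkK[OF that(1)] that(2) by (auto simp: ker_def)
 let ?Ma = "msum {..<a} (%_. ?M)" and ?Mb = "msum {..<b} (%_. ?M)"
 have Mam: "left_module ?E ?Ma" and Mbm: "left_module ?E ?Mb" by (intro msum_lmod E ev)+
 have Maf: "fgm ?E ?Ma" and Mbf: "fgm ?E ?Mb" by (intro fg_msum E evr(2) finite_lessThan)+
 define D where "D m = (\<lambda>j\<in>{..<b}. lincomb M {..<a} m (kk j))" for m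
 have lm: "lincomb M {..<a} m c \<in>[M]" if "m : carrier ?Ma" "c : {..<a} \<rightarrow> carrier L" for m c
  by (rule lincomb_closed[OF Mm]) (use that in auto)
 have D: "lin ?E ?Ma ?Mb D" unfolding D_def
 proof (rule lin_tuple, rule linI)
  fix j m assume j: "j : {..<b}" and m: "m : carrier ?Ma"
  have mi: "m i \<in>[M]" if "i < a" for i using m that by auto
  show "lincomb M {..<a} m (kk j) : carrier ?M" using lm[OF m] kkF j by auto
  fix m' assume m': "m' : carrier ?Ma"
  have mi': "m' i \<in>[M]" if "i < a" for i using m' that by auto
  have "lincomb M {..<a} (m +[?Ma] m') (kk j) = finsum M (%i. kk j i .[M] m i +[M] kk j i .[M] m' i) {..<a}"
   unfolding lincomb_def by (rule M.finsum_cong') (use mi mi' kkF j in "auto simp: M.smult_r_distr")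
  thus "lincomb M {..<a} (m +[?Ma] m') (kk j) = lincomb M {..<a} m (kk j) +[?M] lincomb M {..<a} m' (kk j)"
   unfolding lincomb_def using mi mi' kkF j by (simp add: M.finsum_addf)
 next
  fix j \<phi> m assume j: "j : {..<b}" and p: "\<phi> : carrier ?E" and m: "m : carrier ?Ma"
  have mi: "m i \<in>[M]" if "i < a" for i using m that by auto
  have pl: "lin L M M \<phi>" using Ml p by simp
  have "\<phi> (lincomb M {..<a} m (kk j)) = lincomb M {..<a} (%i. \<phi> (m i)) (kk j)"
   by (rule lin_lincomb_image[OF Mm Mm pl]) (use mi kkF j in auto)
  also have "... = lincomb M {..<a} (\<phi> .[?Ma] m) (kk j)"
   unfolding lincomb_def by (rule M.finsum_cong') (use mi kkF j lin_cl[OF pl] in auto)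
  finally show "lincomb M {..<a} (\<phi> .[?Ma] m) (kk j) = \<phi> .[?M] lincomb M {..<a} m (kk j)" by simp
 qed
 let ?H = "ker ?Ma ?Mb D"
 have HM: "m i \<in>[M]" if "m : ?H" "i < a" for m i using that by (auto simp: ker_def)
 have H0: "lincomb M {..<a} m (kk j) = 0[M]" if "m : ?H" "j < b" for m j
 proof -
  have "D m = 0[?Mb]" using that(1) by (simp only: ker_def mem_Collect_eq)
  hence "D m j = 0[M]" using that(2) by simp
  thus ?thesis using that(2) by (simp add: D_def)
 qed
 have hom: "\<exists>\<eta>. lin L X M \<eta> & (\<forall>i<a. \<eta> (z i) = m i)" if m: "m : ?H" for m
 proof -
  have mf: "m : {..<a} \<rightarrow> carrier M" using HM[OF m] by auto
  note ml = lin_lincomb[OF Mm finite_lessThan mf]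
  have "?K <= ker ?F M (lincomb M {..<a} m)"
  proof
   fix c assume c: "c : ?K"
   have "carrier (sub ?F ?K) <= ker ?F M (lincomb M {..<a} m)"
   proof (rule gens_subset[OF kk])
    fix d assume d: "d \<in>[free L {..<b}]"
    have Ks: "submodule ?K L ?F" by (rule ker_submodule[OF Fm Xm zl])
    have kf: "kk : {..<b} \<rightarrow> ?K" and df: "d : {..<b} \<rightarrow> carrier L" using kkK d by auto
    have kf': "kk : {..<b} \<rightarrow> ker ?F M (lincomb M {..<a} m)" using kkK H0[OF m] by (auto simp: ker_def)
    show "lincomb (sub ?F ?K) {..<b} kk d : ker ?F M (lincomb M {..<a} m)"
     unfolding lincomb_sub[OF Fm Ks finite_lessThan kf df]
     by (rule lincomb_in_submodule[OF Fm ker_submodule[OF Fm Mm ml] finite_lessThan kf' df])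
   qed
   thus "c : ker ?F M (lincomb M {..<a} m)" using c by auto
  qed
  then obtain \<eta> where e: "lin L X M \<eta>" "!!c. c : carrier ?F ==> \<eta> (lincomb X {..<a} z c) = lincomb M {..<a} m c"
   using factor_surj[OF Fm Xm Mm zl gensD(4)[OF z] ml] by blast
  have "\<eta> (z i) = m i" if i: "i < a" for i
  proof -
   let ?d = "%l. if l = i then 1[L] else 0[L]"
   have "?d : {..<a} \<rightarrow> carrier L" by auto
   hence "restrict ?d {..<a} : carrier ?F" "lincomb X {..<a} z (restrict ?d {..<a}) = z i" "lincomb M {..<a} m (restrict ?d {..<a}) = m i"
    using lincomb_restrict[OF Xm gensD(2)[OF z], of ?d] lincomb_delta[OF Xm _ gensD(2)[OF z]]
     lincomb_restrict[OF Mm mf, of ?d] lincomb_delta[OF Mm _ mf] i by auto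
   thus ?thesis using e(2)[of "restrict ?d {..<a}"] by simp
  qed
  thus ?thesis using e(1) by blast
 qed
 have val: "(\<lambda>i\<in>{..<a}. g (z i)) : ?H" if g: "lin L X M g" for g
 proof -
  let ?m = "\<lambda>i\<in>{..<a}. g (z i)"
  have mc: "?m : carrier ?Ma" using lin_cl[OF g zX] by auto
  have "lincomb M {..<a} ?m (kk j) = 0[M]" if j: "j < b" for j
  proof -
   have "lincomb M {..<a} ?m (kk j) = lincomb M {..<a} (%i. g (z i)) (kk j)"
    unfolding lincomb_def by (rule M.finsum_cong') (use lin_cl[OF g zX] kkF j in auto)
   also have "... = g (lincomb X {..<a} z (kk j))"
    by (rule lin_lincomb_image[OF Xm Mm g, symmetric]) (use zX kkF j in auto)
   also have "lincomb X {..<a} z (kk j) = 0[X]" using kkK[OF j] by (simp add: ker_def)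
   also have "g 0[X] = 0[M]" by (rule lin_zero[OF Xm Mm g])
   finally show ?thesis .
  qed
  thus ?thesis using mc by (auto simp: ker_def D_def)
 qed
 have uniq: "g x = g' x" if g: "lin L X M g" "lin L X M g'" "!!i. i < a ==> g (z i) = g' (z i)" and x: "x \<in>[X]" for g g' x
 proof -
  obtain c where c: "c : carrier ?F" "x = lincomb X {..<a} z c" using gens_expand[OF z x] .
  have cL: "c : {..<a} \<rightarrow> carrier L" using c(1) by auto
  have "lincomb M {..<a} (%i. g (z i)) c = lincomb M {..<a} (%i. g' (z i)) c"
   unfolding lincomb_def by (rule M.finsum_cong') (use lin_cl[OF g(2) zX] g(3) cL in auto)
  thus ?thesis unfolding c(2)
   using lin_lincomb_image[OF Xm Mm g(1) finite_lessThan gensD(2)[OF z] cL] lin_lincomb_image[OF Xm Mm g(2) finite_lessThan gensD(2)[OF z] cL] by simp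
 qed
 have HfE: "fgm ?E (sub ?Ma ?H)" using noE[OF Maf] ker_submodule[OF Mam Mbm D] by (simp add: noeth_def)
 obtain n h where h: "gens ?E (sub ?Ma ?H) {..<n::nat} h" using fg_obtain[OF HfE] .
 note Hm = fg_lmod[OF HfE]
 have hH: "h i : ?H" if "i < n" for i using gensD(3)[OF h] that by simp
 let ?En = "free ?E {..<n}"
 have Enf: "fgm ?E ?En" by (rule fg_free[OF E finite_lessThan])
 note Enm = fg_lmod[OF Enf]
 let ?x = "lincomb (sub ?Ma ?H) {..<n} h"
 note xl = lin_lincomb[OF Hm gensD(1,2)[OF h]]
 have HMa: "?H <= carrier ?Ma" by (auto simp: ker_def)
 have xi: "lin ?E ?En ?Ma ?x" using lin_into_sub[OF HMa, of ?E ?En ?x] xl by blast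
 have xim: "?x ` carrier ?En = ker ?Ma ?Mb D" using gensD(4)[OF h] by simp
 have xval: "?x \<phi> l = finsum M (%i. \<phi> i (h i l)) {..<n}" if f: "\<phi> : carrier ?En" and l: "l < a" for \<phi> l
 proof -
  have "?x \<phi> l = finsum ?M (%i. (\<phi> i .[sub ?Ma ?H] h i) l) {..<n}"
   unfolding lincomb_def
   by (rule lin_finsum[OF Hm ev lin_from_sub[OF lin_proj HMa]]) (use l hH f lmodD(7)[OF Hm] in auto)
  also have "... = finsum ?M (%i. \<phi> i (h i l)) {..<n}"
   by (rule abelian_monoid.finsum_cong'[OF abelian_group.axioms(1)[OF lmodD(15)[OF ev]]])
    (use l f HM[OF hH] mhc in "auto simp: PiE_iff")
  also have "... = finsum M (%i. \<phi> i (h i l)) {..<n}"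
   by (rule ev_finsum[OF Mm]) (use l f HM[OF hH] mhc in "auto simp: PiE_iff")
  finally show ?thesis .
 qed
 let ?K0 = "ker ?En ?Ma ?x"
 have K0f: "fgm ?E (sub ?En ?K0)" using noE[OF Enf] ker_submodule[OF Enm Mam xi] by (simp add: noeth_def)
 obtain N q where q: "gens ?E (sub ?En ?K0) {..<N::nat} q" using fg_obtain[OF K0f] .
 note K0m = fg_lmod[OF K0f]
 have qK: "q j : ?K0" if "j < N" for j using gensD(3)[OF q] that by simp
 have K0E: "?K0 <= carrier ?En" by (auto simp: ker_def)
 have qE: "q j i : mod_hom L M M" if "j < N" "i < n" for j i using qK[OF that(1)] K0E that(2) by (auto simp: PiE_iff)
 let ?EN = "free ?E {..<N}"
 have ENm: "left_module ?E ?EN" by (rule free_lmod[OF E])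
 let ?q = "lincomb (sub ?En ?K0) {..<N} q"
 note ql = lin_lincomb[OF K0m gensD(1,2)[OF q]]
 have qi: "lin ?E ?EN ?En ?q" using lin_into_sub[OF K0E, of ?E ?EN ?q] ql by blast
 have qval: "?q \<psi> i y = finsum M (%j. \<psi> j (q j i y)) {..<N}" if p: "\<psi> : carrier ?EN" and i: "i < n" and y: "y \<in>[M]" for \<psi> i y
 proof -
  have pj: "\<psi> j : mod_hom L M M" if "j < N" for j using p that by (auto simp: PiE_iff)
  have evy: "lin ?E (sub ?En ?K0) ?M (%\<phi>. \<phi> i y)"
   by (rule linI) (use i y K0E in \<open>auto simp: PiE_iff compose_def subset_iff intro: mod_hom_closed\<close>)
  have "?q \<psi> i y = finsum ?M (%j. (\<psi> j .[sub ?En ?K0] q j) i y) {..<N}"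
   unfolding lincomb_def[of "sub ?En ?K0" "{..<N}" q]
   by (rule lin_finsum[OF K0m ev evy]) (use qK p lmodD(7)[OF K0m] in auto)
  also have "... = finsum ?M (%j. \<psi> j (q j i y)) {..<N}"
   by (rule abelian_monoid.finsum_cong'[OF abelian_group.axioms(1)[OF lmodD(15)[OF ev]]])
    (use i y pj qE mhc in "auto simp: compose_def")
  also have "... = finsum M (%j. \<psi> j (q j i y)) {..<N}"
   by (rule ev_finsum[OF Mm]) (use i y pj qE mhc in auto)
  finally show ?thesis .
 qed
 have "submodule (D ` carrier ?Ma) ?E ?Mb" by (rule image_submodule[OF Mam Mbm D carrier_submodule[OF Mam]])
 from quotient_exists[OF Mbf this] obtain W :: "('m => 'm) umod" and w where W: "fgm ?E W" "lin ?E ?Mb W w"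
  "w ` carrier ?Mb = carrier W" "ker ?Mb W w = D ` carrier ?Ma" by metis
 note Wm = fg_lmod[OF W(1)]
 obtain P :: "nat => ('m => 'm) umod" and d e where P: "projective_resolution ?E P d e W" "is_zero_module (P 4)"
  using proj_dim_le_3[OF gl Wm] .
 note Ia = rfree_msum[OF evr(1) finite_lessThan finite_lessThan, of a] and Ib = rfree_msum[OF evr(1) finite_lessThan finite_lessThan, of b]
 obtain \<sigma> where \<sigma>: "lin ?E (sub ?En ?K0) ?EN \<sigma>" "!!x. x : ?K0 ==> ?q (\<sigma> x) = x"
  using syzygy_section[OF Wm P Ib W(2,3) Ia D W(4)[symmetric] rfree_free[OF E finite_lessThan] xi xim ENm qi] gensD(4)[OF q] by auto
 let ?X = "msum {..<n} (%_. M)" and ?Y = "msum {..<N} (%_. M)"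
 have Xm': "lmod L ?X" and Ym': "lmod L ?Y" by (intro msum_lmod L.ring_axioms Mm)+
 obtain \<eta> where eta: "!!i. i < n ==> lin L X M (\<eta> i)" "!!i l. i < n ==> l < a ==> \<eta> i (z l) = h i l"
  using hom[OF hH] by metis
 define \<iota> where "\<iota> x = (\<lambda>i\<in>{..<n}. \<eta> i x)" for x
 have io: "lin L X ?X \<iota>" unfolding \<iota>_def by (rule lin_tuple) (use eta in auto)
 \<comment> \<open>a map out of a power of \<open>M\<close> is a tuple of endomorphisms\<close>
 define app where "app c \<phi> y = finsum M (%i. \<phi> i (y i)) {..<c}" for c :: nat and \<phi> :: "nat => 'm => 'm" and y
 have appl: "lin L (msum {..<c} (%_. M)) M (app c \<phi>)" if "\<phi> \<in>[free ?E {..<c}]" for c \<phi>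
  unfolding app_def by (rule lin_cotuple[OF Mm finite_lessThan Ml]) (use that in "auto simp: PiE_iff")
 have appE: "\<exists>\<phi>\<in>carrier (free ?E {..<c}). \<forall>y\<in>carrier (msum {..<c} (%_. M)). g y = app c \<phi> y"
  if g: "lin L (msum {..<c} (%_. M)) M g" for c g
 proof (rule bexI)
  let ?\<phi> = "\<lambda>i\<in>{..<c}. restrict (%y. g (minj {..<c} (%_. M) i y)) (carrier M)"
  have gi: "lin L M M (%y. g (minj {..<c} (%_. M) i y))" if "i < c" for i
   by (rule lin_comp[OF lin_minj g]) (use that Mm in auto)
  show "?\<phi> \<in>[free ?E {..<c}]" using lin_mod_hom[OF Mm gi] by simp
  show "\<forall>y\<in>carrier (msum {..<c} (%_. M)). g y = app c ?\<phi> y"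
  proof
   fix y assume y: "y \<in>[msum {..<c} (%_. M)]"
   have "g y = finsum M (%i. g (minj {..<c} (%_. M) i (y i))) {..<c}"
    by (rule lin_msum_expand[OF L.ring_axioms finite_lessThan Mm Mm g y])
   also have "... = app c ?\<phi> y" unfolding app_def
    by (rule M.finsum_cong') (use y lin_cl[OF gi] in "auto simp: PiE_iff")
   finally show "g y = app c ?\<phi> y" .
  qed
 qed
 \<comment> \<open>composition with \<open>\<iota>\<close> is evaluation of the linear combination of the generators \<open>h\<close>\<close>
 have appi: "app n \<phi> (\<iota> (z l)) = ?x \<phi> l" if "\<phi> : carrier ?En" "l < a" for \<phi> l
  unfolding xval[OF that] app_def
  by (rule M.finsum_cong') (use that HM[OF hH] eta mhc in \<open>auto simp: \<iota>_def PiE_iff\<close>)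
 define p where "p y = (\<lambda>j\<in>{..<N}. app n (q j) y)" for y
 have p: "lin L ?X ?Y p" unfolding p_def by (rule lin_tuple, rule appl) (use qK K0E in auto)
 have kz: "app n \<phi> (\<iota> x) = 0[M]" if f: "\<phi> : ?K0" and x: "x \<in>[X]" for \<phi> x
 proof -
  have fE: "\<phi> : carrier ?En" "?x \<phi> = 0[?Ma]" using f by (auto simp: ker_def)
  have "app n \<phi> (\<iota> x) = (%x. 0[M]) x"
   by (rule uniq[OF lin_comp[OF io appl[OF fE(1)]] lin_zero_map[OF Mm] _ x]) (use appi[OF fE(1)] fE(2) in simp)
  thus ?thesis .
 qed
 define \<epsilon> where "\<epsilon> y = (\<lambda>j\<in>{..<N}. app N (\<sigma> (q j)) y)" for y
 have sq: "\<sigma> \<phi> : carrier ?EN" if "\<phi> : ?K0" for \<phi> using lin_cl[OF \<sigma>(1)] that by simp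
 have ep: "lin L ?Y ?Y \<epsilon>" unfolding \<epsilon>_def by (rule lin_tuple, rule appl) (use qK sq in auto)
 have dbl: "app c \<phi> (\<lambda>j\<in>{..<c}. app c' (\<psi> j) y) = app c' \<theta> y"
  if f: "\<phi> \<in>[free ?E {..<c}]" and p: "!!j. j < c ==> \<psi> j \<in>[free ?E {..<c'}]" and y: "y \<in>[msum {..<c'} (%_. M)]"
   and t: "!!i v. i < c' ==> v \<in>[M] ==> \<theta> i v = finsum M (%j. \<phi> j (\<psi> j i v)) {..<c}"
  for c c' \<phi> \<psi> \<theta> y
 proof -
  have fl: "lin L M M (\<phi> j)" if "j < c" for j using f that Ml by (auto simp: PiE_iff)
  have pl: "lin L M M (\<psi> j i)" if "j < c" "i < c'" for j i using p[OF that(1)] that(2) Ml by (auto simp: PiE_iff)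
  have yi: "y i \<in>[M]" if "i < c'" for i using y that by auto
  have pc: "\<psi> j i (y i) \<in>[M]" "\<phi> j (\<psi> j i (y i)) \<in>[M]" if "j < c" "i < c'" for j i
   using lin_cl[OF pl[OF that] yi[OF that(2)]] lin_cl[OF fl[OF that(1)]] by auto
  have "app c \<phi> (\<lambda>j\<in>{..<c}. app c' (\<psi> j) y) = finsum M (%j. finsum M (%i. \<phi> j (\<psi> j i (y i))) {..<c'}) {..<c}"
   unfolding app_def
  proof (rule M.finsum_cong')
   fix j assume j: "j : {..<c}"
   show "\<phi> j ((\<lambda>j\<in>{..<c}. finsum M (%i. \<psi> j i (y i)) {..<c'}) j) = finsum M (%i. \<phi> j (\<psi> j i (y i))) {..<c'}"
    using lin_finsum[OF Mm Mm fl[of j] finite_lessThan, of "%i. \<psi> j i (y i)" c'] j pc by auto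
  qed (use pc in "auto intro!: M.finsum_closed")
  also have "... = finsum M (%i. finsum M (%j. \<phi> j (\<psi> j i (y i))) {..<c}) {..<c'}"
  proof -
   have "finsum M (%j. finsum M (%i. F j i) {..<c'}) A = finsum M (%i. finsum M (%j. F j i) A) {..<c'}"
    if "finite A" "!!j i. j : A ==> i < c' ==> F j i \<in>[M]" for A :: "nat set" and F
    using that
   proof (induct A)
    case empty
    thus ?case by (simp add: M.finsum_zero)
   next
    case (insert j A)
    have "finsum M (%j. finsum M (%i. F j i) {..<c'}) (insert j A) = finsum M (%i. F j i) {..<c'} +[M] finsum M (%i. finsum M (%j. F j i) A) {..<c'}"
     using insert by (subst M.finsum_insert) auto
    also have "... = finsum M (%i. F j i +[M] finsum M (%j. F j i) A) {..<c'}"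
     by (rule M.finsum_addf[symmetric]) (use insert in auto)
    also have "... = finsum M (%i. finsum M (%j. F j i) (insert j A)) {..<c'}"
     by (rule M.finsum_cong') (use insert in "auto intro!: M.finsum_closed M.finsum_insert[symmetric]")
    finally show ?case .
   qed
   from this[of "{..<c}" "%j i. \<phi> j (\<psi> j i (y i))"] show ?thesis using pc by simp
  qed
  also have "... = app c' \<theta> y" unfolding app_def
   by (rule M.finsum_cong') (use t yi pc in "auto intro!: M.finsum_closed")
  finally show ?thesis .
 qed
 have "split_resolution M X n N \<iota> p \<epsilon>"
  unfolding split_resolution_def Let_def
 proof (intro conjI allI impI ballI io p ep)
  fix g assume g: "lin L X M g"
  have "(\<lambda>i\<in>{..<a}. g (z i)) : ?x ` carrier ?En" unfolding xim by (rule val[OF g])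
  then obtain \<phi> where f: "\<phi> : carrier ?En" "(\<lambda>i\<in>{..<a}. g (z i)) = ?x \<phi>" by (elim imageE)
  have "g x = app n \<phi> (\<iota> x)" if x: "x \<in>[X]" for x
  proof (rule uniq[OF g lin_comp[OF io appl[OF f(1)]] _ x])
   fix i assume "i < a"
   thus "g (z i) = app n \<phi> (\<iota> (z i))" using appi[OF f(1)] fun_cong[OF f(2), of i] by simp
  qed
  thus "\<exists>g'. lin L ?X M g' & (\<forall>x\<in>carrier X. g x = g' (\<iota> x))" using appl[OF f(1)] by blast
 next
  fix x assume "x \<in>[X]"
  thus "p (\<iota> x) = 0[?Y]" unfolding p_def using kz[OF qK] by auto
 next
  fix g assume g: "lin L ?X M g" and g0: "\<forall>x\<in>carrier X. g (\<iota> x) = 0[M]"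
  obtain \<phi> where f: "\<phi> : carrier ?En" "!!y. y : carrier ?X ==> g y = app n \<phi> y" using appE[OF g] by blast
  have "?x \<phi> l = 0[M]" if "l < a" for l
   using appi[OF f(1) that] f(2)[OF lin_cl[OF io zX[OF that]]] bspec[OF g0 zX[OF that]] by simp
  moreover have "?x \<phi> : carrier ?Ma" by (rule lin_cl[OF xi f(1)])
  ultimately have "?x \<phi> = 0[?Ma]" by (auto simp: PiE_iff extensional_def fun_eq_iff)
  hence fK: "\<phi> : ?K0" using f(1) by (simp add: ker_def)
  have "g y = app N (\<sigma> \<phi>) (p y)" if y: "y : carrier ?X" for y
  proof -
   have "app N (\<sigma> \<phi>) (p y) = app n \<phi> y" unfolding p_def
   proof (rule dbl[OF sq[OF fK] _ y])
    show "q j : carrier ?En" if "j < N" for j using qK[OF that] K0E by blast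
    show "\<phi> i v = finsum M (%j. \<sigma> \<phi> j (q j i v)) {..<N}" if "i < n" "v \<in>[M]" for i v
     using qval[OF sq[OF fK] that] \<sigma>(2)[OF fK] by simp
   qed
   thus ?thesis using f(2)[OF y] by simp
  qed
  thus "\<exists>g'. lin L ?Y M g' & (\<forall>y\<in>carrier ?X. g y = g' (p y))" using appl[OF sq[OF fK]] by blast
 next
  \<comment> \<open>the value of \<open>\<sigma>\<close> on a linear combination of the generators \<open>q\<close>\<close>
  have sval: "\<sigma> (?q \<psi>) i v = finsum M (%j. \<psi> j (\<sigma> (q j) i v)) {..<N}"
   if s: "\<psi> : carrier ?EN" and i: "i < N" and v: "v \<in>[M]" for \<psi> i v
  proof -
   have pj: "\<psi> j : mod_hom L M M" if "j < N" for j using s that by (auto simp: PiE_iff)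
   have sj: "\<sigma> (q j) i : mod_hom L M M" if "j < N" for j using sq[OF qK[OF that]] i by (auto simp: PiE_iff)
   have evy: "lin ?E ?EN ?M (%\<phi>. \<phi> i v)"
    by (rule linI) (use i v in "auto simp: PiE_iff compose_def intro: mod_hom_closed")
   have "\<sigma> (?q \<psi>) i v = finsum ?M (%j. (\<sigma> (\<psi> j .[sub ?En ?K0] q j)) i v) {..<N}"
    unfolding lincomb_def[of "sub ?En ?K0" "{..<N}" q]
    by (rule lin_finsum[OF K0m ev lin_comp[OF \<sigma>(1) evy]]) (use qK s lmodD(7)[OF K0m] in auto)
   also have "... = finsum ?M (%j. \<psi> j (\<sigma> (q j) i v)) {..<N}"
    by (rule abelian_monoid.finsum_cong'[OF abelian_group.axioms(1)[OF lmodD(15)[OF ev]]])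
     (use i v pj sj qK lin_smult[OF \<sigma>(1)] mhc in "auto simp: compose_def")
   also have "... = finsum M (%j. \<psi> j (\<sigma> (q j) i v)) {..<N}"
    by (rule ev_finsum[OF Mm]) (use v pj sj mhc in auto)
   finally show ?thesis .
  qed
  fix y assume y: "y : carrier ?Y"
  have se: "app N \<psi> (\<epsilon> y) = app N (\<sigma> (?q \<psi>)) y" if s: "\<psi> : carrier ?EN" for \<psi>
   unfolding \<epsilon>_def by (rule dbl[OF s _ y]) (use sq[OF qK] sval[OF s] in auto)
  have "app N (\<sigma> (q j)) (\<epsilon> y) = app N (\<sigma> (q j)) y" if "j < N" for j
   using se[OF sq[OF qK[OF that]]] \<sigma>(2)[OF qK[OF that]] by simp
  thus "\<epsilon> (\<epsilon> y) = \<epsilon> y" by (auto simp: \<epsilon>_def)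
  fix g assume g: "lin L ?Y M g" and g0: "\<forall>y\<in>carrier ?X. g (p y) = 0[M]"
  obtain \<psi> where s: "\<psi> : carrier ?EN" "!!y. y : carrier ?Y ==> g y = app N \<psi> y" using appE[OF g] by blast
  have qs: "?q \<psi> : ?K0" using lin_cl[OF ql s(1)] by simp
  have "?q \<psi> i v = 0[M]" if iv: "i < n" "v \<in>[M]" for i v
  proof -
   have mj: "minj {..<n} (%_. M) i v : carrier ?X" by (rule lin_cl[OF lin_minj]) (use iv Mm in auto)
   have "app N \<psi> (p (minj {..<n} (%_. M) i v)) = app n (?q \<psi>) (minj {..<n} (%_. M) i v)"
    unfolding p_def by (rule dbl[OF s(1) _ mj]) (use qK K0E qval[OF s(1)] in auto)
   also have "... = ?q \<psi> i v" unfolding app_def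
   proof (rule finsum_single[OF Mm finite_lessThan])
    have qE: "?q \<psi> l : mod_hom L M M" if "l < n" for l using qs K0E that by (auto simp: PiE_iff)
    show "?q \<psi> l (minj {..<n} (%_. M) i v l) = 0[M]" if "l : {..<n}" "l \<noteq> i" for l
     using that lin_zero[OF Mm Mm Ml[OF qE]] by (simp add: minj_apply)
    show "?q \<psi> i v \<in>[M]" by (rule mod_hom_closed[OF qE[OF iv(1)] iv(2)])
   qed (use iv in "auto simp: minj_apply")
   finally show ?thesis using s(2)[OF lin_cl[OF p mj]] bspec[OF g0 mj] by simp
  qed
  hence "?q \<psi> = 0[sub ?En ?K0]" using qs K0E
   by (auto simp: PiE_iff extensional_def fun_eq_iff zero_map_def mod_hom_def)
  hence sz: "\<sigma> (?q \<psi>) = 0[?EN]" using lin_zero[OF K0m ENm \<sigma>(1)] by simp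
  have "g (\<epsilon> y) = app N (\<sigma> (?q \<psi>)) y" using s(2)[OF lin_cl[OF ep y]] se[OF s(1)] by simp
  also have "... = finsum M (%_. 0[M]) {..<N}" unfolding app_def sz
   by (rule M.finsum_cong') (use y in "auto simp: zero_map_def PiE_iff")
  finally show "g (\<epsilon> y) = 0[M]" by (simp add: M.finsum_zero)
 next
  fix y assume y: "y : carrier ?X"
  have "app N (\<sigma> (q j)) (p y) = app n (q j) y" if j: "j < N" for j unfolding p_def
  proof (rule dbl[OF sq[OF qK[OF j]] _ y])
   show "q j' : carrier ?En" if "j' < N" for j' using qK[OF that] K0E by blast
   show "q j i v = finsum M (%l. \<sigma> (q j) l (q l i v)) {..<N}" if "i < n" "v \<in>[M]" for i v
    using qval[OF sq[OF qK[OF j]] that] \<sigma>(2)[OF qK[OF j]] by simp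
  qed
  thus "\<epsilon> (p y) = p y" by (auto simp: \<epsilon>_def p_def)
 qed
 thus ?thesis by blast
qed

end

section \<open>Duality over the base ring\<close>

context complete_algebra
begin

abbreviation functional :: "('l, 'x) module => ('x => 'r) => bool" where
 "functional X f \<equiv> lin R (rscal L X) (reg_mod R) f"

abbreviation DL :: "('l, 'l => 'r) module" where
 "DL \<equiv> dual_regular R L"

lemma dual_regular_simps [simp]:
 "carrier DL = mod_hom R L (reg_mod R)" "0[DL] = (\<lambda>x\<in>carrier L. 0[R])"
 "f +[DL] g = (\<lambda>x\<in>carrier L. f x +[R] g x)" "a .[DL] f = (\<lambda>x\<in>carrier L. f (x *[L] a))"
 by (simp_all add: dual_regular_def)

lemma base_regular_lmod: "lmod R (reg_mod R)"
 by (rule regular_lmod[OF RR.ring_axioms])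

lemma dual_lmod: "lmod L DL"
proof -
 let ?R = "reg_mod R"
 note Rm = base_regular_lmod and Lm = base_lmod
 have fl: "lin R L ?R f" if "f : mod_hom R L ?R" for f using mod_hom_lin[OF that] .
 have fc: "f x \<in>[R]" if "f : mod_hom R L ?R" "x \<in>[L]" for f x using lin_cl[OF fl[OF that(1)] that(2)] by simp
 have fx: "f x = undefined" if "f : mod_hom R L ?R" "x \<notin> carrier L" for f x using that by (auto simp: mod_hom_def)
 have fa: "f (x +[L] y) = f x +[R] f y" if "f : mod_hom R L ?R" "x \<in>[L]" "y \<in>[L]" for f x y
  using lin_add[OF fl[OF that(1)] that(2,3)] by simp
 have mult: "lin R L L (%x. x *[L] a)" if "a \<in>[L]" for a
  by (rule linI) (use that smult_mult_left in "auto simp: L.l_distr")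
 show ?thesis
 proof (rule left_module_intro[OF L.ring_axioms])
  fix f g assume fg: "f \<in>[DL]" "g \<in>[DL]"
  hence l: "lin R L ?R f" "lin R L ?R g" using fl by auto
  show "f +[DL] g \<in>[DL]" using lin_mod_hom[OF Lm lin_plus[OF Rm l]] by simp
  show "f +[DL] g = g +[DL] f" using fc fg by (auto simp: RR.a_comm intro!: restrict_ext)
  fix h assume "h \<in>[DL]"
  thus "f +[DL] g +[DL] h = f +[DL] (g +[DL] h)" using fc fg by (auto simp: RR.a_assoc intro!: restrict_ext)
 next
  show "0[DL] \<in>[DL]" using lin_mod_hom[OF Lm lin_zero_map[OF Rm]] by simp
 next
  fix f assume f: "f \<in>[DL]"
  hence l: "lin R L ?R f" using fl by auto
  have f': "f x = undefined" if "x \<notin> carrier L" for x using fx[OF _ that] f by simp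
  show "0[DL] +[DL] f = f" using f fc f' by (auto simp: fun_eq_iff)
  show "0[L] .[DL] f = 0[DL]" using lin_zero[OF Lm Rm l] by (auto intro!: restrict_ext)
  show "1[L] .[DL] f = f" using f' by (auto simp: fun_eq_iff)
  fix a assume a: "a \<in>[L]"
  show "a .[DL] f \<in>[DL]" using lin_mod_hom[OF Lm lin_comp[OF mult[OF a] l]] by simp
  { fix g assume "g \<in>[DL]"
   thus "a .[DL] (f +[DL] g) = a .[DL] f +[DL] a .[DL] g" using a by (auto intro!: restrict_ext) }
  fix b assume b: "b \<in>[L]"
  show "(a +[L] b) .[DL] f = a .[DL] f +[DL] b .[DL] f"
   using a b f fa by (auto simp: L.r_distr intro!: restrict_ext)
  show "(a *[L] b) .[DL] f = a .[DL] (b .[DL] f)" using a b by (auto simp: L.m_assoc intro!: restrict_ext)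
 qed
qed

text \<open>The adjunction between \<open>R\<close>-linear maps \<open>X \<rightarrow> R\<close> and \<open>L\<close>-linear maps from \<open>X\<close> to the dual of \<open>L\<close>.\<close>

definition hat :: "('l, 'x) module => ('x => 'r) => 'x => 'l => 'r" where
 "hat X f x = (\<lambda>a\<in>carrier L. f (a .[X] x))"

lemma lin_hat:
 assumes X: "lmod L X" and f: "functional X f" shows "lin L X DL (hat X f)"
proof (rule linI)
 interpret X: left_module L X by fact
 have fa: "f (x +[X] y) = f x +[R] f y" if "x \<in>[X]" "y \<in>[X]" for x y using lin_add[OF f] that by simp
 fix x assume x: "x \<in>[X]"
 have "lin R L (rscal L X) (%a. a .[X] x)"
 proof (rule linI)
  fix r a assume ra: "r \<in>[R]" "a \<in>[L]"
  have "(r .[L] a) .[X] x = (scal r *[L] a) .[X] x" using scal_mult(1)[OF ra] by simp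
  also have "... = scal r .[X] (a .[X] x)" by (rule X.smult_assoc) (use ra x in auto)
  finally show "(r .[L] a) .[X] x = r .[rscal L X] (a .[X] x)" by (simp add: scal_def)
 qed (use x in "auto simp: X.smult_l_distr")
 from lin_mod_hom[OF base_lmod lin_comp[OF this f]] show "hat X f x \<in>[DL]" by (simp add: hat_def)
 show "hat X f (x +[X] y) = hat X f x +[DL] hat X f y" if "y \<in>[X]" for y
  using x that fa by (auto simp: hat_def X.smult_r_distr intro!: restrict_ext)
 show "hat X f (a .[X] x) = a .[DL] hat X f x" if "a \<in>[L]" for a
  using x that by (auto simp: hat_def X.smult_assoc intro!: restrict_ext)
qed

lemma hat_one: "[|lmod L X; x \<in>[X]|] ==> hat X f x 1[L] = f x"
 using lmodD(11)[of L X x] by (simp add: hat_def)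

lemma functional_at_one:
 assumes X: "lmod L X" and G: "lin L X DL G" shows "functional X (%x. G x 1[L])"
proof (rule linI)
 have Gl: "lin R L (reg_mod R) (G x)" if "x \<in>[X]" for x using mod_hom_lin lin_cl[OF G that] by simp
 fix x assume x: "x \<in>[rscal L X]"
 show "G x 1[L] \<in>[reg_mod R]" by (rule lin_cl[OF Gl]) (use x in auto)
 show "G (x +[rscal L X] y) 1[L] = G x 1[L] +[reg_mod R] G y 1[L]"
  if "y \<in>[rscal L X]" for y using lin_add[OF G] x that by simp
 fix r assume r: "r \<in>[R]"
 have "G (scal r .[X] x) = scal r .[DL] G x" by (rule lin_smult[OF G]) (use r x in auto)
 hence "G (scal r .[X] x) 1[L] = G x (r .[L] 1[L])" using r by (simp add: scal_def lmodD(7)[OF base_lmod])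
 thus "G (r .[rscal L X] x) 1[L] = r .[reg_mod R] G x 1[L]"
  using lin_smult[OF Gl r, of x "1[L]"] x by (simp add: scal_def)
qed

text \<open>
 What \<open>Hom(-, M)\<close> makes exact is made exact by \<open>Hom(-, DL)\<close>, hence by \<open>Hom\<^sub>R(-, R)\<close>.
\<close>

lemma functional_factor:
 fixes M :: "('l, 'm) module"
 assumes M: "lmod L M" and de: "lin L DL (msum {..<k::nat} (%_. M)) \<delta>" and ga: "lin L (msum {..<k} (%_. M)) DL \<gamma>"
  and gd: "!!f. f \<in>[DL] ==> \<gamma> (\<delta> f) = f"
  and N: "lmod L N1" "lmod L N2" "lin L N1 N2 u" and S: "submodule S L N1"
  and H: "!!g. lin L N1 M g ==> (!!x. x : S ==> g x = 0[M]) ==> \<exists>g'. lin L N2 M g' & (\<forall>x\<in>carrier N1. g x = g' (u x))"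
  and f: "functional N1 f" "!!x. x : S ==> f x = 0[R]"
 shows "\<exists>f'. functional N2 f' & (\<forall>x\<in>carrier N1. f x = f' (u x))"
proof -
 note D = dual_lmod and hl = lin_hat[OF N(1) f(1)]
 note Sf = left_module.subm[OF N(1) S]
 have Mk: "lmod L (msum {..<k} (%_. M))" by (rule msum_lmod[OF L.ring_axioms M])
 have "\<exists>g'. lin L N2 M g' & (\<forall>x\<in>carrier N1. \<delta> (hat N1 f x) j = g' (u x))" if j: "j < k" for j
 proof (rule H)
  show "lin L N1 M (%x. \<delta> (hat N1 f x) j)" using lin_comp[OF lin_comp[OF hl de] lin_proj[of j "{..<k}" L "%_. M"]] j by simp
  fix x assume x: "x : S"
  have "hat N1 f x = 0[DL]" using f(2)[OF Sf(4)[OF _ x]] by (auto simp: hat_def intro!: restrict_ext)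
  thus "\<delta> (hat N1 f x) j = 0[M]" using lin_zero[OF D Mk de] j by simp
 qed
 then obtain g where g: "!!j. j < k ==> lin L N2 M (g j)" "!!j x. j < k ==> x \<in>[N1] ==> \<delta> (hat N1 f x) j = g j (u x)" by metis
 have gt: "lin L N2 (msum {..<k} (%_. M)) (%z. \<lambda>j\<in>{..<k}. g j z)" by (rule lin_tuple) (use g(1) in auto)
 have "functional N2 (%z. \<gamma> (\<lambda>j\<in>{..<k}. g j z) 1[L])" by (rule functional_at_one[OF N(2) lin_comp[OF gt ga]])
 moreover have "f x = \<gamma> (\<lambda>j\<in>{..<k}. g j (u x)) 1[L]" if x: "x \<in>[N1]" for x
 proof -
  have "\<delta> (hat N1 f x) \<in>[msum {..<k} (%_. M)]" by (rule lin_cl[OF de lin_cl[OF hl x]])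
  hence "(\<lambda>j\<in>{..<k}. g j (u x)) = \<delta> (hat N1 f x)" using g(2)[OF _ x] by (auto simp: PiE_iff extensional_def fun_eq_iff)
  thus ?thesis using gd[OF lin_cl[OF hl x]] hat_one[OF N(1) x] by simp
 qed
 ultimately show ?thesis by blast
qed

lemma functional_zero:
 fixes M :: "('l, 'm) module"
 assumes M: "lmod L M" and de: "lin L DL (msum {..<k::nat} (%_. M)) \<delta>" and ga: "lin L (msum {..<k} (%_. M)) DL \<gamma>"
  and gd: "!!f. f \<in>[DL] ==> \<gamma> (\<delta> f) = f"
  and N: "lmod L N1" "lmod L N2" "lin L N1 N2 u"
  and H: "!!g z. [|lin L N2 M g; !!x. x \<in>[N1] ==> g (u x) = 0[M]; z \<in>[N2]|] ==> g z = 0[M]"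
  and f: "functional N2 f" "!!x. x \<in>[N1] ==> f (u x) = 0[R]" and z: "z \<in>[N2]"
 shows "f z = 0[R]"
proof -
 note D = dual_lmod and hl = lin_hat[OF N(2) f(1)]
 have Mk: "lmod L (msum {..<k} (%_. M))" by (rule msum_lmod[OF L.ring_axioms M])
 have "\<delta> (hat N2 f z) j = 0[M]" if j: "j < k" for j
 proof (rule H[OF _ _ z])
  show "lin L N2 M (%x. \<delta> (hat N2 f x) j)" using lin_comp[OF lin_comp[OF hl de] lin_proj[of j "{..<k}" L "%_. M"]] j by simp
  fix x assume x: "x \<in>[N1]"
  have "f (a .[N2] u x) = 0[R]" if "a \<in>[L]" for a
   using f(2)[OF lmodD(7)[OF N(1) that x]] lin_smult[OF N(3) that x] by simp
  hence "hat N2 f (u x) = 0[DL]" by (auto simp: hat_def intro!: restrict_ext)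
  thus "\<delta> (hat N2 f (u x)) j = 0[M]" using lin_zero[OF D Mk de] j by simp
 qed
 moreover have "\<delta> (hat N2 f z) \<in>[msum {..<k} (%_. M)]" by (rule lin_cl[OF de lin_cl[OF hl z]])
 ultimately have "\<delta> (hat N2 f z) = 0[msum {..<k} (%_. M)]" by (auto simp: PiE_iff extensional_def fun_eq_iff)
 hence "hat N2 f z = 0[DL]" using gd[OF lin_cl[OF hl z]] lin_zero[OF Mk D ga] by simp
 thus ?thesis using hat_one[OF N(2) z, of f] by simp
qed

lemma dual_basis:
 assumes "fgm R Y" "rfree R I Y"
 obtains n x h where "x : {..<n::nat} \<rightarrow> carrier Y" "lin R Y (free R {..<n}) h" "!!y. y \<in>[Y] ==> lincomb Y {..<n} x (h y) = y"
proof -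
 obtain n x where x: "gens R Y {..<n::nat} x" using fg_obtain[OF assms(1)] .
 obtain h where "lin R Y (free R {..<n}) h" "!!y. y \<in>[Y] ==> lincomb Y {..<n} x (h y) = y"
  using rfree_fg_section[OF assms(2) x] by blast
 thus ?thesis using that gensD(2)[OF x] by blast
qed

lemma functionals_separate:
 assumes "fgm R Y" "rfree R I Y" and y: "y \<in>[Y]" "y' \<in>[Y]"
  and e: "!!f. lin R Y (reg_mod R) f ==> f y = f y'"
 shows "y = y'"
proof -
 obtain n x h where h: "x : {..<n::nat} \<rightarrow> carrier Y" "lin R Y (free R {..<n}) h" "!!y. y \<in>[Y] ==> lincomb Y {..<n} x (h y) = y"
  using dual_basis[OF assms(1,2)] by metis
 have "h y j = h y' j" if "j < n" for j
  using e[OF lin_comp[OF h(2) lin_proj[of j "{..<n}" R "%_. reg_mod R"]]] that by simp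
 moreover have "h y \<in>[free R {..<n}]" "h y' \<in>[free R {..<n}]" by (rule lin_cl[OF h(2) y(1)], rule lin_cl[OF h(2) y(2)])
 ultimately have hh: "h y = h y'" unfolding msum_simps by (intro PiE_ext[of "h y" _ _ "h y'"]) auto
 have "y = lincomb Y {..<n} x (h y)" by (rule h(3)[OF y(1), symmetric])
 also have "... = y'" unfolding hh by (rule h(3)[OF y(2)])
 finally show ?thesis .
qed

lemma CM_rfree:
 assumes "is_CM R L X"
 shows "fgm L X" "lmod L X" "fgm R (rscal L X)" "\<exists>n::nat. rfree R {..<n} (rscal L X)"
proof -
 show "fgm L X" using assms by (simp add: is_CM_def)
 thus "lmod L X" "fgm R (rscal L X)" by (rule fg_lmod, intro restrict_fg)
 hence "fproj R (rscal L X)" using projective_rfree fprojI assms by (metis is_CM_def)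
 thus "\<exists>n::nat. rfree R {..<n} (rscal L X)" by (simp add: fproj_def)
qed

lemma restrict_scalars_msum: "rscal L (msum J X) = msum J (%j. rscal L (X j))"
 by (simp add: restrict_scalars_def msum_def)

text \<open>
 The retraction \<open>\<rho>\<close> of \<open>\<iota>\<close> exists over \<open>R\<close> since a dual basis of \<open>X\<close> extends to \<open>M\<^sup>n\<close>; the same argument, applied to
 the complement, splits \<open>p\<close> over \<open>R\<close>.
\<close>

lemma add_resolution_exact:
 fixes M :: "('l, 'm) module"
 assumes M: "is_CM R L M" and X: "is_CM R L X"
  and de: "lin L DL (msum {..<k::nat} (%_. M)) \<delta>" and ga: "lin L (msum {..<k} (%_. M)) DL \<gamma>"
  and gd: "!!f. f \<in>[DL] ==> \<gamma> (\<delta> f) = f"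
  and res: "split_resolution M X n N \<iota> p \<epsilon>"
 shows "inj_on \<iota> (carrier X)" "ker (msum {..<n} (%_. M)) (msum {..<N} (%_. M)) p = \<iota> ` carrier X"
  "p ` carrier (msum {..<n} (%_. M)) = \<epsilon> ` carrier (msum {..<N} (%_. M))"
proof -
 let ?X = "msum {..<n} (%_. M)" and ?Y = "msum {..<N} (%_. M)" and ?R = "reg_mod R"
 note sD = split_resolutionD[OF res]
 note io = sD(1,4) and p = sD(2,5,6) and ep = sD(3,7,8,9)
 note Rm = base_regular_lmod and A = RR.ring_axioms
 note Mm = CM_rfree(2)[OF M] and Xm = CM_rfree(2)[OF X]
 have Xnm: "lmod L ?X" and Ynm: "lmod L ?Y" by (intro msum_lmod L.ring_axioms Mm)+
 note rX = restrict_lmod[OF Xm] and rXn = restrict_lmod[OF Xnm] and rYn = restrict_lmod[OF Ynm]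
 have fgs: "fgm L (msum {..<c::nat} (%_. M))" for c by (intro fg_msum L.ring_axioms CM_rfree(1)[OF M]) simp
 have rf: "\<exists>I :: (nat \<times> nat) set. rfree R I (rscal L (msum {..<c::nat} (%_. M)))" for c
  using CM_rfree(4)[OF M] rfree_msum[where C = "{..<c}"] unfolding restrict_scalars_msum by (metis finite_lessThan)
 obtain I :: "(nat \<times> nat) set" where I: "rfree R I (rscal L ?X)" using rf by blast
 interpret XR: left_module R "rscal L ?X" by (rule rXn)
 note rio = lin_restrict[OF io(1)] and rp = lin_restrict[OF p(1)] and rep = lin_restrict[OF ep(1)]
 have iX: "\<iota> x : carrier ?X" if "x \<in>[X]" for x by (rule lin_cl[OF io(1) that])
 have pY: "p y : carrier ?Y" if "y : carrier ?X" for y by (rule lin_cl[OF p(1) that])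
 \<comment> \<open>an \<open>R\<close>-linear retraction of \<open>\<iota>\<close>\<close>
 obtain a xx h where h: "xx : {..<a::nat} \<rightarrow> carrier (rscal L X)" "lin R (rscal L X) (free R {..<a}) h"
  "!!x. x \<in>[rscal L X] ==> lincomb (rscal L X) {..<a} xx (h x) = x"
  using CM_rfree(4)[OF X] dual_basis[OF CM_rfree(3)[OF X]] by metis
 have "\<exists>f'. functional ?X f' & (\<forall>x\<in>carrier X. h x i = f' (\<iota> x))" if i: "i < a" for i
 proof (rule functional_factor[OF Mm de ga gd Xm Xnm io(1), where S = "{0[X]}"])
  interpret X: left_module L X by (rule Xm)
  show "submodule {0[X]} L X" by (rule X.submodule_intro) auto
  show hi: "functional X (%x. h x i)" using lin_comp[OF h(2) lin_proj[of i "{..<a}" R "%_. ?R"]] i by simp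
  show "h x i = 0[R]" if "x : {0[X]}" for x using that lin_zero[OF rX Rm hi] by simp
 qed (use io(2) in auto)
 then obtain F where F: "!!i. i < a ==> functional ?X (F i)" "!!i x. i < a ==> x \<in>[X] ==> h x i = F i (\<iota> x)" by metis
 define \<rho> where "\<rho> y = lincomb (rscal L X) {..<a} xx (\<lambda>i\<in>{..<a}. F i y)" for y
 have "lin R (rscal L ?X) (free R {..<a}) (%y. \<lambda>i\<in>{..<a}. F i y)" by (rule lin_tuple) (use F(1) in auto)
 from lin_comp[OF this lin_lincomb[OF rX finite_lessThan h(1)]]
 have rho: "lin R (rscal L ?X) (rscal L X) \<rho>" by (simp add: \<rho>_def[abs_def])
 have ri: "\<rho> (\<iota> x) = x" if x: "x \<in>[X]" for x
 proof -
  have "h x \<in>[free R {..<a}]" using lin_cl[OF h(2)] x by simp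
  hence "(\<lambda>i\<in>{..<a}. F i (\<iota> x)) = h x" using F(2)[OF _ x] by (auto simp: PiE_iff extensional_def fun_eq_iff)
  thus ?thesis using h(3) x by (simp add: \<rho>_def)
 qed
 show "inj_on \<iota> (carrier X)" by (rule inj_on_inverseI[of _ \<rho>]) (rule ri)
 have rX': "\<rho> y \<in>[X]" if "y : carrier ?X" for y using lin_cl[OF rho] that by simp
 have ir: "lin R (rscal L ?X) (rscal L ?X) (%y. \<iota> (\<rho> y))" by (rule lin_comp[OF rho rio])
 have iS: "submodule (\<iota> ` carrier X) L ?X" by (rule image_submodule[OF Xm Xnm io(1) carrier_submodule[OF Xm]])
 have fac: "\<exists>f'. functional ?Y f' & (\<forall>y\<in>carrier ?X. f (y -[rscal L ?X] \<iota> (\<rho> y)) = f' (p y))" if f: "functional ?X f" for f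
 proof (rule functional_factor[OF Mm de ga gd Xnm Ynm p(1) iS])
  show "\<exists>g'. lin L ?Y M g' & (\<forall>x\<in>carrier ?X. g x = g' (p x))"
   if "lin L ?X M g" "!!x. x : \<iota> ` carrier X ==> g x = 0[M]" for g using p(3)[OF that(1)] that(2) by blast
  show "functional ?X (%y. f (y -[rscal L ?X] \<iota> (\<rho> y)))"
   by (rule lin_comp[OF lin_subtract[OF rXn lin_id ir] f])
  fix x assume "x : \<iota> ` carrier X"
  then obtain x' where x': "x = \<iota> x'" "x' \<in>[X]" by (elim imageE)
  have "x -[rscal L ?X] \<iota> (\<rho> x) = 0[rscal L ?X]"
   unfolding x'(1) ri[OF x'(2)] using iX[OF x'(2)] by (subst XR.minus_eq_zero_iff) simp_all
  thus "f (x -[rscal L ?X] \<iota> (\<rho> x)) = 0[R]" using lin_zero[OF rXn Rm f] by simp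
 qed
 have "y : \<iota> ` carrier X" if y: "y : ker ?X ?Y p" for y
 proof -
  have yc: "y : carrier ?X" "p y = 0[?Y]" using y unfolding ker_def by blast+
  have ic: "\<iota> (\<rho> y) : carrier ?X" by (rule iX[OF rX'[OF yc(1)]])
  have "y -[rscal L ?X] \<iota> (\<rho> y) = 0[rscal L ?X]"
  proof (rule functionals_separate[OF restrict_fg[OF fgs] I])
   show "y -[rscal L ?X] \<iota> (\<rho> y) \<in>[rscal L ?X]" by (rule XR.minus_closed) (use yc ic in simp_all)
   fix f assume f: "functional ?X f"
   obtain f' where f': "functional ?Y f'" "!!y. y : carrier ?X ==> f (y -[rscal L ?X] \<iota> (\<rho> y)) = f' (p y)"
    using fac[OF f] by blast
   have "f' 0[?Y] = 0[R]" using lin_zero[OF rYn Rm f'(1)] by simp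
   thus "f (y -[rscal L ?X] \<iota> (\<rho> y)) = f 0[rscal L ?X]"
    unfolding f'(2)[OF yc(1)] yc(2) lin_zero[OF rXn Rm f] by simp
  qed (rule XR.zero_closed)
  hence "y = \<iota> (\<rho> y)" using XR.minus_eq_zero_iff[of y "\<iota> (\<rho> y)"] yc(1) ic by simp
  thus ?thesis using rX'[OF yc(1)] by blast
 qed
 moreover have "\<iota> x : ker ?X ?Y p" if "x \<in>[X]" for x using iX[OF that] p(2)[OF that] unfolding ker_def by blast
 ultimately show "ker ?X ?Y p = \<iota> ` carrier X" by blast
 \<comment> \<open>the idempotent \<open>1 - \<iota>\<rho>\<close> factors over \<open>p\<close> through a section of \<open>p\<close>\<close>
 let ?C = "\<epsilon> ` carrier ?Y"
 have Cs: "submodule ?C L ?Y" by (rule image_submodule[OF Ynm Ynm ep(1) carrier_submodule[OF Ynm]])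
 note Cm = sub_lmod[OF Ynm Cs]
 note rC = restrict_lmod[OF Cm]
 have CY: "?C <= carrier ?Y" using lin_cl[OF ep(1)] by blast
 have eC: "\<epsilon> z = z" if "z : ?C" for z using that ep(2) by (elim imageE) simp
 have eY: "lin L ?Y (sub ?Y ?C) \<epsilon>" unfolding lin_into_sub[OF CY] using ep(1) by simp
 have pC: "lin L ?X (sub ?Y ?C) p" unfolding lin_into_sub[OF CY]
 proof (intro conjI p(1) subsetI)
  fix z assume "z : p ` carrier ?X"
  then obtain y where y: "z = p y" "y : carrier ?X" by (elim imageE)
  show "z : ?C" by (rule image_eqI[of _ _ "p y"]) (use y ep(3)[OF y(2)] pY[OF y(2)] in simp_all)
 qed
 have fgC: "fgm R (rscal L (sub ?Y ?C))"
  by (rule fg_surj[OF restrict_fg[OF fgs] rC lin_restrict[OF eY]]) simp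
 obtain J :: "(nat \<times> nat) set" where "rfree R J (rscal L ?Y)" using rf by blast
 hence rfC: "rfree R J (rscal L (sub ?Y ?C))"
 proof (rule rfree_retract[OF _ rC lin_restrict[OF lin_incl[OF CY]] lin_restrict[OF eY]])
  fix z assume "z \<in>[rscal L (sub ?Y ?C)]"
  hence "z : ?C" by simp
  thus "\<epsilon> z = z" by (rule eC)
 qed
 obtain b m k where k: "m : {..<b::nat} \<rightarrow> carrier (rscal L ?X)" "lin R (rscal L ?X) (free R {..<b}) k"
  "!!x. x \<in>[rscal L ?X] ==> lincomb (rscal L ?X) {..<b} m (k x) = x"
  using dual_basis[OF restrict_fg[OF fgs] I] by metis
 have "\<exists>f'. functional ?Y f' & (\<forall>y\<in>carrier ?X. k (y -[rscal L ?X] \<iota> (\<rho> y)) i = f' (p y))" if "i < b" for i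
  by (rule fac) (use lin_comp[OF k(2) lin_proj[of i "{..<b}" R "%_. ?R"]] that in simp)
 then obtain G where H: "!!i. i < b ==> functional ?Y (G i)"
  "!!i y. i < b ==> y : carrier ?X ==> k (y -[rscal L ?X] \<iota> (\<rho> y)) i = G i (p y)" by metis
 define s where "s z = lincomb (rscal L ?X) {..<b} m (\<lambda>i\<in>{..<b}. G i z)" for z
 have "lin R (rscal L ?Y) (free R {..<b}) (%y. \<lambda>i\<in>{..<b}. G i y)" by (rule lin_tuple) (use H(1) in auto)
 from lin_comp[OF this lin_lincomb[OF rXn finite_lessThan k(1)]]
 have s: "lin R (rscal L ?Y) (rscal L ?X) s" by (simp add: s_def[abs_def])
 have psp: "p (s (p y)) = p y" if y: "y : carrier ?X" for y
 proof -
  have ic: "\<iota> (\<rho> y) : carrier ?X" by (rule iX[OF rX'[OF y]])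
  let ?w = "y -[rscal L ?X] \<iota> (\<rho> y)"
  have w: "?w \<in>[rscal L ?X]" by (rule XR.minus_closed) (use y ic in simp_all)
  have "k ?w \<in>[free R {..<b}]" by (rule lin_cl[OF k(2) w])
  hence "(\<lambda>i\<in>{..<b}. G i (p y)) = k ?w" using H(2)[OF _ y] by (auto simp: PiE_iff extensional_def fun_eq_iff)
  hence "s (p y) = ?w" using k(3)[OF w] by (simp only: s_def)
  hence "p (s (p y)) = p y -[rscal L ?Y] p (\<iota> (\<rho> y))" using lin_diff[OF rXn rYn rp, of y "\<iota> (\<rho> y)"] y ic by simp
  also have "... = p y -[rscal L ?Y] 0[rscal L ?Y]" using p(2)[OF rX'[OF y]] by simp
  also have "... = p y"
  proof -
   interpret YR: left_module R "rscal L ?Y" by (rule rYn)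
   have "p y \<in>[rscal L ?Y]" using pY[OF y] by simp
   thus ?thesis by (simp only: YR.minus_eq YR.minus_zero_module YR.r_zero)
  qed
  finally show ?thesis .
 qed
 have ps: "p (s z) = z" if z: "z : ?C" for z
 proof (rule functionals_separate[OF fgC rfC])
  have sz: "s z : carrier ?X" using lin_cl[OF s] z CY by auto
  show "p (s z) \<in>[rscal L (sub ?Y ?C)]" using lin_cl[OF pC sz] by simp
  show "z \<in>[rscal L (sub ?Y ?C)]" using z by simp
  fix f assume f: "functional (sub ?Y ?C) f"
  interpret RR': left_module R ?R by (rule Rm)
  have sC: "lin R (rscal L (sub ?Y ?C)) (rscal L ?X) s"
   using lin_from_sub[OF s, of ?C] CY by (simp add: restrict_scalars_sub)
  let ?d = "%z. f (p (s z)) -[?R] f z"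
  have fc: "f z : carrier ?R" if "z : ?C" for z using lin_cl[OF f] that by simp
  have "?d z = 0[R]"
  proof (rule functional_zero[OF Mm de ga gd Xnm Cm pC])
   show "functional (sub ?Y ?C) ?d" by (rule lin_subtract[OF Rm lin_comp[OF lin_comp[OF sC lin_restrict[OF pC]] f] f])
   show "?d (p y) = 0[R]" if y: "y : carrier ?X" for y
   proof -
    have "f (p y) : carrier ?R" using fc lin_cl[OF pC y] by simp
    thus ?thesis unfolding psp[OF y] using RR'.minus_eq_zero_iff[of "f (p y)" "f (p y)"] by simp
   qed
   show "z \<in>[sub ?Y ?C]" using z by simp
   fix g z assume g: "lin L (sub ?Y ?C) M g" "!!y. y : carrier ?X ==> g (p y) = 0[M]" and z: "z \<in>[sub ?Y ?C]"
   have "g (\<epsilon> (\<epsilon> z)) = 0[M]"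
    by (rule ep(4)[OF lin_comp[OF eY g(1)]]) (use g(2) ep(3) z CY in auto)
   thus "g z = 0[M]" using eC[of z] z by simp
  qed
  thus "f (p (s z)) = f z"
   using RR'.minus_eq_zero_iff[of "f (p (s z))" "f z"] fc[OF z] fc[of "p (s z)"] lin_cl[OF pC sz] by simp
 qed
 show "p ` carrier ?X = ?C"
 proof (intro equalityI subsetI)
  fix z assume "z : p ` carrier ?X"
  thus "z : ?C" using lin_cl[OF pC] by (elim imageE) simp
 next
  fix z assume z: "z : ?C"
  have "s z : carrier ?X" using lin_cl[OF s] z CY by auto
  thus "z : p ` carrier ?X" using ps[OF z] by (intro image_eqI[of _ _ "s z"]) simp_all
 qed
qed

section \<open>Rigid lattices\<close>

text \<open>
 The obstruction to lifting \<open>g\<close> along \<open>C\<^sub>0 \<rightarrow> C\<^sub>1\<close> is a class in \<open>Ext\<^sup>1(X, X')\<close>.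
\<close>

lemma ext_vanish_lift:
 fixes X :: "'l umod"
 assumes X: "fgm L X" and X': "lmod L X'" and v: "ext_vanish L X' 0 X"
  and m: "lmod L C0" "lmod L C1"
  and i: "lin L X' C0 i" "inj_on i (carrier X')" and q: "lin L C0 C1 q" "q ` carrier C0 = carrier C1"
  and k: "ker C0 C1 q = i ` carrier X'" and g: "lin L X C1 g"
 obtains g' where "lin L X C0 g'" "!!x. x \<in>[X] ==> q (g' x) = g x"
proof -
 note Xm = fg_lmod[OF X]
 interpret C0: left_module L C0 by (rule m(1))
 interpret C1: left_module L C1 by (rule m(2))
 obtain P :: "'l umod" and e where p: "pres L P e X" using presentation_exists[OF X] .
 obtain n where n: "rfree L {..<n::nat} P" using presD(5)[OF p] ..
 note Pm = presD(2)[OF p] and el = presD(3)[OF p]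
 obtain u where u: "lin L P C0 u" "!!x. x \<in>[P] ==> q (u x) = g (e x)"
  using rfree_lift[OF n m(2,1) q lin_comp[OF el g]] by blast
 have kP: "ker P X e <= carrier P" by (auto simp: ker_def)
 have Km: "lmod L (sub P (ker P X e))" by (rule sub_lmod[OF Pm ker_submodule[OF Pm Xm el]])
 have uk: "u ` carrier (sub P (ker P X e)) <= i ` carrier X'"
  unfolding k[symmetric] using u lin_cl[OF u(1)] lin_zero[OF Xm m(2) g] by (auto simp: ker_def)
 obtain w where w: "lin L (sub P (ker P X e)) X' w" "!!x. x \<in>[sub P (ker P X e)] ==> i (w x) = u x"
  using factor_inj[OF X' m(1) Km i lin_from_sub[OF u(1) kP] uk] by blast
 have "extends L P (ker P X e) X'" using v p by simp
 then obtain W where W: "lin L P X' W" "!!x. x : ker P X e ==> W x = w x" using w(1) unfolding extends_def by blast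
 let ?u = "%x. u x -[C0] i (W x)"
 have ul: "lin L P C0 ?u" by (rule lin_subtract[OF m(1) u(1) lin_comp[OF W(1) i(1)]])
 have "ker P X e <= ker P C0 ?u"
 proof
  fix x assume x: "x : ker P X e"
  hence "i (W x) = u x" using W(2) w(2) by simp
  thus "x : ker P C0 ?u" using x kP lin_cl[OF u(1), of x] by (auto simp: ker_def C0.minus_eq C0.r_neg)
 qed
 then obtain g' where g': "lin L X C0 g'" "!!x. x \<in>[P] ==> g' (e x) = ?u x"
  using factor_surj[OF Pm Xm m(1) el presD(4)[OF p] ul] by blast
 have "q (g' x) = g x" if x: "x \<in>[X]" for x
 proof -
  have "x : e ` carrier P" using x presD(4)[OF p] by simp
  then obtain y where y: "x = e y" "y \<in>[P]" by (elim imageE)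
  have c: "u y \<in>[C0]" "W y \<in>[X']" "i (W y) \<in>[C0]"
   by (intro lin_cl[OF u(1)] lin_cl[OF W(1)] lin_cl[OF i(1)] y(2))+
  have "i (W y) : ker C0 C1 q" unfolding k using c(2) by blast
  hence "q (i (W y)) = 0[C1]" by (simp add: ker_def)
  hence "q (?u y) = g (e y)" using lin_diff[OF m q(1) c(1,3)] u(2)[OF y(2)] lin_cl[OF g lin_cl[OF el y(2)]]
   by (simp add: C1.minus_eq C1.minus_zero_module)
  thus ?thesis using g'(2)[OF y(2)] y(1) by simp
 qed
 thus ?thesis using that g'(1) by blast
qed

lemma orth_of_ext_vanish_dual:
 fixes X :: "'l umod"
 assumes X: "fgm L X" and X': "lmod L X'" and v: "ext_vanish L X' 0 X"
  and m: "lmod L C0" "lmod L C1" "lmod L C0'" "lmod L C1'"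
  and f: "lin L X C0 i" "lin L C0 C1 q" "q ` carrier C0 = carrier C1" "ker C0 C1 q = i ` carrier X"
  and f': "lin L X' C0' i'" "inj_on i' (carrier X')" "lin L C0' C1' q'" "q' ` carrier C0' = carrier C1'" "ker C0' C1' q' = i' ` carrier X'"
  and ext: "!!k. lin L X C0' k ==> \<exists>c. lin L C0 C0' c & (\<forall>x\<in>carrier X. k x = c (i x))"
 shows "orth L C0 C1 q C0' C1' q'"
 unfolding orth_def
proof (intro allI impI)
 fix h assume h: "lin L C0 C1' h"
 interpret C1': left_module L C1' by (rule m(4))
 obtain k where k: "lin L X C0' k" "!!x. x \<in>[X] ==> q' (k x) = h (i x)"
  using ext_vanish_lift[OF X X' v m(3,4) f' lin_comp[OF f(1) h]] by blast
 obtain c where c: "lin L C0 C0' c" "!!x. x \<in>[X] ==> k x = c (i x)" using ext[OF k(1)] by blast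
 let ?d = "%x. h x -[C1'] q' (c x)"
 have d: "lin L C0 C1' ?d" by (rule lin_subtract[OF m(4) h lin_comp[OF c(1) f'(3)]])
 have "ker C0 C1 q <= ker C0 C1' ?d"
 proof
  fix y assume "y : ker C0 C1 q"
  then obtain x where x: "y = i x" "x \<in>[X]" unfolding f(4) by (elim imageE)
  have y: "y \<in>[C0]" unfolding x(1) by (rule lin_cl[OF f(1) x(2)])
  have "q' (c y) = h y" using k(2)[OF x(2)] c(2)[OF x(2)] x(1) by simp
  thus "y : ker C0 C1' ?d" using y lin_cl[OF h y] by (simp add: ker_def C1'.minus_eq C1'.r_neg)
 qed
 then obtain b where b: "lin L C1 C1' b" "!!x. x \<in>[C0] ==> b (q x) = ?d x"
  using factor_surj[OF m(1,2,4) f(2,3) d] by blast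
 have "h x = b (q x) +[C1'] q' (c x)" if x: "x \<in>[C0]" for x
 proof -
  have "h x \<in>[C1']" "q' (c x) \<in>[C1']" by (intro lin_cl[OF h] lin_cl[OF f'(3)] lin_cl[OF c(1)] x)+
  thus ?thesis using b(2)[OF x] by (simp add: C1'.minus_eq C1'.a_assoc C1'.l_neg)
 qed
 thus "\<exists>b c. lin L C1 C1' b & lin L C0 C0' c & (\<forall>x\<in>carrier C0. h x = b (q x) +[C1'] q' (c x))"
  using b(1) c(1) by blast
qed

definition add_copresentation :: "'l umod => 'l umod => 'l umod => 'l umod => (_ => _) => (_ => _) => bool" where
 "add_copresentation M X C0 C1 i q \<longleftrightarrow> fgm L C0 & fgm L C1 & lin L X C0 i & inj_on i (carrier X) &
  lin L C0 C1 q & q ` carrier C0 = carrier C1 & ker C0 C1 q = i ` carrier X &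
  set_mset (dec C0) <= set_mset (dec M) & set_mset (dec C1) <= set_mset (dec M) &
  (\<exists>n \<phi>. iso L C0 (msum {..<n::nat} (%_. M)) \<phi>) &
  (\<forall>g. lin L X M g \<longrightarrow> (\<exists>g'. lin L C0 M g' & (\<forall>x\<in>carrier X. g x = g' (i x))))"

lemma dec_power:
 assumes "fgm L M" shows "set_mset (dec (msum {..<n::nat} (%_. M))) <= set_mset (dec M)"
 using dec_msum[OF finite_lessThan assms, of n] by (auto simp: set_mset_sum)

lemma add_copresentation_exists:
 assumes M: "is_CM R L M" and X: "is_CM R L X" and gl: "gl_dim (End_ring L M) \<le> 3"
  and s: "lin L (reg_mod L) (msum {..<k::nat} (%_. M)) s" "lin L (msum {..<k} (%_. M)) (reg_mod L) r" "r (s 1[L]) = 1[L]"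
  and de: "lin L DL (msum {..<k} (%_. M)) \<delta>" and ga: "lin L (msum {..<k} (%_. M)) DL \<gamma>"
  and gd: "!!f. f \<in>[DL] ==> \<gamma> (\<delta> f) = f"
 shows "\<exists>C0 C1 i q. add_copresentation M X C0 C1 i q"
proof -
 note Mf = CM_rfree(1)[OF M] and Mm = CM_rfree(2)[OF M] and Xf = CM_rfree(1)[OF X] and Xm = CM_rfree(2)[OF X]
 obtain n N \<iota> p \<epsilon> where res: "split_resolution M X n N \<iota> p \<epsilon>"
  using add_resolution[OF Mf Xf gl s] by blast
 note sD = split_resolutionD[OF res]
 note io = sD(1,4) and p = sD(2,5,6) and ep = sD(3,7,8,9)
 let ?X = "msum {..<n} (%_. M)" and ?Y = "msum {..<N} (%_. M)"
 note ex = add_resolution_exact[OF M X de ga gd res]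
 have fX: "fgm L ?X" and fY: "fgm L ?Y" by (intro fg_msum L.ring_axioms Mf finite_lessThan)+
 note Xn = fg_lmod[OF fX] and Yn = fg_lmod[OF fY]
 let ?C = "sub ?Y (\<epsilon> ` carrier ?Y)"
 have CY: "\<epsilon> ` carrier ?Y <= carrier ?Y" using lin_cl[OF ep(1)] by blast
 have Cm: "lmod L ?C" by (rule sub_lmod[OF Yn image_submodule[OF Yn Yn ep(1) carrier_submodule[OF Yn]]])
 have eY: "lin L ?Y ?C \<epsilon>" unfolding lin_into_sub[OF CY] using ep(1) by simp
 have fC: "fgm L ?C" by (rule fg_surj[OF fY Cm eY]) simp
 have eC: "\<epsilon> z = z" if "z : carrier ?C" for z
 proof -
  have "z : \<epsilon> ` carrier ?Y" using that by simp
  thus ?thesis using ep(2) by (elim imageE) simp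
 qed
 have "mod_iso L ?Y (dirsum ?C (sub ?Y (ker ?Y ?C \<epsilon>)))" by (rule split_iso[OF Cm Yn lin_incl[OF CY] eY]) (rule eC)
 hence "dec ?C <=# dec ?Y" by (rule dec_summand[OF fY Cm sub_lmod[OF Yn ker_submodule[OF Yn Cm eY]]])
 hence dC: "set_mset (dec ?C) <= set_mset (dec M)" using dec_power[OF Mf, of N] set_mset_mono by blast
 have pC: "lin L ?X ?C p" unfolding lin_into_sub[OF CY] using p(1) ex(3) by simp
 obtain C0 :: "'l umod" and a where C0: "fgm L C0" "iso L ?X C0 a" using universe_copy[OF fX] .
 obtain C1 :: "'l umod" and b where C1: "fgm L C1" "iso L ?C C1 b" using universe_copy[OF fC] .
 note m = fg_lmod[OF C0(1)] fg_lmod[OF C1(1)]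
 obtain a' where a': "iso L C0 ?X a'" "!!x. x : carrier ?X ==> a' (a x) = x" "!!y. y \<in>[C0] ==> a (a' y) = y"
  using iso_inverse[OF Xn m(1) C0(2)] by metis
 have d: "dec ?X = dec C0" "dec ?C = dec C1"
  by (rule dec_iso[OF fX m(1) mod_isoI[OF Xn C0(2)]], rule dec_iso[OF fC m(2) mod_isoI[OF Cm C1(2)]])
 have ioc: "\<iota> x : carrier ?X" if "x \<in>[X]" for x by (rule lin_cl[OF io(1) that])
 have "add_copresentation M X C0 C1 (%x. a (\<iota> x)) (%y. b (p (a' y)))"
  unfolding add_copresentation_def
 proof (intro conjI C0(1) C1(1))
  show "lin L X C0 (%x. a (\<iota> x))" by (rule lin_comp[OF io(1) isoD(1)[OF C0(2)]])
  show "inj_on (%x. a (\<iota> x)) (carrier X)"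
   using inj_onD[OF isoD(2)[OF C0(2)]] inj_onD[OF ex(1)] ioc by (intro inj_onI) blast
  show "lin L C0 C1 (%y. b (p (a' y)))" by (rule lin_comp[OF lin_comp[OF isoD(1)[OF a'(1)] pC] isoD(1)[OF C1(2)]])
  have "(%y. b (p (a' y))) ` carrier C0 = b ` p ` a' ` carrier C0" by (simp add: image_image)
  also have "... = carrier C1" using isoD(3)[OF a'(1)] ex(3) isoD(3)[OF C1(2)] by simp
  finally show "(%y. b (p (a' y))) ` carrier C0 = carrier C1" .
  have bz: "b z = 0[C1] \<longleftrightarrow> z = 0[?Y]" if "z : carrier ?C" for z
   using inj_onD[OF isoD(2)[OF C1(2)], of z "0[?C]"] lin_zero[OF Cm m(2) isoD(1)[OF C1(2)]] lmodD(2)[OF Cm] that by auto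
  have kk: "y : ker C0 C1 (%y. b (p (a' y))) \<longleftrightarrow> y \<in>[C0] & a' y : \<iota> ` carrier X" for y
  proof (cases "y \<in>[C0]")
   case True
   note ay = lin_cl[OF isoD(1)[OF a'(1)] True]
   have "b (p (a' y)) = 0[C1] \<longleftrightarrow> p (a' y) = 0[?Y]" by (rule bz[OF lin_cl[OF pC ay]])
   also have "... \<longleftrightarrow> a' y : ker ?X ?Y p" using ay unfolding ker_def by blast
   finally have "b (p (a' y)) = 0[C1] \<longleftrightarrow> a' y : \<iota> ` carrier X" by (simp only: ex(2))
   thus ?thesis using True unfolding ker_def by blast
  qed (simp add: ker_def)
  show "ker C0 C1 (%y. b (p (a' y))) = (%x. a (\<iota> x)) ` carrier X"
  proof (intro equalityI subsetI)
   fix y assume "y : ker C0 C1 (%y. b (p (a' y)))"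
   hence y: "y \<in>[C0]" "a' y : \<iota> ` carrier X" using kk by auto
   then obtain x where "a' y = \<iota> x" "x \<in>[X]" by (elim imageE)
   thus "y : (%x. a (\<iota> x)) ` carrier X" using a'(3)[OF y(1)] by (intro image_eqI[of _ _ x]) simp_all
  next
   fix y assume "y : (%x. a (\<iota> x)) ` carrier X"
   then obtain x where x: "y = a (\<iota> x)" "x \<in>[X]" by (elim imageE)
   show "y : ker C0 C1 (%y. b (p (a' y)))"
    unfolding kk using lin_cl[OF isoD(1)[OF C0(2)] ioc[OF x(2)]] a'(2)[OF ioc[OF x(2)]] x by simp
  qed
  show "set_mset (dec C0) <= set_mset (dec M)" "set_mset (dec C1) <= set_mset (dec M)"
   using dec_power[OF Mf, of n] dC unfolding d by auto
  show "\<exists>n \<phi>. iso L C0 (msum {..<n::nat} (%_. M)) \<phi>" using a'(1) by blast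
  show "\<forall>g. lin L X M g \<longrightarrow> (\<exists>g'. lin L C0 M g' & (\<forall>x\<in>carrier X. g x = g' (a (\<iota> x))))"
  proof (intro allI impI)
   fix g assume "lin L X M g"
   then obtain g' where g': "lin L ?X M g'" "\<forall>x\<in>carrier X. g x = g' (\<iota> x)" using io(2) by blast
   thus "\<exists>g'. lin L C0 M g' & (\<forall>x\<in>carrier X. g x = g' (a (\<iota> x)))"
    using lin_comp[OF isoD(1)[OF a'(1)] g'(1)] a'(2)[OF ioc] by (intro exI[of _ "%y. g' (a' y)"]) auto
  qed
 qed
 thus ?thesis by blast
qed

lemma add_closure_retract:
 fixes M :: "'l umod" and U :: "('l, 'u) module"
 assumes M: "fgm L M" and U: "lmod L U" and b: "belongs_to L U (add_closure L M)"
 obtains k s r where "lin L U (msum {..<k::nat} (%_. M)) s" "lin L (msum {..<k} (%_. M)) U r" "!!u. u \<in>[U] ==> r (s u) = u"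
proof -
 obtain Y where Y: "Y : add_closure L M" "mod_iso L U Y" using b by (auto simp: belongs_to_def)
 then obtain Z :: "'l umod" and k where Z: "fgm L Y" "fgm L Z" "mod_iso L (dirsum Y Z) (copower M {..<k::nat})"
  by (auto simp: add_closure_def fg_modules_def)
 let ?K = "msum {..<k} (%_. M)"
 note Ym = fg_lmod[OF Z(1)] and Zm = fg_lmod[OF Z(2)]
 note YZ = dsum_lmod[OF Ym Zm]
 have Km: "lmod L ?K" by (rule msum_lmod[OF L.ring_axioms fg_lmod[OF M]])
 have "mod_iso L (dirsum Y Z) ?K" using Z(3) by (simp add: copower_finite)
 then obtain f where f: "iso L (dirsum Y Z) ?K f" using mod_isoE[OF _ YZ] by blast
 obtain f' where f': "iso L ?K (dirsum Y Z) f'" "!!x. x \<in>[dirsum Y Z] ==> f' (f x) = x"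
  using iso_inverse[OF YZ Km f] by metis
 obtain g where g: "iso L U Y g" using mod_isoE[OF Y(2) U] .
 obtain g' where g': "iso L Y U g'" "!!x. x \<in>[U] ==> g' (g x) = x" using iso_inverse[OF U Ym g] by metis
 show ?thesis
 proof (rule that[of k "%u. f (g u, 0[Z])" "%x. g' (fst (f' x))"])
  show "lin L U ?K (%u. f (g u, 0[Z]))" by (rule lin_comp[OF lin_pair[OF isoD(1)[OF g] lin_zero_map[OF Zm]] isoD(1)[OF f]])
  show "lin L ?K U (%x. g' (fst (f' x)))" by (rule lin_comp[OF lin_comp[OF isoD(1)[OF f'(1)] lin_fst] isoD(1)[OF g'(1)]])
  show "g' (fst (f' (f (g u, 0[Z])))) = u" if "u \<in>[U]" for u
   using f'(2)[of "(g u, 0[Z])"] g'(2)[OF that] lin_cl[OF isoD(1)[OF g] that] lmodD(2)[OF Zm] by simp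
 qed
qed

theorem orth_number_CM_finite:
 assumes "rep_dim_1 R L \<le> 3" shows "orth_number L (CM R L) < \<infinity>"
proof -
 let ?S = "{gl_dim (End_ring L M) | M. M : CM R L &
   belongs_to L (dirsum (reg_mod L) DL) (add_closure L M)}"
 have "rep_dim_1 R L < 4" using assms by (rule le_less_trans) simp
 hence "Inf ?S < 4" unfolding rep_dim_1_def .
 then obtain t where "t : ?S" "t < 4" unfolding Inf_less_iff by blast
 then obtain M :: "'l umod" where M: "is_CM R L M" "belongs_to L (dirsum (reg_mod L) DL) (add_closure L M)" "gl_dim (End_ring L M) < 4"
  unfolding CM_def by blast
 have gl: "gl_dim (End_ring L M) \<le> 3" using M(3) by (cases "gl_dim (End_ring L M)") (auto simp: numeral_eq_enat)
 note Mf = CM_rfree(1)[OF M(1)] and Mm = CM_rfree(2)[OF M(1)]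
 note Rm = regular_lmod[OF L.ring_axioms] and D = dual_lmod
 obtain k s r where sr: "lin L (dirsum (reg_mod L) DL) (msum {..<k::nat} (%_. M)) s"
  "lin L (msum {..<k} (%_. M)) (dirsum (reg_mod L) DL) r"
  "!!u. u \<in>[dirsum (reg_mod L) DL] ==> r (s u) = u"
  by (rule add_closure_retract[OF Mf dsum_lmod[OF Rm D] M(2)]) (rule that)
 have res: "\<exists>C0 C1 i q. add_copresentation M X C0 C1 i q" if "is_CM R L X" for X
 proof (rule add_copresentation_exists[OF M(1) that gl])
  show "lin L (reg_mod L) (msum {..<k} (%_. M)) (%a. s (a, 0[DL]))" by (rule lin_comp[OF lin_inl[OF D] sr(1)])
  show "lin L (msum {..<k} (%_. M)) (reg_mod L) (%x. fst (r x))" by (rule lin_comp[OF sr(2) lin_fst])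
  show "fst (r (s (1[L], 0[DL]))) = 1[L]" using sr(3)[of "(1[L], 0[DL])"] lmodD(2)[OF D] by (simp del: dual_regular_simps)
  show "lin L DL (msum {..<k} (%_. M)) (%f. s (0[reg_mod L], f))" by (rule lin_comp[OF lin_inr[OF Rm] sr(1)])
  show "lin L (msum {..<k} (%_. M)) DL (%x. snd (r x))" by (rule lin_comp[OF sr(2) lin_snd])
  show "snd (r (s (0[reg_mod L], f))) = f" if "f \<in>[DL]" for f
   using sr(3)[of "(0[reg_mod L], f)"] that lmodD(2)[OF Rm] by (simp del: dual_regular_simps)
 qed
 define G where "G X C0 C1 q \<longleftrightarrow> (\<exists>i. add_copresentation M X C0 C1 i q)" for X C0 C1 :: "'l umod" and q
 have "orth_number L (CM R L) \<le> enat (card (set_mset (dec M)))"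
 proof (rule orth_number_le)
  fix B assume B: "B <= CM R L" "!!X Y. [|X : B; Y : B|] ==> Ext_perp L 1 X Y"
  have Bcm: "is_CM R L X" if "X : B" for X using B(1) that by (auto simp: CM_def)
  note Bf = CM_rfree(1)[OF Bcm] and Bm = CM_rfree(2)[OF Bcm]
  show "ecard (ind L B) \<le> enat (card (set_mset (dec M)))"
  proof (rule ecard_ind_le[where G = G, OF _ Bf])
   show "\<exists>P Q f. G X P Q f" if "X : B" for X using res[OF Bcm[OF that]] unfolding G_def by blast
  next
   fix X C0 C1 q assume X: "X : B" and g: "G X C0 C1 q"
   obtain i where c: "fgm L C0" "fgm L C1" and f: "lin L X C0 i" "inj_on i (carrier X)" "lin L C0 C1 q"
    "q ` carrier C0 = carrier C1" "ker C0 C1 q = i ` carrier X"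
    and dM: "set_mset (dec C0) <= set_mset (dec M)" "set_mset (dec C1) <= set_mset (dec M)"
    using g unfolding G_def add_copresentation_def by (elim conjE exE) (rule that)
   have a: "arr L C0 C1 q" using c f(3) by (simp add: arr_def)
   note m = fg_lmod[OF c(2)]
   have iK: "i ` carrier X <= carrier C0" using lin_cl[OF f(1)] by blast
   have "iso L X (sub C0 (ker C0 C1 q)) i"
    unfolding f(5) iso_def bij_betw_def lin_into_sub[OF iK] using f(1,2) by simp
   hence "dec X = dec (sub C0 (ker C0 C1 q))"
    by (intro dec_iso[OF Bf[OF X] _ mod_isoI[OF Bm[OF X]]] fg_lmod[OF ker_fg[OF c(1) m f(3)]])
   moreover obtain Z :: "'l umod" where Z: "fgm L Z" "is_zero_module Z" using zero_umodule[OF L.ring_axioms] .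
   moreover have "kc C0 C1 q = dec (sub C0 (ker C0 C1 q)) + dec Z"
    by (rule kc_eqI[OF a fg_lmod[OF Z(1)] lin_zero_map[OF fg_lmod[OF Z(1)]]])
     (use Z(2) lmodD(2)[OF m] f(4) in "auto simp: ker_def is_zero_module_def")
   moreover have "dec Z = {#}" by (rule dec_zero[OF fg_lmod[OF Z(1)] Z(2)])
   ultimately show "arr L C0 C1 q & kc C0 C1 q = dec X & set_mset (dec C0) <= set_mset (dec M) & set_mset (dec C1) <= set_mset (dec M)"
    using a dM by simp
  next
   fix X X' C0 C1 q C0' C1' q' assume X: "X : B" "X' : B" and g: "G X C0 C1 q" "G X' C0' C1' q'"
   obtain i where c: "fgm L C0" "fgm L C1"
    and f: "lin L X C0 i" "lin L C0 C1 q" "q ` carrier C0 = carrier C1" "ker C0 C1 q = i ` carrier X"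
    and ext: "\<forall>g. lin L X M g \<longrightarrow> (\<exists>g'. lin L C0 M g' & (\<forall>x\<in>carrier X. g x = g' (i x)))"
    using g(1) unfolding G_def add_copresentation_def by (elim conjE exE) (rule that)
   obtain i' n \<phi> where c': "fgm L C0'" "fgm L C1'"
    and f': "lin L X' C0' i'" "inj_on i' (carrier X')" "lin L C0' C1' q'" "q' ` carrier C0' = carrier C1'" "ker C0' C1' q' = i' ` carrier X'"
    and ph: "iso L C0' (msum {..<n::nat} (%_. M)) \<phi>"
    using g(2) unfolding G_def add_copresentation_def by (elim conjE exE) (rule that)
   note m = fg_lmod[OF c(1)] fg_lmod[OF c(2)] fg_lmod[OF c'(1)] fg_lmod[OF c'(2)]
   have v: "ext_vanish L X' 0 X" using B(2)[OF X] Ext_perp_1_iff[OF Bf[OF X(1)] Bm[OF X(2)]] by simp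
   show "orth L C0 C1 q C0' C1' q'"
   proof (rule orth_of_ext_vanish_dual[OF Bf[OF X(1)] Bm[OF X(2)] v m f f'])
    fix h assume h: "lin L X C0' h"
    let ?P = "msum {..<n} (%_. M)"
    have Pm: "lmod L ?P" by (rule msum_lmod[OF L.ring_axioms Mm])
    obtain \<psi> where ps: "iso L ?P C0' \<psi>" "!!x. x \<in>[C0'] ==> \<psi> (\<phi> x) = x" using iso_inverse[OF m(3) Pm ph] by metis
    have "\<exists>g'. lin L C0 M g' & (\<forall>x\<in>carrier X. \<phi> (h x) j = g' (i x))" if j: "j < n" for j
     using ext lin_comp[OF lin_comp[OF h isoD(1)[OF ph]] lin_proj[of j "{..<n}" L "%_. M"]] j by blast
    then obtain H where H: "!!j. j < n ==> lin L C0 M (H j)" "!!j x. j < n ==> x \<in>[X] ==> \<phi> (h x) j = H j (i x)" by metis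
    have Gt: "lin L C0 ?P (%y. \<lambda>j\<in>{..<n}. H j y)" by (rule lin_tuple) (use H(1) in auto)
    have "h x = \<psi> (\<lambda>j\<in>{..<n}. H j (i x))" if x: "x \<in>[X]" for x
    proof -
     have "\<phi> (h x) : carrier ?P" by (rule lin_cl[OF isoD(1)[OF ph] lin_cl[OF h x]])
     hence "(\<lambda>j\<in>{..<n}. H j (i x)) = \<phi> (h x)" using H(2)[OF _ x] by (auto simp: PiE_iff extensional_def fun_eq_iff)
     thus ?thesis using ps(2)[OF lin_cl[OF h x]] by simp
    qed
    thus "\<exists>c. lin L C0 C0' c & (\<forall>x\<in>carrier X. h x = c (i x))"
     using lin_comp[OF Gt isoD(1)[OF ps(1)]] by blast
   qed
  qed auto
 qed
 thus ?thesis by (rule le_less_trans) simp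
qed

end

theorem mainTheorem11:
  fixes R :: "('r, 'q) ring_scheme" and \<Lambda> :: "('r, 'l) module"
    and T :: "('l, 't) module" and d m :: nat
  assumes "complete_regular_local_ring R" and "krull_dim R = enat d"
    and "order_algebra R \<Lambda>" and "isolated_singularity R \<Lambda>"
    and "m \<ge> d" and "cotilting R \<Lambda> d m T"
  shows "(rep_dim_1 R \<Lambda> \<le> 3 \<longrightarrow> orth_number \<Lambda> (CM R \<Lambda>) < \<infinity>) \<and>
    (\<forall>C. maximal_orthogonal \<Lambda> (left_perp \<Lambda> T) 1 C \<longrightarrow>
       orth_number \<Lambda> (left_perp \<Lambda> T) = ecard (ind \<Lambda> C)) \<and>
    (\<forall>C. subcategory \<Lambda> C \<and> C \<subseteq> left_perp \<Lambda> T \<and> belongs_to \<Lambda> (regular_module \<Lambda>) C \<and>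
         rel_dim_le_1 \<Lambda> C (left_perp \<Lambda> T) \<longrightarrow>
       orth_number \<Lambda> (left_perp \<Lambda> T) \<le> ecard (ind \<Lambda> C))"
proof -
  interpret O: order_algebra R \<Lambda> by (rule assms(3))
  interpret C: complete_regular_local_ring R by (rule assms(1))
  interpret complete_algebra R \<Lambda>
    by (intro complete_algebra.intro noetherian_algebra.intro noetherian_algebra_axioms.intro
      O.module_finite_algebra_axioms assms(1) C.noetherian_ring_axioms)
  have T: "left_module \<Lambda> T" using assms(6) by (simp add: cotilting_def is_CM_def fg_module_def)
  have B: "left_perp \<Lambda> T <= fg_modules \<Lambda>" by (auto simp: left_perp_def)
  show ?thesis
  proof (intro conjI allI impI)
    fix C assume "subcategory \<Lambda> C & C <= left_perp \<Lambda> T & belongs_to \<Lambda> (reg_mod \<Lambda>) C & rel_dim_le_1 \<Lambda> C (left_perp \<Lambda> T)"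
    thus "orth_number \<Lambda> (left_perp \<Lambda> T) \<le> ecard (ind \<Lambda> C)"
      by (intro orth_number_le rigid_card_le[OF B]) auto
  qed (rule orth_number_CM_finite orth_number_maximal_orthogonal[OF T], assumption)+
qed


end
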